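(* Let $p$ be a prime number, $n\ge 1$ an integer, and let $0\le i\le j$ be integers. (a) If $j-i<n$ then $$\beta^{-i,2j}(X(\mathbb{F}_p^n))={n\brack j-i}_p\,\beta^{-i,2j}(X(\mathbb{F}_p^{j-i})).$$ (b) If $j-i=n$ then $$\beta^{-i,2j}(X(\mathbb{F}_p^n))=\sum_{k=0}^n\frac{(-1)^{n-k}p^{\frac12k(k-1)}(p)_n}{k!\,(p)_{n-k}}\binom{p^n-1-k}{j-k}-\sum_{l=0}^{n-1}(-1)^{n-l}\beta^{-j+l,2j}(X(\mathbb{F}_p^n)).$$
   Context: $X(\mathbb{F}_p^n)$ is the simplicial complex whose vertices are the nonzero vectors of $\mathbb{F}_p^n$ and whose simplices are the linearly independent subsets of $\mathbb{F}_p^n$, including the empty set (so $X(\mathbb{F}_p^0)=\{\emptyset\}$ has no vertices). Let $\mathbf{k}$ be $\mathbb{Z}$ or a prime field. For a simplicial complex $\mathcal{K}$ on $[m]=\{1,\dots,m\}$, $\mathbf{k}[\mathcal{K}]=\mathbf{k}[v_1,\dots,v_m]/(v_{i_1}\cdots v_{i_k}:\{i_1,\dots,i_k\}\notin\mathcal{K})$ is its Stanley–Reisner ring, and the bigraded Betti number $\beta^{-i,2j}(\mathcal{K})$ is the rank (dimension, if $\mathbf{k}$ is a field) over $\mathbf{k}$ of $\mathrm{Tor}^{-i,2j}_{\mathbf{k}[v_1,\dots,v_m]}(\mathbf{k}[\mathcal{K}],\mathbf{k})$, where $-i$ is the (negated) homological degree and $2j$ is the internal degree with $\deg v_s=2$.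 Equivalently (Hochster's formula), $\beta^{-i,2j}(\mathcal{K})=\sum_{J\subseteq[m],|J|=j}\mathrm{rank}\,\widetilde{H}^{j-i-1}(\mathcal{K}_J;\mathbf{k})$, where $\mathcal{K}_J$ is the full subcomplex on $J$ (with $\widetilde H^{-1}(\{\emptyset\})=\mathbf{k}$). Notation: $(p)_k=(p-1)(p^2-1)\cdots(p^k-1)$, $(p)_0=1$, and ${n\brack l}_p=\frac{(p)_n}{(p)_l(p)_{n-l}}$ is the number of $l$-dimensional subspaces of $\mathbb{F}_p^n$. Binomial coefficients $\binom{a}{b}$ with $b>a\ge0$ are $0$. *)

theory Defs
  imports
    "HOL-Library.Poly_Mapping"
    "HOL-Algebra.Subrings"
    "Jordan_Normal_Form.VS_Connect"
    "Berlekamp_Zassenhaus.Finite_Field"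
begin

section \<open>Coefficients\<close>

text \<open>A prime field is a field without proper subfields.\<close>

definition prime_field :: "'k::idom itself \<Rightarrow> bool" where
  "prime_field _ \<longleftrightarrow>
     field (class_ring :: 'k ring) \<and> (\<forall>F. subfield F (class_ring :: 'k ring) \<longrightarrow> F = UNIV)"

definition integers_or_prime_field :: "'k::idom itself \<Rightarrow> bool" where
  "integers_or_prime_field _ \<longleftrightarrow> bij (of_int :: int \<Rightarrow> 'k) \<or> prime_field TYPE('k)"

section \<open>Polynomial rings and Stanley--Reisner ideals\<close>

text \<open>Polynomials have variables from a type \<open>'v\<close>; the ring \<open>k[v | v \<in> V]\<close> for a set
  \<open>V\<close> of variables is the carrier \<open>polys V\<close>. Every variable has degree 2.\<close>

type_synonym ('v, 'k) mpoly = "('v \<Rightarrow>\<^sub>0 nat) \<Rightarrow>\<^sub>0 'k"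

definition polys :: "'v set \<Rightarrow> ('v, 'k::comm_ring_1) mpoly set" where
  "polys V = {f. \<forall>t\<in>Poly_Mapping.keys f. Poly_Mapping.keys t \<subseteq> V}"

definition mon_degree :: "('v \<Rightarrow>\<^sub>0 nat) \<Rightarrow> nat" where
  "mon_degree t = 2 * (\<Sum>v\<in>Poly_Mapping.keys t. Poly_Mapping.lookup t v)"

definition var :: "'v \<Rightarrow> ('v, 'k::comm_ring_1) mpoly" where
  "var v = Poly_Mapping.single (Poly_Mapping.single v 1) 1"

text \<open>A simplicial complex is given by its set \<open>V\<close> of vertices and its set \<open>K\<close> of simplices;
  for finite \<open>V\<close> the Stanley--Reisner ring is \<open>polys V\<close> modulo the following ideal.\<close>

definition SR_ideal :: "'v set \<Rightarrow> 'v set set \<Rightarrow> ('v, 'k::comm_ring_1) mpoly set" where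
  "SR_ideal V K =
     {\<Sum>\<sigma> | \<sigma> \<subseteq> V \<and> \<sigma> \<notin> K. g \<sigma> * (\<Prod>v\<in>\<sigma>. var v) | g. \<forall>\<sigma>. g \<sigma> \<in> polys V}"

section \<open>Graded free resolutions and Tor\<close>

text \<open>Elements of a free module with a given basis are finitely supported coefficient functions.\<close>

definition scale :: "'r::comm_ring_1 \<Rightarrow> ('b \<Rightarrow>\<^sub>0 'r) \<Rightarrow> ('b \<Rightarrow>\<^sub>0 'r)" where
  "scale c x = Poly_Mapping.map ((*) c) x"

definition lin_ext :: "('b \<Rightarrow> ('c \<Rightarrow>\<^sub>0 'r)) \<Rightarrow> ('b \<Rightarrow>\<^sub>0 'r::comm_ring_1) \<Rightarrow> ('c \<Rightarrow>\<^sub>0 'r)" where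
  "lin_ext f x = (\<Sum>b\<in>Poly_Mapping.keys x. scale (Poly_Mapping.lookup x b) (f b))"

text \<open>Data of a complex \<open>\<dots> \<rightarrow> R\<^sub>1 \<rightarrow> R\<^sub>0 \<rightarrow> polys V\<close> of based graded free modules: \<open>gens R i\<close> is a
  basis of \<open>R\<^sub>i\<close>, \<open>gdeg R i b\<close> the degree of \<open>b\<close>, \<open>bdry R i b \<in> R\<^sub>i\<close> the image of the basis
  element \<open>b\<close> of \<open>R\<^sub>i\<^sub>+\<^sub>1\<close>, and \<open>augm R b\<close> a representative of the image of the basis element \<open>b\<close>
  of \<open>R\<^sub>0\<close> in a quotient of \<open>polys V\<close>.\<close>

record (overloaded) ('v, 'k) free_complex =
  gens :: "nat \<Rightarrow> nat set"
  gdeg :: "nat \<Rightarrow> nat \<Rightarrow> nat"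
  bdry :: "nat \<Rightarrow> nat \<Rightarrow> (nat \<Rightarrow>\<^sub>0 ('v, 'k::comm_ring_1) mpoly)"
  augm :: "nat \<Rightarrow> ('v, 'k) mpoly"

definition free_mod ::
    "'v set \<Rightarrow> ('v, 'k::comm_ring_1) free_complex \<Rightarrow> nat \<Rightarrow> (nat \<Rightarrow>\<^sub>0 ('v, 'k) mpoly) set" where
  "free_mod V R i =
     {x. Poly_Mapping.keys x \<subseteq> gens R i \<and> (\<forall>b. Poly_Mapping.lookup x b \<in> polys V)}"

definition augm_ext ::
    "('v, 'k::comm_ring_1) free_complex \<Rightarrow> (nat \<Rightarrow>\<^sub>0 ('v, 'k) mpoly) \<Rightarrow> ('v, 'k) mpoly" where
  "augm_ext R x = (\<Sum>b\<in>Poly_Mapping.keys x. Poly_Mapping.lookup x b * augm R b)"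

text \<open>\<open>R\<close> is a graded free resolution of \<open>polys V / I\<close>, with maps of internal degree 0.\<close>

definition graded_free_resolution ::
    "'v set \<Rightarrow> ('v, 'k::comm_ring_1) mpoly set \<Rightarrow> ('v, 'k) free_complex \<Rightarrow> bool" where
  "graded_free_resolution V I R \<longleftrightarrow>
     (\<forall>b\<in>gens R 0. augm R b \<in> polys V \<and>
        (\<forall>t\<in>Poly_Mapping.keys (augm R b). mon_degree t = gdeg R 0 b)) \<and>
     (\<forall>i. \<forall>b\<in>gens R (Suc i). bdry R i b \<in> free_mod V R i \<and>
        (\<forall>c. \<forall>t\<in>Poly_Mapping.keys (Poly_Mapping.lookup (bdry R i b) c).
           mon_degree t + gdeg R i c = gdeg R (Suc i) b)) \<and>
     (\<forall>f\<in>polys V. \<exists>x\<in>free_mod V R 0. f - augm_ext R x \<in> I) \<and>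
     {x \<in> free_mod V R 0. augm_ext R x \<in> I} = lin_ext (bdry R 0) ` free_mod V R 1 \<and>
     (\<forall>i. {x \<in> free_mod V R (Suc i). lin_ext (bdry R i) x = 0} =
        lin_ext (bdry R (Suc i)) ` free_mod V R (Suc (Suc i)))"

text \<open>The rank of the quotient \<open>Z / B\<close> of two submodules of a free module: the maximal size of a
  family that is linearly independent modulo \<open>B\<close>. It is the dimension if the coefficients form
  a field.\<close>

definition subquotient_rank :: "('b \<Rightarrow>\<^sub>0 'k::comm_ring_1) set \<Rightarrow> ('b \<Rightarrow>\<^sub>0 'k) set \<Rightarrow> nat" where
  "subquotient_rank Z B =
     Sup {card A | A. finite A \<and> A \<subseteq> Z \<and>
            (\<forall>c. (\<Sum>a\<in>A. scale (c a) a) \<in> B \<longrightarrow> (\<forall>a\<in>A. c a = 0))}"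

text \<open>Here \<open>k\<close> is the quotient of \<open>polys V\<close> in which all variables are zero. Hence \<open>R\<^sub>i \<otimes> k\<close> is
  the free \<open>k\<close>-module on \<open>gens R i\<close>, and its differential has as matrix entries the constant terms
  of the matrix entries of \<open>bdry R\<close>. \<open>tor_chains R i e\<close> is its part of internal degree \<open>e\<close>.\<close>

definition tor_chains :: "('v, 'k::comm_ring_1) free_complex \<Rightarrow> nat \<Rightarrow> nat \<Rightarrow> (nat \<Rightarrow>\<^sub>0 'k) set" where
  "tor_chains R i e = {x. Poly_Mapping.keys x \<subseteq> {b \<in> gens R i. gdeg R i b = e}}"

definition tor_bdry :: "('v, 'k::comm_ring_1) free_complex \<Rightarrow> nat \<Rightarrow> (nat \<Rightarrow>\<^sub>0 'k) \<Rightarrow> (nat \<Rightarrow>\<^sub>0 'k)" where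
  "tor_bdry R i = lin_ext (\<lambda>b. Poly_Mapping.map (\<lambda>q. Poly_Mapping.lookup q 0) (bdry R i b))"

definition tor_cycles :: "('v, 'k::comm_ring_1) free_complex \<Rightarrow> nat \<Rightarrow> nat \<Rightarrow> (nat \<Rightarrow>\<^sub>0 'k) set" where
  "tor_cycles R i e =
     {x \<in> tor_chains R i e. case i of 0 \<Rightarrow> True | Suc i' \<Rightarrow> tor_bdry R i' x = 0}"

definition tor_boundaries ::
    "('v, 'k::comm_ring_1) free_complex \<Rightarrow> nat \<Rightarrow> nat \<Rightarrow> (nat \<Rightarrow>\<^sub>0 'k) set" where
  "tor_boundaries R i e = tor_bdry R i ` tor_chains R (Suc i) e"

text \<open>\<open>tor_rank V I i e\<close> is the rank of the part of homological degree \<open>i\<close> and internal degree \<open>e\<close> of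
  \<open>Tor(polys V / I, k)\<close> over \<open>polys V\<close>, computed from a chosen resolution of \<open>polys V / I\<close>.\<close>

definition tor_rank :: "'v set \<Rightarrow> ('v, 'k::comm_ring_1) mpoly set \<Rightarrow> nat \<Rightarrow> nat \<Rightarrow> nat" where
  "tor_rank V I i e =
     (let R = (SOME R. graded_free_resolution V I R)
      in subquotient_rank (tor_cycles R i e) (tor_boundaries R i e))"

text \<open>\<open>betti TYPE('k) V K i j\<close> is \<open>\<beta>\<^sup>-\<^sup>i\<^sup>,\<^sup>2\<^sup>j\<close>.\<close>

definition betti ::
    "'k::comm_ring_1 itself \<Rightarrow> 'v set \<Rightarrow> 'v set set \<Rightarrow> nat \<Rightarrow> nat \<Rightarrow> nat" where
  "betti _ V K i j = tor_rank V (SR_ideal V K :: ('v, 'k) mpoly set) i (2 * j)"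

section \<open>The universal complex\<close>

definition X_vertices :: "'p::prime_card itself \<Rightarrow> nat \<Rightarrow> 'p mod_ring vec set" where
  "X_vertices _ n = carrier_vec n - {0\<^sub>v n}"

definition X_simplices :: "'p::prime_card itself \<Rightarrow> nat \<Rightarrow> 'p mod_ring vec set set" where
  "X_simplices _ n =
     {A. A \<subseteq> carrier_vec n \<and>
         \<not> LinearCombinations.module.lin_dep class_ring (module_vec TYPE('p mod_ring) n) A}"

definition betti_X :: "'k::comm_ring_1 itself \<Rightarrow> 'p::prime_card itself \<Rightarrow> nat \<Rightarrow> nat \<Rightarrow> nat \<Rightarrow> nat" where
  "betti_X k P n i j = betti k (X_vertices P n) (X_simplices P n) i j"

section \<open>Gaussian binomials\<close>

definition p_poch :: "nat \<Rightarrow> nat \<Rightarrow> rat" where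
  "p_poch p k = (\<Prod>s=1..k. of_nat p ^ s - 1)"

definition gauss_binomial :: "nat \<Rightarrow> nat \<Rightarrow> nat \<Rightarrow> rat" where
  "gauss_binomial p n l = p_poch p n / (p_poch p l * p_poch p (n - l))"

end

(*
  By Hochster's formula the Betti numbers of X(F_p^n) are sums of ranks of reduced cohomology groups
  of the full subcomplexes on sets J of nonzero vectors. Such a subcomplex consists of the
  independent sets of a linear matroid of rank r = dim span J, hence has reduced cohomology only in
  degree r - 1. So only sets J of rank j - i contribute to the Betti number of index (i, j), and a
  contribution depends on J only up to linear isomorphism of its span. Grouping the sets J by the
  (j - i)-dimensional subspace that they span gives (a). For (b) all J of size j are taken together:
  the alternating sum of their Euler characteristics counts pairs of J and an independent subset A
  of size k, and choosing first A and then J yields the binomial coefficients.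

  Tor is computed from an arbitrary graded free resolution, so Hochster's formula is reached through
  the Koszul complex: by dimension shifting the Koszul homology of k[K] is Tor of that resolution.
*)
theory Submission
  imports
    Defs
    "HOL-Library.Function_Algebras"
    "HOL-Computational_Algebra.Polynomial_Factorial"
    "HOL-Library.Countable_Set"
begin

text \<open>The coefficients may be the integers, so ranks replace dimensions and are made additive
  by passing to the fraction field. Homology modules are never formed: a subquotient is a pair of
  sets, and two ranks are compared through an additive relation between representatives.
  \<open>tor_rank\<close> selects its resolution by \<open>SOME\<close>, so a resolution must be
  shown to exist. Its generators are natural numbers, which calls for countable coefficients; this
  is where the restriction to the integers or a prime field enters. Dimension shifting works because
  the Koszul complex of a free module is exact in positive exterior degree, and the same contracting
  homotopy disposes of all multidegrees that are not squarefree. The Gaussian binomial arises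
  without counting subspaces: pairs of a vertex set of rank \<open>d\<close> and a basis of its span
  are counted twice, so the factor is the number of independent \<open>d\<close>-sets in dimension
  \<open>n\<close> divided by that in dimension \<open>d\<close>.\<close>

section \<open>Modules, submodules and ranks of subquotients\<close>

locale kmodule =
  fixes scl :: "'k::idom \<Rightarrow> 'a::ab_group_add \<Rightarrow> 'a"
  assumes scl_add_right: "scl c (x + y) = scl c x + scl c y"
    and scl_add_left: "scl (c + d) x = scl c x + scl d x"
    and scl_scl: "scl c (scl d x) = scl (c * d) x"
    and scl_one: "scl 1 x = x"
begin

lemma scl_zero_right: "scl c 0 = 0"
  using scl_add_right[of c 0 0] by simp

lemma scl_zero_left: "scl 0 x = 0"
  using scl_add_left[of 0 0 x] by simp

lemma scl_minus_left: "scl (- c) x = - scl c x"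
  using scl_add_left[of "-c" c x] by (simp add: eq_neg_iff_add_eq_0 scl_zero_left scl_zero_right)

lemma scl_minus_right: "scl c (- x) = - scl c x"
  using scl_add_right[of c "-x" x] by (simp add: eq_neg_iff_add_eq_0 scl_zero_left scl_zero_right)

lemma scl_diff_right: "scl c (x - y) = scl c x - scl c y"
  using scl_add_right[of c x "-y"] by (simp add: scl_minus_right)

lemma scl_sum: "scl c (sum f A) = (\<Sum>a\<in>A. scl c (f a))"
  by (induction A rule: infinite_finite_induct) (auto simp: scl_add_right scl_zero_right)

end

definition submod :: "('k \<Rightarrow> 'a \<Rightarrow> 'a::ab_group_add) \<Rightarrow> 'a set \<Rightarrow> bool" where
  "submod scl Z \<longleftrightarrow> 0 \<in> Z \<and> (\<forall>x\<in>Z. \<forall>y\<in>Z. x + y \<in> Z) \<and> (\<forall>c. \<forall>x\<in>Z. scl c x \<in> Z)"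

lemma submodI:
  assumes "0 \<in> Z" "\<And>x y. x \<in> Z \<Longrightarrow> y \<in> Z \<Longrightarrow> x + y \<in> Z" "\<And>c x. x \<in> Z \<Longrightarrow> scl c x \<in> Z"
  shows "submod scl Z"
  using assms by (auto simp: submod_def)

lemma submodD:
  assumes "submod scl Z"
  shows "0 \<in> Z" "\<And>x y. x \<in> Z \<Longrightarrow> y \<in> Z \<Longrightarrow> x + y \<in> Z" "\<And>c x. x \<in> Z \<Longrightarrow> scl c x \<in> Z"
  using assms by (auto simp: submod_def)

lemma submod_sum:
  "submod scl Z \<Longrightarrow> (\<And>a. a \<in> A \<Longrightarrow> f a \<in> Z) \<Longrightarrow> sum f A \<in> Z"
  by (induction A rule: infinite_finite_induct) (auto simp: submod_def)

context kmodule begin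

lemma submod_minus: "submod scl Z \<Longrightarrow> x \<in> Z \<Longrightarrow> - x \<in> Z"
  using submodD(3)[of scl Z x "-1"] by (simp add: scl_minus_left scl_one)

lemma submod_diff: "submod scl Z \<Longrightarrow> x \<in> Z \<Longrightarrow> y \<in> Z \<Longrightarrow> x - y \<in> Z"
  using submodD(2)[of scl Z x "-y"] submod_minus by simp

end

definition indep_mod :: "('k::zero \<Rightarrow> 'a \<Rightarrow> 'a::ab_group_add) \<Rightarrow> 'a set \<Rightarrow> 'a set \<Rightarrow> bool" where
  "indep_mod scl B A \<longleftrightarrow> (\<forall>c. (\<Sum>a\<in>A. scl (c a) a) \<in> B \<longrightarrow> (\<forall>a\<in>A. c a = 0))"

text \<open>Same formula as \<open>subquotient_rank\<close>, for an arbitrary action: the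
  subquotients to be compared consist of polynomials, cochains and Koszul chains. The supremum is
  meaningful only for bounded sizes.\<close>

definition mrank :: "('k::zero \<Rightarrow> 'a \<Rightarrow> 'a::ab_group_add) \<Rightarrow> 'a set \<Rightarrow> 'a set \<Rightarrow> nat" where
  "mrank scl Z B = Sup {card A | A. finite A \<and> A \<subseteq> Z \<and> indep_mod scl B A}"

lemma subquotient_rank_eq_mrank: "subquotient_rank Z B = mrank scale Z B"
  by (simp add: subquotient_rank_def mrank_def indep_mod_def)

text \<open>Additive relations, as opposed to maps, cover connecting homomorphisms without choosing
  preimages.\<close>

definition quot_iso_rel ::
    "('k::idom \<Rightarrow> 'a \<Rightarrow> 'a::ab_group_add) \<Rightarrow> ('k \<Rightarrow> 'b \<Rightarrow> 'b::ab_group_add) \<Rightarrow> 'a set \<Rightarrow> 'a set \<Rightarrow>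
     'b set \<Rightarrow> 'b set \<Rightarrow> ('a \<Rightarrow> 'b \<Rightarrow> bool) \<Rightarrow> bool" where
  "quot_iso_rel s1 s2 Z1 B1 Z2 B2 \<rho> \<longleftrightarrow>
     submod s1 Z1 \<and> submod s2 Z2 \<and> 0 \<in> B1 \<and> 0 \<in> B2 \<and> \<rho> 0 0 \<and>
     (\<forall>x y x' y'. \<rho> x y \<longrightarrow> \<rho> x' y' \<longrightarrow> \<rho> (x + x') (y + y')) \<and>
     (\<forall>c x y. \<rho> x y \<longrightarrow> \<rho> (s1 c x) (s2 c y)) \<and>
     (\<forall>x\<in>Z1. \<exists>y\<in>Z2. \<rho> x y) \<and> (\<forall>y\<in>Z2. \<exists>x\<in>Z1. \<rho> x y) \<and>
     (\<forall>x\<in>Z1. \<forall>y\<in>Z2. \<rho> x y \<longrightarrow> x \<in> B1 \<longleftrightarrow> y \<in> B2)"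

lemma quot_iso_rel_sym:
  "quot_iso_rel s1 s2 Z1 B1 Z2 B2 \<rho> \<Longrightarrow> quot_iso_rel s2 s1 Z2 B2 Z1 B1 (\<lambda>y x. \<rho> x y)"
  unfolding quot_iso_rel_def by blast

text \<open>Elements related to the members of \<open>A\<close> are chosen arbitrarily. The relation
  is compatible with linear combinations and matches \<open>B1\<close> with \<open>B2\<close>, so a
  combination of the chosen elements that lies in \<open>B2\<close> comes from a combination of
  \<open>A\<close> in \<open>B1\<close>.\<close>

lemma quot_iso_rel_indep:
  assumes m1: "kmodule s1" and m2: "kmodule s2" and \<rho>: "quot_iso_rel s1 s2 Z1 B1 Z2 B2 \<rho>"
    and A: "finite A" "A \<subseteq> Z1" "indep_mod s1 B1 A"
  shows "\<exists>A'. finite A' \<and> A' \<subseteq> Z2 \<and> indep_mod s2 B2 A' \<and> card A' = card A"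
proof -
  interpret m1: kmodule s1 by fact
  interpret m2: kmodule s2 by fact
  have Z1: "submod s1 Z1" and Z2: "submod s2 Z2" and B2: "0 \<in> B2" and \<rho>0: "\<rho> 0 0"
    and \<rho>_add: "\<And>x y x' y'. \<rho> x y \<Longrightarrow> \<rho> x' y' \<Longrightarrow> \<rho> (x + x') (y + y')"
    and \<rho>_scl: "\<And>c x y. \<rho> x y \<Longrightarrow> \<rho> (s1 c x) (s2 c y)"
    and tot: "\<And>x. x \<in> Z1 \<Longrightarrow> \<exists>y\<in>Z2. \<rho> x y"
    and iff: "\<And>x y. x \<in> Z1 \<Longrightarrow> y \<in> Z2 \<Longrightarrow> \<rho> x y \<Longrightarrow> x \<in> B1 \<longleftrightarrow> y \<in> B2"
    using \<rho> unfolding quot_iso_rel_def by blast+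
  have "\<forall>x\<in>A. \<exists>y. y \<in> Z2 \<and> \<rho> x y" using A(2) tot by blast
  from bchoice[OF this] obtain f where f: "\<And>x. x \<in> A \<Longrightarrow> f x \<in> Z2" "\<And>x. x \<in> A \<Longrightarrow> \<rho> x (f x)"
    by blast
  have sums: "\<rho> (\<Sum>a\<in>S. s1 (c a) a) (\<Sum>a\<in>S. s2 (c a) (f a))" if "S \<subseteq> A" for S and c
  proof -
    from that A(1) have "finite S" using finite_subset by blast
    then show ?thesis using that
    proof (induction S)
      case empty
      then show ?case using \<rho>0 by simp
    next
      case (insert x S)
      then show ?case by (simp add: \<rho>_add \<rho>_scl f)
    qed
  qed
  have key: "\<forall>a\<in>A. c a = 0" if "(\<Sum>a\<in>A. s2 (c a) (f a)) \<in> B2" for c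
  proof -
    have "(\<Sum>a\<in>A. s1 (c a) a) \<in> Z1" by (intro submod_sum[OF Z1] submodD(3)[OF Z1]) (use A(2) in auto)
    moreover have "(\<Sum>a\<in>A. s2 (c a) (f a)) \<in> Z2" by (intro submod_sum[OF Z2] submodD(3)[OF Z2] f)
    ultimately have "(\<Sum>a\<in>A. s1 (c a) a) \<in> B1" using sums[OF subset_refl, of c] that iff by blast
    then show ?thesis using A(3) by (auto simp: indep_mod_def)
  qed
  have inj: "inj_on f A"
  proof (rule inj_onI)
    fix a b assume ab: "a \<in> A" "b \<in> A" "f a = f b"
    show "a = b"
    proof (rule ccontr)
      assume ne: "a \<noteq> b"
      \<comment> \<open>If \<open>f a = f b\<close>, the combination with coefficients 1 and -1 is
        zero and so lies in \<open>B2\<close>; independence then gives 1 = 0.\<close>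
      define c where "c = (\<lambda>x. if x = a then 1 else if x = b then -1 else 0 :: 'a)"
      have "(\<Sum>x\<in>A. s2 (c x) (f x)) = (\<Sum>x\<in>{a, b}. s2 (c x) (f x))"
        by (rule sum.mono_neutral_right) (use ab A in \<open>auto simp: c_def m2.scl_zero_left\<close>)
      also have "\<dots> = 0" using ne ab by (simp add: c_def m2.scl_minus_left m2.scl_one)
      finally have "\<forall>x\<in>A. c x = 0" using key[of c] B2 by simp
      then show False using ab(1) by (auto simp: c_def)
    qed
  qed
  have "indep_mod s2 B2 (f ` A)"
    unfolding indep_mod_def
  proof (intro allI impI)
    fix c assume "(\<Sum>a\<in>f ` A. s2 (c a) a) \<in> B2"
    then have "(\<Sum>a\<in>A. s2 (c (f a)) (f a)) \<in> B2" using inj by (simp add: sum.reindex)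
    from key[OF this] show "\<forall>a\<in>f ` A. c a = 0" by simp
  qed
  then show ?thesis using A(1) f(1) inj by (intro exI[of _ "f ` A"]) (auto simp: card_image)
qed

text \<open>Independent families transport in both directions, so the two suprema are taken over
  literally the same set of sizes.\<close>

lemma quot_iso_rel_mrank:
  assumes m1: "kmodule s1" and m2: "kmodule s2" and \<rho>: "quot_iso_rel s1 s2 Z1 B1 Z2 B2 \<rho>"
  shows "mrank s1 Z1 B1 = mrank s2 Z2 B2"
proof -
  have "{card A | A. finite A \<and> A \<subseteq> Z1 \<and> indep_mod s1 B1 A} =
      {card A | A. finite A \<and> A \<subseteq> Z2 \<and> indep_mod s2 B2 A}"
    using quot_iso_rel_indep[OF m1 m2 \<rho>] quot_iso_rel_indep[OF m2 m1 quot_iso_rel_sym[OF \<rho>]]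
    by (auto; metis)
  then show ?thesis by (simp add: mrank_def)
qed

lemma indep_mod_notin:
  assumes "kmodule scl" "finite A" "indep_mod scl B A" "a \<in> A"
  shows "a \<notin> B"
proof
  interpret kmodule scl by fact
  assume "a \<in> B"
  have "(\<Sum>x\<in>A. scl (if x = a then 1 else 0) x) = (\<Sum>x\<in>{a}. scl (if x = a then 1 else 0) x)"
    by (rule sum.mono_neutral_right) (use assms in \<open>auto simp: scl_zero_left\<close>)
  also have "\<dots> = a" by (simp add: scl_one)
  finally have "(\<Sum>x\<in>A. scl (if x = a then 1 else 0) x) = a" .
  with \<open>a \<in> B\<close> have "(\<Sum>x\<in>A. scl (if x = a then 1 else 0) x) \<in> B" by simp
  with assms(3)[unfolded indep_mod_def, THEN spec, of "\<lambda>x. if x = a then 1 else 0"]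
  show False using assms(4) by auto
qed

subsection \<open>Additivity of the rank over a domain\<close>

lemma sum_fun_apply: "(\<Sum>a\<in>A. f a) x = (\<Sum>a\<in>A. f a x)"
  by (induction A rule: infinite_finite_induct) auto

definition fscale :: "'k::times \<Rightarrow> ('b \<Rightarrow> 'k) \<Rightarrow> 'b \<Rightarrow> 'k" where
  "fscale c f = (\<lambda>x. c * f x)"

lemma fscale_apply: "fscale c f x = c * f x"
  by (simp add: fscale_def)

lemma kmodule_fscale: "kmodule (fscale :: 'k::idom \<Rightarrow> _)"
  by standard (auto simp: fscale_def algebra_simps)

interpretation fscale: kmodule "fscale :: 'k::idom \<Rightarrow> ('b \<Rightarrow> 'k) \<Rightarrow> _"
  by (rule kmodule_fscale)

interpretation fvs: vector_space "fscale :: 'f::field \<Rightarrow> ('b \<Rightarrow> 'f) \<Rightarrow> _"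
  by standard (auto simp: fscale_def algebra_simps)

definition supported_on :: "'b set \<Rightarrow> ('b \<Rightarrow> 'k::zero) set" where
  "supported_on S = {f. \<forall>x. x \<notin> S \<longrightarrow> f x = 0}"

definition frac_emb :: "('b \<Rightarrow> 'k::idom) \<Rightarrow> 'b \<Rightarrow> 'k fract" where
  "frac_emb f = (\<lambda>x. to_fract (f x))"

lemma frac_emb_add: "frac_emb (f + g) = frac_emb f + frac_emb g"
  by (auto simp: frac_emb_def)

lemma frac_emb_zero [simp]: "frac_emb 0 = 0"
  by (auto simp: frac_emb_def)

lemma frac_emb_scale: "frac_emb (fscale c f) = fscale (to_fract c) (frac_emb f)"
  by (auto simp: frac_emb_def fscale_apply)

lemma frac_emb_sum: "frac_emb (sum f A) = (\<Sum>a\<in>A. frac_emb (f a))"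
  by (rule ext) (simp add: frac_emb_def sum_fun_apply to_fract_sum)

lemma inj_frac_emb: "inj frac_emb"
  by (rule injI) (auto simp: frac_emb_def fun_eq_iff)

lemma fract_eq_quotient:
  obtains a b where "x = to_fract a / to_fract b" "b \<noteq> (0::'k::idom)"
proof (cases x)
  case (Fract a b)
  then show ?thesis using that[of a b] by (simp add: to_fract_def)
qed

text \<open>An element of the span is a finite sum of fractions times images of elements of
  \<open>B\<close>. One denominator is absorbed at each step of the span induction, and closure of
  \<open>B\<close> under scalars keeps the numerator in \<open>B\<close>.\<close>

lemma frac_span_clear_denominators:
  assumes B: "submod fscale B" and x: "x \<in> fvs.span (frac_emb ` B)"
  shows "\<exists>q\<noteq>0. \<exists>b\<in>B. fscale (to_fract q) x = frac_emb b"
  using x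
proof (induction rule: fvs.span_induct_alt)
  case base
  have "fscale (to_fract 1) 0 = frac_emb 0" by (simp add: fscale.scl_zero_right)
  with submodD(1)[OF B] have "\<exists>b\<in>B. fscale (to_fract 1) 0 = frac_emb b" by blast
  then show ?case by (intro exI[of _ 1] conjI) (rule one_neq_zero)
next
  case (step c x y)
  obtain b0 where b0: "b0 \<in> B" "x = frac_emb b0" using step by blast
  obtain q b where qb: "q \<noteq> 0" "b \<in> B" "fscale (to_fract q) y = frac_emb b" using step by blast
  obtain m n where mn: "c = to_fract m / to_fract n" "n \<noteq> 0" by (rule fract_eq_quotient)
  have n0: "to_fract n \<noteq> 0" using mn by simp
  have "fscale (to_fract (q * n)) (fscale c x + y) =
      fscale (to_fract (q * m)) x + fscale (to_fract n) (fscale (to_fract q) y)"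
    using n0 by (auto simp: mn(1) fun_eq_iff fscale_apply field_simps)
  also have "\<dots> = frac_emb (fscale (q * m) b0 + fscale n b)"
    by (simp add: qb b0 frac_emb_add frac_emb_scale)
  finally have "fscale (to_fract (q * n)) (fscale c x + y) = frac_emb (fscale (q * m) b0 + fscale n b)" .
  moreover have "fscale (q * m) b0 + fscale n b \<in> B" using qb(2) b0(1) submodD[OF B] by blast
  moreover have "q * n \<noteq> 0" using qb(1) mn(2) by simp
  ultimately show ?case by blast
qed

lemma common_denominator:
  assumes "finite A"
  shows "\<exists>q\<noteq>0. \<exists>d. \<forall>a\<in>A. to_fract q * c a = to_fract (d a :: 'k::idom)"
  using assms
proof induction
  case empty
  then show ?case by (intro exI[of _ 1]) auto
next
  case (insert x A)
  obtain q d where qd: "q \<noteq> 0" "\<forall>a\<in>A. to_fract q * c a = to_fract (d a)" using insert by auto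
  obtain m n where mn: "c x = to_fract m / to_fract n" "n \<noteq> 0" by (rule fract_eq_quotient)
  have n0: "to_fract n \<noteq> 0" using mn by simp
  have "to_fract (n * q) * c a = to_fract (if a = x then q * m else n * d a)"
    if "a \<in> insert x A" for a
  proof (cases "a = x")
    case True
    then show ?thesis using n0 by (simp add: mn)
  next
    case False
    then have "to_fract q * c a = to_fract (d a)" using that qd by auto
    then show ?thesis using False by (simp add: mult.assoc)
  qed
  then have "\<forall>a\<in>insert x A. to_fract (n * q) * c a = to_fract (if a = x then q * m else n * d a)"
    by auto
  then show ?case using qd mn
    by (intro exI[of _ "n * q"] conjI exI[of _ "\<lambda>a. if a = x then q * m else n * d a"]) auto
qed

text \<open>Independence modulo \<open>B\<close> survives in the fraction field, even jointly with
  an independent family \<open>b\<close> drawn from the image of \<open>B\<close>. A linear relation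
  is multiplied by \<open>q\<close> to clear the coefficients on \<open>A\<close> and by
  \<open>r\<close> to bring the part in the span into \<open>B\<close>; both can be cancelled in a
  domain.\<close>

lemma indep_mod_frac_independent:
  assumes B: "submod fscale B" and A: "finite A" "indep_mod fscale B A"
    and b: "b \<subseteq> frac_emb ` B" "fvs.independent b" "finite b"
  shows "fvs.independent (frac_emb ` A \<union> b)" "frac_emb ` A \<inter> b = {}"
proof -
  show disj: "frac_emb ` A \<inter> b = {}"
    using indep_mod_notin[OF kmodule_fscale A] b(1) inj_frac_emb by (auto simp: inj_on_def)
  show "fvs.independent (frac_emb ` A \<union> b)"
  proof (rule fvs.independent_if_scalars_zero)
    show "finite (frac_emb ` A \<union> b)" using A b by simp
    fix u x assume s: "(\<Sum>x\<in>frac_emb ` A \<union> b. fscale (u x) x) = 0" and x: "x \<in> frac_emb ` A \<union> b"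
    have split: "(\<Sum>x\<in>A. fscale (u (frac_emb x)) (frac_emb x)) + (\<Sum>x\<in>b. fscale (u x) x) = 0"
      using s disj A b inj_frac_emb
      by (simp add: sum.union_disjoint sum.reindex inj_on_subset[OF inj_frac_emb])
    obtain q d where qd: "q \<noteq> 0" "\<forall>a\<in>A. to_fract q * u (frac_emb a) = to_fract (d a)"
      using common_denominator[OF A(1), of "\<lambda>a. u (frac_emb a)"] by auto
    have qs: "fscale (to_fract q) (\<Sum>x\<in>A. fscale (u (frac_emb x)) (frac_emb x)) =
        frac_emb (\<Sum>a\<in>A. fscale (d a) a)"
      using qd by (auto simp: fscale.scl_sum frac_emb_sum frac_emb_scale fscale.scl_scl intro!: sum.cong)
    have "- (\<Sum>x\<in>b. fscale (u x) x) \<in> fvs.span (frac_emb ` B)"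
      using b(1) by (intro fvs.span_neg fvs.span_sum fvs.span_scale fvs.span_base) auto
    moreover have "(\<Sum>x\<in>A. fscale (u (frac_emb x)) (frac_emb x)) = - (\<Sum>x\<in>b. fscale (u x) x)"
      using split by (simp only: eq_neg_iff_add_eq_0)
    ultimately have "(\<Sum>x\<in>A. fscale (u (frac_emb x)) (frac_emb x)) \<in> fvs.span (frac_emb ` B)" by simp
    from fvs.span_scale[OF this, of "to_fract q"]
    have "frac_emb (\<Sum>a\<in>A. fscale (d a) a) \<in> fvs.span (frac_emb ` B)" unfolding qs .
    from frac_span_clear_denominators[OF B this]
    obtain r y where ry: "r \<noteq> 0" "y \<in> B"
      "frac_emb (fscale r (\<Sum>a\<in>A. fscale (d a) a)) = frac_emb y" unfolding frac_emb_scale by blast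
    then have "fscale r (\<Sum>a\<in>A. fscale (d a) a) = y" using injD[OF inj_frac_emb] by blast
    then have "(\<Sum>a\<in>A. fscale (r * d a) a) \<in> B"
      using ry by (simp add: fscale.scl_sum fscale.scl_scl)
    then have "\<forall>a\<in>A. r * d a = 0" using A(2) unfolding indep_mod_def by fastforce
    then have "\<forall>a\<in>A. d a = 0" using ry by auto
    then have uA: "\<forall>a\<in>A. u (frac_emb a) = 0" using qd by force
    then have "(\<Sum>x\<in>b. fscale (u x) x) = 0" using split by simp
    then have "\<forall>x\<in>b. u x = 0"
      using b(2,3) unfolding fvs.independent_explicit_finite_subsets by blast
    then show "u x = 0" using x uA by auto
  qed
qed

definition delta :: "'b \<Rightarrow> 'b \<Rightarrow> 'k::zero_neq_one" where
  "delta x = (\<lambda>y. if y = x then 1 else 0)"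

lemma supported_on_span_delta:
  fixes f :: "'b \<Rightarrow> 'f::field"
  assumes "finite S" "f \<in> supported_on S"
  shows "f = (\<Sum>x\<in>S. fscale (f x) (delta x))"
proof
  fix y
  have "(\<Sum>x\<in>S. fscale (f x) (delta x)) y = (\<Sum>x\<in>S. if y = x then f x else 0)"
    by (auto simp: sum_fun_apply delta_def fscale_apply intro!: sum.cong)
  also have "\<dots> = f y" using assms by (auto simp: supported_on_def)
  finally show "f y = (\<Sum>x\<in>S. fscale (f x) (delta x)) y" by simp
qed

lemma supported_on_in_span:
  fixes f :: "'b \<Rightarrow> 'f::field"
  assumes "finite S" "f \<in> supported_on S"
  shows "f \<in> fvs.span (delta ` S)"
  by (subst supported_on_span_delta[OF assms]) (intro fvs.span_sum fvs.span_scale fvs.span_base imageI)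

lemma delta_independent:
  assumes "finite S"
  shows "fvs.independent (delta ` S :: ('b \<Rightarrow> 'f::field) set)"
proof (rule fvs.independent_if_scalars_zero)
  show "finite (delta ` S :: ('b \<Rightarrow> 'f) set)" using assms by simp
  have inj: "inj (delta :: 'b \<Rightarrow> 'b \<Rightarrow> 'f)"
    by (rule injI) (auto simp: delta_def fun_eq_iff split: if_splits)
  fix u :: "('b \<Rightarrow> 'f) \<Rightarrow> 'f" and x :: "'b \<Rightarrow> 'f"
  assume s: "(\<Sum>x\<in>delta ` S. fscale (u x) x) = 0" and "x \<in> delta ` S"
  then obtain y where y: "x = delta y" "y \<in> S" by auto
  have "(\<Sum>x\<in>S. fscale (u (delta x)) (delta x)) = 0"
    using s sum.reindex[OF inj_on_subset[OF inj subset_UNIV, of S], of "\<lambda>x. fscale (u x) x"]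
    by (simp only: comp_def)
  then have "0 = (\<Sum>x\<in>S. fscale (u (delta x)) (delta x)) y" by simp
  also have "\<dots> = (\<Sum>x\<in>S. if y = x then u (delta x) else 0)"
    by (auto simp: sum_fun_apply delta_def fscale_apply intro!: sum.cong)
  also have "\<dots> = u x" using y assms by simp
  finally show "u x = 0" by simp
qed

text \<open>For the upper bound, a basis of the span of \<open>B\<close> is adjoined to an
  independent family. The family attaining it is the preimage of what extends that basis to a
  maximal independent subset of the image of \<open>Z\<close>. Finiteness of \<open>S\<close> makes
  all these families finite.\<close>

lemma mrank_eq_dim_diff:
  fixes Z B :: "('b \<Rightarrow> 'k::idom) set"
  assumes S: "finite S" "Z \<subseteq> supported_on S" and Z: "submod fscale Z" and B: "submod fscale B" "B \<subseteq> Z"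
  shows "mrank fscale Z B + fvs.dim (frac_emb ` B) = fvs.dim (frac_emb ` Z)"
proof -
  have sp: "frac_emb ` Z \<subseteq> fvs.span (delta ` S)"
  proof
    fix f assume "f \<in> frac_emb ` Z"
    then have "f \<in> supported_on S" using S(2) by (auto simp: supported_on_def frac_emb_def)
    then show "f \<in> fvs.span (delta ` S)" by (rule supported_on_in_span[OF S(1)])
  qed
  obtain b where b: "b \<subseteq> frac_emb ` B" "fvs.independent b" "frac_emb ` B \<subseteq> fvs.span b"
      "card b = fvs.dim (frac_emb ` B)"
    by (rule fvs.basis_exists)
  have fin: "finite c" if "c \<subseteq> frac_emb ` Z" "fvs.independent c" for c
    using fvs.independent_span_bound[of "delta ` S" c] S(1) sp that by auto
  have bZ: "b \<subseteq> frac_emb ` Z" using b(1) B(2) by auto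
  obtain z where z: "b \<subseteq> z" "z \<subseteq> frac_emb ` Z" "fvs.independent z" "frac_emb ` Z \<subseteq> fvs.span z"
    using fvs.maximal_independent_subset_extend[OF bZ b(2)] by blast
  have dimZ: "card z = fvs.dim (frac_emb ` Z)" using z by (intro fvs.basis_card_eq_dim)
  have finz: "finite z" and finb: "finite b" using fin z b bZ by auto
  let ?N = "{card A | A. finite A \<and> A \<subseteq> Z \<and> indep_mod fscale B A}"
  have ub: "n + card b \<le> card z" if "n \<in> ?N" for n
  proof -
    from that obtain A where A: "n = card A" "finite A" "A \<subseteq> Z" "indep_mod fscale B A" by auto
    note * = indep_mod_frac_independent[OF B(1) A(2,4) b(1,2) finb]
    have "frac_emb ` A \<union> b \<subseteq> fvs.span z" using A(3) bZ z(4) by auto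
    then have "card (frac_emb ` A \<union> b) \<le> card z"
      using fvs.independent_span_bound[OF finz *(1)] by auto
    moreover have "card (frac_emb ` A \<union> b) = card A + card b"
      using * A(2) finb by (simp add: card_Un_disjoint card_image inj_on_subset[OF inj_frac_emb])
    ultimately show ?thesis using A(1) by simp
  qed
  define A where "A = frac_emb -` (z - b) \<inter> Z"
  have imA: "frac_emb ` A = z - b" using z(2) by (auto simp: A_def)
  have injA: "inj_on frac_emb A" by (rule inj_on_subset[OF inj_frac_emb]) simp
  have finA: "finite A" using imA finz injA by (metis finite_Diff finite_imageD)
  have cardA: "card A + card b = card z"
    using imA injA z(1) finz finb
    by (metis card_image card_Diff_subset card_mono le_add_diff_inverse2)
  have "indep_mod fscale B A"
    unfolding indep_mod_def
  proof (intro allI impI)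
    fix c assume "(\<Sum>a\<in>A. fscale (c a) a) \<in> B"
    then have "frac_emb (\<Sum>a\<in>A. fscale (c a) a) \<in> fvs.span b" using b(3) by auto
    then have "(\<Sum>a\<in>A. fscale (to_fract (c a)) (frac_emb a)) \<in> fvs.span b"
      by (simp add: frac_emb_sum frac_emb_scale)
    then obtain u where u: "(\<Sum>a\<in>A. fscale (to_fract (c a)) (frac_emb a)) = (\<Sum>v\<in>b. fscale (u v) v)"
      using fvs.span_finite[OF finb] by auto
    \<comment> \<open>Moves the combination of \<open>b\<close> to the other side: \<open>w\<close>
      are the coefficients of a vanishing combination of the whole basis \<open>z\<close>.\<close>
    define w where "w v = (if v \<in> b then - u v else to_fract (c (the_inv_into A frac_emb v)))" for v
    have "(\<Sum>v\<in>z. fscale (w v) v) = (\<Sum>v\<in>z - b. fscale (w v) v) + (\<Sum>v\<in>b. fscale (w v) v)"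
      by (rule sum.subset_diff[OF z(1) finz])
    also have "(\<Sum>v\<in>z - b. fscale (w v) v) = (\<Sum>a\<in>A. fscale (w (frac_emb a)) (frac_emb a))"
      using injA by (simp add: imA[symmetric] sum.reindex)
    also have "\<dots> = (\<Sum>a\<in>A. fscale (to_fract (c a)) (frac_emb a))"
    proof (rule sum.cong)
      fix a assume a: "a \<in> A"
      then have "frac_emb a \<notin> b" using imA by auto
      then show "fscale (w (frac_emb a)) (frac_emb a) = fscale (to_fract (c a)) (frac_emb a)"
        using a injA by (simp add: w_def the_inv_into_f_f)
    qed simp
    also have "(\<Sum>v\<in>b. fscale (w v) v) = - (\<Sum>v\<in>b. fscale (u v) v)"
      by (simp add: w_def fscale.scl_minus_left sum_negf)
    finally have "(\<Sum>v\<in>z. fscale (w v) v) = 0" unfolding u by (simp only: add.right_inverse)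
    then have w0: "\<forall>v\<in>z. w v = 0"
      using z(3) finz unfolding fvs.independent_explicit_finite_subsets by blast
    show "\<forall>a\<in>A. c a = 0"
    proof
      fix a assume a: "a \<in> A"
      then have "frac_emb a \<in> z" "frac_emb a \<notin> b" using imA by auto
      then show "c a = 0" using w0 a injA by (force simp: w_def the_inv_into_f_f)
    qed
  qed
  then have mem: "card A \<in> ?N" using finA by (auto simp: A_def)
  have "mrank fscale Z B = card A"
    unfolding mrank_def
  proof (rule cSup_eq_maximum[OF mem])
    fix n assume "n \<in> ?N"
    from ub[OF this] cardA show "n \<le> card A" by linarith
  qed
  then show ?thesis using cardA dimZ b(4) by simp
qed

lemma submod_zero: "submod fscale {0 :: 'b \<Rightarrow> 'k::idom}"
  by (auto simp: submod_def fscale.scl_zero_right)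

text \<open>The three dimension formulas telescope, so additivity holds although a subquotient over
  a domain need not be free.\<close>

lemma mrank_add:
  fixes Z B N :: "('b \<Rightarrow> 'k::idom) set"
  assumes "finite S" "Z \<subseteq> supported_on S" "submod fscale Z" "submod fscale N" "submod fscale B"
    "B \<subseteq> N" "N \<subseteq> Z"
  shows "mrank fscale Z B = mrank fscale Z N + mrank fscale N B"
proof -
  have "mrank fscale Z B + fvs.dim (frac_emb ` B) = fvs.dim (frac_emb ` Z)"
    by (rule mrank_eq_dim_diff[OF assms(1)]) (use assms in auto)
  moreover have "mrank fscale Z N + fvs.dim (frac_emb ` N) = fvs.dim (frac_emb ` Z)"
    by (rule mrank_eq_dim_diff[OF assms(1)]) (use assms in auto)
  moreover have "mrank fscale N B + fvs.dim (frac_emb ` B) = fvs.dim (frac_emb ` N)"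
    by (rule mrank_eq_dim_diff[OF assms(1)]) (use assms in auto)
  ultimately show ?thesis by simp
qed

lemma submod_supported_on: "submod fscale (supported_on S :: ('b \<Rightarrow> 'k::idom) set)"
  by (auto simp: submod_def supported_on_def fscale_apply)

lemma mrank_supported_on:
  assumes "finite S"
  shows "mrank fscale (supported_on S :: ('b \<Rightarrow> 'k::idom) set) {0} = card S"
proof -
  let ?Z = "supported_on S :: ('b \<Rightarrow> 'k) set"
  have emb_delta: "frac_emb (delta x :: 'b \<Rightarrow> 'k) = delta x" for x
    by (auto simp: frac_emb_def delta_def)
  have "card (delta ` S :: ('b \<Rightarrow> 'k fract) set) = fvs.dim (frac_emb ` ?Z)"
  proof (rule fvs.basis_card_eq_dim)
    show "delta ` S \<subseteq> frac_emb ` ?Z"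
    proof
      fix f :: "'b \<Rightarrow> 'k fract" assume "f \<in> delta ` S"
      then obtain x where "x \<in> S" "f = frac_emb (delta x)" using emb_delta by auto
      then show "f \<in> frac_emb ` ?Z" by (auto simp: supported_on_def delta_def)
    qed
    show "frac_emb ` ?Z \<subseteq> fvs.span (delta ` S)"
    proof
      fix f assume "f \<in> frac_emb ` ?Z"
      then have "f \<in> supported_on S" by (auto simp: supported_on_def frac_emb_def)
      then show "f \<in> fvs.span (delta ` S)" by (rule supported_on_in_span[OF assms])
    qed
    show "fvs.independent (delta ` S :: ('b \<Rightarrow> 'k fract) set)" by (rule delta_independent[OF assms])
  qed
  moreover have "card (delta ` S :: ('b \<Rightarrow> 'k fract) set) = card S"
    by (rule card_image, rule inj_onI) (auto simp: delta_def fun_eq_iff split: if_splits)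
  moreover have "mrank fscale ?Z {0} + fvs.dim (frac_emb ` {0 :: 'b \<Rightarrow> 'k}) = fvs.dim (frac_emb ` ?Z)"
    by (rule mrank_eq_dim_diff[OF assms _ submod_supported_on submod_zero]) (auto simp: supported_on_def)
  moreover have "fvs.dim (frac_emb ` {0 :: 'b \<Rightarrow> 'k}) = 0"
    using fvs.dim_le_card[of "{0 :: 'b \<Rightarrow> 'k fract}" "{}"] fvs.span_zero by simp
  ultimately show ?thesis by simp
qed

section \<open>Ranks of direct sums\<close>

text \<open>The direct sum of the \<open>Z i\<close>, encoded on pairs so that it is again a set of
  scalar functions, to which additivity of the rank applies.\<close>

definition fiberwise :: "'i set \<Rightarrow> ('i \<Rightarrow> ('b \<Rightarrow> 'k::idom) set) \<Rightarrow> ('i \<times> 'b \<Rightarrow> 'k) set" where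
  "fiberwise I Z = {f. (\<forall>i\<in>I. (\<lambda>x. f (i, x)) \<in> Z i) \<and> (\<forall>i x. i \<notin> I \<longrightarrow> f (i, x) = 0)}"

lemma fiber_zero: "(\<lambda>x. (0 :: 'i \<times> 'b \<Rightarrow> 'k::idom) (i, x)) = 0"
  by (rule ext) (simp only: zero_fun_apply)

lemma fiber_add: "(\<lambda>x. (f + g :: 'i \<times> 'b \<Rightarrow> 'k::idom) (i, x)) = (\<lambda>x. f (i, x)) + (\<lambda>x. g (i, x))"
  by (rule ext) (simp only: plus_fun_apply)

lemma fiber_fscale: "(\<lambda>x. fscale c f (i, x)) = fscale c (\<lambda>x. f (i, x))"
  by (rule ext) (simp only: fscale_apply)

lemma submod_fiberwise:
  assumes "\<And>i. i \<in> I \<Longrightarrow> submod fscale (Z i)"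
  shows "submod fscale (fiberwise I Z)"
proof (rule submodI)
  show "0 \<in> fiberwise I Z"
    unfolding fiberwise_def mem_Collect_eq fiber_zero using submodD(1)[OF assms] by auto
  show "f + g \<in> fiberwise I Z" if "f \<in> fiberwise I Z" "g \<in> fiberwise I Z" for f g
    using that submodD(2)[OF assms] unfolding fiberwise_def mem_Collect_eq fiber_add by auto
  show "fscale c f \<in> fiberwise I Z" if "f \<in> fiberwise I Z" for c f
    using that submodD(3)[OF assms] unfolding fiberwise_def mem_Collect_eq fiber_fscale
    by (auto simp: fscale_apply)
qed

lemma fiberwise_supported:
  assumes "\<And>i. i \<in> I \<Longrightarrow> Z i \<subseteq> supported_on S"
  shows "fiberwise I Z \<subseteq> supported_on (I \<times> S)"
  using assms by (fastforce simp: fiberwise_def supported_on_def)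

lemma fiberwise_mono:
  assumes "\<And>i. i \<in> I \<Longrightarrow> B i \<subseteq> Z i"
  shows "fiberwise I B \<subseteq> fiberwise I Z"
  using assms unfolding fiberwise_def by blast

text \<open>Adding an index \<open>i\<close> enlarges the sum by \<open>Z i\<close>: restriction to
  the fibre over \<open>i\<close> identifies the quotient of the larger sum by the smaller one with
  \<open>Z i\<close>.\<close>

lemma mrank_fiberwise_zero:
  assumes "finite I" "finite S" "\<And>i. i \<in> I \<Longrightarrow> submod fscale (Z i)" "\<And>i. i \<in> I \<Longrightarrow> Z i \<subseteq> supported_on S"
  shows "mrank fscale (fiberwise I Z) {0} = (\<Sum>i\<in>I. mrank fscale (Z i) {0 :: 'b \<Rightarrow> 'k::idom})"
  using assms
proof (induction I)
  case empty
  have "(fiberwise {} Z :: ('a \<times> 'b \<Rightarrow> 'k) set) = supported_on {}"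
    by (auto simp: fiberwise_def supported_on_def)
  then show ?case using mrank_supported_on[of "{} :: ('a \<times> 'b) set", where 'k='k] by (simp only: sum.empty card.empty finite.emptyI)
next
  case (insert i I)
  let ?J = "insert i I"
  have sub: "submod fscale (fiberwise ?J Z)" "submod fscale (fiberwise I Z)" "submod fscale (Z i)"
    by (auto intro!: submod_fiberwise insert.prems)
  have sup: "fiberwise ?J Z \<subseteq> supported_on (?J \<times> S)"
    using insert.prems by (intro fiberwise_supported) auto
  have mono: "fiberwise I Z \<subseteq> fiberwise ?J Z"
  proof
    fix f assume f: "f \<in> fiberwise I Z"
    then have "(\<lambda>x. f (i, x)) = 0" using insert.hyps by (auto simp: fiberwise_def)
    then have "(\<lambda>x. f (i, x)) \<in> Z i" using submodD(1)[OF sub(3)] by simp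
    with f show "f \<in> fiberwise ?J Z" by (auto simp: fiberwise_def)
  qed
  have "mrank fscale (fiberwise ?J Z) {0} =
      mrank fscale (fiberwise ?J Z) (fiberwise I Z) + mrank fscale (fiberwise I Z) {0}"
    by (rule mrank_add[OF _ sup sub(1,2) submod_zero _ mono])
      (use insert submodD(1)[OF sub(2)] in auto)
  also have "mrank fscale (fiberwise ?J Z) (fiberwise I Z) = mrank fscale (Z i) {0}"
  proof (rule quot_iso_rel_mrank[OF kmodule_fscale kmodule_fscale])
    show "quot_iso_rel fscale fscale (fiberwise ?J Z) (fiberwise I Z) (Z i) {0}
        (\<lambda>f g. g = (\<lambda>x. f (i, x)))"
      unfolding quot_iso_rel_def
    proof (intro conjI allI impI ballI)
      show "submod fscale (fiberwise ?J Z)" "submod fscale (Z i)" "0 \<in> fiberwise I Z"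
        "0 \<in> {0}" by (fact sub(1), fact sub(3), fact submodD(1)[OF sub(2)], simp)
      show "0 = (\<lambda>x. (0 :: 'a \<times> 'b \<Rightarrow> 'k) (i, x))" by (fact fiber_zero[symmetric])
      show "y + y' = (\<lambda>a. (x + x') (i, a))" if "y = (\<lambda>a. x (i, a))" "y' = (\<lambda>a. x' (i, a))"
        for x x' :: "'a \<times> 'b \<Rightarrow> 'k" and y y' unfolding that fiber_add ..
      show "fscale c y = (\<lambda>a. fscale c x (i, a))" if "y = (\<lambda>a. x (i, a))"
        for c and x :: "'a \<times> 'b \<Rightarrow> 'k" and y unfolding that fiber_fscale ..
      show "\<exists>y\<in>Z i. y = (\<lambda>a. x (i, a))" if "x \<in> fiberwise ?J Z" for x
        using that by (auto simp: fiberwise_def)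
      show "\<exists>x\<in>fiberwise ?J Z. y = (\<lambda>a. x (i, a))" if y: "y \<in> Z i" for y
      proof -
        have "(\<lambda>(j, a). if j = i then y a else 0) \<in> fiberwise ?J Z"
          unfolding fiberwise_def mem_Collect_eq
        proof (intro conjI ballI allI impI)
          fix j assume "j \<in> ?J"
          show "(\<lambda>x. case (j, x) of (j, a) \<Rightarrow> if j = i then y a else 0) \<in> Z j"
          proof (cases "j = i")
            case True
            then show ?thesis using y by simp
          next
            case False
            then have "(\<lambda>x. case (j, x) of (j, a) \<Rightarrow> if j = i then y a else 0) = 0" by auto
            then show ?thesis using submodD(1)[OF insert.prems(2)[OF \<open>j \<in> ?J\<close>]] by (simp only:)
          qed
        qed auto
        then show ?thesis by (intro bexI[of _ "\<lambda>(j, a). if j = i then y a else 0"]) auto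
      qed
      show "x \<in> fiberwise I Z \<longleftrightarrow> y \<in> {0}"
        if x: "x \<in> fiberwise ?J Z" and "y \<in> Z i" and y: "y = (\<lambda>a. x (i, a))" for x y
      proof
        assume "x \<in> fiberwise I Z"
        then show "y \<in> {0}" using insert.hyps unfolding y by (auto simp: fiberwise_def)
      next
        assume "y \<in> {0}"
        then have x0: "x (i, a) = 0" for a using fun_cong[OF y, of a] by simp
        have "x (j, a) = 0" if "j \<notin> I" for j a
          using x x0 that unfolding fiberwise_def by (cases "j = i") blast+
        then show "x \<in> fiberwise I Z" using x unfolding fiberwise_def by blast
      qed
    qed
  qed
  also have "mrank fscale (fiberwise I Z) {0} = (\<Sum>i\<in>I. mrank fscale (Z i) {0})"
    by (rule insert.IH) (auto intro!: insert.prems)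
  finally show ?case using insert.hyps by (simp only: sum.insert not_False_eq_True)
qed

text \<open>Numerators and denominators are treated separately, each modulo zero, and then
  subtracted by additivity.\<close>

lemma mrank_fiberwise:
  assumes "finite I" "finite S" and Z: "\<And>i. i \<in> I \<Longrightarrow> submod fscale (Z i)"
    and B: "\<And>i. i \<in> I \<Longrightarrow> submod fscale (B i)"
    and S: "\<And>i. i \<in> I \<Longrightarrow> Z i \<subseteq> supported_on S" and BZ: "\<And>i. i \<in> I \<Longrightarrow> B i \<subseteq> Z i"
  shows "mrank fscale (fiberwise I Z) (fiberwise I B) = (\<Sum>i\<in>I. mrank fscale (Z i) (B i :: ('b \<Rightarrow> 'k::idom) set))"
proof -
  have BS: "B i \<subseteq> supported_on S" if "i \<in> I" for i using S BZ that by blast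
  have "mrank fscale (fiberwise I Z) {0} =
      mrank fscale (fiberwise I Z) (fiberwise I B) + mrank fscale (fiberwise I B) {0}"
    by (rule mrank_add[OF _ fiberwise_supported[OF S] submod_fiberwise[OF Z] submod_fiberwise[OF B]
          submod_zero _ fiberwise_mono[OF BZ]])
      (use assms submodD(1)[OF submod_fiberwise[of I B]] in auto)
  moreover have "mrank fscale (Z i) {0} = mrank fscale (Z i) (B i) + mrank fscale (B i) {0}" if "i \<in> I" for i
    by (rule mrank_add[OF \<open>finite S\<close> S[OF that] Z[OF that] B[OF that] submod_zero _ BZ[OF that]])
      (use submodD(1)[OF B[OF that]] in auto)
  then have "(\<Sum>i\<in>I. mrank fscale (Z i) {0}) =
      (\<Sum>i\<in>I. mrank fscale (Z i) (B i)) + (\<Sum>i\<in>I. mrank fscale (B i) {0})"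
    by (simp add: sum.distrib)
  ultimately show ?thesis
    using mrank_fiberwise_zero[OF assms(1,2) Z S] mrank_fiberwise_zero[OF assms(1,2) B BS] by simp
qed

section \<open>Signs and the Koszul complex of a graded module\<close>

text \<open>\<open>sg v s\<close> is the sign relating \<open>v \<and> s\<close> to the basis element \<open>insert v s\<close> of the exterior algebra;
  leaving it abstract avoids a linear order on the vertices.\<close>

definition sign_system :: "'v set \<Rightarrow> ('v \<Rightarrow> 'v set \<Rightarrow> 'k::comm_ring_1) \<Rightarrow> bool" where
  "sign_system V sg \<longleftrightarrow>
     (\<forall>v s. sg v s * sg v s = 1) \<and>
     (\<forall>v\<in>V. \<forall>w\<in>V. \<forall>s. s \<subseteq> V \<longrightarrow> v \<noteq> w \<longrightarrow> v \<notin> s \<longrightarrow> w \<notin> s \<longrightarrow>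
        sg v s * sg w (insert v s) = - (sg w s * sg v (insert w s)))"

text \<open>The usual sign: -1 to the number of elements of \<open>s\<close> that precede
  \<open>v\<close> in an arbitrary numbering of \<open>V\<close>. Inserting the smaller of two
  vertices changes the count of the larger one by one, while inserting the larger leaves the other
  count alone.\<close>

lemma sign_system_exists:
  assumes "finite V"
  shows "\<exists>sg :: 'v \<Rightarrow> 'v set \<Rightarrow> 'k::comm_ring_1. sign_system V sg"
proof -
  obtain f :: "'v \<Rightarrow> nat" where f: "inj_on f V"
    using finite_imp_inj_to_nat_seg[OF assms] by metis
  define sg :: "'v \<Rightarrow> 'v set \<Rightarrow> 'k" where "sg v s = (-1) ^ card {u \<in> s. f u < f v}" for v s
  have "sg v s * sg w (insert v s) = - (sg w s * sg v (insert w s))"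
    if "v \<in> V" "w \<in> V" "s \<subseteq> V" "v \<noteq> w" "v \<notin> s" "w \<notin> s" for v w s
  proof -
    have ins: "card {u \<in> insert x s. f u < f y} = (if f x < f y then Suc (card {u \<in> s. f u < f y}) else card {u \<in> s. f u < f y})"
      if "x \<notin> s" for x y
    proof -
      have "{u \<in> insert x s. f u < f y} = (if f x < f y then insert x {u \<in> s. f u < f y} else {u \<in> s. f u < f y})"
        by auto
      then show ?thesis using \<open>x \<notin> s\<close> finite_subset[OF \<open>s \<subseteq> V\<close> assms] by auto
    qed
    have "f v < f w \<or> f w < f v" using that f by (metis inj_onD linorder_neqE_nat)
    then show ?thesis unfolding sg_def ins[OF \<open>v \<notin> s\<close>] ins[OF \<open>w \<notin> s\<close>] by (auto simp: mult.commute)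
  qed
  moreover have "sg v s * sg v s = 1" for v s
    by (simp add: sg_def flip: power_add mult_2)
  ultimately show ?thesis unfolding sign_system_def by blast
qed

text \<open>The cancellation behind every d d = 0 below. The diagonal is required to vanish
  separately, since in characteristic 2 antisymmetry says nothing about it.\<close>

lemma antisym_double_sum_zero:
  fixes F :: "'v \<Rightarrow> 'v \<Rightarrow> 'a::ab_group_add"
  assumes "finite A" "\<And>v w. v \<in> A \<Longrightarrow> w \<in> A \<Longrightarrow> v \<noteq> w \<Longrightarrow> F v w + F w v = 0" "\<And>v. v \<in> A \<Longrightarrow> F v v = 0"
  shows "(\<Sum>v\<in>A. \<Sum>w\<in>A. F v w) = 0"
  using assms
proof induction
  case (insert x A)
  have "(\<Sum>v\<in>insert x A. \<Sum>w\<in>insert x A. F v w) =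
      F x x + (\<Sum>w\<in>A. F x w) + ((\<Sum>v\<in>A. F v x) + (\<Sum>v\<in>A. \<Sum>w\<in>A. F v w))"
    using insert.hyps by (simp add: sum.distrib)
  also have "\<dots> = (\<Sum>w\<in>A. F x w + F w x)"
    using insert by (simp add: sum.distrib)
  also have "\<dots> = 0" using insert by (intro sum.neutral) auto
  finally show ?case .
qed simp

text \<open>\<open>X v\<close> is multiplication by the variable \<open>v\<close>. Keeping the
  module abstract lets one development serve both the polynomial ring and the free modules of a
  resolution.\<close>

locale koszul = kmodule scl for scl :: "'k::idom \<Rightarrow> 'a::ab_group_add \<Rightarrow> 'a" +
  fixes V :: "'v set" and sg :: "'v \<Rightarrow> 'v set \<Rightarrow> 'k" and X :: "'v \<Rightarrow> 'a \<Rightarrow> 'a"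
  assumes fin_V: "finite V" and sgs: "sign_system V sg"
    and X_add: "X v (x + y) = X v x + X v y" and X_scl: "X v (scl c x) = scl c (X v x)"
    and X_comm: "X v (X w x) = X w (X v x)"
begin

lemma X_zero: "X v 0 = 0"
  using X_add[of v 0 0] by simp

lemma X_sum: "X v (sum f A) = (\<Sum>a\<in>A. X v (f a))"
  by (induction A rule: infinite_finite_induct) (auto simp: X_add X_zero)

text \<open>The Koszul differential: \<open>c \<sigma>\<close> is the coefficient of the exterior
  basis element \<open>\<sigma>\<close>, and the boundary at \<open>\<sigma>\<close> collects
  contributions from the basis elements with one vertex more.\<close>

definition kd :: "('v set \<Rightarrow> 'a) \<Rightarrow> 'v set \<Rightarrow> 'a" where
  "kd c \<sigma> = (\<Sum>v\<in>V - \<sigma>. scl (sg v \<sigma>) (X v (c (insert v \<sigma>))))"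

definition cscl :: "'k \<Rightarrow> ('v set \<Rightarrow> 'a) \<Rightarrow> 'v set \<Rightarrow> 'a" where
  "cscl r c = (\<lambda>\<sigma>. scl r (c \<sigma>))"

lemma kmodule_cscl: "kmodule cscl"
  by standard (auto simp: cscl_def fun_eq_iff scl_add_left scl_add_right scl_scl scl_one)

lemma kd_add: "kd (c + c') = kd c + kd c'"
  by (rule ext) (simp add: kd_def X_add scl_add_right sum.distrib)

lemma kd_zero: "kd 0 = 0"
  by (rule ext) (simp add: kd_def X_zero scl_zero_right)

lemma kd_cscl: "kd (cscl r c) = cscl r (kd c)"
  by (rule ext) (simp add: kd_def cscl_def X_scl scl_sum scl_scl mult.commute)

lemma kd_minus: "kd (- c) = - kd c"
  using kd_add[of "-c" c] by (simp only: eq_neg_iff_add_eq_0 kd_zero add.left_inverse)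

lemma kd_diff: "kd (c - c') = kd c - kd c'"
  using kd_add[of c "-c'"] by (simp only: kd_minus diff_conv_add_uminus)

lemma kd_kd:
  assumes "\<And>\<sigma>. \<not> \<sigma> \<subseteq> V \<Longrightarrow> c \<sigma> = 0"
  shows "kd (kd c) = 0"
proof (rule ext)
  fix \<sigma>
  show "kd (kd c) \<sigma> = 0 \<sigma>"
  proof (cases "\<sigma> \<subseteq> V")
    case False
    then have "c (insert v (insert w \<sigma>)) = 0" for v w by (intro assms) auto
    then show ?thesis by (simp add: kd_def X_zero scl_zero_right)
  next
    case True
    \<comment> \<open>Set to zero on the diagonal so that the inner sum can run over all of
      \<open>V - \<sigma>\<close> and the double sum becomes symmetric in its ranges.\<close>
    define F where "F v w = (if v = w then 0 else
      scl (sg v \<sigma> * sg w (insert v \<sigma>)) (X v (X w (c (insert w (insert v \<sigma>))))))" for v w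
    have "kd (kd c) \<sigma> = (\<Sum>v\<in>V - \<sigma>. \<Sum>w\<in>V - insert v \<sigma>. F v w)"
      unfolding kd_def X_sum scl_sum
      by (intro sum.cong refl) (auto simp: F_def X_scl scl_scl)
    also have "\<dots> = (\<Sum>v\<in>V - \<sigma>. \<Sum>w\<in>V - \<sigma>. F v w)"
      by (intro sum.cong refl sum.mono_neutral_left) (use fin_V in \<open>auto simp: F_def\<close>)
    also have "\<dots> = 0"
    proof (rule antisym_double_sum_zero)
      fix v w assume vw: "v \<in> V - \<sigma>" "w \<in> V - \<sigma>" "v \<noteq> w"
      have "sg v \<sigma> * sg w (insert v \<sigma>) = - (sg w \<sigma> * sg v (insert w \<sigma>))"
        using sgs vw True unfolding sign_system_def by blast
      then show "F v w + F w v = 0"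
        using vw X_comm[of v w] by (simp add: F_def scl_minus_left insert_commute)
    qed (use fin_V in \<open>auto simp: F_def\<close>)
    finally show ?thesis by simp
  qed
qed

definition gsub :: "(nat \<Rightarrow> 'a set) \<Rightarrow> bool" where
  "gsub M \<longleftrightarrow> (\<forall>e. submod scl (M e)) \<and> (\<forall>v\<in>V. \<forall>e. \<forall>x\<in>M e. X v x \<in> M (e + 2))"

text \<open>Chains of exterior degree \<open>a\<close> and total internal degree \<open>e\<close>,
  each exterior factor counting 2. The clause \<open>2 * a \<le> e\<close> excludes the degrees in
  which the truncated \<open>e - 2 * a\<close> would be wrong.\<close>

definition Kc :: "nat \<Rightarrow> nat \<Rightarrow> (nat \<Rightarrow> 'a set) \<Rightarrow> ('v set \<Rightarrow> 'a) set" where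
  "Kc a e M = {c. \<forall>\<sigma>. c \<sigma> \<in> M (e - 2 * a) \<and> (c \<sigma> \<noteq> 0 \<longrightarrow> \<sigma> \<subseteq> V \<and> card \<sigma> = a \<and> 2 * a \<le> e)}"

lemma gsub_zero: "gsub (\<lambda>_. {0})"
  by (auto simp: gsub_def submod_def scl_zero_right X_zero)

lemma Kc_zero_eq: "Kc a e (\<lambda>_. {0}) = {0}"
  by (auto simp: Kc_def fun_eq_iff)

lemma submod_Kc:
  assumes "gsub M"
  shows "submod cscl (Kc a e M)"
proof (rule submodI)
  have M: "submod scl (M e)" for e using assms by (simp add: gsub_def)
  note MD = submodD[OF M]
  show "0 \<in> Kc a e M" using MD(1) by (auto simp: Kc_def)
  show "x + y \<in> Kc a e M" if "x \<in> Kc a e M" "y \<in> Kc a e M" for x y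
    unfolding Kc_def mem_Collect_eq
  proof (intro allI conjI impI)
    fix \<sigma>
    show "(x + y) \<sigma> \<in> M (e - 2 * a)" using that MD(2) by (simp add: Kc_def)
    assume "(x + y) \<sigma> \<noteq> 0"
    then have "x \<sigma> \<noteq> 0 \<or> y \<sigma> \<noteq> 0" by auto
    then show "\<sigma> \<subseteq> V" "card \<sigma> = a" "2 * a \<le> e" using that unfolding Kc_def by blast+
  qed
  show "cscl r x \<in> Kc a e M" if "x \<in> Kc a e M" for r x
    unfolding Kc_def mem_Collect_eq
  proof (intro allI conjI impI)
    fix \<sigma>
    show "cscl r x \<sigma> \<in> M (e - 2 * a)" using that MD(3) by (simp add: Kc_def cscl_def)
    assume "cscl r x \<sigma> \<noteq> 0"
    then have "x \<sigma> \<noteq> 0" by (auto simp: cscl_def scl_zero_right)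
    then show "\<sigma> \<subseteq> V" "card \<sigma> = a" "2 * a \<le> e" using that unfolding Kc_def by blast+
  qed
qed

lemma Kc_mono: "(\<And>e. M e \<subseteq> N e) \<Longrightarrow> Kc a e M \<subseteq> Kc a e N"
  unfolding Kc_def by blast

lemma Kc_vanish: "c \<in> Kc a e M \<Longrightarrow> \<not> \<sigma> \<subseteq> V \<Longrightarrow> c \<sigma> = 0"
  unfolding Kc_def by blast

lemma kd_kd_Kc: "c \<in> Kc a e M \<Longrightarrow> kd (kd c) = 0"
  by (rule kd_kd) (rule Kc_vanish)

lemma kd_Kc:
  assumes M: "gsub M" and c: "c \<in> Kc (Suc a) e M"
  shows "kd c \<in> Kc a e M"
  unfolding Kc_def mem_Collect_eq
proof (intro allI conjI impI)
  fix \<sigma>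
  have sub: "submod scl (M e)" for e using M by (simp add: gsub_def)
  show "kd c \<sigma> \<in> M (e - 2 * a)"
    unfolding kd_def
  proof (intro submod_sum[OF sub] submodD(3)[OF sub])
    fix v assume v: "v \<in> V - \<sigma>"
    show "X v (c (insert v \<sigma>)) \<in> M (e - 2 * a)"
    proof (cases "c (insert v \<sigma>) = 0")
      case True
      then show ?thesis using submodD(1)[OF sub] by (simp add: X_zero)
    next
      case False
      then have "2 * Suc a \<le> e" "c (insert v \<sigma>) \<in> M (e - 2 * Suc a)" using c unfolding Kc_def by blast+
      moreover have "e - 2 * Suc a + 2 = e - 2 * a" using \<open>2 * Suc a \<le> e\<close> by simp
      ultimately show ?thesis using M v unfolding gsub_def by fastforce
    qed
  qed
  assume "kd c \<sigma> \<noteq> 0"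
  then obtain v where v: "v \<in> V - \<sigma>" "scl (sg v \<sigma>) (X v (c (insert v \<sigma>))) \<noteq> 0"
    unfolding kd_def by (meson sum.neutral)
  then have "c (insert v \<sigma>) \<noteq> 0" by (auto simp: X_zero scl_zero_right)
  then have i: "insert v \<sigma> \<subseteq> V" "card (insert v \<sigma>) = Suc a" "2 * Suc a \<le> e"
    using c unfolding Kc_def by blast+
  have "finite \<sigma>" using i(1) fin_V by (meson finite_subset insert_subset)
  then show "\<sigma> \<subseteq> V" "card \<sigma> = a" "2 * a \<le> e" using i v by auto
qed

lemma kd_Kc_0:
  assumes "c \<in> Kc 0 e M"
  shows "kd c = 0"
proof (rule ext)
  fix \<sigma>
  have "c (insert v \<sigma>) = 0" if "v \<in> V - \<sigma>" for v
  proof (rule ccontr)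
    assume "c (insert v \<sigma>) \<noteq> 0"
    then have "insert v \<sigma> \<subseteq> V" "card (insert v \<sigma>) = 0" using assms unfolding Kc_def by blast+
    then show False using fin_V by (metis card_0_eq finite_subset insert_not_empty)
  qed
  then show "kd c \<sigma> = 0 \<sigma>" by (simp add: kd_def X_zero scl_zero_right)
qed

lemma kd_Kc':
  assumes M: "gsub M" and c: "c \<in> Kc a e M"
  shows "kd c \<in> Kc (a - 1) e M"
proof (cases a)
  case 0
  then show ?thesis using kd_Kc_0 c submodD(1)[OF submod_Kc[OF M]] by simp
next
  case (Suc b)
  then show ?thesis using kd_Kc[OF M] c by simp
qed

text \<open>The quotient \<open>M / N\<close> is represented by a pair of families, so a cycle is a
  chain over \<open>M\<close> with boundary over \<open>N\<close>, and boundaries are taken up to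
  chains over \<open>N\<close>.\<close>

definition Zk :: "nat \<Rightarrow> nat \<Rightarrow> (nat \<Rightarrow> 'a set) \<Rightarrow> (nat \<Rightarrow> 'a set) \<Rightarrow> ('v set \<Rightarrow> 'a) set" where
  "Zk a e M N = {c \<in> Kc a e M. kd c \<in> Kc (a - 1) e N}"

definition Bk :: "nat \<Rightarrow> nat \<Rightarrow> (nat \<Rightarrow> 'a set) \<Rightarrow> (nat \<Rightarrow> 'a set) \<Rightarrow> ('v set \<Rightarrow> 'a) set" where
  "Bk a e M N = {kd c + n | c n. c \<in> Kc (Suc a) e M \<and> n \<in> Kc a e N}"

text \<open>Rank of the Koszul homology of the graded module \<open>M / N\<close>. For \<open>a = 0\<close> the truncated \<open>a - 1\<close> in
  \<open>Zk\<close> is harmless, since \<open>kd\<close> vanishes on \<open>Kc 0\<close>.\<close>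

definition kh :: "nat \<Rightarrow> nat \<Rightarrow> (nat \<Rightarrow> 'a set) \<Rightarrow> (nat \<Rightarrow> 'a set) \<Rightarrow> nat" where
  "kh a e M N = mrank cscl (Zk a e M N) (Bk a e M N)"

lemma submod_Zk:
  assumes "gsub M" "gsub N"
  shows "submod cscl (Zk a e M N)"
  unfolding Zk_def
  by (rule submodI)
    (use submodD[OF submod_Kc[OF assms(1)]] submodD[OF submod_Kc[OF assms(2)]] in
      \<open>auto simp: kd_add kd_zero kd_cscl\<close>)

lemma zero_Bk: "gsub M \<Longrightarrow> gsub N \<Longrightarrow> 0 \<in> Bk a e M N"
  unfolding Bk_def mem_Collect_eq
  by (intro exI[of _ 0] conjI submodD(1)[OF submod_Kc]) (simp_all only: kd_zero add_0)

text \<open>Positive exterior degrees only: in degree 0 the homology is the module modulo multiples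
  of the variables.\<close>

definition kexact :: "(nat \<Rightarrow> 'a set) \<Rightarrow> bool" where
  "kexact F \<longleftrightarrow> (\<forall>a e c. c \<in> Kc (Suc a) e F \<longrightarrow> kd c = 0 \<longrightarrow> (\<exists>c'\<in>Kc (Suc (Suc a)) e F. c = kd c'))"

text \<open>The connecting homomorphism of \<open>0 -> N -> F -> F / N -> 0\<close>, given by
  \<open>kd\<close> itself. It is bijective on homology because the Koszul homology of
  \<open>F\<close> vanishes in the adjacent degrees \<open>Suc a\<close> and
  \<open>Suc (Suc a)\<close>.\<close>

lemma kh_shift:
  assumes F: "gsub F" and N: "gsub N" and NF: "\<And>e. N e \<subseteq> F e" and ex: "kexact F"
  shows "kh (Suc (Suc a)) e F N = kh (Suc a) e N (\<lambda>_. {0})"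
  unfolding kh_def
proof (rule quot_iso_rel_mrank[OF kmodule_cscl kmodule_cscl, where \<rho> = "\<lambda>c z. z = kd c"])
  show "quot_iso_rel cscl cscl (Zk (Suc (Suc a)) e F N) (Bk (Suc (Suc a)) e F N)
     (Zk (Suc a) e N (\<lambda>_. {0})) (Bk (Suc a) e N (\<lambda>_. {0})) (\<lambda>c z. z = kd c)"
    unfolding quot_iso_rel_def
  proof (intro conjI allI impI ballI)
    show "submod cscl (Zk (Suc (Suc a)) e F N)" "submod cscl (Zk (Suc a) e N (\<lambda>_. {0}))"
      "0 \<in> Bk (Suc (Suc a)) e F N" "0 \<in> Bk (Suc a) e N (\<lambda>_. {0})" "0 = kd 0"
      by (intro submod_Zk zero_Bk F N gsub_zero kd_zero[symmetric])+
    show "y + y' = kd (x + x')" if "y = kd x" "y' = kd x'" for x y x' y' unfolding that kd_add ..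
    show "cscl c y = kd (cscl c x)" if "y = kd x" for c x y unfolding that kd_cscl ..
    show "\<exists>y\<in>Zk (Suc a) e N (\<lambda>_. {0}). y = kd x" if "x \<in> Zk (Suc (Suc a)) e F N" for x
      using that kd_kd_Kc[of x] by (auto simp: Zk_def Kc_zero_eq)
    show "\<exists>x\<in>Zk (Suc (Suc a)) e F N. y = kd x" if y: "y \<in> Zk (Suc a) e N (\<lambda>_. {0})" for y
    proof -
      have y: "y \<in> Kc (Suc a) e N" "kd y = 0" using y by (auto simp: Zk_def Kc_zero_eq)
      then obtain c where "c \<in> Kc (Suc (Suc a)) e F" "y = kd c"
        using ex Kc_mono[of N F, OF NF] unfolding kexact_def by blast
      then show ?thesis using y by (auto simp: Zk_def)
    qed
    show "x \<in> Bk (Suc (Suc a)) e F N \<longleftrightarrow> y \<in> Bk (Suc a) e N (\<lambda>_. {0})"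
      if x: "x \<in> Zk (Suc (Suc a)) e F N" and y: "y = kd x" for x y
    proof
      assume "x \<in> Bk (Suc (Suc a)) e F N"
      then obtain c n where cn: "c \<in> Kc (Suc (Suc (Suc a))) e F" "n \<in> Kc (Suc (Suc a)) e N" "x = kd c + n"
        by (auto simp: Bk_def)
      have "y = kd n + 0" unfolding y cn(3) kd_add kd_kd_Kc[OF cn(1)] by (simp only: add_0 add_0_right)
      then show "y \<in> Bk (Suc a) e N (\<lambda>_. {0})" using cn(2) by (auto simp only: Bk_def Kc_zero_eq)
    next
      assume "y \<in> Bk (Suc a) e N (\<lambda>_. {0})"
      then obtain n where n: "n \<in> Kc (Suc (Suc a)) e N" "y = kd n"
        by (auto simp: Bk_def Kc_zero_eq)
      have "x - n \<in> Kc (Suc (Suc a)) e F"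
        using x n(1) Kc_mono[of N F, OF NF] kmodule.submod_diff[OF kmodule_cscl submod_Kc[OF F]]
        unfolding Zk_def by blast
      moreover have "kd (x - n) = 0" using n y by (simp only: kd_diff diff_self)
      ultimately obtain c where "c \<in> Kc (Suc (Suc (Suc a))) e F" "x - n = kd c"
        using ex unfolding kexact_def by blast
      moreover from this(2) have "x = kd c + n" by (simp only: diff_eq_eq)
      ultimately show "x \<in> Bk (Suc (Suc a)) e F N" using n unfolding Bk_def by blast
    qed
  qed
qed

text \<open>The degree \<open>e\<close> part of the ideal of the variables times \<open>M\<close>: a
  sum of variable multiples is, up to signs, the boundary of a chain of exterior degree 1.\<close>

definition mprod :: "nat \<Rightarrow> (nat \<Rightarrow> 'a set) \<Rightarrow> 'a set" where
  "mprod e M = {kd c {} | c. c \<in> Kc 1 e M}"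

lemma Kc_0_eqI:
  assumes "c \<in> Kc 0 e M" "c {} = 0"
  shows "c = 0"
proof (rule ext)
  fix \<sigma>
  show "c \<sigma> = 0 \<sigma>"
    using assms fin_V unfolding Kc_def by (metis (mono_tags, lifting) card_0_eq finite_subset mem_Collect_eq zero_fun_apply)
qed

lemma submod_mprod:
  assumes "gsub M"
  shows "submod scl (mprod e M)"
proof (rule submodI)
  note MD = submodD[OF submod_Kc[OF assms]]
  have z: "kd 0 {} = 0" by (simp only: kd_zero zero_fun_apply)
  show "0 \<in> mprod e M" unfolding mprod_def mem_Collect_eq by (intro exI[of _ 0] conjI z[symmetric] MD(1))
  show "x + y \<in> mprod e M" if xy: "x \<in> mprod e M" "y \<in> mprod e M" for x y
  proof -
    obtain c c' where "c \<in> Kc 1 e M" "c' \<in> Kc 1 e M" "x = kd c {}" "y = kd c' {}"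
      using xy unfolding mprod_def by blast
    moreover have "kd c {} + kd c' {} = kd (c + c') {}" by (simp only: kd_add plus_fun_apply)
    ultimately show ?thesis using MD(2) unfolding mprod_def by blast
  qed
  show "scl r x \<in> mprod e M" if x: "x \<in> mprod e M" for r x
  proof -
    obtain c where "c \<in> Kc 1 e M" "x = kd c {}" using x unfolding mprod_def by blast
    moreover have "scl r (kd c {}) = kd (cscl r c) {}" by (subst kd_cscl) (simp only: cscl_def)
    ultimately show ?thesis using MD(3) unfolding mprod_def by blast
  qed
qed

text \<open>The end of the long exact sequence, where \<open>F\<close> has homology in degree 0: the
  connecting homomorphism maps onto the kernel of \<open>N / m N -> F / m F\<close>, with
  \<open>m\<close> the ideal of the variables.\<close>

lemma kh_one:
  assumes F: "gsub F" and N: "gsub N" and NF: "\<And>e. N e \<subseteq> F e" and ex: "kexact F"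
  shows "kh 1 e F N = mrank scl (N e \<inter> mprod e F) (mprod e N)"
  unfolding kh_def
proof (rule quot_iso_rel_mrank[OF kmodule_cscl kmodule_axioms, where \<rho> = "\<lambda>c z. z = kd c {}"])
  show "quot_iso_rel cscl scl (Zk 1 e F N) (Bk 1 e F N) (N e \<inter> mprod e F) (mprod e N) (\<lambda>c z. z = kd c {})"
    unfolding quot_iso_rel_def
  proof (intro conjI allI impI ballI)
    show "submod cscl (Zk 1 e F N)" "0 \<in> Bk 1 e F N" by (intro submod_Zk zero_Bk F N)+
    show "0 \<in> mprod e N" by (rule submodD(1)[OF submod_mprod[OF N]])
    show "submod scl (N e \<inter> mprod e F)"
      using submod_mprod[OF F, of e] N unfolding gsub_def submod_def by auto
    show "0 = kd 0 {}" by (simp only: kd_zero zero_fun_apply)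
    show "y + y' = kd (x + x') {}" if "y = kd x {}" "y' = kd x' {}" for x y x' y'
      unfolding that by (simp only: kd_add plus_fun_apply)
    show "scl c y = kd (cscl c x) {}" if "y = kd x {}" for c x y
      unfolding that by (subst kd_cscl) (simp only: cscl_def)
    show "\<exists>y\<in>N e \<inter> mprod e F. y = kd x {}" if "x \<in> Zk 1 e F N" for x
    proof -
      have x: "x \<in> Kc 1 e F" "kd x \<in> Kc 0 e N" using that by (simp_all add: Zk_def)
      have "kd x {} \<in> N e" using x(2) unfolding Kc_def by simp
      then show ?thesis using x(1) unfolding mprod_def by blast
    qed
    show "\<exists>x\<in>Zk 1 e F N. y = kd x {}" if y: "y \<in> N e \<inter> mprod e F" for y
    proof -
      obtain c where c: "c \<in> Kc 1 e F" "y = kd c {}" using y unfolding mprod_def by blast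
      have *: "kd c \<in> Kc 0 e F" using kd_Kc[OF F, of c 0] c(1) by simp
      have "kd c \<in> Kc 0 e N"
        unfolding Kc_def mem_Collect_eq
      proof (intro allI conjI)
        fix \<sigma>
        show "kd c \<sigma> \<in> N (e - 2 * 0)"
        proof (cases "\<sigma> = {}")
          case True
          then show ?thesis using c y by simp
        next
          case False
          then have "kd c \<sigma> = 0" using * fin_V unfolding Kc_def
            by (metis (mono_tags, lifting) card_0_eq finite_subset mem_Collect_eq)
          then show ?thesis using N submodD(1) unfolding gsub_def by metis
        qed
        show "kd c \<sigma> \<noteq> 0 \<longrightarrow> \<sigma> \<subseteq> V \<and> card \<sigma> = 0 \<and> 2 * 0 \<le> e" using * unfolding Kc_def by blast
      qed
      then show ?thesis using c by (auto simp: Zk_def)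
    qed
    show "x \<in> Bk 1 e F N \<longleftrightarrow> y \<in> mprod e N" if x: "x \<in> Zk 1 e F N" and y: "y = kd x {}" for x y
    proof
      assume "x \<in> Bk 1 e F N"
      then obtain c n where cn: "c \<in> Kc (Suc 1) e F" "n \<in> Kc 1 e N" "x = kd c + n"
        by (auto simp: Bk_def)
      have "y = kd n {}" unfolding y cn(3) kd_add kd_kd_Kc[OF cn(1)] by (simp only: add_0)
      then show "y \<in> mprod e N" using cn(2) unfolding mprod_def by blast
    next
      assume "y \<in> mprod e N"
      then obtain n where n: "n \<in> Kc 1 e N" "y = kd n {}" unfolding mprod_def by blast
      have nF: "n \<in> Kc 1 e F" using n(1) Kc_mono[of N F, OF NF] by blast
      have xn: "x - n \<in> Kc 1 e F"
        using x nF kmodule.submod_diff[OF kmodule_cscl submod_Kc[OF F]] unfolding Zk_def by blast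
      have "kd (x - n) \<in> Kc 0 e F" using kd_Kc[OF F, of "x - n" 0] xn by simp
      moreover have "kd (x - n) {} = 0"
        using fun_cong[OF kd_diff[of x n], of "{}"] n y by (simp add: fun_diff_def)
      ultimately have "kd (x - n) = 0" by (rule Kc_0_eqI)
      then obtain c where "c \<in> Kc (Suc 1) e F" "x - n = kd c"
        using ex xn unfolding kexact_def by (metis One_nat_def)
      moreover from this(2) have "x = kd c + n" by (simp only: diff_eq_eq)
      ultimately show "x \<in> Bk 1 e F N" using n unfolding Bk_def by blast
    qed
  qed
qed

end

section \<open>Invariance of Koszul homology under isomorphisms of graded modules\<close>

lemma additive_sum:
  fixes \<phi> :: "'a::ab_group_add \<Rightarrow> 'b::ab_group_add"
  assumes "\<And>x y. \<phi> (x + y) = \<phi> x + \<phi> y"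
  shows "\<phi> (sum f A) = (\<Sum>a\<in>A. \<phi> (f a))"
proof -
  have "\<phi> 0 = 0" using assms[of 0 0] by simp
  then show ?thesis by (induction A rule: infinite_finite_induct) (auto simp: assms)
qed

text \<open>The hypotheses say that \<open>\<phi>\<close> induces an isomorphism
  \<open>M / N -> M' / N'\<close>. Preimages exist only modulo \<open>N'\<close>, so chains over the
  two modules are compared by a relation that allows an error over \<open>N'\<close>.\<close>

lemma kh_iso:
  assumes k1: "koszul s1 V sg X1" and k2: "koszul s2 V sg X2"
    and M: "koszul.gsub s1 V X1 M" "koszul.gsub s1 V X1 N" "\<And>e. N e \<subseteq> M e"
    and M': "koszul.gsub s2 V X2 M'" "koszul.gsub s2 V X2 N'" "\<And>e. N' e \<subseteq> M' e"
    and \<phi>_add: "\<And>x y. \<phi> (x + y) = \<phi> x + \<phi> y" and \<phi>_scl: "\<And>c x. \<phi> (s1 c x) = s2 c (\<phi> x)"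
    and \<phi>_X: "\<And>v x. \<phi> (X1 v x) = X2 v (\<phi> x)"
    and into: "\<And>e x. x \<in> M e \<Longrightarrow> \<phi> x \<in> M' e"
    and inj: "\<And>e x. x \<in> M e \<Longrightarrow> \<phi> x \<in> N' e \<longleftrightarrow> x \<in> N e"
    and surj: "\<And>e y. y \<in> M' e \<Longrightarrow> \<exists>x\<in>M e. y - \<phi> x \<in> N' e"
  shows "koszul.kh s1 V sg X1 a e M N = koszul.kh s2 V sg X2 a e M' N'"
proof -
  interpret k1: koszul s1 V sg X1 by fact
  interpret k2: koszul s2 V sg X2 by fact
  have \<phi>_zero: "\<phi> 0 = 0" using \<phi>_add[of 0 0] by simp
  define \<Phi> where "\<Phi> c = (\<lambda>\<sigma>. \<phi> (c \<sigma>))" for c :: "'c set \<Rightarrow> 'b"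
  have \<Phi>_zero: "\<Phi> 0 = 0" by (rule ext) (simp add: \<Phi>_def \<phi>_zero)
  have \<Phi>_add: "\<Phi> (c + c') = \<Phi> c + \<Phi> c'" for c c' by (rule ext) (simp add: \<Phi>_def \<phi>_add)
  have \<Phi>_scl: "\<Phi> (k1.cscl r c) = k2.cscl r (\<Phi> c)" for r c
    by (rule ext) (simp add: \<Phi>_def k1.cscl_def k2.cscl_def \<phi>_scl)
  have \<Phi>_diff: "\<Phi> (c - c') = \<Phi> c - \<Phi> c'" for c c'
    using \<Phi>_add[of "c - c'" c'] by (simp only: diff_add_cancel eq_diff_eq)
  have \<Phi>_kd: "\<Phi> (k1.kd c) = k2.kd (\<Phi> c)" for c
  proof (rule ext)
    fix \<sigma>
    have "\<phi> (\<Sum>v\<in>V - \<sigma>. s1 (sg v \<sigma>) (X1 v (c (insert v \<sigma>)))) =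
        (\<Sum>v\<in>V - \<sigma>. s2 (sg v \<sigma>) (X2 v (\<phi> (c (insert v \<sigma>)))))"
      by (subst additive_sum[of \<phi>, OF \<phi>_add]) (simp only: \<phi>_scl \<phi>_X)
    then show "\<Phi> (k1.kd c) \<sigma> = k2.kd (\<Phi> c) \<sigma>" by (simp only: \<Phi>_def k1.kd_def k2.kd_def)
  qed
  note sub1 = k1.submod_Kc[OF M(1)] k1.submod_Kc[OF M(2)]
  note sub2 = k2.submod_Kc[OF M'(1)] k2.submod_Kc[OF M'(2)]
  note diff1 = kmodule.submod_diff[OF k1.kmodule_cscl] and diff2 = kmodule.submod_diff[OF k2.kmodule_cscl]
  have NM: "k1.Kc a e N \<subseteq> k1.Kc a e M" for a e by (rule k1.Kc_mono[of N M, OF M(3)])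
  have NM': "k2.Kc a e N' \<subseteq> k2.Kc a e M'" for a e by (rule k2.Kc_mono[of N' M', OF M'(3)])
  have ne: "\<phi> x \<noteq> 0 \<Longrightarrow> x \<noteq> 0" for x using \<phi>_zero by blast
  have \<Phi>_M: "\<Phi> c \<in> k2.Kc a e M'" if "c \<in> k1.Kc a e M" for a e c
    using that into ne unfolding k1.Kc_def k2.Kc_def \<Phi>_def mem_Collect_eq by meson
  have \<Phi>_N: "\<Phi> c \<in> k2.Kc a e N'" if "c \<in> k1.Kc a e N" for a e c
    using that inj M(3) ne unfolding k1.Kc_def k2.Kc_def \<Phi>_def mem_Collect_eq by (meson subsetD)
  have \<Phi>_inj: "c \<in> k1.Kc a e N" if "c \<in> k1.Kc a e M" "\<Phi> c \<in> k2.Kc a e N'" for a e c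
    using that inj unfolding k1.Kc_def k2.Kc_def \<Phi>_def mem_Collect_eq by meson
  have lift: "\<exists>c\<in>k1.Kc a e M. c' - \<Phi> c \<in> k2.Kc a e N'" if c': "c' \<in> k2.Kc a e M'" for a e c'
  proof -
    \<comment> \<open>Zero coefficients are lifted to zero, so that the lifted chain keeps its
      support and hence its exterior degree.\<close>
    have "\<exists>x. x \<in> M (e - 2 * a) \<and> c' \<sigma> - \<phi> x \<in> N' (e - 2 * a) \<and> (c' \<sigma> = 0 \<longrightarrow> x = 0)" for \<sigma>
    proof (cases "c' \<sigma> = 0")
      case True
      have "0 \<in> M (e - 2 * a)" "0 \<in> N' (e - 2 * a)"
        using M(1) M'(2) submodD(1) unfolding k1.gsub_def k2.gsub_def by blast+
      then show ?thesis using True \<phi>_zero by (intro exI[of _ 0]) simp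
    next
      case False
      have "c' \<sigma> \<in> M' (e - 2 * a)" using c' unfolding k2.Kc_def by blast
      from surj[OF this] show ?thesis using False by blast
    qed
    then obtain c where c: "\<And>\<sigma>. c \<sigma> \<in> M (e - 2 * a)" "\<And>\<sigma>. c' \<sigma> - \<phi> (c \<sigma>) \<in> N' (e - 2 * a)"
        "\<And>\<sigma>. c' \<sigma> = 0 \<Longrightarrow> c \<sigma> = 0" by metis
    have "c \<in> k1.Kc a e M" using c(1,3) c' unfolding k1.Kc_def k2.Kc_def by blast
    moreover have "c' - \<Phi> c \<in> k2.Kc a e N'"
      unfolding k2.Kc_def mem_Collect_eq
    proof (intro allI conjI)
      fix \<sigma>
      have eq: "(c' - \<Phi> c) \<sigma> = c' \<sigma> - \<phi> (c \<sigma>)" by (simp only: fun_diff_def \<Phi>_def)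
      show "(c' - \<Phi> c) \<sigma> \<in> N' (e - 2 * a)" unfolding eq by (rule c(2))
      show "(c' - \<Phi> c) \<sigma> \<noteq> 0 \<longrightarrow> \<sigma> \<subseteq> V \<and> card \<sigma> = a \<and> 2 * a \<le> e"
      proof
        assume "(c' - \<Phi> c) \<sigma> \<noteq> 0"
        then have "c' \<sigma> \<noteq> 0" using c(3) \<phi>_zero unfolding eq by auto
        then show "\<sigma> \<subseteq> V \<and> card \<sigma> = a \<and> 2 * a \<le> e" using c' unfolding k2.Kc_def by blast
      qed
    qed
    ultimately show ?thesis by blast
  qed
  show ?thesis
    unfolding k1.kh_def k2.kh_def
  proof (rule quot_iso_rel_mrank[OF k1.kmodule_cscl k2.kmodule_cscl,
        where \<rho> = "\<lambda>c c'. c' - \<Phi> c \<in> k2.Kc a e N'"])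
    show "quot_iso_rel k1.cscl k2.cscl (k1.Zk a e M N) (k1.Bk a e M N) (k2.Zk a e M' N') (k2.Bk a e M' N')
      (\<lambda>c c'. c' - \<Phi> c \<in> k2.Kc a e N')"
      unfolding quot_iso_rel_def
    proof (intro conjI allI impI ballI)
      show "submod k1.cscl (k1.Zk a e M N)" "submod k2.cscl (k2.Zk a e M' N')"
        "0 \<in> k1.Bk a e M N" "0 \<in> k2.Bk a e M' N'"
        by (intro k1.submod_Zk k2.submod_Zk k1.zero_Bk k2.zero_Bk M M')+
      show "0 - \<Phi> 0 \<in> k2.Kc a e N'" unfolding \<Phi>_zero using submodD(1)[OF sub2(2)] by (simp only: diff_self)
      show "y + y' - \<Phi> (x + x') \<in> k2.Kc a e N'" if "y - \<Phi> x \<in> k2.Kc a e N'" "y' - \<Phi> x' \<in> k2.Kc a e N'"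
        for x y x' y'
      proof -
        have "y + y' - \<Phi> (x + x') = (y - \<Phi> x) + (y' - \<Phi> x')" unfolding \<Phi>_add by (rule add_diff_add)
        then show ?thesis using submodD(2)[OF sub2(2) that] by (simp only:)
      qed
      show "k2.cscl r y - \<Phi> (k1.cscl r x) \<in> k2.Kc a e N'" if "y - \<Phi> x \<in> k2.Kc a e N'" for r x y
        unfolding \<Phi>_scl kmodule.scl_diff_right[OF k2.kmodule_cscl, symmetric]
        by (rule submodD(3)[OF sub2(2) that])
      show "\<exists>y\<in>k2.Zk a e M' N'. y - \<Phi> x \<in> k2.Kc a e N'" if x: "x \<in> k1.Zk a e M N" for x
      proof (rule bexI[of _ "\<Phi> x"])
        show "\<Phi> x - \<Phi> x \<in> k2.Kc a e N'" using submodD(1)[OF sub2(2)] by (simp only: diff_self)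
        show "\<Phi> x \<in> k2.Zk a e M' N'"
          using x \<Phi>_M \<Phi>_N unfolding k1.Zk_def k2.Zk_def mem_Collect_eq \<Phi>_kd[symmetric] by blast
      qed
      show "\<exists>x\<in>k1.Zk a e M N. y - \<Phi> x \<in> k2.Kc a e N'" if y: "y \<in> k2.Zk a e M' N'" for y
      proof -
        have y1: "y \<in> k2.Kc a e M'" "k2.kd y \<in> k2.Kc (a - 1) e N'" using y by (simp_all add: k2.Zk_def)
        from lift[OF y1(1)] obtain c where c: "c \<in> k1.Kc a e M" "y - \<Phi> c \<in> k2.Kc a e N'" by blast
        have "\<Phi> (k1.kd c) = k2.kd y - k2.kd (y - \<Phi> c)"
          unfolding \<Phi>_kd k2.kd_diff by (simp only: diff_diff_eq2 add_diff_cancel_left')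
        also have "\<dots> \<in> k2.Kc (a - 1) e N'"
          by (rule diff2[OF sub2(2) y1(2) k2.kd_Kc'[OF M'(2) c(2)]])
        finally have "k1.kd c \<in> k1.Kc (a - 1) e N"
          by (rule \<Phi>_inj[OF k1.kd_Kc'[OF M(1) c(1)]])
        then show ?thesis using c unfolding k1.Zk_def by blast
      qed
      show "x \<in> k1.Bk a e M N \<longleftrightarrow> y \<in> k2.Bk a e M' N'"
        if x: "x \<in> k1.Zk a e M N" and y: "y \<in> k2.Zk a e M' N'" and xy: "y - \<Phi> x \<in> k2.Kc a e N'" for x y
      proof
        assume "x \<in> k1.Bk a e M N"
        then obtain b n where b: "b \<in> k1.Kc (Suc a) e M" "n \<in> k1.Kc a e N" "x = k1.kd b + n"
          unfolding k1.Bk_def by blast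
        have "y = k2.kd (\<Phi> b) + (\<Phi> n + (y - \<Phi> x))"
          unfolding b(3) \<Phi>_add \<Phi>_kd by (simp only: add_diff_eq add_diff_cancel_left' add.assoc[symmetric])
        moreover have "\<Phi> n + (y - \<Phi> x) \<in> k2.Kc a e N'"
          by (rule submodD(2)[OF sub2(2) \<Phi>_N[OF b(2)] xy])
        ultimately show "y \<in> k2.Bk a e M' N'" using \<Phi>_M[OF b(1)] unfolding k2.Bk_def by blast
      next
        assume "y \<in> k2.Bk a e M' N'"
        then obtain b' n where b': "b' \<in> k2.Kc (Suc a) e M'" "n \<in> k2.Kc a e N'" "y = k2.kd b' + n"
          unfolding k2.Bk_def by blast
        from lift[OF b'(1)] obtain b where b: "b \<in> k1.Kc (Suc a) e M" "b' - \<Phi> b \<in> k2.Kc (Suc a) e N'"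
          by blast
        have "\<Phi> (x - k1.kd b) = (k2.kd (b' - \<Phi> b) + n) - (y - \<Phi> x)"
          unfolding \<Phi>_diff \<Phi>_kd k2.kd_diff b'(3) by (simp only: diff_conv_add_uminus minus_add minus_minus ac_simps add_minus_cancel minus_add_cancel)
        also have "\<dots> \<in> k2.Kc a e N'"
          by (rule diff2[OF sub2(2) submodD(2)[OF sub2(2) k2.kd_Kc[OF M'(2) b(2)] b'(2)] xy])
        finally have "\<Phi> (x - k1.kd b) \<in> k2.Kc a e N'" .
        moreover have "x - k1.kd b \<in> k1.Kc a e M"
          using x by (intro diff1[OF sub1(1)] k1.kd_Kc[OF M(1) b(1)]) (simp add: k1.Zk_def)
        ultimately have "x - k1.kd b \<in> k1.Kc a e N" by (rule \<Phi>_inj[rotated])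
        moreover have "x = k1.kd b + (x - k1.kd b)" by (simp only: add_diff_cancel_left' add_diff_eq)
        ultimately show "x \<in> k1.Bk a e M N" using b(1) unfolding k1.Bk_def by blast
      qed
    qed
  qed
qed

subsection \<open>Polynomials\<close>

abbreviation "lookup \<equiv> Poly_Mapping.lookup"
abbreviation "keys \<equiv> Poly_Mapping.keys"
abbreviation "single \<equiv> Poly_Mapping.single"

lemma lookup_map0: "f 0 = 0 \<Longrightarrow> lookup (Poly_Mapping.map f x) b = f (lookup x b)"
  by transfer (auto simp: when_def)

lemma lookup_scale: "lookup (scale c x) b = c * lookup x b"
  by (simp add: scale_def lookup_map0)

lemma kmodule_scale: "kmodule (scale :: 'k::idom \<Rightarrow> ('b \<Rightarrow>\<^sub>0 'k) \<Rightarrow> _)"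
  by standard (auto intro!: poly_mapping_eqI simp: lookup_scale lookup_add algebra_simps)

lemma scale_mpoly: "scale c p = single 0 c * (p :: ('v, 'k::comm_ring_1) mpoly)"
  unfolding scale_def by (rule mult_map_scale_conv_mult)

lemma keys_scale_subset: "keys (scale c x) \<subseteq> keys x"
  by (auto simp: in_keys_iff lookup_scale)

lemma lookup_single_mult:
  fixes p :: "'m::cancel_comm_monoid_add \<Rightarrow>\<^sub>0 'k::comm_ring_1"
  shows "lookup (single s c * p) (s + u) = c * lookup p u"
  by (simp add: lookup_mult lookup_single when_mult)

lemma lookup_single_mult_0:
  fixes p :: "'m::cancel_comm_monoid_add \<Rightarrow>\<^sub>0 'k::comm_ring_1"
  assumes "\<And>u. t \<noteq> s + u"
  shows "lookup (single s c * p) t = 0"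
  by (simp add: lookup_mult lookup_single when_mult assms)

definition ind1 :: "'v \<Rightarrow> ('v \<Rightarrow>\<^sub>0 nat)" where "ind1 v = single v 1"

lemma lookup_ind1: "lookup (ind1 v) w = (if v = w then 1 else 0)"
  by (simp add: ind1_def lookup_single when_def)

lemma keys_ind1 [simp]: "keys (ind1 v) = {v}"
  by (simp add: ind1_def)

lemma ind1_decomp:
  assumes "lookup t v \<ge> 1"
  shows "ind1 v + (t - ind1 v) = t" "t - ind1 v + ind1 v = t"
  using assms by (auto intro!: poly_mapping_eqI simp: lookup_add lookup_minus lookup_ind1)

lemma lookup_var_mult:
  "lookup (var v * p) t = (if lookup t v \<ge> 1 then lookup p (t - ind1 v) else 0)"
proof (cases "lookup t v \<ge> 1")
  case True
  then show ?thesis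
    using lookup_single_mult[of "ind1 v" 1 p "t - ind1 v"] ind1_decomp[OF True] by (simp add: var_def ind1_def)
next
  case False
  have "t \<noteq> ind1 v + u" for u
    using False by (auto simp: lookup_add lookup_ind1)
  then show ?thesis using False by (simp add: var_def lookup_single_mult_0 ind1_def)
qed

lemma mon_degree_sum:
  assumes "finite S" "keys t \<subseteq> S"
  shows "mon_degree t = 2 * (\<Sum>v\<in>S. lookup t v)"
  unfolding mon_degree_def
  by (intro arg_cong[where f = "(*) 2"] sum.mono_neutral_left) (use assms in \<open>auto simp: in_keys_iff\<close>)

lemma mon_degree_add: "mon_degree (s + t) = mon_degree s + mon_degree t"
proof -
  let ?S = "keys s \<union> keys t"
  have "mon_degree (s + t) = 2 * (\<Sum>v\<in>?S. lookup (s + t) v)"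
    by (rule mon_degree_sum) (use keys_add[of s t] in auto)
  moreover have "mon_degree s = 2 * (\<Sum>v\<in>?S. lookup s v)" "mon_degree t = 2 * (\<Sum>v\<in>?S. lookup t v)"
    by (rule mon_degree_sum; simp)+
  ultimately show ?thesis by (simp add: lookup_add sum.distrib)
qed

lemma mon_degree_zero [simp]: "mon_degree 0 = 0"
  by (simp add: mon_degree_def)

lemma mon_degree_ind1 [simp]: "mon_degree (ind1 v) = 2"
  by (simp add: mon_degree_def lookup_ind1)

text \<open>The exponent vector of the squarefree monomial with support
  \<open>\<sigma>\<close>.\<close>

definition chi :: "'v set \<Rightarrow> ('v \<Rightarrow>\<^sub>0 nat)" where
  "chi \<sigma> = (\<Sum>v\<in>\<sigma>. ind1 v)"

lemma lookup_chi: "finite \<sigma> \<Longrightarrow> lookup (chi \<sigma>) v = (if v \<in> \<sigma> then 1 else 0)"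
  by (simp add: chi_def lookup_sum lookup_ind1)

lemma keys_chi: "finite \<sigma> \<Longrightarrow> keys (chi \<sigma>) = \<sigma>"
  by (auto simp: in_keys_iff lookup_chi split: if_splits)

lemma mon_degree_chi: "finite \<sigma> \<Longrightarrow> mon_degree (chi \<sigma>) = 2 * card \<sigma>"
  by (simp add: mon_degree_def keys_chi lookup_chi)

lemma chi_insert: "finite \<sigma> \<Longrightarrow> v \<notin> \<sigma> \<Longrightarrow> chi (insert v \<sigma>) = ind1 v + chi \<sigma>"
  by (simp add: chi_def)

lemma keys_add_nat: "keys (s + t) = keys s \<union> keys (t :: 'v \<Rightarrow>\<^sub>0 nat)"
  by (auto simp: in_keys_iff lookup_add)

definition pgr :: "'v set \<Rightarrow> nat \<Rightarrow> ('v, 'k::comm_ring_1) mpoly set" where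
  "pgr V e = {p \<in> polys V. \<forall>t\<in>keys p. mon_degree t = e}"

lemma koszul_poly:
  assumes "finite V" "sign_system V sg"
  shows "koszul (scale :: 'k::idom \<Rightarrow> ('v, 'k) mpoly \<Rightarrow> _) V sg (\<lambda>v. (*) (var v))"
proof (intro koszul.intro kmodule_scale koszul_axioms.intro assms)
  fix v w c and x y :: "('v, 'k) mpoly"
  show "var v * (x + y) = var v * x + var v * y" by (rule distrib_left)
  show "var v * scale c x = scale c (var v * x)" by (simp add: scale_mpoly mult.left_commute)
  show "var v * (var w * x) = var w * (var v * x)" by (rule mult.left_commute)
qed

lemma polys_zero: "0 \<in> polys V"
  by (simp add: polys_def)

lemma polys_add: "p \<in> polys V \<Longrightarrow> q \<in> polys V \<Longrightarrow> p + q \<in> polys V"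
  unfolding polys_def using keys_add[of p q] by blast

lemma polys_scale: "p \<in> polys V \<Longrightarrow> scale c p \<in> polys V"
  unfolding polys_def using keys_scale_subset[of c p] by blast

lemma polys_mult: "p \<in> polys V \<Longrightarrow> q \<in> polys V \<Longrightarrow> p * q \<in> polys V"
  unfolding polys_def
proof (intro CollectI ballI)
  fix t assume *: "p \<in> {f. \<forall>t\<in>keys f. keys t \<subseteq> V}" "q \<in> {f. \<forall>t\<in>keys f. keys t \<subseteq> V}" and t: "t \<in> keys (p * q)"
  obtain a b where "t = a + b" "a \<in> keys p" "b \<in> keys q" using keys_mult[of p q] t by auto
  then show "keys t \<subseteq> V" using * by (auto simp: keys_add_nat)
qed

lemma polys_sum: "(\<And>a. a \<in> A \<Longrightarrow> f a \<in> polys V) \<Longrightarrow> sum f A \<in> polys V"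
  by (induction A rule: infinite_finite_induct) (auto simp: polys_zero polys_add)

lemma polys_single: "keys t \<subseteq> V \<Longrightarrow> single t c \<in> polys V"
  by (auto simp: polys_def)

lemma polys_var: "v \<in> V \<Longrightarrow> var v \<in> polys V"
  by (auto simp: var_def polys_def)

lemma keys_var_mult:
  assumes "t \<in> keys (var v * p)"
  shows "lookup t v \<ge> 1" "t - ind1 v \<in> keys p"
  using assms by (auto simp: in_keys_iff lookup_var_mult split: if_splits)

lemma mon_degree_diff_ind1: "lookup t v \<ge> 1 \<Longrightarrow> mon_degree t = mon_degree (t - ind1 v) + 2"
  using mon_degree_add[of "t - ind1 v" "ind1 v"] ind1_decomp(2)[of t v] by simp

lemma pgr_var_mult:
  assumes "v \<in> V" "p \<in> pgr V e"
  shows "var v * p \<in> pgr V (e + 2)"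
  using assms keys_var_mult[of _ v p] mon_degree_diff_ind1[of _ v]
  by (auto simp: pgr_def intro!: polys_mult polys_var)

lemma submod_pgr: "submod scale (pgr V e)"
proof (rule submodI)
  show "0 \<in> pgr V e" by (simp add: pgr_def polys_zero)
  show "x + y \<in> pgr V e" if "x \<in> pgr V e" "y \<in> pgr V e" for x y
    using that keys_add[of x y] by (auto simp: pgr_def intro!: polys_add)
  show "scale c x \<in> pgr V e" if "x \<in> pgr V e" for c x
    using that keys_scale_subset[of c x] by (auto simp: pgr_def intro!: polys_scale)
qed

subsection \<open>A contracting homotopy of the Koszul complex, one multidegree at a time\<close>

locale signs =
  fixes V :: "'v set" and sg :: "'v \<Rightarrow> 'v set \<Rightarrow> 'k::idom"
  assumes fin_V: "finite V" and sgs: "sign_system V sg"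
begin

sublocale K: koszul "scale :: 'k \<Rightarrow> ('v, 'k) mpoly \<Rightarrow> _" V sg "\<lambda>v. (*) (var v)"
  by (rule koszul_poly[OF fin_V sgs])

lemma gsub_pgr: "K.gsub (pgr V)"
  unfolding K.gsub_def by (intro conjI allI ballI submod_pgr pgr_var_mult)

text \<open>\<open>kd\<close> on coefficients, for arbitrary functions on monomials: the homotopy
  identity can be verified here before finite support is established.\<close>

definition mkd :: "('v set \<Rightarrow> ('v \<Rightarrow>\<^sub>0 nat) \<Rightarrow> 'k) \<Rightarrow> 'v set \<Rightarrow> ('v \<Rightarrow>\<^sub>0 nat) \<Rightarrow> 'k" where
  "mkd c \<sigma> t = (\<Sum>v\<in>V - \<sigma>. sg v \<sigma> * (if lookup t v \<ge> 1 then c (insert v \<sigma>) (t - ind1 v) else 0))"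

lemma lookup_kd: "lookup (K.kd c \<sigma>) t = mkd (\<lambda>\<sigma>. lookup (c \<sigma>)) \<sigma> t"
  by (simp add: K.kd_def mkd_def lookup_sum lookup_scale lookup_var_mult)

lemma sg_sq: "sg v s * sg v s = 1"
  using sgs by (simp add: sign_system_def)

lemma sg_anti:
  assumes "v \<in> V" "w \<in> V" "s \<subseteq> V" "v \<noteq> w" "v \<notin> s" "w \<notin> s"
  shows "sg v s * sg w (insert v s) = - (sg w s * sg v (insert w s))"
  using sgs assms unfolding sign_system_def by blast

text \<open>Anticommutation rearranged by inserting squares of signs; in this form it cancels the
  cross terms of the homotopy.\<close>

lemma sg_anti':
  assumes "v \<in> V" "w \<in> V" "s \<subseteq> V" "v \<noteq> w" "v \<notin> s" "w \<notin> s"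
  shows "sg v (insert w s) * sg w (insert v s) = - (sg w s * sg v s)"
proof -
  have "sg v (insert w s) * sg w (insert v s) =
      (sg v s * sg v s) * sg v (insert w s) * sg w (insert v s)" by (simp add: sg_sq)
  also have "\<dots> = sg v s * sg v (insert w s) * (sg v s * sg w (insert v s))" by (simp add: ac_simps)
  also have "\<dots> = - (sg w s * sg v s * (sg v (insert w s) * sg v (insert w s)))"
    unfolding sg_anti[OF assms] by (simp add: ac_simps)
  finally show ?thesis by (simp add: sg_sq)
qed

text \<open>\<open>t + chi \<sigma>\<close> is the multidegree of the monomial \<open>t\<close> times the exterior basis element \<open>\<sigma>\<close>. In the multidegrees
  selected by \<open>P\<close> the homotopy divides by one chosen variable and moves it to the exterior factor.\<close>

definition htpy_coeff :: "(('v \<Rightarrow>\<^sub>0 nat) \<Rightarrow> bool) \<Rightarrow> (('v \<Rightarrow>\<^sub>0 nat) \<Rightarrow> 'v) \<Rightarrow>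
    ('v set \<Rightarrow> ('v \<Rightarrow>\<^sub>0 nat) \<Rightarrow> 'k) \<Rightarrow> 'v set \<Rightarrow> ('v \<Rightarrow>\<^sub>0 nat) \<Rightarrow> 'k" where
  "htpy_coeff P pick c \<sigma> t = (let w = pick (t + chi \<sigma>) in
     if P (t + chi \<sigma>) \<and> w \<in> \<sigma> then sg w (\<sigma> - {w}) * c (\<sigma> - {w}) (t + ind1 w) else 0)"

text \<open>Differential and homotopy both preserve the multidegree \<open>t + chi \<sigma>\<close>,
  so the same variable \<open>w\<close> is picked throughout. If \<open>w\<close> is not in
  \<open>\<sigma>\<close>, only the term that inserts \<open>w\<close> survives in the first summand
  and the second vanishes. If it is, the second summand gives \<open>c \<sigma> t\<close>, and the
  remaining terms cancel in pairs by \<open>sg_anti'\<close>.\<close>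

lemma homotopy:
  assumes pick: "\<And>a. P a \<Longrightarrow> pick a \<in> V \<and> lookup a (pick a) \<ge> 1" and \<sigma>: "\<sigma> \<subseteq> V"
  shows "mkd (htpy_coeff P pick c) \<sigma> t + htpy_coeff P pick (mkd c) \<sigma> t = (if P (t + chi \<sigma>) then c \<sigma> t else 0)"
proof -
  have fin: "finite \<sigma>" using \<sigma> fin_V finite_subset by blast
  define a where "a = t + chi \<sigma>"
  define w where "w = pick a"
  have deg1: "t - ind1 v + chi (insert v \<sigma>) = a" if "v \<notin> \<sigma>" "lookup t v \<ge> 1" for v
    using ind1_decomp[OF that(2)] chi_insert[OF fin that(1)] by (simp add: a_def ac_simps flip: add.assoc)
  have mkd_htpy_coeff: "mkd (htpy_coeff P pick c) \<sigma> t = (\<Sum>v\<in>V - \<sigma>. sg v \<sigma> * (if lookup t v \<ge> 1 then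
      (if P a \<and> w \<in> insert v \<sigma> then sg w (insert v \<sigma> - {w}) * c (insert v \<sigma> - {w}) (t - ind1 v + ind1 w) else 0)
      else 0))"
    unfolding mkd_def htpy_coeff_def Let_def by (intro sum.cong refl) (simp add: deg1 w_def; blast)
  show ?thesis
  proof (cases "P a")
    case False
    then have "htpy_coeff P pick (mkd c) \<sigma> t = 0" by (simp add: htpy_coeff_def a_def)
    then show ?thesis using False unfolding mkd_htpy_coeff by (simp add: a_def)
  next
    case Pa: True
    have w: "w \<in> V" "lookup a w \<ge> 1" using pick[OF Pa] by (simp_all add: w_def)
    show ?thesis
    proof (cases "w \<in> \<sigma>")
      case False
      have tw: "lookup t w \<ge> 1" using w(2) False fin by (simp add: a_def lookup_add lookup_chi)
      have "mkd (htpy_coeff P pick c) \<sigma> t = (\<Sum>v\<in>{w}. sg v \<sigma> * (sg w (insert v \<sigma> - {w}) * c (insert v \<sigma> - {w}) (t - ind1 v + ind1 w)))"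
        unfolding mkd_htpy_coeff
        by (rule sum.mono_neutral_cong_right) (use fin_V w False Pa tw in auto)
      also have "\<dots> = c \<sigma> t"
        using ind1_decomp[OF tw] False sg_sq[of w \<sigma>] by (simp add: mult.assoc[symmetric])
      finally show ?thesis using False Pa by (simp add: htpy_coeff_def a_def w_def)
    next
      case True
      define \<tau> where "\<tau> = \<sigma> - {w}"
      have \<tau>: "\<sigma> = insert w \<tau>" "w \<notin> \<tau>" "\<tau> \<subseteq> V" using True \<sigma> by (auto simp: \<tau>_def)
      have V\<tau>: "V - \<tau> = insert w (V - \<sigma>)" using w(1) \<tau> by auto
      let ?C = "\<lambda>v. if lookup t v \<ge> 1 then c (insert v \<tau>) (t + ind1 w - ind1 v) else 0"
      have "htpy_coeff P pick (mkd c) \<sigma> t = sg w \<tau> * mkd c \<tau> (t + ind1 w)"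
        using Pa True by (simp add: htpy_coeff_def Let_def a_def w_def \<tau>_def)
      also have "mkd c \<tau> (t + ind1 w) = sg w \<tau> * c \<sigma> t + (\<Sum>v\<in>V - \<sigma>. sg v \<tau> *
          (if lookup (t + ind1 w) v \<ge> 1 then c (insert v \<tau>) (t + ind1 w - ind1 v) else 0))"
        unfolding mkd_def V\<tau> using True fin_V by (simp add: \<tau>(1)[symmetric] lookup_add lookup_ind1)
      also have "(\<Sum>v\<in>V - \<sigma>. sg v \<tau> * (if lookup (t + ind1 w) v \<ge> 1 then c (insert v \<tau>) (t + ind1 w - ind1 v) else 0))
          = (\<Sum>v\<in>V - \<sigma>. sg v \<tau> * ?C v)"
        by (intro sum.cong refl) (use True in \<open>auto simp: lookup_add lookup_ind1\<close>)
      finally have h: "htpy_coeff P pick (mkd c) \<sigma> t = c \<sigma> t + (\<Sum>v\<in>V - \<sigma>. sg w \<tau> * sg v \<tau> * ?C v)"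
        by (simp only: distrib_left sum_distrib_left mult.assoc[symmetric] sg_sq mult_1_left)
      have shift: "t - ind1 v + ind1 w = t + ind1 w - ind1 v" if "lookup t v \<ge> 1" for v
        using that by (auto intro!: poly_mapping_eqI simp: lookup_add lookup_minus lookup_ind1)
      have "mkd (htpy_coeff P pick c) \<sigma> t = (\<Sum>v\<in>V - \<sigma>. - (sg w \<tau> * sg v \<tau> * ?C v))"
        unfolding mkd_htpy_coeff
      proof (intro sum.cong refl)
        fix v assume v: "v \<in> V - \<sigma>"
        have "insert v \<sigma> - {w} = insert v \<tau>" using v True \<tau> by auto
        moreover have "sg v (insert w \<tau>) * sg w (insert v \<tau>) = - (sg w \<tau> * sg v \<tau>)"
          using v True \<tau> w(1) by (intro sg_anti') auto
        ultimately show "sg v \<sigma> * (if lookup t v \<ge> 1 then (if P a \<and> w \<in> insert v \<sigma> then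
            sg w (insert v \<sigma> - {w}) * c (insert v \<sigma> - {w}) (t - ind1 v + ind1 w) else 0) else 0) =
            - (sg w \<tau> * sg v \<tau> * ?C v)"
          using Pa True shift \<tau>(1) by (simp add: mult.assoc[symmetric])
      qed
      then show ?thesis using h Pa by (simp add: sum_negf a_def)
    qed
  qed
qed

definition htpy :: "(('v \<Rightarrow>\<^sub>0 nat) \<Rightarrow> bool) \<Rightarrow> (('v \<Rightarrow>\<^sub>0 nat) \<Rightarrow> 'v) \<Rightarrow>
    ('v set \<Rightarrow> ('v, 'k) mpoly) \<Rightarrow> 'v set \<Rightarrow> ('v, 'k) mpoly" where
  "htpy P pick c \<sigma> = (if \<sigma> \<subseteq> V then Abs_poly_mapping (htpy_coeff P pick (\<lambda>\<sigma>. lookup (c \<sigma>)) \<sigma>) else 0)"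

lemma lookup_htpy:
  assumes "\<sigma> \<subseteq> V"
  shows "lookup (htpy P pick c \<sigma>) t = htpy_coeff P pick (\<lambda>\<sigma>. lookup (c \<sigma>)) \<sigma> t"
proof -
  have fin: "finite \<sigma>" using assms fin_V finite_subset by blast
  \<comment> \<open>Every value is read from some \<open>c (\<sigma> - {w})\<close>, so the support
    lies in finitely many shifted supports.\<close>
  have "{t. htpy_coeff P pick (\<lambda>\<sigma>. lookup (c \<sigma>)) \<sigma> t \<noteq> 0} \<subseteq> (\<Union>w\<in>\<sigma>. (\<lambda>s. s - ind1 w) ` keys (c (\<sigma> - {w})))"
  proof
    fix t assume "t \<in> {t. htpy_coeff P pick (\<lambda>\<sigma>. lookup (c \<sigma>)) \<sigma> t \<noteq> 0}"
    then have "pick (t + chi \<sigma>) \<in> \<sigma>"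
      "t + ind1 (pick (t + chi \<sigma>)) \<in> keys (c (\<sigma> - {pick (t + chi \<sigma>)}))"
      by (auto simp: htpy_coeff_def Let_def in_keys_iff split: if_splits)
    then show "t \<in> (\<Union>w\<in>\<sigma>. (\<lambda>s. s - ind1 w) ` keys (c (\<sigma> - {w})))"
      by (intro UN_I[of "pick (t + chi \<sigma>)"] image_eqI[of _ _ "t + ind1 (pick (t + chi \<sigma>))"]) auto
  qed
  then have "finite {t. htpy_coeff P pick (\<lambda>\<sigma>. lookup (c \<sigma>)) \<sigma> t \<noteq> 0}"
    by (rule finite_subset) (use fin in auto)
  then show ?thesis using assms by (simp add: htpy_def)
qed

text \<open>The cycle condition is asked only at the one coefficient that the homotopy reads, so the
  lemma also applies to chains that are cycles merely modulo the Stanley--Reisner ideal.\<close>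

lemma homotopy_poly:
  assumes pick: "\<And>a. P a \<Longrightarrow> pick a \<in> V \<and> lookup a (pick a) \<ge> 1" and \<sigma>: "\<sigma> \<subseteq> V"
    and cyc: "P (t + chi \<sigma>) \<Longrightarrow> pick (t + chi \<sigma>) \<in> \<sigma> \<Longrightarrow>
      lookup (K.kd c (\<sigma> - {pick (t + chi \<sigma>)})) (t + ind1 (pick (t + chi \<sigma>))) = 0"
  shows "lookup (K.kd (htpy P pick c) \<sigma>) t = (if P (t + chi \<sigma>) then lookup (c \<sigma>) t else 0)"
proof -
  have "lookup (K.kd (htpy P pick c) \<sigma>) t = mkd (htpy_coeff P pick (\<lambda>\<sigma>. lookup (c \<sigma>))) \<sigma> t"
    unfolding lookup_kd unfolding mkd_def
    by (intro sum.cong refl) (use \<sigma> in \<open>auto simp: lookup_htpy\<close>)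
  moreover have "htpy_coeff P pick (mkd (\<lambda>\<sigma>. lookup (c \<sigma>))) \<sigma> t = 0"
    using cyc by (simp add: htpy_coeff_def Let_def lookup_kd)
  ultimately show ?thesis using homotopy[of P pick \<sigma> "\<lambda>\<sigma>. lookup (c \<sigma>)" t] pick \<sigma> by simp
qed

lemma htpy_Kc:
  assumes c: "c \<in> K.Kc a e (pgr V)"
    and M: "\<And>\<sigma> w t. \<sigma> \<subseteq> V \<Longrightarrow> w \<in> \<sigma> \<Longrightarrow> P (t + chi \<sigma>) \<Longrightarrow> w = pick (t + chi \<sigma>) \<Longrightarrow>
      t + ind1 w \<in> keys (c (\<sigma> - {w})) \<Longrightarrow> Q t"
  shows "htpy P pick c \<in> K.Kc (Suc a) e (\<lambda>e. {p \<in> pgr V e. \<forall>t\<in>keys p. Q t})"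
proof -
  have key: "keys t \<subseteq> V \<and> mon_degree t = e - 2 * Suc a \<and> Q t \<and> card \<sigma> = Suc a \<and> 2 * Suc a \<le> e"
    if \<sigma>: "\<sigma> \<subseteq> V" and t: "t \<in> keys (htpy P pick c \<sigma>)" for \<sigma> t
  proof -
    let ?w = "pick (t + chi \<sigma>)"
    have "htpy_coeff P pick (\<lambda>\<sigma>. lookup (c \<sigma>)) \<sigma> t \<noteq> 0" using t \<sigma> by (simp add: in_keys_iff lookup_htpy)
    then have P: "P (t + chi \<sigma>)" and w: "?w \<in> \<sigma>" and k: "t + ind1 ?w \<in> keys (c (\<sigma> - {?w}))"
      by (auto simp: htpy_coeff_def Let_def in_keys_iff split: if_splits)
    then have "c (\<sigma> - {?w}) \<noteq> 0" by auto
    then have *: "c (\<sigma> - {?w}) \<in> pgr V (e - 2 * a)" "card (\<sigma> - {?w}) = a" "2 * a \<le> e"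
      using c unfolding K.Kc_def by blast+
    have "keys (t + ind1 ?w) \<subseteq> V" "mon_degree (t + ind1 ?w) = e - 2 * a"
      using *(1) k by (auto simp: pgr_def polys_def)
    moreover have "finite \<sigma>" using \<sigma> fin_V finite_subset by blast
    then have "card \<sigma> = Suc a" using *(2) w card_Suc_Diff1[of \<sigma> ?w] by simp
    ultimately show ?thesis using M[OF \<sigma> w P refl k] *(3) by (auto simp: keys_add_nat mon_degree_add)
  qed
  show ?thesis
    unfolding K.Kc_def mem_Collect_eq
  proof (intro allI)
    fix \<sigma>
    show "(htpy P pick c \<sigma> \<in> pgr V (e - 2 * Suc a) \<and> (\<forall>t\<in>keys (htpy P pick c \<sigma>). Q t)) \<and>
      (htpy P pick c \<sigma> \<noteq> 0 \<longrightarrow> \<sigma> \<subseteq> V \<and> card \<sigma> = Suc a \<and> 2 * Suc a \<le> e)"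
    proof (cases "\<sigma> \<subseteq> V")
      case True
      have "htpy P pick c \<sigma> \<noteq> 0 \<Longrightarrow> \<exists>t. t \<in> keys (htpy P pick c \<sigma>)" by (metis ex_in_conv keys_eq_empty)
      then have "htpy P pick c \<sigma> \<noteq> 0 \<longrightarrow> \<sigma> \<subseteq> V \<and> card \<sigma> = Suc a \<and> 2 * Suc a \<le> e"
        using key[OF True] True by blast
      moreover have "htpy P pick c \<sigma> \<in> pgr V (e - 2 * Suc a) \<and> (\<forall>t\<in>keys (htpy P pick c \<sigma>). Q t)"
        unfolding pgr_def polys_def using key[OF True] by blast
      ultimately show ?thesis by blast
    next
      case False
      then show ?thesis by (simp add: htpy_def pgr_def polys_zero)
    qed
  qed
qed

text \<open>A chain of positive exterior degree lives in nonzero multidegrees, since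
  \<open>\<sigma>\<close> is nonempty. There is always a variable to contract along, and the
  homotopy exhibits every cycle as a boundary.\<close>

lemma kexact_pgr: "K.kexact (pgr V)"
  unfolding K.kexact_def
proof (intro allI impI)
  fix a e c assume c: "c \<in> K.Kc (Suc a) e (pgr V)" and 0: "K.kd c = 0"
  define P :: "('v \<Rightarrow>\<^sub>0 nat) \<Rightarrow> bool" where "P a \<longleftrightarrow> keys a \<noteq> {} \<and> keys a \<subseteq> V" for a
  define pick :: "('v \<Rightarrow>\<^sub>0 nat) \<Rightarrow> 'v" where "pick a = (SOME v. v \<in> keys a)" for a
  have pick: "pick a \<in> V \<and> lookup a (pick a) \<ge> 1" if "P a" for a
  proof -
    have "\<exists>v. v \<in> keys a" using that unfolding P_def by blast
    then have "pick a \<in> keys a" unfolding pick_def by (rule someI_ex)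
    then show ?thesis using that by (auto simp: P_def in_keys_iff)
  qed
  have "htpy P pick c \<in> K.Kc (Suc (Suc a)) e (\<lambda>e. {p \<in> pgr V e. \<forall>t\<in>keys p. True})"
    by (rule htpy_Kc[OF c]) simp
  then have "htpy P pick c \<in> K.Kc (Suc (Suc a)) e (pgr V)" by simp
  moreover have "c = K.kd (htpy P pick c)"
  proof (rule ext)
    fix \<sigma>
    show "c \<sigma> = K.kd (htpy P pick c) \<sigma>"
    proof (cases "\<sigma> \<subseteq> V")
      case False
      then show ?thesis using K.Kc_vanish[OF c] K.Kc_vanish[OF K.kd_Kc[OF gsub_pgr calculation]] by simp
    next
      case True
      show ?thesis
      proof (rule poly_mapping_eqI)
        fix t
        have "lookup (K.kd (htpy P pick c) \<sigma>) t = (if P (t + chi \<sigma>) then lookup (c \<sigma>) t else 0)"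
          by (rule homotopy_poly[OF pick True]) (simp_all add: 0)
        moreover have "P (t + chi \<sigma>)" if "lookup (c \<sigma>) t \<noteq> 0"
        proof -
          have "c \<sigma> \<noteq> 0" using that by auto
          then have "c \<sigma> \<in> pgr V (e - 2 * Suc a)" "card \<sigma> = Suc a" using c unfolding K.Kc_def by blast+
          moreover have "finite \<sigma>" using True fin_V finite_subset by blast
          ultimately show ?thesis using that True
            by (auto simp: P_def keys_add_nat keys_chi pgr_def polys_def in_keys_iff)
        qed
        ultimately show "lookup (c \<sigma>) t = lookup (K.kd (htpy P pick c) \<sigma>) t" by auto
      qed
    qed
  qed
  ultimately show "\<exists>c'\<in>K.Kc (Suc (Suc a)) e (pgr V). c = K.kd c'" by blast
qed

end

subsection \<open>Cohomology of independence complexes of matroids\<close>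

text \<open>Signs indexed by the larger face, as suits a coboundary. They are abstract so that the
  link of \<open>e\<close> can inherit the signs of \<open>insert e \<tau>\<close>.\<close>

definition cochain_signs :: "'v set set \<Rightarrow> ('v \<Rightarrow> 'v set \<Rightarrow> 'k::idom) \<Rightarrow> bool" where
  "cochain_signs C s \<longleftrightarrow> (\<forall>v \<tau>. s v \<tau> * s v \<tau> = 1) \<and>
     (\<forall>\<tau>\<in>C. \<forall>v\<in>\<tau>. \<forall>w\<in>\<tau>. v \<noteq> w \<longrightarrow> s v \<tau> * s w (\<tau> - {v}) = - (s w \<tau> * s v (\<tau> - {w})))"

text \<open>Coboundary of the augmented cochain complex: faces are graded by cardinality, so the
  empty face takes part and the cohomology is reduced.\<close>

definition gcod :: "('v \<Rightarrow> 'v set \<Rightarrow> 'k::idom) \<Rightarrow> ('v set \<Rightarrow> 'k) \<Rightarrow> 'v set \<Rightarrow> 'k" where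
  "gcod s f \<tau> = (\<Sum>v\<in>\<tau>. s v \<tau> * f (\<tau> - {v}))"

lemma gcod_gcod:
  assumes "cochain_signs C s" "\<tau> \<in> C" "finite \<tau>"
  shows "gcod s (gcod s f) \<tau> = 0"
proof -
  define F where "F v w = (if v = w then 0 else s v \<tau> * s w (\<tau> - {v}) * f (\<tau> - {v} - {w}))" for v w
  have "gcod s (gcod s f) \<tau> = (\<Sum>v\<in>\<tau>. \<Sum>w\<in>\<tau> - {v}. F v w)"
    unfolding gcod_def sum_distrib_left by (intro sum.cong refl) (auto simp: F_def mult.assoc)
  also have "\<dots> = (\<Sum>v\<in>\<tau>. \<Sum>w\<in>\<tau>. F v w)"
    by (intro sum.cong refl sum.mono_neutral_left) (use assms in \<open>auto simp: F_def\<close>)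
  also have "\<dots> = 0"
  proof (rule antisym_double_sum_zero)
    fix v w assume vw: "v \<in> \<tau>" "w \<in> \<tau>" "v \<noteq> w"
    have "s v \<tau> * s w (\<tau> - {v}) = - (s w \<tau> * s v (\<tau> - {w}))"
      using assms vw unfolding cochain_signs_def by blast
    moreover have "\<tau> - {v} - {w} = \<tau> - {w} - {v}" by auto
    ultimately show "F v w + F w v = 0" using vw by (simp add: F_def)
  qed (use assms in \<open>auto simp: F_def\<close>)
  finally show ?thesis .
qed

lemma gcod_cong: "(\<And>v. v \<in> \<tau> \<Longrightarrow> f (\<tau> - {v}) = g (\<tau> - {v})) \<Longrightarrow> gcod s f \<tau> = gcod s g \<tau>"
  unfolding gcod_def by (intro sum.cong refl) simp

lemma gcod_diff: "gcod s (\<lambda>x. f x - g x) \<tau> = gcod s f \<tau> - gcod s g \<tau>"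
  by (simp add: gcod_def right_diff_distrib sum_subtractf)

lemma gcod_add: "gcod s (\<lambda>x. f x + g x) \<tau> = gcod s f \<tau> + gcod s g \<tau>"
  by (simp add: gcod_def distrib_left sum.distrib)

definition indep_complex :: "'v set set \<Rightarrow> bool" where
  "indep_complex C \<longleftrightarrow> finite C \<and> (\<forall>A\<in>C. finite A) \<and> (\<forall>A\<in>C. \<forall>B. B \<subseteq> A \<longrightarrow> B \<in> C) \<and>
     (\<forall>A\<in>C. \<forall>B\<in>C. card A < card B \<longrightarrow> (\<exists>b\<in>B - A. insert b A \<in> C))"

lemma indep_complexD:
  assumes "indep_complex C"
  shows "finite C" "\<And>A. A \<in> C \<Longrightarrow> finite A" "\<And>A B. A \<in> C \<Longrightarrow> B \<subseteq> A \<Longrightarrow> B \<in> C"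
    "\<And>A B. A \<in> C \<Longrightarrow> B \<in> C \<Longrightarrow> card A < card B \<Longrightarrow> \<exists>b\<in>B - A. insert b A \<in> C"
  using assms unfolding indep_complex_def by blast+

lemma indep_complex_extend:
  assumes C: "indep_complex C" and "A \<in> C" "B \<in> C"
  shows "\<exists>A'\<in>C. A \<subseteq> A' \<and> card B \<le> card A'"
  using \<open>A \<in> C\<close>
proof (induction "card B - card A" arbitrary: A rule: less_induct)
  case less
  show ?case
  proof (cases "card A < card B")
    case False
    then show ?thesis using less.prems by auto
  next
    case True
    then obtain b where b: "b \<in> B - A" "insert b A \<in> C"
      using indep_complexD(4)[OF C less.prems \<open>B \<in> C\<close>] by blast
    have "card (insert b A) = Suc (card A)" using b indep_complexD(2)[OF C less.prems] by simp
    then have "card B - card (insert b A) < card B - card A" using True by simp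
    from less.hyps[OF this b(2)] show ?thesis by blast
  qed
qed

text \<open>Contraction to the apex \<open>e\<close> of the cone: \<open>g\<close> evaluates
  \<open>f\<close> on \<open>insert e \<tau>\<close>. On faces containing \<open>e\<close> a single
  term survives; on the others the cocycle condition at \<open>insert e \<tau>\<close> evaluates the
  sum.\<close>

lemma cone_exact:
  assumes C: "indep_complex C" and s: "cochain_signs C s"
    and cone: "\<And>A. A \<in> C \<Longrightarrow> insert e A \<in> C"
    and cyc: "\<And>\<tau>. \<tau> \<in> C \<Longrightarrow> card \<tau> = Suc d \<Longrightarrow> gcod s f \<tau> = 0"
  shows "\<exists>g. \<forall>\<tau>\<in>C. card \<tau> = d \<longrightarrow> f \<tau> = gcod s g \<tau>"
proof -
  have sq: "s v \<tau> * s v \<tau> = 1" for v \<tau> using s by (simp add: cochain_signs_def)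
  have anti: "s v \<tau> * s w (\<tau> - {v}) = - (s w \<tau> * s v (\<tau> - {w}))" if "\<tau> \<in> C" "v \<in> \<tau>" "w \<in> \<tau>" "v \<noteq> w" for v w \<tau>
    using s that unfolding cochain_signs_def by blast
  define g where "g \<tau> = (if e \<in> \<tau> then 0 else s e (insert e \<tau>) * f (insert e \<tau>))" for \<tau>
  have "f \<tau> = gcod s g \<tau>" if \<tau>: "\<tau> \<in> C" "card \<tau> = d" for \<tau>
  proof (cases "e \<in> \<tau>")
    case True
    have "gcod s g \<tau> = (\<Sum>v\<in>{e}. s v \<tau> * g (\<tau> - {v}))"
      unfolding gcod_def
      by (rule sum.mono_neutral_right) (use True indep_complexD(2)[OF C \<tau>(1)] in \<open>auto simp: g_def\<close>)
    also have "\<dots> = f \<tau>" using True sq[of e \<tau>] by (simp add: g_def insert_absorb mult.assoc[symmetric])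
    finally show ?thesis by simp
  next
    case False
    define \<tau>e where "\<tau>e = insert e \<tau>"
    have fin: "finite \<tau>" using indep_complexD(2)[OF C \<tau>(1)] .
    have \<tau>e: "\<tau>e \<in> C" "card \<tau>e = Suc d" "\<tau>e - {e} = \<tau>" using cone \<tau> False fin by (auto simp: \<tau>e_def)
    have "gcod s f \<tau>e = s e \<tau>e * f \<tau> + (\<Sum>v\<in>\<tau>. s v \<tau>e * f (\<tau>e - {v}))"
      unfolding gcod_def using False fin \<tau>e(3) by (subst \<tau>e_def, subst sum.insert) (auto simp: \<tau>e_def)
    then have 0: "s e \<tau>e * f \<tau> + (\<Sum>v\<in>\<tau>. s v \<tau>e * f (\<tau>e - {v})) = 0" using cyc[OF \<tau>e(1,2)] by simp
    have "gcod s g \<tau> = (\<Sum>v\<in>\<tau>. - (s e \<tau>e * (s v \<tau>e * f (\<tau>e - {v}))))"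
      unfolding gcod_def
    proof (intro sum.cong refl)
      fix v assume v: "v \<in> \<tau>"
      have ne: "v \<noteq> e" using v False by auto
      have ins: "insert e (\<tau> - {v}) = \<tau>e - {v}" using ne by (auto simp: \<tau>e_def)
      have a: "s v \<tau>e * s e (\<tau>e - {v}) = - (s e \<tau>e * s v \<tau>)"
        using anti[OF \<tau>e(1), of v e] v ne \<tau>e(3) by (simp add: \<tau>e_def)
      have "s v \<tau> * s e (\<tau>e - {v}) = (s v \<tau>e * s v \<tau>e) * s v \<tau> * s e (\<tau>e - {v})" by (simp add: sq)
      also have "\<dots> = s v \<tau>e * s v \<tau> * (s v \<tau>e * s e (\<tau>e - {v}))" by (simp add: ac_simps)
      also have "\<dots> = - (s e \<tau>e * s v \<tau>e * (s v \<tau> * s v \<tau>))" unfolding a by (simp add: ac_simps)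
      finally have b: "s v \<tau> * s e (\<tau>e - {v}) = - (s e \<tau>e * s v \<tau>e)" by (simp add: sq)
      have "s v \<tau> * g (\<tau> - {v}) = s v \<tau> * s e (\<tau>e - {v}) * f (\<tau>e - {v})"
        using False ins by (simp add: g_def mult.assoc)
      then show "s v \<tau> * g (\<tau> - {v}) = - (s e \<tau>e * (s v \<tau>e * f (\<tau>e - {v})))"
        unfolding b by (simp add: mult.assoc)
    qed
    also have "\<dots> = - (s e \<tau>e * (\<Sum>v\<in>\<tau>. s v \<tau>e * f (\<tau>e - {v})))"
      by (simp add: sum_negf sum_distrib_left)
    also have "(\<Sum>v\<in>\<tau>. s v \<tau>e * f (\<tau>e - {v})) = - (s e \<tau>e * f \<tau>)"
      using 0 by (simp add: eq_neg_iff_add_eq_0 add.commute)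
    also have "- (s e \<tau>e * - (s e \<tau>e * f \<tau>)) = f \<tau>" by (simp add: mult.assoc[symmetric] sq)
    finally show ?thesis by simp
  qed
  then show ?thesis by blast
qed

lemma cochain_signs_subset: "cochain_signs C s \<Longrightarrow> D \<subseteq> C \<Longrightarrow> cochain_signs D s"
  unfolding cochain_signs_def by blast

lemma indep_complex_deletion:
  assumes "indep_complex C"
  shows "indep_complex {A \<in> C. e \<notin> A}"
  unfolding indep_complex_def
proof (intro conjI ballI allI impI)
  note C = indep_complexD[OF assms]
  show "finite {A \<in> C. e \<notin> A}" using C(1) by simp
  show "finite A" if "A \<in> {A \<in> C. e \<notin> A}" for A using that C(2) by simp
  show "B \<in> {A \<in> C. e \<notin> A}" if "A \<in> {A \<in> C. e \<notin> A}" "B \<subseteq> A" for A B using that C(3) by blast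
  show "\<exists>b\<in>B - A. insert b A \<in> {A \<in> C. e \<notin> A}"
    if "A \<in> {A \<in> C. e \<notin> A}" "B \<in> {A \<in> C. e \<notin> A}" "card A < card B" for A B
    using that C(4)[of A B] by blast
qed

text \<open>Exchange in the link is exchange between \<open>insert e A\<close> and
  \<open>insert e B\<close>; since both contain \<open>e\<close>, the new element differs from
  \<open>e\<close>.\<close>

lemma indep_complex_link:
  assumes "indep_complex C"
  shows "indep_complex {A. e \<notin> A \<and> insert e A \<in> C}"
  unfolding indep_complex_def
proof (intro conjI ballI allI impI)
  note C = indep_complexD[OF assms]
  have sub: "{A. e \<notin> A \<and> insert e A \<in> C} \<subseteq> C" using C(3) by blast
  then show "finite {A. e \<notin> A \<and> insert e A \<in> C}" using C(1) finite_subset by blast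
  show fin: "finite A" if "A \<in> {A. e \<notin> A \<and> insert e A \<in> C}" for A using that C(2) sub by blast
  show "B \<in> {A. e \<notin> A \<and> insert e A \<in> C}" if "A \<in> {A. e \<notin> A \<and> insert e A \<in> C}" "B \<subseteq> A" for A B
    using that C(3)[of "insert e A" "insert e B"] by blast
  show "\<exists>b\<in>B - A. insert b A \<in> {A. e \<notin> A \<and> insert e A \<in> C}"
    if A: "A \<in> {A. e \<notin> A \<and> insert e A \<in> C}" and B: "B \<in> {A. e \<notin> A \<and> insert e A \<in> C}"
      and card: "card A < card B" for A B
  proof -
    have "card (insert e A) < card (insert e B)" using A B card fin[OF A] fin[OF B] by simp
    then obtain b where "b \<in> insert e B - insert e A" "insert b (insert e A) \<in> C"
      using A B C(4)[of "insert e A" "insert e B"] by blast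
    then show ?thesis using A by (intro bexI[of _ b]) (auto simp: insert_commute)
  qed
qed

text \<open>Induction by deletion and contraction of an element \<open>e\<close> of
  \<open>B\<close>. If every independent set extends by \<open>e\<close>, the complex is a cone.
  Otherwise the deletion still has an independent set of more than \<open>d\<close> elements, so
  \<open>f\<close> may be changed by a coboundary to vanish on faces without \<open>e\<close>. What
  remains is a cocycle of the link in one degree less.\<close>

theorem indep_complex_cohomology_vanishes:
  assumes "indep_complex C" "cochain_signs C s" "B \<in> C" "d < card B"
    and "\<And>\<tau>. \<tau> \<in> C \<Longrightarrow> card \<tau> = Suc d \<Longrightarrow> gcod s f \<tau> = 0"
  shows "\<exists>g. \<forall>\<tau>\<in>C. card \<tau> = d \<longrightarrow> f \<tau> = gcod s g \<tau>"
  using assms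
proof (induction "card (\<Union>C)" arbitrary: C s B d f rule: less_induct)
  case less
  note C = indep_complexD[OF less.prems(1)] and s = less.prems(2) and B = less.prems(3,4) and cyc = less.prems(5)
  have finU: "finite (\<Union>C)" using C by blast
  have "B \<noteq> {}" using B by auto
  then obtain e where e: "e \<in> B" by blast
  let ?D = "{A \<in> C. e \<notin> A}" and ?L = "{A. e \<notin> A \<and> insert e A \<in> C}"
  have LC: "?L \<subseteq> ?D" using C(3) by blast
  have eU: "e \<in> \<Union>C" using e B by blast
  have smaller: "card (\<Union>?D) < card (\<Union>C)" "card (\<Union>?L) < card (\<Union>C)"
    using LC eU by (auto intro!: psubset_card_mono[OF finU])
  have sD: "cochain_signs ?D s" by (rule cochain_signs_subset[OF s]) auto
  show ?case
  proof (cases "\<forall>A\<in>C. insert e A \<in> C")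
    case True
    then show ?thesis using cone_exact[OF less.prems(1) s _ cyc] by blast
  next
    case False
    then obtain A where A: "A \<in> C" "insert e A \<notin> C" by blast
    \<comment> \<open>A set that does not extend by \<open>e\<close> grows to one at least as large
      as \<open>B\<close> and still avoiding \<open>e\<close>, so the deletion keeps a set of more
      than \<open>d\<close> elements.\<close>
    obtain A' where A': "A' \<in> C" "A \<subseteq> A'" "card B \<le> card A'"
      using indep_complex_extend[OF less.prems(1) A(1) B(1)] by blast
    have "e \<notin> A'"
    proof
      assume "e \<in> A'"
      then have "insert e A \<subseteq> A'" using A' by auto
      then show False using A A' C(3) by blast
    qed
    then have "A' \<in> ?D" "d < card A'" using A' B by auto
    from less.hyps[OF smaller(1) indep_complex_deletion[OF less.prems(1)] sD this, of f]
    obtain g0 where g0: "\<And>\<tau>. \<tau> \<in> ?D \<Longrightarrow> card \<tau> = d \<Longrightarrow> f \<tau> = gcod s g0 \<tau>" using cyc by blast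
    show ?thesis
    proof (cases d)
      case 0
      \<comment> \<open>The only face of cardinality 0 is empty and lies in the deletion, so
        \<open>g0\<close> already serves.\<close>
      have "f \<tau> = gcod s g0 \<tau>" if "\<tau> \<in> C" "card \<tau> = d" for \<tau>
        using g0[of \<tau>] that 0 C(2)[OF that(1)] by auto
      then show ?thesis by blast
    next
      case (Suc d')
      \<comment> \<open>Extended by zero, \<open>g0\<close> becomes a cochain on all of
        \<open>C\<close>; its coboundary on faces without \<open>e\<close> does not change.\<close>
      define g1 where "g1 \<sigma> = (if e \<in> \<sigma> then 0 else g0 \<sigma>)" for \<sigma>
      define f1 where "f1 = (\<lambda>\<tau>. f \<tau> - gcod s g1 \<tau>)"
      have f1D: "f1 \<tau> = 0" if "\<tau> \<in> ?D" "card \<tau> = d" for \<tau>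
      proof -
        have "gcod s g1 \<tau> = gcod s g0 \<tau>" using that by (intro gcod_cong) (auto simp: g1_def)
        then show ?thesis using g0[OF that] by (simp add: f1_def)
      qed
      have f1cyc: "gcod s f1 \<tau> = 0" if "\<tau> \<in> C" "card \<tau> = Suc d" for \<tau>
        unfolding f1_def gcod_diff using cyc[OF that] gcod_gcod[OF s that(1) C(2)[OF that(1)]] by simp
      define s' where "s' v \<tau> = s v (insert e \<tau>)" for v \<tau>
      define h where "h A = f1 (insert e A)" for A
      have s'L: "cochain_signs ?L s'"
        unfolding cochain_signs_def
      proof (intro conjI allI ballI impI)
        show "s' v \<tau> * s' v \<tau> = 1" for v \<tau> using s by (simp add: s'_def cochain_signs_def)
        fix \<tau> v w assume *: "\<tau> \<in> ?L" "v \<in> \<tau>" "w \<in> \<tau>" "v \<noteq> w"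
        then have "s v (insert e \<tau>) * s w (insert e \<tau> - {v}) = - (s w (insert e \<tau>) * s v (insert e \<tau> - {w}))"
          using s unfolding cochain_signs_def by blast
        moreover have "insert e \<tau> - {v} = insert e (\<tau> - {v})" "insert e \<tau> - {w} = insert e (\<tau> - {w})" using * by auto
        ultimately show "s' v \<tau> * s' w (\<tau> - {v}) = - (s' w \<tau> * s' v (\<tau> - {w}))" by (simp add: s'_def)
      qed
      have finL: "finite A" if "A \<in> ?L" for A using that C(2)[of "insert e A"] by auto
      have split: "gcod s k (insert e A) = s e (insert e A) * k A + (\<Sum>v\<in>A. s' v A * k (insert e (A - {v})))"
        if "A \<in> ?L" for A k
      proof -
        have "gcod s k (insert e A) = s e (insert e A) * k (insert e A - {e}) + (\<Sum>v\<in>A. s v (insert e A) * k (insert e A - {v}))"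
          unfolding gcod_def using that finL[OF that] by (subst sum.insert) auto
        also have "insert e A - {e} = A" using that by auto
        also have "(\<Sum>v\<in>A. s v (insert e A) * k (insert e A - {v})) = (\<Sum>v\<in>A. s' v A * k (insert e (A - {v})))"
        proof (intro sum.cong refl)
          fix v assume "v \<in> A"
          then have "insert e A - {v} = insert e (A - {v})" using that by auto
          then show "s v (insert e A) * k (insert e A - {v}) = s' v A * k (insert e (A - {v}))" by (simp add: s'_def)
        qed
        finally show ?thesis .
      qed
      have hcyc: "gcod s' h A = 0" if "A \<in> ?L" "card A = Suc d'" for A
      proof -
        have "card (insert e A) = Suc d" using that finL[OF that(1)] Suc by simp
        \<comment> \<open>The term of the face without \<open>e\<close> drops out since
          \<open>f1\<close> vanishes there, leaving the coboundary of the link.\<close>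
        moreover have "f1 A = 0" by (rule f1D) (use that LC Suc in auto)
        ultimately show ?thesis using split[OF that(1), of f1] f1cyc[of "insert e A"] that
          by (simp add: gcod_def h_def)
      qed
      obtain B' where B': "B' \<in> C" "{e} \<subseteq> B'" "card B \<le> card B'"
        using indep_complex_extend[OF less.prems(1) _ B(1), of "{e}"] C(3)[OF B(1), of "{e}"] e by blast
      have BL: "B' - {e} \<in> ?L" using B' by (auto simp: insert_absorb)
      have "d' < card (B' - {e})" using B' B Suc C(2)[OF B'(1)] by simp
      from less.hyps[OF smaller(2) indep_complex_link[OF less.prems(1)] s'L BL this, of h]
      obtain h' where h': "\<And>A. A \<in> ?L \<Longrightarrow> card A = d' \<Longrightarrow> h A = gcod s' h' A" using hcyc by blast
      define g2 where "g2 \<sigma> = (if e \<in> \<sigma> then h' (\<sigma> - {e}) else 0)" for \<sigma>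
      have "f1 \<tau> = gcod s g2 \<tau>" if \<tau>: "\<tau> \<in> C" "card \<tau> = d" for \<tau>
      proof (cases "e \<in> \<tau>")
        case False
        then have "gcod s g2 \<tau> = 0" by (auto simp: gcod_def g2_def)
        then show ?thesis using f1D \<tau> False by simp
      next
        case True
        define A where "A = \<tau> - {e}"
        have A: "\<tau> = insert e A" "A \<in> ?L" using True \<tau> by (auto simp: A_def insert_absorb)
        have cA: "card A = d'" using \<tau> True Suc C(2)[OF \<tau>(1)] by (simp add: A_def)
        have "gcod s g2 \<tau> = (\<Sum>v\<in>A. s' v A * g2 (insert e (A - {v})))"
          unfolding A(1) split[OF A(2)] using A(2) by (simp add: g2_def)
        also have "\<dots> = gcod s' h' A"
          unfolding gcod_def by (intro sum.cong refl) (use A in \<open>auto simp: g2_def\<close>)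
        also have "\<dots> = f1 \<tau>" using h'[OF A(2) cA] by (simp add: h_def A(1))
        finally show ?thesis by simp
      qed
      then have "f \<tau> = gcod s (\<lambda>\<sigma>. g1 \<sigma> + g2 \<sigma>) \<tau>" if "\<tau> \<in> C" "card \<tau> = d" for \<tau>
        using that unfolding gcod_add f1_def by (metis add.commute diff_add_cancel)
      then show ?thesis by blast
    qed
  qed
qed

subsection \<open>Stanley--Reisner ideals and reduction to squarefree multidegrees\<close>

lemma poly_mapping_sum_singles: "f = (\<Sum>t\<in>keys f. single t (lookup f t))"
  by (rule poly_mapping_eqI) (simp add: lookup_sum lookup_single when_def in_keys_iff)

lemma prod_var: "finite \<sigma> \<Longrightarrow> (\<Prod>v\<in>\<sigma>. var v) = (single (chi \<sigma>) 1 :: ('v, 'k::comm_ring_1) mpoly)"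
proof (induction \<sigma> rule: finite_induct)
  case empty
  then show ?case by (simp add: chi_def)
next
  case (insert v \<sigma>)
  then show ?case by (simp add: chi_insert var_def mult_single ind1_def)
qed

lemma chi_inj: "finite \<sigma> \<Longrightarrow> finite \<tau> \<Longrightarrow> chi \<sigma> = chi \<tau> \<longleftrightarrow> \<sigma> = \<tau>"
  using keys_chi by metis

text \<open>Membership in a monomial ideal is decided monomial by monomial. For the converse each
  monomial of \<open>f\<close> is charged to the generator of its own support, which divides it, so
  the supports distribute \<open>f\<close> among the \<open>g \<sigma>\<close>.\<close>

lemma SR_ideal_iff:
  fixes f :: "('v, 'k::comm_ring_1) mpoly"
  assumes V: "finite V" and down: "\<And>\<sigma> \<tau>. \<sigma> \<in> K \<Longrightarrow> \<tau> \<subseteq> \<sigma> \<Longrightarrow> \<tau> \<in> K"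
  shows "f \<in> SR_ideal V K \<longleftrightarrow> f \<in> polys V \<and> (\<forall>t\<in>keys f. keys t \<notin> K)"
proof
  let ?A = "{\<sigma>. \<sigma> \<subseteq> V \<and> \<sigma> \<notin> K}"
  have fin: "finite \<sigma>" if "\<sigma> \<in> ?A" for \<sigma> using that V finite_subset by blast
  have finA: "finite ?A" using V by (auto intro: finite_subset[of _ "Pow V"])
  assume "f \<in> SR_ideal V K"
  then obtain g where g: "\<And>\<sigma>. g \<sigma> \<in> polys V" "f = (\<Sum>\<sigma>\<in>?A. g \<sigma> * (\<Prod>v\<in>\<sigma>. var v))"
    unfolding SR_ideal_def by blast
  have f: "f = (\<Sum>\<sigma>\<in>?A. g \<sigma> * single (chi \<sigma>) 1)"
    unfolding g(2) by (intro sum.cong refl) (simp add: prod_var fin)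
  show "f \<in> polys V \<and> (\<forall>t\<in>keys f. keys t \<notin> K)"
  proof
    show "f \<in> polys V"
      unfolding f by (intro polys_sum polys_mult g polys_single) (auto simp: keys_chi fin)
    show "\<forall>t\<in>keys f. keys t \<notin> K"
    proof
      fix t assume "t \<in> keys f"
      then obtain \<sigma> where \<sigma>: "\<sigma> \<in> ?A" "t \<in> keys (g \<sigma> * single (chi \<sigma>) 1)"
        using keys_sum[of "\<lambda>\<sigma>. g \<sigma> * single (chi \<sigma>) 1" ?A] unfolding f by blast
      then obtain s where "t = s + chi \<sigma>"
        using keys_mult[of "g \<sigma>" "single (chi \<sigma>) (1::'k)"] by (auto split: if_splits)
      then have "\<sigma> \<subseteq> keys t" using fin[OF \<sigma>(1)] by (simp add: keys_add_nat keys_chi)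
      then show "keys t \<notin> K" using \<sigma>(1) down by blast
    qed
  qed
next
  let ?A = "{\<sigma>. \<sigma> \<subseteq> V \<and> \<sigma> \<notin> K}"
  have fin: "finite \<sigma>" if "\<sigma> \<in> ?A" for \<sigma> using that V finite_subset by blast
  have finA: "finite ?A" using V by (auto intro: finite_subset[of _ "Pow V"])
  assume f: "f \<in> polys V \<and> (\<forall>t\<in>keys f. keys t \<notin> K)"
  define g where "g \<sigma> = (\<Sum>t\<in>{t \<in> keys f. keys t = \<sigma>}. single (t - chi \<sigma>) (lookup f t))" for \<sigma>
  have "g \<sigma> \<in> polys V" for \<sigma>
    unfolding g_def
  proof (intro polys_sum polys_single)
    fix t assume "t \<in> {t \<in> keys f. keys t = \<sigma>}"
    then have "keys t \<subseteq> V" using f by (auto simp: polys_def)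
    then show "keys (t - chi \<sigma>) \<subseteq> V" by (auto simp: in_keys_iff lookup_minus)
  qed
  moreover have "f = (\<Sum>\<sigma>\<in>?A. g \<sigma> * (\<Prod>v\<in>\<sigma>. var v))"
  proof -
    have "g \<sigma> * (\<Prod>v\<in>\<sigma>. var v) = (\<Sum>t\<in>{t \<in> keys f. keys t = \<sigma>}. single t (lookup f t))" if "\<sigma> \<in> ?A" for \<sigma>
    proof -
      have "t - chi \<sigma> + chi \<sigma> = t" if "keys t = \<sigma>" for t
        using that by (intro poly_mapping_eqI)
          (auto simp: lookup_add lookup_minus lookup_chi fin[OF \<open>\<sigma> \<in> ?A\<close>] in_keys_iff)
      then show ?thesis
        unfolding g_def prod_var[OF fin[OF \<open>\<sigma> \<in> ?A\<close>]] sum_distrib_right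
        by (intro sum.cong refl) (auto simp: mult_single)
    qed
    then have "(\<Sum>\<sigma>\<in>?A. g \<sigma> * (\<Prod>v\<in>\<sigma>. var v)) = (\<Sum>\<sigma>\<in>?A. \<Sum>t\<in>{t \<in> keys f. keys t = \<sigma>}. single t (lookup f t))"
      by (intro sum.cong refl)
    also have "\<dots> = (\<Sum>t\<in>keys f. single t (lookup f t))"
      by (rule sum.group) (use f finA in \<open>auto simp: polys_def\<close>)
    finally show ?thesis using poly_mapping_sum_singles[of f] by simp
  qed
  ultimately show "f \<in> SR_ideal V K" unfolding SR_ideal_def by blast
qed

locale signed_complex = signs V sg for V :: "'v set" and sg :: "'v \<Rightarrow> 'v set \<Rightarrow> 'k::idom" +
  fixes C :: "'v set set"
  assumes down: "\<sigma> \<in> C \<Longrightarrow> \<tau> \<subseteq> \<sigma> \<Longrightarrow> \<tau> \<in> C"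
begin

definition Igr :: "nat \<Rightarrow> ('v, 'k) mpoly set" where
  "Igr e = {p \<in> pgr V e. \<forall>t\<in>keys p. keys t \<notin> C}"

lemma Igr_eq: "Igr e = pgr V e \<inter> SR_ideal V C"
  using SR_ideal_iff[OF fin_V, of C] down by (auto simp: Igr_def pgr_def)

lemma Igr_subset: "Igr e \<subseteq> pgr V e"
  by (auto simp: Igr_def)

lemma gsub_Igr: "K.gsub Igr"
  unfolding K.gsub_def
proof (intro conjI allI ballI)
  fix e
  show "submod scale (Igr e)"
  proof (rule submodI)
    show "0 \<in> Igr e" using submodD(1)[OF submod_pgr] by (simp add: Igr_def)
    show "x + y \<in> Igr e" if "x \<in> Igr e" "y \<in> Igr e" for x y
      using that submodD(2)[OF submod_pgr] keys_add[of x y] unfolding Igr_def by blast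
    show "scale c x \<in> Igr e" if "x \<in> Igr e" for c x
      using that submodD(3)[OF submod_pgr] keys_scale_subset[of c x] unfolding Igr_def by blast
  qed
  fix v x assume v: "v \<in> V" and x: "x \<in> Igr e"
  have "keys t \<notin> C" if "t \<in> keys (var v * x)" for t
  proof -
    from keys_var_mult[OF that] have "lookup t v \<ge> 1" "t - ind1 v \<in> keys x" by auto
    moreover from this have "keys (t - ind1 v) \<subseteq> keys t" by (auto simp: in_keys_iff lookup_minus)
    ultimately show ?thesis using x down unfolding Igr_def by blast
  qed
  then show "var v * x \<in> Igr (e + 2)" using pgr_var_mult[OF v, of x e] x by (simp add: Igr_def)
qed

definition face :: "'v set \<Rightarrow> nat \<Rightarrow> 'v set set" where
  "face J d = {\<tau>. \<tau> \<subseteq> J \<and> \<tau> \<in> C \<and> card \<tau> = d}"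

text \<open>Faces with one element less than \<open>d\<close>. Writing \<open>face J (d - 1)\<close>
  instead would be wrong for \<open>d = 0\<close>, where there are none.\<close>

definition pface :: "'v set \<Rightarrow> nat \<Rightarrow> 'v set set" where
  "pface J d = {\<tau>. \<tau> \<subseteq> J \<and> \<tau> \<in> C \<and> Suc (card \<tau>) = d}"

text \<open>In the squarefree multidegree \<open>J\<close> the monomial \<open>chi \<tau>\<close> is
  paired with the exterior element \<open>J - \<tau>\<close>; hence the signs of complements, which
  make this the Koszul differential.\<close>

definition cod :: "'v set \<Rightarrow> ('v set \<Rightarrow> 'k) \<Rightarrow> 'v set \<Rightarrow> 'k" where
  "cod J f \<tau> = (\<Sum>v\<in>\<tau>. sg v (J - \<tau>) * f (\<tau> - {v}))"

definition CZ :: "'v set \<Rightarrow> nat \<Rightarrow> ('v set \<Rightarrow> 'k) set" where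
  "CZ J d = {f \<in> supported_on (face J d). \<forall>\<tau>\<in>face J (Suc d). cod J f \<tau> = 0}"

definition CB :: "'v set \<Rightarrow> nat \<Rightarrow> ('v set \<Rightarrow> 'k) set" where
  "CB J d = {\<lambda>\<tau>. if \<tau> \<in> face J d then cod J g \<tau> else 0 | g. g \<in> supported_on (pface J d)}"

text \<open>Multiplying by a vertex moves it from the exterior factor to the monomial, that is, it
  enlarges the face. So the Koszul boundary in multidegree \<open>J\<close> is the coboundary of the
  full subcomplex on \<open>J\<close>.\<close>

lemma lookup_kd_squarefree:
  assumes J: "J \<subseteq> V" "\<tau> \<subseteq> J"
  shows "lookup (K.kd c (J - \<tau>)) (chi \<tau>) =
    (\<Sum>v\<in>\<tau>. sg v (J - \<tau>) * lookup (c (J - (\<tau> - {v}))) (chi (\<tau> - {v})))"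
proof -
  have fin: "finite \<tau>" by (rule finite_subset[OF _ fin_V]) (use J in blast)
  have "lookup (K.kd c (J - \<tau>)) (chi \<tau>) = (\<Sum>v\<in>V - (J - \<tau>). sg v (J - \<tau>) *
      (if lookup (chi \<tau>) v \<ge> 1 then lookup (c (insert v (J - \<tau>))) (chi \<tau> - ind1 v) else 0))"
    by (simp add: lookup_kd mkd_def)
  also have "\<dots> = (\<Sum>v\<in>\<tau>. sg v (J - \<tau>) * lookup (c (J - (\<tau> - {v}))) (chi (\<tau> - {v})))"
  proof (rule sum.mono_neutral_cong_right)
    fix v assume v: "v \<in> \<tau>"
    have "chi \<tau> - ind1 v = chi (\<tau> - {v})"
      using fin v by (intro poly_mapping_eqI) (auto simp: lookup_minus lookup_chi lookup_ind1)
    moreover have "insert v (J - \<tau>) = J - (\<tau> - {v})" using v J by auto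
    ultimately show "sg v (J - \<tau>) * (if lookup (chi \<tau>) v \<ge> 1 then lookup (c (insert v (J - \<tau>))) (chi \<tau> - ind1 v) else 0)
      = sg v (J - \<tau>) * lookup (c (J - (\<tau> - {v}))) (chi (\<tau> - {v}))"
      using fin v by (simp add: lookup_chi)
  qed (use J fin_V fin in \<open>auto simp: lookup_chi\<close>)
  finally show ?thesis .
qed

text \<open>Assembles cochains on all vertex sets into one Koszul chain: the monomial
  \<open>chi \<tau>\<close> at \<open>\<sigma>\<close> carries the cochain of
  \<open>\<sigma> \<union> \<tau>\<close>. It lifts cocycles as well as the cochains that bound
  them.\<close>

lemma kc_lift:
  assumes f: "\<And>J \<tau>. f J \<tau> \<noteq> 0 \<Longrightarrow> \<tau> \<in> C \<and> card \<tau> = d" and j: "j = a + d"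
  shows "\<exists>b. b \<in> K.Kc a (2 * j) (pgr V) \<and>
    (\<forall>\<sigma> \<tau>. \<sigma> \<subseteq> V \<longrightarrow> \<tau> \<subseteq> V - \<sigma> \<longrightarrow> card \<sigma> = a \<longrightarrow> lookup (b \<sigma>) (chi \<tau>) = f (\<sigma> \<union> \<tau>) \<tau>) \<and>
    (\<forall>\<sigma> t. t \<in> keys (b \<sigma>) \<longrightarrow> (\<exists>\<tau>. t = chi \<tau> \<and> \<tau> \<subseteq> V - \<sigma> \<and> \<tau> \<in> C))"
proof -
  define b where "b \<sigma> = (if \<sigma> \<subseteq> V \<and> card \<sigma> = a then \<Sum>\<tau>\<in>Pow (V - \<sigma>). single (chi \<tau>) (f (\<sigma> \<union> \<tau>) \<tau>) else 0)" for \<sigma>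
  have fin: "finite \<tau>" if "\<tau> \<subseteq> V - \<sigma>" for \<tau> \<sigma>
    by (rule finite_subset[OF _ fin_V]) (use that in blast)
  have lk: "lookup (b \<sigma>) (chi \<tau>) = f (\<sigma> \<union> \<tau>) \<tau>" if "\<sigma> \<subseteq> V" "\<tau> \<subseteq> V - \<sigma>" "card \<sigma> = a" for \<sigma> \<tau>
  proof -
    have "lookup (b \<sigma>) (chi \<tau>) = (\<Sum>\<tau>'\<in>Pow (V - \<sigma>). if \<tau>' = \<tau> then f (\<sigma> \<union> \<tau>') \<tau>' else 0)"
      using that fin by (auto simp: b_def lookup_sum lookup_single when_def chi_inj intro!: sum.cong)
    then show ?thesis using that fin_V by simp
  qed
  have ks: "\<exists>\<tau>. t = chi \<tau> \<and> \<tau> \<subseteq> V - \<sigma> \<and> \<tau> \<in> C \<and> card \<tau> = d \<and> \<sigma> \<subseteq> V \<and> card \<sigma> = a" if "t \<in> keys (b \<sigma>)" for t \<sigma>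
  proof -
    have \<sigma>: "\<sigma> \<subseteq> V \<and> card \<sigma> = a" using that unfolding b_def by (auto split: if_splits)
    then have "t \<in> keys (\<Sum>\<tau>\<in>Pow (V - \<sigma>). single (chi \<tau>) (f (\<sigma> \<union> \<tau>) \<tau>))" using that by (simp add: b_def)
    then obtain \<tau> where "\<tau> \<in> Pow (V - \<sigma>)" "t \<in> keys (single (chi \<tau>) (f (\<sigma> \<union> \<tau>) \<tau>))"
      using keys_sum[of "\<lambda>\<tau>. single (chi \<tau>) (f (\<sigma> \<union> \<tau>) \<tau>)" "Pow (V - \<sigma>)"] by blast
    then show ?thesis using f \<sigma> by (auto split: if_splits)
  qed
  have "b \<in> K.Kc a (2 * j) (pgr V)"
    unfolding K.Kc_def mem_Collect_eq
  proof (intro allI conjI)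
    fix \<sigma>
    have "keys t \<subseteq> V \<and> mon_degree t = 2 * j - 2 * a" if "t \<in> keys (b \<sigma>)" for t
    proof -
      from ks[OF that] obtain \<tau> where "t = chi \<tau>" "\<tau> \<subseteq> V - \<sigma>" "card \<tau> = d" by blast
      then show ?thesis using fin[of \<tau> \<sigma>] j by (auto simp: keys_chi mon_degree_chi)
    qed
    then show "b \<sigma> \<in> pgr V (2 * j - 2 * a)" by (simp add: pgr_def polys_def)
    show "b \<sigma> \<noteq> 0 \<longrightarrow> \<sigma> \<subseteq> V \<and> card \<sigma> = a \<and> 2 * a \<le> 2 * j"
      using j by (auto simp: b_def)
  qed
  then show ?thesis
  proof (intro exI[of _ b] conjI allI impI)
    show "lookup (b \<sigma>) (chi \<tau>) = f (\<sigma> \<union> \<tau>) \<tau>" if "\<sigma> \<subseteq> V" "\<tau> \<subseteq> V - \<sigma>" "card \<sigma> = a" for \<sigma> \<tau>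
      by (rule lk[OF that])
    show "\<exists>\<tau>. t = chi \<tau> \<and> \<tau> \<subseteq> V - \<sigma> \<and> \<tau> \<in> C" if "t \<in> keys (b \<sigma>)" for \<sigma> t
      using ks[OF that] by metis
  qed
qed

lemma face_subset: "J \<subseteq> V \<Longrightarrow> face J d \<subseteq> Pow V"
  by (auto simp: face_def)

lemma cod_cong:
  assumes "\<And>v. v \<in> \<tau> \<Longrightarrow> f (\<tau> - {v}) = g (\<tau> - {v})"
  shows "cod J f \<tau> = cod J g \<tau>"
  unfolding cod_def by (intro sum.cong refl) (simp add: assms)

lemma cod_add: "cod J (f + g) \<tau> = cod J f \<tau> + cod J g \<tau>"
  by (simp add: cod_def distrib_left sum.distrib)

lemma cod_fscale: "cod J (fscale c f) \<tau> = c * cod J f \<tau>"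
  by (simp add: cod_def fscale_apply sum_distrib_left mult.left_commute)

lemma cod_zero: "cod J 0 \<tau> = 0"
  by (simp add: cod_def)

lemma submod_CZ: "submod fscale (CZ J d)"
  by (rule submodI)
    (use submodD[OF submod_supported_on] in \<open>auto simp: CZ_def cod_add cod_zero cod_fscale\<close>)

lemma submod_CB: "submod fscale (CB J d)"
proof (rule submodI)
  note sup = submodD[OF submod_supported_on[of "pface J d"]]
  have "0 = (\<lambda>\<tau>. if \<tau> \<in> face J d then cod J 0 \<tau> else 0)" by (auto simp: cod_zero)
  then show "0 \<in> CB J d" using sup(1) unfolding CB_def by blast
  show "x + y \<in> CB J d" if xy: "x \<in> CB J d" "y \<in> CB J d" for x y
  proof -
    obtain g h where gh: "g \<in> supported_on (pface J d)" "h \<in> supported_on (pface J d)"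
      "x = (\<lambda>\<tau>. if \<tau> \<in> face J d then cod J g \<tau> else 0)" "y = (\<lambda>\<tau>. if \<tau> \<in> face J d then cod J h \<tau> else 0)"
      using xy unfolding CB_def by blast
    have "x + y = (\<lambda>\<tau>. if \<tau> \<in> face J d then cod J (g + h) \<tau> else 0)"
      unfolding gh by (rule ext) (simp add: cod_add)
    then show ?thesis using sup(2)[OF gh(1,2)] unfolding CB_def by blast
  qed
  show "fscale c x \<in> CB J d" if x: "x \<in> CB J d" for c x
  proof -
    obtain g where g: "g \<in> supported_on (pface J d)" "x = (\<lambda>\<tau>. if \<tau> \<in> face J d then cod J g \<tau> else 0)"
      using x unfolding CB_def by blast
    have "fscale c x = (\<lambda>\<tau>. if \<tau> \<in> face J d then cod J (fscale c g) \<tau> else 0)"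
      unfolding g by (rule ext) (simp add: cod_fscale fscale_apply)
    then show ?thesis using sup(3)[OF g(1)] unfolding CB_def by blast
  qed
qed

lemma cod_eq_gcod: "cod J f \<tau> = gcod (\<lambda>v \<tau>. sg v (J - \<tau>)) f \<tau>"
  by (simp add: cod_def gcod_def)

lemma cochain_signs_sg:
  assumes "J \<subseteq> V"
  shows "cochain_signs {\<tau> \<in> C. \<tau> \<subseteq> J} (\<lambda>v \<tau>. sg v (J - \<tau>))"
  unfolding cochain_signs_def
proof (intro conjI allI ballI impI)
  show "sg v (J - \<tau>) * sg v (J - \<tau>) = 1" for v \<tau> by (rule sg_sq)
  fix \<tau> v w assume *: "\<tau> \<in> {\<tau> \<in> C. \<tau> \<subseteq> J}" "v \<in> \<tau>" "w \<in> \<tau>" "v \<noteq> w"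
  have "J - (\<tau> - {v}) = insert v (J - \<tau>)" "J - (\<tau> - {w}) = insert w (J - \<tau>)" using * by auto
  moreover have "sg v (J - \<tau>) * sg w (insert v (J - \<tau>)) = - (sg w (J - \<tau>) * sg v (insert w (J - \<tau>)))"
    by (rule sg_anti) (use * assms in auto)
  ultimately show "sg v (J - \<tau>) * sg w (J - (\<tau> - {v})) = - (sg w (J - \<tau>) * sg v (J - (\<tau> - {w})))"
    by simp
qed

lemma cod_restrict:
  assumes "\<tau> \<in> face J (Suc d)" "finite \<tau>"
  shows "cod J (\<lambda>\<tau>. if \<tau> \<in> face J d then f \<tau> else 0) \<tau> = cod J f \<tau>"
proof (rule cod_cong)
  fix v assume "v \<in> \<tau>"
  then have "\<tau> - {v} \<in> face J d" using assms down[of \<tau> "\<tau> - {v}"] by (auto simp: face_def)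
  then show "(if \<tau> - {v} \<in> face J d then f (\<tau> - {v}) else 0) = f (\<tau> - {v})" by simp
qed

lemma CB_subset_CZ:
  assumes "J \<subseteq> V"
  shows "CB J d \<subseteq> CZ J d"
proof
  fix f assume "f \<in> CB J d"
  then obtain g where f: "f = (\<lambda>\<tau>. if \<tau> \<in> face J d then cod J g \<tau> else 0)" unfolding CB_def by blast
  have "cod J f \<tau> = 0" if \<tau>: "\<tau> \<in> face J (Suc d)" for \<tau>
  proof -
    have fin: "finite \<tau>" by (rule finite_subset[OF _ fin_V]) (use \<tau> assms in \<open>auto simp: face_def\<close>)
    have "cod J f \<tau> = cod J (cod J g) \<tau>" unfolding f by (rule cod_restrict[OF \<tau> fin])
    also have "\<dots> = 0"
      unfolding cod_eq_gcod by (rule gcod_gcod[OF cochain_signs_sg[OF assms] _ fin]) (use \<tau> in \<open>auto simp: face_def\<close>)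
    finally show ?thesis .
  qed
  then show "f \<in> CZ J d" by (auto simp: CZ_def f supported_on_def)
qed

definition sqfree_coeffs :: "nat \<Rightarrow> nat \<Rightarrow> ('v set \<Rightarrow> ('v, 'k) mpoly) \<Rightarrow> 'v set \<times> 'v set \<Rightarrow> 'k" where
  "sqfree_coeffs j d c = (\<lambda>(J, \<tau>). if J \<subseteq> V \<and> card J = j \<and> \<tau> \<in> face J d then lookup (c (J - \<tau>)) (chi \<tau>) else 0)"

lemma Igr_lookup: "p \<in> Igr e \<Longrightarrow> keys t \<in> C \<Longrightarrow> lookup p t = 0"
  by (auto simp: Igr_def in_keys_iff)

text \<open>Hochster's formula: in the squarefree multidegree \<open>J\<close> the Koszul complex is the cochain complex of
  the full subcomplex on \<open>J\<close>, while in the other multidegrees the contracting homotopy along a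
  variable of exponent at least 2 preserves the Stanley--Reisner ideal.\<close>

lemma kh_eq_cochain_rank:
  assumes j: "j = a + d"
  shows "K.kh a (2 * j) (pgr V) Igr = (\<Sum>J | J \<subseteq> V \<and> card J = j. mrank fscale (CZ J d) (CB J d))"
proof -
  let ?I = "{J. J \<subseteq> V \<and> card J = j}"
  have finJ: "finite J" if "J \<subseteq> V" for J by (rule finite_subset[OF that fin_V])
  have lkI: "lookup (c \<sigma>) (chi \<tau>) = 0" if "c \<in> K.Kc a e Igr" "\<tau> \<in> C" "\<tau> \<subseteq> V" for a e c \<sigma> \<tau>
  proof -
    have "c \<sigma> \<in> Igr (e - 2 * a)" using that unfolding K.Kc_def by blast
    then show ?thesis using that finJ Igr_lookup by (simp add: keys_chi)
  qed
  have "K.kh a (2 * j) (pgr V) Igr = mrank fscale (fiberwise ?I (\<lambda>J. CZ J d)) (fiberwise ?I (\<lambda>J. CB J d))"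
    unfolding K.kh_def
  proof (rule quot_iso_rel_mrank[OF K.kmodule_cscl kmodule_fscale, where \<rho> = "\<lambda>c f. f = sqfree_coeffs j d c"])
    show "quot_iso_rel K.cscl fscale (K.Zk a (2 * j) (pgr V) Igr) (K.Bk a (2 * j) (pgr V) Igr)
        (fiberwise ?I (\<lambda>J. CZ J d)) (fiberwise ?I (\<lambda>J. CB J d)) (\<lambda>c f. f = sqfree_coeffs j d c)"
      unfolding quot_iso_rel_def
    proof (intro conjI allI impI ballI)
      show "submod K.cscl (K.Zk a (2 * j) (pgr V) Igr)" "0 \<in> K.Bk a (2 * j) (pgr V) Igr"
        by (intro K.submod_Zk K.zero_Bk gsub_pgr gsub_Igr)+
      show "submod fscale (fiberwise ?I (\<lambda>J. CZ J d))" by (intro submod_fiberwise submod_CZ)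
      show "0 \<in> fiberwise ?I (\<lambda>J. CB J d)" by (intro submodD(1)[OF submod_fiberwise] submod_CB)
      show "0 = sqfree_coeffs j d 0" by (rule ext) (auto simp: sqfree_coeffs_def)
      show "y + y' = sqfree_coeffs j d (x + x')" if "y = sqfree_coeffs j d x" "y' = sqfree_coeffs j d x'" for x y x' y'
        unfolding that by (rule ext) (auto simp: sqfree_coeffs_def lookup_add)
      show "fscale c y = sqfree_coeffs j d (K.cscl c x)" if "y = sqfree_coeffs j d x" for c x y
        unfolding that by (rule ext) (auto simp: sqfree_coeffs_def lookup_scale K.cscl_def fscale_apply)
      show "\<exists>y\<in>fiberwise ?I (\<lambda>J. CZ J d). y = sqfree_coeffs j d c" if c: "c \<in> K.Zk a (2 * j) (pgr V) Igr" for c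
      proof -
        have "(\<lambda>\<tau>. sqfree_coeffs j d c (J, \<tau>)) \<in> CZ J d" if J: "J \<in> ?I" for J
          unfolding CZ_def mem_Collect_eq
        proof (intro conjI ballI)
          show "(\<lambda>\<tau>. sqfree_coeffs j d c (J, \<tau>)) \<in> supported_on (face J d)" by (auto simp: supported_on_def sqfree_coeffs_def)
          fix \<tau> assume \<tau>: "\<tau> \<in> face J (Suc d)"
          have "cod J (\<lambda>\<tau>. sqfree_coeffs j d c (J, \<tau>)) \<tau> =
              (\<Sum>v\<in>\<tau>. sg v (J - \<tau>) * lookup (c (J - (\<tau> - {v}))) (chi (\<tau> - {v})))"
            unfolding cod_def
          proof (intro sum.cong refl)
            fix v assume "v \<in> \<tau>"
            then have "\<tau> - {v} \<in> face J d" using \<tau> down[of \<tau> "\<tau> - {v}"] J finJ finite_subset[of \<tau> J]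
              by (auto simp: face_def)
            then show "sg v (J - \<tau>) * sqfree_coeffs j d c (J, \<tau> - {v}) = sg v (J - \<tau>) * lookup (c (J - (\<tau> - {v}))) (chi (\<tau> - {v}))"
              using J by (simp add: sqfree_coeffs_def)
          qed
          also have "\<dots> = lookup (K.kd c (J - \<tau>)) (chi \<tau>)"
            using J \<tau> by (intro lookup_kd_squarefree[symmetric]) (auto simp: face_def)
          also have "\<dots> = 0"
            by (rule lkI[of _ "a - 1" "2 * j"]) (use c \<tau> J in \<open>auto simp: K.Zk_def face_def\<close>)
          finally show "cod J (\<lambda>\<tau>. sqfree_coeffs j d c (J, \<tau>)) \<tau> = 0" .
        qed
        then show ?thesis by (auto simp: fiberwise_def sqfree_coeffs_def)
      qed
      show "\<exists>c\<in>K.Zk a (2 * j) (pgr V) Igr. f = sqfree_coeffs j d c" if f: "f \<in> fiberwise ?I (\<lambda>J. CZ J d)" for f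
      proof -
        have fZ: "(\<lambda>\<tau>. f (J, \<tau>)) \<in> CZ J d" if "J \<in> ?I" for J using f that unfolding fiberwise_def by blast
        have f0: "f (J, \<tau>) = 0" if "J \<notin> ?I" for J \<tau> using f that unfolding fiberwise_def by blast
        have fs: "J \<in> ?I \<and> \<tau> \<in> face J d" if "f (J, \<tau>) \<noteq> 0" for J \<tau>
          using that fZ[of J] f0[of J \<tau>] unfolding CZ_def supported_on_def by blast
        have fs': "\<tau> \<in> C \<and> card \<tau> = d" if "f (J, \<tau>) \<noteq> 0" for J \<tau>
          using fs[OF that] by (simp add: face_def)
        obtain c where c0: "c \<in> K.Kc a (2 * j) (pgr V) \<and>
          (\<forall>\<sigma> \<tau>. \<sigma> \<subseteq> V \<longrightarrow> \<tau> \<subseteq> V - \<sigma> \<longrightarrow> card \<sigma> = a \<longrightarrow> lookup (c \<sigma>) (chi \<tau>) = f (\<sigma> \<union> \<tau>, \<tau>)) \<and>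
          (\<forall>\<sigma> t. t \<in> keys (c \<sigma>) \<longrightarrow> (\<exists>\<tau>. t = chi \<tau> \<and> \<tau> \<subseteq> V - \<sigma> \<and> \<tau> \<in> C))"
          using kc_lift[of "\<lambda>J \<tau>. f (J, \<tau>)", OF fs' j] by (rule exE)
        note c = c0[THEN conjunct1] c0[THEN conjunct2, THEN conjunct1, rule_format]
          c0[THEN conjunct2, THEN conjunct2, rule_format]
        have lk: "lookup (c (J - \<tau>)) (chi \<tau>) = f (J, \<tau>)" if "J \<in> ?I" "\<tau> \<subseteq> J" "card \<tau> = d" for J \<tau>
        proof -
          have "card (J - \<tau>) = a" using that finJ finite_subset[of \<tau> J] j by (simp add: card_Diff_subset)
          moreover have "J - \<tau> \<union> \<tau> = J" using that by auto
          ultimately show ?thesis using c(2)[of "J - \<tau>" \<tau>] that by auto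
        qed
        have eq: "f = sqfree_coeffs j d c"
        proof (rule ext, clarify)
          fix J \<tau>
          show "f (J, \<tau>) = sqfree_coeffs j d c (J, \<tau>)"
          proof (cases "J \<in> ?I \<and> \<tau> \<in> face J d")
            case True
            then show ?thesis using lk[of J \<tau>] by (simp add: sqfree_coeffs_def face_def)
          next
            case False
            then show ?thesis using fs[of J \<tau>] by (auto simp: sqfree_coeffs_def)
          qed
        qed
        \<comment> \<open>Outside the ideal the boundary vanishes: a nonzero coefficient forces
          \<open>t\<close> to be squarefree and disjoint from \<open>\<sigma>\<close>, and then it
          is a value of the coboundary of the cocycle on \<open>J\<close>.\<close>
        have kd0: "lookup (K.kd c \<sigma>) t = 0" if \<sigma>: "\<sigma> \<subseteq> V" "Suc (card \<sigma>) = a" and t: "keys t \<in> C" "keys t \<subseteq> V" for \<sigma> t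
        proof (rule ccontr)
          assume ne: "lookup (K.kd c \<sigma>) t \<noteq> 0"
          then obtain v where v0: "v \<in> V - \<sigma>"
            "sg v \<sigma> * (if lookup t v \<ge> 1 then lookup (c (insert v \<sigma>)) (t - ind1 v) else 0) \<noteq> 0"
            unfolding lookup_kd mkd_def by (rule sum.not_neutral_contains_not_neutral)
          then have v: "v \<in> V - \<sigma>" "lookup t v \<ge> 1" "lookup (c (insert v \<sigma>)) (t - ind1 v) \<noteq> 0"
            by (auto split: if_splits)
          then obtain \<tau> where \<tau>: "t - ind1 v = chi \<tau>" "\<tau> \<subseteq> V - insert v \<sigma>" "\<tau> \<in> C"
            using c(3)[of "t - ind1 v" "insert v \<sigma>"] by (auto simp: in_keys_iff)
          have fin\<tau>: "finite \<tau>" using \<tau> finJ by blast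
          have "t = ind1 v + chi \<tau>" using \<tau>(1) ind1_decomp[OF v(2)] by simp
          also have "\<dots> = chi (insert v \<tau>)" using \<tau> fin\<tau> by (subst chi_insert) auto
          finally have t\<tau>: "t = chi (insert v \<tau>)" .
          define \<tau>' where "\<tau>' = insert v \<tau>"
          define J where "J = \<sigma> \<union> \<tau>'"
          have k: "keys t = \<tau>'" using t\<tau> fin\<tau> by (simp add: keys_chi \<tau>'_def)
          have J: "J \<subseteq> V" "\<tau>' \<subseteq> J" "\<sigma> = J - \<tau>'" using \<sigma> \<tau> v by (auto simp: J_def \<tau>'_def)
          have "c (insert v \<sigma>) \<noteq> 0" using v(3) by auto
          have "c (insert v \<sigma>) \<in> pgr V (2 * j - 2 * a)" using c(1) unfolding K.Kc_def by blast
          then have "mon_degree (t - ind1 v) = 2 * d" using v(3) j by (auto simp: pgr_def in_keys_iff)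
          then have card\<tau>: "card \<tau> = d" using \<tau>(1) fin\<tau> by (simp add: mon_degree_chi)
          have v\<tau>: "v \<notin> \<tau>" using \<tau>(2) by blast
          then have card\<tau>': "card \<tau>' = Suc d" using card\<tau> fin\<tau> by (simp add: \<tau>'_def)
          have "card J = j" using \<sigma> \<tau> v card\<tau>' j fin\<tau> finJ[OF \<sigma>(1)] unfolding J_def
            by (subst card_Un_disjoint) (auto simp: \<tau>'_def)
          then have JI: "J \<in> ?I" using J by simp
          have \<tau>'f: "\<tau>' \<in> face J (Suc d)" using J k t card\<tau>' by (simp add: face_def)
          have "lookup (K.kd c \<sigma>) t = (\<Sum>v\<in>\<tau>'. sg v (J - \<tau>') * lookup (c (J - (\<tau>' - {v}))) (chi (\<tau>' - {v})))"
            using lookup_kd_squarefree[OF J(1,2), of c] J(3) t\<tau> by (simp add: \<tau>'_def)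
          also have "\<dots> = cod J (\<lambda>\<tau>. f (J, \<tau>)) \<tau>'"
            unfolding cod_def
            by (intro sum.cong refl, subst lk[OF JI]) (use J card\<tau>' in \<open>auto simp: \<tau>'_def fin\<tau>\<close>)
          also have "\<dots> = 0" using fZ[OF JI] \<tau>'f by (auto simp: CZ_def)
          finally show False using ne by simp
        qed
        have "K.kd c \<in> K.Kc (a - 1) (2 * j) Igr"
        proof (cases a)
          case 0
          then have "K.kd c = 0" using c(1) K.kd_Kc_0 by simp
          then show ?thesis using submodD(1)[OF K.submod_Kc[OF gsub_Igr]] by simp
        next
          case (Suc a')
          have kc: "K.kd c \<in> K.Kc (a - 1) (2 * j) (pgr V)" by (rule K.kd_Kc'[OF gsub_pgr c(1)])
          have "K.kd c \<sigma> \<in> Igr (2 * j - 2 * (a - 1))" for \<sigma>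
          proof -
            have p: "K.kd c \<sigma> \<in> pgr V (2 * j - 2 * (a - 1))" using kc unfolding K.Kc_def by blast
            have "keys t \<notin> C" if "t \<in> keys (K.kd c \<sigma>)" for t
            proof
              assume "keys t \<in> C"
              have "K.kd c \<sigma> \<noteq> 0" using that by auto
              then have "\<sigma> \<subseteq> V" "card \<sigma> = a - 1" using kc unfolding K.Kc_def by blast+
              moreover have "keys t \<subseteq> V" using p that by (auto simp: pgr_def polys_def)
              ultimately show False using kd0[of \<sigma> t] \<open>keys t \<in> C\<close> that Suc by (simp add: in_keys_iff)
            qed
            then show ?thesis using p by (simp add: Igr_def)
          qed
          then show ?thesis using kc unfolding K.Kc_def by blast
        qed
        then show ?thesis using c(1) eq unfolding K.Zk_def by blast
      qed
      show "c \<in> K.Bk a (2 * j) (pgr V) Igr \<longleftrightarrow> f \<in> fiberwise ?I (\<lambda>J. CB J d)"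
        if c: "c \<in> K.Zk a (2 * j) (pgr V) Igr" and f: "f = sqfree_coeffs j d c" for c f
      proof
        assume "c \<in> K.Bk a (2 * j) (pgr V) Igr"
        then obtain b n where b: "b \<in> K.Kc (Suc a) (2 * j) (pgr V)" "n \<in> K.Kc a (2 * j) Igr" "c = K.kd b + n"
          unfolding K.Bk_def by blast
        have "(\<lambda>\<tau>. f (J, \<tau>)) \<in> CB J d" if J: "J \<in> ?I" for J
        proof -
          define g where "g \<tau> = (if \<tau> \<in> pface J d then lookup (b (J - \<tau>)) (chi \<tau>) else 0)" for \<tau>
          have "f (J, \<tau>) = (if \<tau> \<in> face J d then cod J g \<tau> else 0)" for \<tau>
          proof (cases "\<tau> \<in> face J d")
            case True
            then have \<tau>: "\<tau> \<subseteq> J" "\<tau> \<in> C" "card \<tau> = d" "finite \<tau>" using J finJ finite_subset[of \<tau> J]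
              by (auto simp: face_def)
            have "f (J, \<tau>) = lookup (K.kd b (J - \<tau>)) (chi \<tau>) + lookup (n (J - \<tau>)) (chi \<tau>)"
              using True J by (simp add: f sqfree_coeffs_def b(3) lookup_add)
            also have "lookup (n (J - \<tau>)) (chi \<tau>) = 0" by (rule lkI[OF b(2)]) (use \<tau> J in auto)
            also have "lookup (K.kd b (J - \<tau>)) (chi \<tau>) = cod J g \<tau>"
              unfolding cod_def
            proof (subst lookup_kd_squarefree)
              show "J \<subseteq> V" "\<tau> \<subseteq> J" using J \<tau> by auto
              show "(\<Sum>v\<in>\<tau>. sg v (J - \<tau>) * lookup (b (J - (\<tau> - {v}))) (chi (\<tau> - {v}))) =
                (\<Sum>v\<in>\<tau>. sg v (J - \<tau>) * g (\<tau> - {v}))"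
              proof (intro sum.cong refl)
                fix v assume v: "v \<in> \<tau>"
                have "\<tau> - {v} \<in> pface J d"
                  using v \<tau> down[of \<tau> "\<tau> - {v}"] card_Suc_Diff1[of \<tau> v] by (auto simp: pface_def)
                then show "sg v (J - \<tau>) * lookup (b (J - (\<tau> - {v}))) (chi (\<tau> - {v})) = sg v (J - \<tau>) * g (\<tau> - {v})"
                  by (simp add: g_def)
              qed
            qed
            finally show ?thesis using True by simp
          next
            case False
            then show ?thesis by (simp add: f sqfree_coeffs_def)
          qed
          moreover have "g \<in> supported_on (pface J d)" by (simp add: g_def supported_on_def)
          ultimately show ?thesis unfolding CB_def by blast
        qed
        then show "f \<in> fiberwise ?I (\<lambda>J. CB J d)" by (auto simp: fiberwise_def f sqfree_coeffs_def)
      next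
        assume "f \<in> fiberwise ?I (\<lambda>J. CB J d)"
        then have fB: "(\<lambda>\<tau>. f (J, \<tau>)) \<in> CB J d" if "J \<in> ?I" for J using that unfolding fiberwise_def by blast
        have "\<exists>g. g \<in> supported_on (pface J d) \<and>
            (J \<in> ?I \<longrightarrow> (\<lambda>\<tau>. f (J, \<tau>)) = (\<lambda>\<tau>. if \<tau> \<in> face J d then cod J g \<tau> else 0))" for J
        proof (cases "J \<in> ?I")
          case True
          then show ?thesis using fB[OF True] unfolding CB_def by blast
        next
          case False
          then show ?thesis by (intro exI[of _ "\<lambda>_. 0"]) (auto simp: supported_on_def)
        qed
        then have "\<forall>J. \<exists>g. g \<in> supported_on (pface J d) \<and>
            (J \<in> ?I \<longrightarrow> (\<lambda>\<tau>. f (J, \<tau>)) = (\<lambda>\<tau>. if \<tau> \<in> face J d then cod J g \<tau> else 0))" by (rule allI)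
        then obtain g where g0: "\<forall>J. g J \<in> supported_on (pface J d) \<and>
            (J \<in> ?I \<longrightarrow> (\<lambda>\<tau>. f (J, \<tau>)) = (\<lambda>\<tau>. if \<tau> \<in> face J d then cod J (g J) \<tau> else 0))"
          by (rule choice[THEN exE])
        note g = g0[rule_format, THEN conjunct1] g0[rule_format, THEN conjunct2, rule_format]
        have g2: "f (J, \<tau>) = cod J (g J) \<tau>" if "J \<in> ?I" "\<tau> \<in> face J d" for J \<tau>
          using fun_cong[OF g(2)[OF that(1)], of \<tau>] that(2) by simp
        have "\<exists>b\<in>K.Kc (Suc a) (2 * j) (pgr V). \<forall>\<sigma> \<tau>. \<sigma> \<subseteq> V \<longrightarrow> \<tau> \<subseteq> V - \<sigma> \<longrightarrow> card \<sigma> = Suc a \<longrightarrow>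
            Suc (card \<tau>) = d \<longrightarrow> lookup (b \<sigma>) (chi \<tau>) = g (\<sigma> \<union> \<tau>) \<tau>"
        \<comment> \<open>For \<open>d = 0\<close> there are no faces of cardinality
          \<open>d - 1\<close>, and the zero chain will do.\<close>
        proof (cases d)
          case 0
          then show ?thesis using submodD(1)[OF K.submod_Kc[OF gsub_pgr]] by (intro bexI[of _ 0]) auto
        next
          case (Suc d')
          have gs: "\<tau> \<in> C \<and> card \<tau> = d'" if "g J \<tau> \<noteq> 0" for J \<tau>
            using that g(1)[of J] Suc by (auto simp: supported_on_def pface_def)
          have j': "j = Suc a + d'" by (simp add: j Suc)
          obtain b where b: "b \<in> K.Kc (Suc a) (2 * j) (pgr V) \<and>
            (\<forall>\<sigma> \<tau>. \<sigma> \<subseteq> V \<longrightarrow> \<tau> \<subseteq> V - \<sigma> \<longrightarrow> card \<sigma> = Suc a \<longrightarrow> lookup (b \<sigma>) (chi \<tau>) = g (\<sigma> \<union> \<tau>) \<tau>) \<and>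
            (\<forall>\<sigma> t. t \<in> keys (b \<sigma>) \<longrightarrow> (\<exists>\<tau>. t = chi \<tau> \<and> \<tau> \<subseteq> V - \<sigma> \<and> \<tau> \<in> C))"
            using kc_lift[of g, OF gs j'] by (rule exE)
          then show ?thesis by (intro bexI[of _ b]) simp_all
        qed
        then obtain b where b0: "b \<in> K.Kc (Suc a) (2 * j) (pgr V)" "\<forall>\<sigma> \<tau>. \<sigma> \<subseteq> V \<longrightarrow> \<tau> \<subseteq> V - \<sigma> \<longrightarrow> card \<sigma> = Suc a \<longrightarrow>
            Suc (card \<tau>) = d \<longrightarrow> lookup (b \<sigma>) (chi \<tau>) = g (\<sigma> \<union> \<tau>) \<tau>" by (rule bexE)
        note b = b0(1) b0(2)[rule_format]
        \<comment> \<open>Removing this boundary leaves a chain with no coefficients at faces in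
          squarefree multidegrees; the other multidegrees are left to the homotopy.\<close>
        define c1 where "c1 = c - K.kd b"
        have cK: "c \<in> K.Kc a (2 * j) (pgr V)" "K.kd c \<in> K.Kc (a - 1) (2 * j) Igr"
          using c by (simp_all add: K.Zk_def)
        have c1K: "c1 \<in> K.Kc a (2 * j) (pgr V)"
          unfolding c1_def by (rule kmodule.submod_diff[OF K.kmodule_cscl K.submod_Kc[OF gsub_pgr] cK(1) K.kd_Kc[OF gsub_pgr b(1)]])
        have kdc1: "K.kd c1 = K.kd c"
          unfolding c1_def K.kd_diff K.kd_kd_Kc[OF b(1)] by (simp only: diff_zero)
        have c1_sqfree_coeffs: "lookup (c1 \<sigma>) (chi \<tau>) = 0" if \<tau>: "\<tau> \<in> C" "\<tau> \<subseteq> V - \<sigma>" for \<sigma> \<tau>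
        proof (rule ccontr)
          assume ne: "lookup (c1 \<sigma>) (chi \<tau>) \<noteq> 0"
          then have "c1 \<sigma> \<noteq> 0" by auto
          then have \<sigma>: "\<sigma> \<subseteq> V" "card \<sigma> = a" "c1 \<sigma> \<in> pgr V (2 * j - 2 * a)" using c1K unfolding K.Kc_def by blast+
          have fin: "finite \<sigma>" "finite \<tau>" using \<sigma> \<tau> finJ by blast+
          have "mon_degree (chi \<tau>) = 2 * d" using \<sigma>(3) ne j by (auto simp: pgr_def in_keys_iff)
          then have card\<tau>: "card \<tau> = d" using fin by (simp add: mon_degree_chi)
          define J where "J = \<sigma> \<union> \<tau>"
          have "card J = j" using \<sigma> \<tau> card\<tau> j fin unfolding J_def by (subst card_Un_disjoint) auto
          then have J: "J \<in> ?I" "\<tau> \<in> face J d" "\<sigma> = J - \<tau>" "J \<subseteq> V" "\<tau> \<subseteq> J"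
            using \<sigma> \<tau> card\<tau> by (auto simp: J_def face_def)
          have "lookup (K.kd b \<sigma>) (chi \<tau>) = cod J (g J) \<tau>"
            unfolding J(3) lookup_kd_squarefree[OF J(4,5)] cod_def
          proof (intro sum.cong refl)
            fix v assume v: "v \<in> \<tau>"
            have s: "Suc (card (\<tau> - {v})) = d" using card_Suc_Diff1[of \<tau> v] v fin card\<tau> by simp
            have "card (J - (\<tau> - {v})) = Suc a"
            proof -
              have "J - (\<tau> - {v}) = insert v \<sigma>" "v \<notin> \<sigma>" using v \<tau> by (auto simp: J_def)
              then show ?thesis using fin \<sigma> by simp
            qed
            then have "lookup (b (J - (\<tau> - {v}))) (chi (\<tau> - {v})) = g (J - (\<tau> - {v}) \<union> (\<tau> - {v})) (\<tau> - {v})"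
              using J s by (intro b(2)) auto
            also have "J - (\<tau> - {v}) \<union> (\<tau> - {v}) = J" using J by auto
            finally show "sg v (J - \<tau>) * lookup (b (J - (\<tau> - {v}))) (chi (\<tau> - {v})) = sg v (J - \<tau>) * g J (\<tau> - {v})"
              by simp
          qed
          also have "\<dots> = f (J, \<tau>)" using g2 J by simp
          also have "\<dots> = lookup (c \<sigma>) (chi \<tau>)" using J by (simp add: f sqfree_coeffs_def)
          finally show False using ne by (simp add: c1_def fun_diff_def lookup_minus)
        qed
        \<comment> \<open>The multidegrees that are not squarefree; \<open>pick\<close> returns a
          vertex of exponent at least 2.\<close>
        define P :: "('v \<Rightarrow>\<^sub>0 nat) \<Rightarrow> bool" where "P m \<longleftrightarrow> (\<exists>v\<in>V. lookup m v \<ge> 2)" for m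
        define pick :: "('v \<Rightarrow>\<^sub>0 nat) \<Rightarrow> 'v" where "pick m = (SOME v. v \<in> V \<and> lookup m v \<ge> 2)" for m
        have pick2: "pick m \<in> V \<and> lookup m (pick m) \<ge> 2" if "P m" for m
        proof -
          have "\<exists>v. v \<in> V \<and> lookup m v \<ge> 2" using that unfolding P_def by blast
          then show ?thesis unfolding pick_def by (rule someI_ex)
        qed
        have pick: "pick m \<in> V \<and> lookup m (pick m) \<ge> 1" if "P m" for m
          using pick2[OF that] by simp
        have hK: "htpy P pick c1 \<in> K.Kc (Suc a) (2 * j) (pgr V)"
          using htpy_Kc[OF c1K, of P pick "\<lambda>_. True"] by simp
        define n where "n = c1 - K.kd (htpy P pick c1)"
        have nK: "n \<in> K.Kc a (2 * j) (pgr V)"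
          unfolding n_def by (rule kmodule.submod_diff[OF K.kmodule_cscl K.submod_Kc[OF gsub_pgr] c1K K.kd_Kc[OF gsub_pgr hK]])
        have n0: "lookup (n \<sigma>) t = 0" if \<sigma>: "\<sigma> \<subseteq> V" and t: "keys t \<in> C" "keys t \<subseteq> V" for \<sigma> t
        proof -
          have fin: "finite \<sigma>" using \<sigma> finJ by blast
          have "lookup (K.kd (htpy P pick c1) \<sigma>) t = (if P (t + chi \<sigma>) then lookup (c1 \<sigma>) t else 0)"
          proof (rule homotopy_poly[OF pick \<sigma>])
            let ?w = "pick (t + chi \<sigma>)"
            assume P: "P (t + chi \<sigma>)"
            \<comment> \<open>An exponent of at least 2 in \<open>t + chi \<sigma>\<close> leaves
              the picked vertex in the support of \<open>t\<close>. Multiplying by it thus keeps the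
              support a face, where \<open>kd c\<close> has no coefficient.\<close>
            have "?w \<in> keys t" using pick2[OF P] fin
              by (auto simp: lookup_add lookup_chi in_keys_iff split: if_splits)
            then have "keys (t + ind1 ?w) = keys t" by (auto simp: keys_add_nat)
            moreover have "K.kd c (\<sigma> - {?w}) \<in> Igr (2 * j - 2 * (a - 1))" using cK(2) unfolding K.Kc_def by blast
            ultimately show "lookup (K.kd c1 (\<sigma> - {?w})) (t + ind1 ?w) = 0"
              unfolding kdc1 using t by (intro Igr_lookup) auto
          qed
          moreover have "lookup (c1 \<sigma>) t = 0" if nP: "\<not> P (t + chi \<sigma>)"
          proof -
            have le: "lookup t v + (if v \<in> \<sigma> then 1 else 0) \<le> 1" for v
            proof (cases "v \<in> V")
              case True
              then have "\<not> lookup (t + chi \<sigma>) v \<ge> 2" using nP unfolding P_def by blast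
              then show ?thesis using fin by (simp add: lookup_add lookup_chi split: if_splits)
            next
              case False
              then have "v \<notin> keys t" "v \<notin> \<sigma>" using t \<sigma> by auto
              then show ?thesis by (simp add: in_keys_iff)
            qed
            have "t = chi (keys t)"
            proof (rule poly_mapping_eqI)
              fix v show "lookup t v = lookup (chi (keys t)) v"
                using le[of v] by (auto simp: lookup_chi in_keys_iff)
            qed
            moreover have "keys t \<subseteq> V - \<sigma>"
            proof
              fix v assume "v \<in> keys t"
              then show "v \<in> V - \<sigma>" using le[of v] t by (auto simp: in_keys_iff split: if_splits)
            qed
            ultimately show ?thesis using c1_sqfree_coeffs[of "keys t" \<sigma>] t by simp
          qed
          ultimately show ?thesis by (auto simp: n_def fun_diff_def lookup_minus)
        qed
        have "n \<sigma> \<in> Igr (2 * j - 2 * a)" for \<sigma>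
        proof (cases "n \<sigma> = 0")
          case True
          then show ?thesis using submodD(1) gsub_Igr unfolding K.gsub_def by metis
        next
          case False
          then have "\<sigma> \<subseteq> V" "n \<sigma> \<in> pgr V (2 * j - 2 * a)" using nK unfolding K.Kc_def by blast+
          moreover from this have "keys t \<notin> C" if "t \<in> keys (n \<sigma>)" for t
            using n0[of \<sigma> t] that by (auto simp: pgr_def polys_def in_keys_iff)
          ultimately show ?thesis by (simp add: Igr_def)
        qed
        then have nI: "n \<in> K.Kc a (2 * j) Igr" using nK unfolding K.Kc_def by blast
        have "c = K.kd (b + htpy P pick c1) + n"
          unfolding K.kd_add n_def c1_def
          by (subst add.commute) (simp only: diff_diff_eq diff_add_cancel)
        moreover have "b + htpy P pick c1 \<in> K.Kc (Suc a) (2 * j) (pgr V)"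
          by (rule submodD(2)[OF K.submod_Kc[OF gsub_pgr] b(1) hK])
        ultimately show "c \<in> K.Bk a (2 * j) (pgr V) Igr" using nI unfolding K.Bk_def by blast
      qed
    qed
  qed
  also have "\<dots> = (\<Sum>J | J \<subseteq> V \<and> card J = j. mrank fscale (CZ J d) (CB J d))"
  proof (rule mrank_fiberwise[where S = "Pow V"])
    show "finite ?I" "finite (Pow V)" using fin_V by auto
    fix J assume J: "J \<in> ?I"
    show "submod fscale (CZ J d)" by (rule submod_CZ)
    show "submod fscale (CB J d)" by (rule submod_CB)
    show "CZ J d \<subseteq> supported_on (Pow V)"
      using face_subset[of J d] J by (auto simp: CZ_def supported_on_def)
    show "CB J d \<subseteq> CZ J d" using J by (intro CB_subset_CZ) simp
  qed
  finally show ?thesis .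
qed

end

section \<open>Euler characteristic and vanishing for the cohomology of full subcomplexes\<close>

lemma mrank_trivial:
  assumes "kmodule scl" "Z \<subseteq> B" "0 \<in> B"
  shows "mrank scl Z B = 0"
proof -
  have "A = {}" if A: "finite A" "A \<subseteq> Z" "indep_mod scl B A" for A
    using indep_mod_notin[OF assms(1) A(1,3)] A(2) assms(2) by blast
  moreover have "indep_mod scl B {}" by (simp add: indep_mod_def)
  ultimately have "{card A | A. finite A \<and> A \<subseteq> Z \<and> indep_mod scl B A} = {0}"
    by (auto intro!: exI[of _ "{}"])
  then show ?thesis by (simp add: mrank_def)
qed

context signed_complex begin

lemma finite_face: "J \<subseteq> V \<Longrightarrow> finite (face J d)"
  using face_subset[of J d] fin_V finite_subset by blast

lemma pface_Suc: "pface J (Suc d) = face J d"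
  by (auto simp: pface_def face_def)

text \<open>Rank and nullity for the coboundary: cochains modulo cocycles correspond to coboundaries
  one degree higher.\<close>

lemma mrank_cocycles_complement:
  "mrank fscale (supported_on (face J d)) (CZ J d) = mrank fscale (CB J (Suc d)) {0}"
proof (rule quot_iso_rel_mrank[OF kmodule_fscale kmodule_fscale,
      where \<rho> = "\<lambda>f g. g = (\<lambda>\<tau>. if \<tau> \<in> face J (Suc d) then cod J f \<tau> else 0)"])
  let ?D = "\<lambda>f \<tau>. if \<tau> \<in> face J (Suc d) then cod J f \<tau> else 0"
  show "quot_iso_rel fscale fscale (supported_on (face J d)) (CZ J d) (CB J (Suc d)) {0} (\<lambda>f g. g = ?D f)"
    unfolding quot_iso_rel_def
  proof (intro conjI allI impI ballI)
    show "submod fscale (supported_on (face J d) :: ('v set \<Rightarrow> 'k) set)" by (rule submod_supported_on)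
    show "submod fscale (CB J (Suc d))" by (rule submod_CB)
    show "0 \<in> CZ J d" by (rule submodD(1)[OF submod_CZ])
    show "0 \<in> {0}" by simp
    show "0 = ?D 0" by (rule ext) (simp add: cod_zero)
    show "y + y' = ?D (x + x')" if "y = ?D x" "y' = ?D x'" for x y x' y'
      unfolding that by (rule ext) (simp add: cod_add)
    show "fscale c y = ?D (fscale c x)" if "y = ?D x" for c x y
      unfolding that by (rule ext) (simp add: cod_fscale fscale_apply)
    show "\<exists>y\<in>CB J (Suc d). y = ?D x" if "x \<in> supported_on (face J d)" for x
      using that unfolding CB_def pface_Suc by blast
    show "\<exists>x\<in>supported_on (face J d). y = ?D x" if "y \<in> CB J (Suc d)" for y
      using that unfolding CB_def pface_Suc by blast
    show "x \<in> CZ J d \<longleftrightarrow> y \<in> {0}" if x: "x \<in> supported_on (face J d)" and y: "y = ?D x" for x y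
    proof
      assume "x \<in> CZ J d"
      then show "y \<in> {0}" unfolding y by (auto simp: CZ_def)
    next
      assume "y \<in> {0}"
      then have "cod J x \<tau> = 0" if "\<tau> \<in> face J (Suc d)" for \<tau> using fun_cong[OF y, of \<tau>] that by simp
      then show "x \<in> CZ J d" using x by (simp add: CZ_def)
    qed
  qed
qed

text \<open>The rank of the reduced cohomology in degree \<open>d - 1\<close> of the full subcomplex
  on \<open>J\<close>; \<open>d\<close> counts the vertices of a face.\<close>

definition crank :: "'v set \<Rightarrow> nat \<Rightarrow> nat" where
  "crank J d = mrank fscale (CZ J d) (CB J d)"

lemma card_face_eq:
  assumes "J \<subseteq> V"
  shows "card (face J d) = crank J d + mrank fscale (CB J d) {0} + mrank fscale (CB J (Suc d)) {0}"
proof -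
  note fin = finite_face[OF assms, of d]
  have Zs: "CZ J d \<subseteq> supported_on (face J d)" by (auto simp: CZ_def)
  have z: "{0} \<subseteq> CB J d" using submodD(1)[OF submod_CB] by simp
  note BZ = CB_subset_CZ[OF assms, of d]
  have "card (face J d) = mrank fscale (supported_on (face J d)) {0 :: 'v set \<Rightarrow> 'k}"
    using mrank_supported_on[OF fin] by (rule sym)
  also have "\<dots> = mrank fscale (supported_on (face J d)) (CZ J d) + mrank fscale (CZ J d) {0}"
    by (rule mrank_add[OF fin subset_refl submod_supported_on submod_CZ submod_zero _ Zs]) (use z BZ in blast)
  also have "mrank fscale (CZ J d) {0} = mrank fscale (CZ J d) (CB J d) + mrank fscale (CB J d) {0}"
    by (rule mrank_add[OF fin Zs submod_CZ submod_CB submod_zero z BZ])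
  finally show ?thesis unfolding mrank_cocycles_complement crank_def by simp
qed

lemma CB_trivial:
  assumes "face J d = {} \<or> d = 0"
  shows "CB J d = {0}"
proof -
  have "f = 0" if f: "f \<in> CB J d" for f
  proof -
    obtain g where g: "g \<in> supported_on (pface J d)" "f = (\<lambda>\<tau>. if \<tau> \<in> face J d then cod J g \<tau> else 0)"
      using f unfolding CB_def by blast
    have "cod J g \<tau> = 0" if "d = 0" for \<tau> using g(1) that by (simp add: cod_def supported_on_def pface_def)
    then show ?thesis using assms unfolding g(2) by auto
  qed
  then show ?thesis using submodD(1)[OF submod_CB, of J d] by blast
qed

lemma mrank_CB_trivial:
  assumes "face J d = {} \<or> d = 0"
  shows "mrank fscale (CB J d) {0} = 0"
  unfolding CB_trivial[OF assms] by (rule mrank_trivial[OF kmodule_fscale]) simp_all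

text \<open>Each coboundary rank enters two consecutive face counts with opposite signs. The partial
  sums differ by the one left over at the top, which is zero beyond the largest faces.\<close>

lemma euler_characteristic:
  assumes J: "J \<subseteq> V" and N: "face J (Suc N) = {}"
  shows "(\<Sum>d\<le>N. (-1) ^ d * int (card (face J d))) = (\<Sum>d\<le>N. (-1) ^ d * int (crank J d))"
proof -
  define b where "b d = mrank fscale (CB J d) {0}" for d
  note ce = card_face_eq[OF J, folded b_def] and b0 = mrank_CB_trivial[of J, folded b_def]
  have "(\<Sum>d\<le>M. (-1) ^ d * int (card (face J d))) =
      (\<Sum>d\<le>M. (-1) ^ d * int (crank J d)) + (-1) ^ M * int (b (Suc M))" for M
  proof (induction M)
    case 0
    show ?case using ce[of 0] b0[of 0] by simp
  next
    case (Suc M)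
    then show ?case using ce[of "Suc M"] by (simp add: algebra_simps)
  qed
  from this[of N] show ?thesis using b0[of "Suc N"] N by simp
qed

text \<open>Here \<open>r\<close> is the rank of \<open>J\<close>. Below it the matroid vanishing
  theorem applies; above it there are no faces, since exchange with a larger face would extend a
  face of size \<open>r\<close> to one of size \<open>Suc r\<close>.\<close>

lemma crank_eq_0:
  assumes J: "J \<subseteq> V" and C: "indep_complex {\<tau> \<in> C. \<tau> \<subseteq> J}"
    and r: "face J r \<noteq> {}" "face J (Suc r) = {}" and d: "d \<noteq> r"
  shows "crank J d = 0"
  unfolding crank_def
proof (rule mrank_trivial[OF kmodule_fscale])
  show "0 \<in> CB J d" by (rule submodD(1)[OF submod_CB])
  obtain B where B: "B \<in> face J r" using r by blast
  have finJ: "finite \<tau>" if "\<tau> \<subseteq> J" for \<tau> by (rule finite_subset[OF _ fin_V]) (use J that in blast)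
  show "CZ J d \<subseteq> CB J d"
  proof (cases "d < r")
    case True
    show ?thesis
    proof
      fix f assume f: "f \<in> CZ J d"
      have "\<exists>g. \<forall>\<tau>\<in>{\<tau> \<in> C. \<tau> \<subseteq> J}. card \<tau> = d \<longrightarrow> f \<tau> = gcod (\<lambda>v \<tau>. sg v (J - \<tau>)) g \<tau>"
      proof (rule indep_complex_cohomology_vanishes[OF C cochain_signs_sg[OF J]])
        show "B \<in> {\<tau> \<in> C. \<tau> \<subseteq> J}" "d < card B" using B True by (auto simp: face_def)
        fix \<tau> assume "\<tau> \<in> {\<tau> \<in> C. \<tau> \<subseteq> J}" "card \<tau> = Suc d"
        then show "gcod (\<lambda>v \<tau>. sg v (J - \<tau>)) f \<tau> = 0"
          using f by (auto simp: CZ_def cod_eq_gcod face_def)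
      qed
      then obtain g where g: "\<And>\<tau>. \<tau> \<in> face J d \<Longrightarrow> f \<tau> = cod J g \<tau>"
        by (auto simp: cod_eq_gcod face_def)
      define g' where "g' \<tau> = (if \<tau> \<in> pface J d then g \<tau> else 0)" for \<tau>
      have "cod J g \<tau> = cod J g' \<tau>" if \<tau>: "\<tau> \<in> face J d" for \<tau>
      proof (rule cod_cong)
        fix v assume "v \<in> \<tau>"
        then have "\<tau> - {v} \<in> pface J d"
          using \<tau> down[of \<tau> "\<tau> - {v}"] finJ[of \<tau>] card_Suc_Diff1[of \<tau> v] by (auto simp: face_def pface_def)
        then show "g (\<tau> - {v}) = g' (\<tau> - {v})" by (simp add: g'_def)
      qed
      then have "f = (\<lambda>\<tau>. if \<tau> \<in> face J d then cod J g' \<tau> else 0)"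
        using g f by (auto simp: CZ_def supported_on_def)
      moreover have "g' \<in> supported_on (pface J d)" by (simp add: g'_def supported_on_def)
      ultimately show "f \<in> CB J d" unfolding CB_def by blast
    qed
  next
    case False
    have "face J d = {}"
    proof (rule ccontr)
      assume "face J d \<noteq> {}"
      then obtain \<tau> where \<tau>: "\<tau> \<in> face J d" by blast
      have "card B < card \<tau>" using B \<tau> False d by (auto simp: face_def)
      then obtain b where "b \<in> \<tau> - B" "insert b B \<in> C" "insert b B \<subseteq> J"
        using indep_complexD(4)[OF C, of B \<tau>] B \<tau> by (auto simp: face_def)
      then have "insert b B \<in> face J (Suc r)" using B finJ[of B] by (auto simp: face_def)
      then show False using r by blast
    qed
    then have "f = 0" if "f \<in> CZ J d" for f using that by (auto simp: CZ_def supported_on_def)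
    then show ?thesis using submodD(1)[OF submod_CB, of J d] by blast
  qed
qed

text \<open>Only degree \<open>r\<close> survives in the Euler characteristic; multiplying by
  \<open>(-1) ^ r\<close> gives it a positive sign.\<close>

lemma crank_eq:
  assumes J: "J \<subseteq> V" and C: "indep_complex {\<tau> \<in> C. \<tau> \<subseteq> J}"
    and r: "face J r \<noteq> {}" "face J (Suc r) = {}"
  shows "int (crank J r) = (\<Sum>d\<le>r. (-1) ^ (r - d) * int (card (face J d)))"
proof -
  have "(\<Sum>d\<le>r. (-1) ^ d * int (crank J d)) = (\<Sum>d\<in>{r}. (-1) ^ d * int (crank J d))"
    by (rule sum.mono_neutral_right) (use crank_eq_0[OF J C r] in auto)
  then have "(-1) ^ r * int (crank J r) = (\<Sum>d\<le>r. (-1) ^ d * int (card (face J d)))"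
    using euler_characteristic[OF J r(2)] by simp
  then have "(-1) ^ r * ((-1) ^ r * int (crank J r)) = (\<Sum>d\<le>r. (-1) ^ r * (-1) ^ d * int (card (face J d)))"
    by (simp add: sum_distrib_left mult.assoc)
  also have "\<dots> = (\<Sum>d\<le>r. (-1) ^ (r - d) * int (card (face J d)))"
  proof (intro sum.cong refl)
    fix d assume "d \<in> {..r}"
    then have "r = (r - d) + d" by simp
    then have "(-1) ^ r * (-1) ^ d = ((-1) ^ (r - d) * ((-1) ^ d * (-1) ^ d) :: int)"
      by (metis power_add mult.assoc)
    then show "(-1) ^ r * (-1) ^ d * int (card (face J d)) = (-1) ^ (r - d) * int (card (face J d))"
      by (simp flip: power_mult_distrib)
  qed
  finally show ?thesis by (simp add: mult.assoc[symmetric] flip: power_mult_distrib)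
qed

end

subsection \<open>Free modules over a polynomial ring\<close>

lemma scale_add_right: "scale c (x + y) = scale c x + scale c y"
  by (rule poly_mapping_eqI) (simp add: lookup_scale lookup_add distrib_left)

lemma scale_add_left: "scale (c + d) x = scale c x + scale d x"
  by (rule poly_mapping_eqI) (simp add: lookup_scale lookup_add distrib_right)

lemma scale_scale: "scale c (scale d x) = scale (c * d) x"
  by (rule poly_mapping_eqI) (simp add: lookup_scale mult.assoc)

lemma scale_one: "scale 1 x = x"
  by (rule poly_mapping_eqI) (simp add: lookup_scale)

lemma scale_zero_left: "scale 0 x = 0"
  by (rule poly_mapping_eqI) (simp add: lookup_scale)

lemma scale_zero_right: "scale c 0 = 0"
  by (rule poly_mapping_eqI) (simp add: lookup_scale)

lemma scale_sum: "scale c (sum f A) = (\<Sum>a\<in>A. scale c (f a))"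
  by (rule poly_mapping_eqI) (simp add: lookup_scale lookup_sum sum_distrib_left)

lemma lin_ext_superset:
  assumes "finite S" "keys x \<subseteq> S"
  shows "lin_ext f x = (\<Sum>b\<in>S. scale (lookup x b) (f b))"
  unfolding lin_ext_def
  by (rule sum.mono_neutral_left) (use assms in \<open>auto simp: in_keys_iff scale_zero_left\<close>)

lemma lin_ext_add: "lin_ext f (x + y) = lin_ext f x + lin_ext f y"
proof -
  let ?S = "keys x \<union> keys y"
  have "lin_ext f z = (\<Sum>b\<in>?S. scale (lookup z b) (f b))" if "z \<in> {x, y, x + y}" for z
    by (rule lin_ext_superset) (use that keys_add[of x y] in auto)
  then show ?thesis by (simp add: lookup_add scale_add_left sum.distrib)
qed

lemma lin_ext_scale: "lin_ext f (scale c x) = scale c (lin_ext f x)"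
proof -
  have "lin_ext f (scale c x) = (\<Sum>b\<in>keys x. scale (lookup (scale c x) b) (f b))"
    by (rule lin_ext_superset) (use keys_scale_subset[of c x] in auto)
  then show ?thesis by (simp add: lin_ext_def lookup_scale scale_sum scale_scale)
qed

lemma lin_ext_zero: "lin_ext f 0 = 0"
  by (simp add: lin_ext_def)

lemma lin_ext_diff: "lin_ext f (x - y) = lin_ext f x - lin_ext f y"
  using lin_ext_add[of f "x - y" y] by simp

lemma lookup_lin_ext: "lookup (lin_ext f x) c = (\<Sum>b\<in>keys x. lookup x b * lookup (f b) c)"
  by (simp add: lin_ext_def lookup_sum lookup_scale)

lemma augm_ext_superset:
  assumes "finite S" "keys x \<subseteq> S"
  shows "augm_ext R x = (\<Sum>b\<in>S. lookup x b * augm R b)"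
  unfolding augm_ext_def
  by (rule sum.mono_neutral_left) (use assms in \<open>auto simp: in_keys_iff\<close>)

lemma augm_ext_add: "augm_ext R (x + y) = augm_ext R x + augm_ext R y"
proof -
  let ?S = "keys x \<union> keys y"
  have "augm_ext R z = (\<Sum>b\<in>?S. lookup z b * augm R b)" if "z \<in> {x, y, x + y}" for z
    by (rule augm_ext_superset) (use that keys_add[of x y] in auto)
  then show ?thesis by (simp add: lookup_add distrib_right sum.distrib)
qed

lemma augm_ext_scale: "augm_ext R (scale c x) = c * augm_ext R x"
proof -
  have "augm_ext R (scale c x) = (\<Sum>b\<in>keys x. lookup (scale c x) b * augm R b)"
    by (rule augm_ext_superset) (use keys_scale_subset[of c x] in auto)
  then show ?thesis by (simp add: augm_ext_def lookup_scale sum_distrib_left mult.assoc)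
qed

definition filt :: "('m \<Rightarrow> bool) \<Rightarrow> ('m \<Rightarrow>\<^sub>0 'k::zero) \<Rightarrow> ('m \<Rightarrow>\<^sub>0 'k)" where
  "filt P p = Abs_poly_mapping (\<lambda>t. if P t then lookup p t else 0)"

lemma lookup_filt: "lookup (filt P p) t = (if P t then lookup p t else 0)"
proof -
  have "finite {t. (if P t then lookup p t else 0) \<noteq> 0}"
    by (rule finite_subset[OF _ finite_keys[of p]]) (auto simp: in_keys_iff)
  then show ?thesis by (simp add: filt_def)
qed

lemma keys_filt: "keys (filt P p) = {t \<in> keys p. P t}"
  by (auto simp: in_keys_iff lookup_filt split: if_splits)

lemma filt_add: "filt P (p + q) = filt P p + filt P (q :: 'm \<Rightarrow>\<^sub>0 'k::comm_monoid_add)"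
  by (rule poly_mapping_eqI) (simp add: lookup_filt lookup_add)

lemma filt_diff: "filt P (p - q) = filt P p - filt P (q :: 'm \<Rightarrow>\<^sub>0 'k::ab_group_add)"
  by (rule poly_mapping_eqI) (simp add: lookup_filt lookup_minus)

lemma filt_sum: "filt P (sum f A) = (\<Sum>a\<in>A. filt P (f a :: 'm \<Rightarrow>\<^sub>0 'k::comm_monoid_add))"
  by (rule poly_mapping_eqI) (simp add: lookup_filt lookup_sum)

lemma filt_id: "(\<And>t. t \<in> keys p \<Longrightarrow> P t) \<Longrightarrow> filt P p = p"
  by (rule poly_mapping_eqI) (auto simp: lookup_filt in_keys_iff)

lemma filt_none: "(\<And>t. t \<in> keys p \<Longrightarrow> \<not> P t) \<Longrightarrow> filt P p = 0"
  by (rule poly_mapping_eqI) (auto simp: lookup_filt in_keys_iff)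

text \<open>Homogeneous components pass through a product with a homogeneous factor. The constants
  \<open>k\<close> and \<open>k'\<close> are degrees of generators, so the statement fits the
  entries of a homogeneous matrix.\<close>

lemma filt_mult:
  fixes p q :: "('v, 'k::comm_ring_1) mpoly"
  assumes q: "\<And>s. s \<in> keys q \<Longrightarrow> mon_degree s + k' = k"
  shows "filt (\<lambda>t. mon_degree t + k' = e) (p * q) = filt (\<lambda>t. mon_degree t + k = e) p * q"
proof -
  let ?P = "\<lambda>t. mon_degree t + k = e" and ?Q = "\<lambda>t. mon_degree t + k' = e"
  have p: "p = filt ?P p + filt (\<lambda>t. \<not> ?P t) p"
    by (rule poly_mapping_eqI) (simp add: lookup_filt lookup_add)
  have deg: "mon_degree t + k' = e \<longleftrightarrow> R" if t: "t \<in> keys (r * q)" and r: "\<And>a. a \<in> keys r \<Longrightarrow> ?P a \<longleftrightarrow> R" for t r R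
  proof -
    obtain a s where "t = a + s" "a \<in> keys r" "s \<in> keys q" using keys_mult[of r q] t by blast
    then show ?thesis using q[of s] r[of a] by (auto simp: mon_degree_add)
  qed
  have "filt ?Q (p * q) = filt ?Q (filt ?P p * q) + filt ?Q (filt (\<lambda>t. \<not> ?P t) p * q)"
    by (subst p) (simp only: distrib_right filt_add)
  also have "filt ?Q (filt ?P p * q) = filt ?P p * q"
  proof (rule filt_id)
    fix t assume t: "t \<in> keys (filt ?P p * q)"
    have "?P a \<longleftrightarrow> True" if "a \<in> keys (filt ?P p)" for a using that by (simp add: keys_filt)
    from deg[OF t this] show "?Q t" by simp
  qed
  also have "filt ?Q (filt (\<lambda>t. \<not> ?P t) p * q) = 0"
  proof (rule filt_none)
    fix t assume t: "t \<in> keys (filt (\<lambda>t. \<not> ?P t) p * q)"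
    have "?P a \<longleftrightarrow> False" if "a \<in> keys (filt (\<lambda>t. \<not> ?P t) p)" for a using that by (simp add: keys_filt)
    from deg[OF t this] show "\<not> ?Q t" by simp
  qed
  finally show ?thesis by simp
qed

text \<open>Scalars from the coefficient ring act on the free module through constant polynomials,
  as the Koszul locale expects.\<close>

definition kscl :: "'k::comm_ring_1 \<Rightarrow> (nat \<Rightarrow>\<^sub>0 ('v, 'k) mpoly) \<Rightarrow> (nat \<Rightarrow>\<^sub>0 ('v, 'k) mpoly)" where
  "kscl r = scale (single 0 r)"

lemma lookup_kscl: "lookup (kscl r x) b = scale r (lookup x b)"
  by (simp add: kscl_def lookup_scale scale_mpoly)

lemma kmodule_kscl: "kmodule (kscl :: 'k::idom \<Rightarrow> (nat \<Rightarrow>\<^sub>0 ('v, 'k) mpoly) \<Rightarrow> _)"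
  by standard
    (simp_all add: kscl_def scale_add_right scale_scale mult_single scale_one single_add scale_add_left)

lemma koszul_free:
  assumes "finite V" "sign_system V sg"
  shows "koszul (kscl :: 'k::idom \<Rightarrow> (nat \<Rightarrow>\<^sub>0 ('v, 'k) mpoly) \<Rightarrow> _) V sg (\<lambda>v. scale (var v))"
proof (intro koszul.intro kmodule_kscl koszul_axioms.intro assms)
  fix v w c and x y :: "nat \<Rightarrow>\<^sub>0 ('v, 'k) mpoly"
  show "scale (var v) (x + y) = scale (var v) x + scale (var v) y" by (rule scale_add_right)
  show "scale (var v) (kscl c x) = kscl c (scale (var v) x)"
    by (simp add: kscl_def scale_scale mult.commute)
  show "scale (var v) (scale (var w) x) = scale (var w) (scale (var v) x)"
    by (simp add: scale_scale mult.commute)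
qed

definition Fgr :: "'v set \<Rightarrow> ('v, 'k::comm_ring_1) free_complex \<Rightarrow> nat \<Rightarrow> nat \<Rightarrow> (nat \<Rightarrow>\<^sub>0 ('v, 'k) mpoly) set" where
  "Fgr V R i e = {x \<in> free_mod V R i. \<forall>b. \<forall>t\<in>keys (lookup x b). mon_degree t + gdeg R i b = e}"

lemma Fgr_lookup:
  assumes "x \<in> Fgr V R i e" "lookup x b \<noteq> 0"
  shows "b \<in> gens R i" "gdeg R i b \<le> e" "lookup x b \<in> pgr V (e - gdeg R i b)"
proof -
  show "b \<in> gens R i" using assms by (auto simp: Fgr_def free_mod_def in_keys_iff)
  obtain t where "t \<in> keys (lookup x b)" using assms(2) by (metis ex_in_conv keys_eq_empty)
  then have "mon_degree t + gdeg R i b = e" using assms(1) by (simp add: Fgr_def)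
  then show "gdeg R i b \<le> e" by simp
  have "mon_degree t = e - gdeg R i b" if "t \<in> keys (lookup x b)" for t
    using assms(1) that unfolding Fgr_def by fastforce
  then show "lookup x b \<in> pgr V (e - gdeg R i b)"
    using assms(1) by (auto simp: pgr_def Fgr_def free_mod_def)
qed

lemma FgrI:
  assumes "\<And>b. lookup x b \<noteq> 0 \<Longrightarrow> b \<in> gens R i \<and> gdeg R i b \<le> e \<and> lookup x b \<in> pgr V (e - gdeg R i b)"
  shows "x \<in> Fgr V R i e"
  unfolding Fgr_def free_mod_def mem_Collect_eq
proof (intro conjI allI ballI subsetI)
  show "b \<in> gens R i" if "b \<in> keys x" for b using assms[of b] that by (simp add: in_keys_iff)
  show "lookup x b \<in> polys V" for b using assms[of b] polys_zero by (cases "lookup x b = 0") (auto simp: pgr_def)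
  fix b t assume t: "t \<in> keys (lookup x b)"
  then have "lookup x b \<noteq> 0" by auto
  from assms[OF this] t show "mon_degree t + gdeg R i b = e" by (auto simp: pgr_def)
qed

lemma submod_free_mod_add: "x \<in> free_mod V R i \<Longrightarrow> y \<in> free_mod V R i \<Longrightarrow> x + y \<in> free_mod V R i"
  using keys_add[of x y] by (auto simp: free_mod_def lookup_add intro!: polys_add)

lemma free_mod_scale: "p \<in> polys V \<Longrightarrow> x \<in> free_mod V R i \<Longrightarrow> scale p x \<in> free_mod V R i"
  using keys_scale_subset[of p x] by (auto simp: free_mod_def lookup_scale intro!: polys_mult)

lemma free_mod_zero: "0 \<in> free_mod V R i"
  by (simp add: free_mod_def polys_zero)

lemma submod_Fgr: "submod kscl (Fgr V R i e :: (nat \<Rightarrow>\<^sub>0 ('v, 'k::idom) mpoly) set)"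
proof (rule submodI)
  show "0 \<in> Fgr V R i e" by (rule FgrI) simp
  fix x y :: "nat \<Rightarrow>\<^sub>0 ('v, 'k) mpoly" and r
  assume x: "x \<in> Fgr V R i e"
  note sub = submod_pgr
  show "kscl r x \<in> Fgr V R i e"
  proof (rule FgrI)
    fix b assume "lookup (kscl r x) b \<noteq> 0"
    then have "lookup x b \<noteq> 0" by (auto simp: lookup_kscl scale_zero_right)
    from Fgr_lookup[OF x this] show "b \<in> gens R i \<and> gdeg R i b \<le> e \<and> lookup (kscl r x) b \<in> pgr V (e - gdeg R i b)"
      using submodD(3)[OF sub] by (simp add: lookup_kscl)
  qed
  assume y: "y \<in> Fgr V R i e"
  show "x + y \<in> Fgr V R i e"
  proof (rule FgrI)
    fix b assume "lookup (x + y) b \<noteq> 0"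
    then have "lookup x b \<noteq> 0 \<or> lookup y b \<noteq> 0" by (auto simp: lookup_add)
    then have b: "b \<in> gens R i" "gdeg R i b \<le> e" using Fgr_lookup(1,2)[OF x] Fgr_lookup(1,2)[OF y] by blast+
    have "lookup x b \<in> pgr V (e - gdeg R i b)" "lookup y b \<in> pgr V (e - gdeg R i b)"
      using Fgr_lookup(3)[OF x, of b] Fgr_lookup(3)[OF y, of b] submodD(1)[OF sub, of V "e - gdeg R i b"] by metis+
    then show "b \<in> gens R i \<and> gdeg R i b \<le> e \<and> lookup (x + y) b \<in> pgr V (e - gdeg R i b)"
      using b submodD(2)[OF sub] by (simp add: lookup_add)
  qed
qed

lemma Fgr_var:
  assumes v: "v \<in> V" and x: "x \<in> Fgr V R i e"
  shows "scale (var v) x \<in> Fgr V R i (e + 2)"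
proof (rule FgrI)
  fix b assume "lookup (scale (var v) x) b \<noteq> 0"
  then have "lookup x b \<noteq> 0" by (auto simp: lookup_scale)
  note * = Fgr_lookup[OF x this]
  have "e - gdeg R i b + 2 = e + 2 - gdeg R i b" using *(2) by simp
  then show "b \<in> gens R i \<and> gdeg R i b \<le> e + 2 \<and> lookup (scale (var v) x) b \<in> pgr V (e + 2 - gdeg R i b)"
    using * pgr_var_mult[OF v *(3)] by (simp add: lookup_scale)
qed

definition gcomp :: "(nat \<Rightarrow> nat) \<Rightarrow> nat \<Rightarrow> (nat \<Rightarrow>\<^sub>0 ('v, 'k::comm_ring_1) mpoly) \<Rightarrow> (nat \<Rightarrow>\<^sub>0 ('v, 'k) mpoly)" where
  "gcomp d e x = Abs_poly_mapping (\<lambda>b. filt (\<lambda>t. mon_degree t + d b = e) (lookup x b))"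

lemma filt_zero: "filt P (0 :: ('m \<Rightarrow>\<^sub>0 'k::zero)) = 0"
  by (rule filt_none) simp

lemma lookup_gcomp: "lookup (gcomp d e x) b = filt (\<lambda>t. mon_degree t + d b = e) (lookup x b)"
proof -
  have "finite {b. filt (\<lambda>t. mon_degree t + d b = e) (lookup x b) \<noteq> 0}"
    by (rule finite_subset[OF _ finite_keys[of x]]) (auto simp: in_keys_iff filt_zero)
  then show ?thesis by (simp add: gcomp_def)
qed

lemma keys_gcomp: "keys (gcomp d e x) \<subseteq> keys x"
  by (auto simp: in_keys_iff lookup_gcomp filt_zero)

lemma filt_polys: "p \<in> polys V \<Longrightarrow> filt P p \<in> polys V"
  by (simp add: polys_def keys_filt)

lemma lookup_lin_ext_superset:
  "keys x \<subseteq> S \<Longrightarrow> finite S \<Longrightarrow> lookup (lin_ext f x) c = (\<Sum>b\<in>S. lookup x b * lookup (f b) c)"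
  by (subst lin_ext_superset[of S]) (auto simp: lookup_sum lookup_scale)

text \<open>A map with homogeneous matrix entries commutes with taking components. In this way
  graded statements follow from the ungraded exactness of a resolution.\<close>

lemma lin_ext_gcomp:
  assumes hom: "\<And>b c t. b \<in> keys x \<Longrightarrow> t \<in> keys (lookup (f b) c) \<Longrightarrow> mon_degree t + d' c = d b"
  shows "lin_ext f (gcomp d e x) = gcomp d' e (lin_ext f x)"
proof (rule poly_mapping_eqI)
  fix c
  have "lookup (gcomp d' e (lin_ext f x)) c =
      (\<Sum>b\<in>keys x. filt (\<lambda>t. mon_degree t + d' c = e) (lookup x b * lookup (f b) c))"
    by (simp add: lookup_gcomp lookup_lin_ext filt_sum)
  also have "\<dots> = (\<Sum>b\<in>keys x. lookup (gcomp d e x) b * lookup (f b) c)"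
  proof (intro sum.cong refl)
    fix b assume "b \<in> keys x"
    then show "filt (\<lambda>t. mon_degree t + d' c = e) (lookup x b * lookup (f b) c) =
        lookup (gcomp d e x) b * lookup (f b) c"
      unfolding lookup_gcomp by (intro filt_mult hom)
  qed
  also have "\<dots> = lookup (lin_ext f (gcomp d e x)) c"
    by (rule lookup_lin_ext_superset[OF keys_gcomp, symmetric]) simp
  finally show "lookup (lin_ext f (gcomp d e x)) c = lookup (gcomp d' e (lin_ext f x)) c" by simp
qed

context signs begin

sublocale KF: koszul "kscl :: 'k \<Rightarrow> (nat \<Rightarrow>\<^sub>0 ('v, 'k) mpoly) \<Rightarrow> _" V sg "\<lambda>v. scale (var v)"
  by (rule koszul_free[OF fin_V sgs])

lemma gsub_Fgr: "KF.gsub (Fgr V R i)"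
  unfolding KF.gsub_def by (intro conjI allI ballI submod_Fgr Fgr_var)

lemma lookup_KF_kd: "lookup (KF.kd c \<sigma>) b = K.kd (\<lambda>\<sigma>. lookup (c \<sigma>) b) \<sigma>"
  by (simp add: KF.kd_def K.kd_def lookup_sum lookup_kscl lookup_scale)

text \<open>A free module is a direct sum of shifted copies of the polynomial ring, so its Koszul
  complex splits over the basis. When \<open>gdeg R i b\<close> exceeds \<open>e\<close> the
  component is zero, which makes the truncated subtraction harmless.\<close>

lemma Kc_component:
  assumes c: "c \<in> KF.Kc a e (Fgr V R i)"
  shows "(\<lambda>\<sigma>. lookup (c \<sigma>) b) \<in> K.Kc a (e - gdeg R i b) (pgr V)"
  unfolding K.Kc_def mem_Collect_eq
proof (intro allI)
  fix \<sigma>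
  show "lookup (c \<sigma>) b \<in> pgr V (e - gdeg R i b - 2 * a) \<and>
    (lookup (c \<sigma>) b \<noteq> 0 \<longrightarrow> \<sigma> \<subseteq> V \<and> card \<sigma> = a \<and> 2 * a \<le> e - gdeg R i b)"
  proof (cases "lookup (c \<sigma>) b = 0")
    case True
    then show ?thesis using submodD(1)[OF submod_pgr] by simp
  next
    case False
    then have "c \<sigma> \<noteq> 0" by auto
    then have *: "\<sigma> \<subseteq> V" "card \<sigma> = a" "2 * a \<le> e" "c \<sigma> \<in> Fgr V R i (e - 2 * a)"
      using c unfolding KF.Kc_def by blast+
    note ** = Fgr_lookup[OF *(4) False]
    have "e - 2 * a - gdeg R i b = e - gdeg R i b - 2 * a" "2 * a \<le> e - gdeg R i b"
      using *(3) **(2) by arith+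
    then show ?thesis using * ** by simp
  qed
qed

lemma Kc_component_0:
  assumes c: "c \<in> KF.Kc a e (Fgr V R i)" and b: "b \<notin> gens R i \<or> e < gdeg R i b"
  shows "lookup (c \<sigma>) b = 0"
proof (rule ccontr)
  assume ne: "lookup (c \<sigma>) b \<noteq> 0"
  then have "c \<sigma> \<noteq> 0" by auto
  then have *: "2 * a \<le> e" "c \<sigma> \<in> Fgr V R i (e - 2 * a)" using c unfolding KF.Kc_def by blast+
  then show False using Fgr_lookup[OF *(2) ne] b by auto
qed

text \<open>Converse of the splitting. \<open>B\<close> has to be finite because elements of the
  module have finite support while its basis may be infinite.\<close>

lemma Kc_glue:
  assumes fin: "finite B" and B: "\<And>b. b \<in> B \<Longrightarrow> b \<in> gens R i \<and> gdeg R i b \<le> e"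
    and cb: "\<And>b. b \<in> B \<Longrightarrow> cb b \<in> K.Kc a (e - gdeg R i b) (pgr V)"
  shows "\<exists>c. c \<in> KF.Kc a e (Fgr V R i) \<and>
    (\<forall>\<sigma> b. lookup (c \<sigma>) b = (if b \<in> B then cb b \<sigma> else 0))"
proof -
  define c where "c \<sigma> = Abs_poly_mapping (\<lambda>b. if b \<in> B then cb b \<sigma> else 0)" for \<sigma>
  have lk: "lookup (c \<sigma>) b = (if b \<in> B then cb b \<sigma> else 0)" for \<sigma> b
  proof -
    have "finite {b. (if b \<in> B then cb b \<sigma> else 0) \<noteq> 0}"
      by (rule finite_subset[OF _ fin]) auto
    then show ?thesis by (simp add: c_def)
  qed
  have "c \<in> KF.Kc a e (Fgr V R i)"
    unfolding KF.Kc_def mem_Collect_eq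
  proof (intro allI conjI impI)
    fix \<sigma>
    have key: "b \<in> B \<and> \<sigma> \<subseteq> V \<and> card \<sigma> = a \<and> 2 * a \<le> e - gdeg R i b \<and> cb b \<sigma> \<in> pgr V (e - gdeg R i b - 2 * a)"
      if "lookup (c \<sigma>) b \<noteq> 0" for b
    proof -
      have b: "b \<in> B" "cb b \<sigma> \<noteq> 0" using that by (auto simp: lk split: if_splits)
      then show ?thesis using cb[OF b(1)] unfolding K.Kc_def by blast
    qed
    show "c \<sigma> \<in> Fgr V R i (e - 2 * a)"
    proof (rule FgrI)
      fix b assume "lookup (c \<sigma>) b \<noteq> 0"
      note * = key[OF this]
      have "e - gdeg R i b - 2 * a = e - 2 * a - gdeg R i b" by simp
      then show "b \<in> gens R i \<and> gdeg R i b \<le> e - 2 * a \<and> lookup (c \<sigma>) b \<in> pgr V (e - 2 * a - gdeg R i b)"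
        using * B[of b] by (auto simp: lk)
    qed
    assume "c \<sigma> \<noteq> 0"
    then obtain b where "lookup (c \<sigma>) b \<noteq> 0" by (metis lookup_zero poly_mapping_eqI)
    from key[OF this] show "\<sigma> \<subseteq> V" "card \<sigma> = a" "2 * a \<le> e" by auto
  qed
  then show ?thesis using lk by (intro exI[of _ c] conjI allI)
qed

text \<open>Inherited from the polynomial ring, one basis element at a time. Only finitely many
  basis elements occur in a chain, since it is supported on the finitely many subsets of
  \<open>V\<close>.\<close>

lemma kexact_Fgr: "KF.kexact (Fgr V R i)"
  unfolding KF.kexact_def
proof (intro allI impI)
  fix a e c assume c: "c \<in> KF.Kc (Suc a) e (Fgr V R i)" and 0: "KF.kd c = 0"
  define B where "B = (\<Union>\<sigma>\<in>Pow V. keys (c \<sigma>))"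
  have fin: "finite B" using fin_V by (simp add: B_def)
  have B: "b \<in> gens R i \<and> gdeg R i b \<le> e" if "b \<in> B" for b
    using that Kc_component_0[OF c, of b] unfolding B_def by (auto simp: in_keys_iff not_less[symmetric])
  have "\<exists>c'. c' \<in> K.Kc (Suc (Suc a)) (e - gdeg R i b) (pgr V) \<and> (\<lambda>\<sigma>. lookup (c \<sigma>) b) = K.kd c'" for b
  proof -
    have "K.kd (\<lambda>\<sigma>. lookup (c \<sigma>) b) = 0"
    proof (rule ext)
      fix \<sigma> show "K.kd (\<lambda>\<sigma>. lookup (c \<sigma>) b) \<sigma> = 0 \<sigma>"
        using lookup_KF_kd[of c \<sigma> b] 0 by simp
    qed
    then show ?thesis using kexact_pgr Kc_component[OF c, of b] unfolding K.kexact_def by blast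
  qed
  then have "\<forall>b. \<exists>c'. c' \<in> K.Kc (Suc (Suc a)) (e - gdeg R i b) (pgr V) \<and> (\<lambda>\<sigma>. lookup (c \<sigma>) b) = K.kd c'"
    by (rule allI)
  then obtain cb where cb: "\<forall>b. cb b \<in> K.Kc (Suc (Suc a)) (e - gdeg R i b) (pgr V) \<and> (\<lambda>\<sigma>. lookup (c \<sigma>) b) = K.kd (cb b)"
    by (rule choice[THEN exE])
  have cb': "cb b \<in> K.Kc (Suc (Suc a)) (e - gdeg R i b) (pgr V)" if "b \<in> B" for b using cb by blast
  obtain c' where c'0: "c' \<in> KF.Kc (Suc (Suc a)) e (Fgr V R i) \<and>
    (\<forall>\<sigma> b. lookup (c' \<sigma>) b = (if b \<in> B then cb b \<sigma> else 0))"
    using Kc_glue[OF fin B cb'] by (rule exE)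
  note c' = c'0[THEN conjunct1] and lk = c'0[THEN conjunct2, rule_format]
  have "c = KF.kd c'"
  proof (rule ext, rule poly_mapping_eqI)
    fix \<sigma> b
    show "lookup (c \<sigma>) b = lookup (KF.kd c' \<sigma>) b"
    proof (cases "b \<in> B")
      case True
      have "K.kd (cb b) \<sigma> = lookup (c \<sigma>) b" using cb fun_cong[of "\<lambda>\<sigma>. lookup (c \<sigma>) b" "K.kd (cb b)" \<sigma>] by simp
      moreover have "(\<lambda>\<sigma>. lookup (c' \<sigma>) b) = cb b" using True by (auto simp: lk)
      ultimately show ?thesis by (simp add: lookup_KF_kd)
    next
      case False
      have "lookup (c \<sigma>) b = 0"
      proof (cases "\<sigma> \<subseteq> V")
        case True
        then show ?thesis using False by (auto simp: B_def in_keys_iff)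
      next
        case False
        then show ?thesis using KF.Kc_vanish[OF c] by simp
      qed
      moreover have "(\<lambda>\<sigma>. lookup (c' \<sigma>) b) = 0" using False by (auto simp: lk)
      then have "lookup (KF.kd c' \<sigma>) b = 0" unfolding lookup_KF_kd by (simp only: K.kd_zero zero_fun_apply)
      ultimately show ?thesis by simp
    qed
  qed
  then show "\<exists>c'\<in>KF.Kc (Suc (Suc a)) e (Fgr V R i). c = KF.kd c'" using c' by blast
qed

text \<open>\<open>p\<close> is regarded as a chain of exterior degree 0. The only multidegree there
  that cannot be contracted is the constant one, so the homotopy writes \<open>p\<close> as a
  combination of variable multiples.\<close>

lemma pgr_constant_free:
  assumes p: "p \<in> pgr V e" "lookup p 0 = 0"
  shows "\<exists>c\<in>K.Kc 1 e (pgr V). K.kd c {} = p"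
proof -
  define c :: "'v set \<Rightarrow> ('v, 'k) mpoly" where "c \<sigma> = (if \<sigma> = {} then p else 0)" for \<sigma>
  have c: "c \<in> K.Kc 0 e (pgr V)" using p submodD(1)[OF submod_pgr] by (auto simp: K.Kc_def c_def)
  define P :: "('v \<Rightarrow>\<^sub>0 nat) \<Rightarrow> bool" where "P a \<longleftrightarrow> keys a \<noteq> {} \<and> keys a \<subseteq> V" for a
  define pick :: "('v \<Rightarrow>\<^sub>0 nat) \<Rightarrow> 'v" where "pick a = (SOME v. v \<in> keys a)" for a
  have pick: "pick a \<in> V \<and> lookup a (pick a) \<ge> 1" if "P a" for a
  proof -
    have "\<exists>v. v \<in> keys a" using that unfolding P_def by blast
    then have "pick a \<in> keys a" unfolding pick_def by (rule someI_ex)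
    then show ?thesis using that by (auto simp: P_def in_keys_iff)
  qed
  have "htpy P pick c \<in> K.Kc (Suc 0) e (\<lambda>e. {p \<in> pgr V e. \<forall>t\<in>keys p. True})"
    by (rule htpy_Kc[OF c]) simp
  then have h: "htpy P pick c \<in> K.Kc 1 e (pgr V)" by simp
  have "K.kd (htpy P pick c) {} = p"
  proof (rule poly_mapping_eqI)
    fix t
    have "lookup (K.kd (htpy P pick c) {}) t = (if P (t + chi {}) then lookup (c {}) t else 0)"
      by (rule homotopy_poly[OF pick]) simp_all
    moreover have "P t" if "lookup p t \<noteq> 0"
    proof -
      have "t \<noteq> 0" using that p(2) by auto
      then show ?thesis using that p(1) by (auto simp: P_def pgr_def polys_def in_keys_iff)
    qed
    ultimately show "lookup (K.kd (htpy P pick c) {}) t = lookup p t" by (auto simp: chi_def c_def)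
  qed
  then show ?thesis using h by blast
qed

text \<open>Hence the quotient by multiples of the variables is read off from constant terms, which
  is how \<open>tor_bdry\<close> is formed.\<close>

lemma mprod_Fgr: "KF.mprod e (Fgr V R i) = {x \<in> Fgr V R i e. \<forall>b. lookup (lookup x b) 0 = 0}"
proof (intro equalityI subsetI)
  fix x assume "x \<in> KF.mprod e (Fgr V R i)"
  then obtain c where c: "c \<in> KF.Kc 1 e (Fgr V R i)" "x = KF.kd c {}" unfolding KF.mprod_def by blast
  have "KF.kd c \<in> KF.Kc 0 e (Fgr V R i)" using KF.kd_Kc[OF gsub_Fgr, of c 0] c(1) by simp
  then have "x \<in> Fgr V R i (e - 2 * 0)" unfolding c(2) KF.Kc_def by blast
  moreover have "lookup (lookup x b) 0 = 0" for b
    unfolding c(2) lookup_KF_kd lookup_kd mkd_def by simp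
  ultimately show "x \<in> {x \<in> Fgr V R i e. \<forall>b. lookup (lookup x b) 0 = 0}" by simp
next
  fix x assume "x \<in> {x \<in> Fgr V R i e. \<forall>b. lookup (lookup x b) 0 = 0}"
  then have x: "x \<in> Fgr V R i e" "\<And>b. lookup (lookup x b) 0 = 0" by auto
  have "\<forall>b. \<exists>c. b \<in> keys x \<longrightarrow> c \<in> K.Kc 1 (e - gdeg R i b) (pgr V) \<and> K.kd c {} = lookup x b"
  proof
    fix b
    show "\<exists>c. b \<in> keys x \<longrightarrow> c \<in> K.Kc 1 (e - gdeg R i b) (pgr V) \<and> K.kd c {} = lookup x b"
    proof (cases "b \<in> keys x")
      case True
      then have "lookup x b \<in> pgr V (e - gdeg R i b)" using Fgr_lookup(3)[OF x(1)] by (simp add: in_keys_iff)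
      from pgr_constant_free[OF this x(2)] show ?thesis by blast
    qed auto
  qed
  then obtain cb where cb: "\<forall>b. b \<in> keys x \<longrightarrow> cb b \<in> K.Kc 1 (e - gdeg R i b) (pgr V) \<and> K.kd (cb b) {} = lookup x b"
    by (rule choice[THEN exE])
  have B: "b \<in> gens R i \<and> gdeg R i b \<le> e" if "b \<in> keys x" for b
    using Fgr_lookup(1,2)[OF x(1), of b] that by (simp add: in_keys_iff)
  have cb': "cb b \<in> K.Kc 1 (e - gdeg R i b) (pgr V)" if "b \<in> keys x" for b using cb that by blast
  obtain c where c0: "c \<in> KF.Kc 1 e (Fgr V R i) \<and>
    (\<forall>\<sigma> b. lookup (c \<sigma>) b = (if b \<in> keys x then cb b \<sigma> else 0))"
    using Kc_glue[OF finite_keys B cb'] by (rule exE)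
  note c = c0[THEN conjunct1] and lk = c0[THEN conjunct2, rule_format]
  have "KF.kd c {} = x"
  proof (rule poly_mapping_eqI)
    fix b
    show "lookup (KF.kd c {}) b = lookup x b"
    proof (cases "b \<in> keys x")
      case True
      then have "(\<lambda>\<sigma>. lookup (c \<sigma>) b) = cb b" by (auto simp: lk)
      then show ?thesis using cb True by (simp add: lookup_KF_kd)
    next
      case False
      then have "(\<lambda>\<sigma>. lookup (c \<sigma>) b) = 0" by (auto simp: lk)
      then have "lookup (KF.kd c {}) b = 0" unfolding lookup_KF_kd by (simp only: K.kd_zero zero_fun_apply)
      then show ?thesis using False by (simp add: in_keys_iff)
    qed
  qed
  then show "x \<in> KF.mprod e (Fgr V R i)" using c unfolding KF.mprod_def by blast
qed

end

subsection \<open>Tor computed from an arbitrary resolution\<close>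

text \<open>Reduction modulo the variables; \<open>lft\<close> is its section by constant
  polynomials.\<close>

definition cst :: "(nat \<Rightarrow>\<^sub>0 ('v, 'k::comm_ring_1) mpoly) \<Rightarrow> (nat \<Rightarrow>\<^sub>0 'k)" where
  "cst x = Poly_Mapping.map (\<lambda>q. lookup q 0) x"

definition lft :: "(nat \<Rightarrow>\<^sub>0 'k::comm_ring_1) \<Rightarrow> (nat \<Rightarrow>\<^sub>0 ('v, 'k) mpoly)" where
  "lft y = Poly_Mapping.map (single 0) y"

lemma lookup_cst: "lookup (cst x) b = lookup (lookup x b) 0"
  by (simp add: cst_def lookup_map0)

lemma lookup_lft: "lookup (lft y) b = single 0 (lookup y b)"
  by (simp add: lft_def lookup_map0)

lemma cst_add: "cst (x + y) = cst x + cst y"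
  by (rule poly_mapping_eqI) (simp add: lookup_cst lookup_add)

lemma cst_diff: "cst (x - y) = cst x - cst y"
  by (rule poly_mapping_eqI) (simp add: lookup_cst lookup_minus)

lemma cst_kscl: "cst (kscl r x) = scale r (cst x)"
  by (rule poly_mapping_eqI) (simp add: lookup_cst lookup_kscl lookup_scale)

lemma cst_zero: "cst 0 = 0"
  by (rule poly_mapping_eqI) (simp add: lookup_cst)

lemma cst_lft: "cst (lft y) = y"
  by (rule poly_mapping_eqI) (simp add: lookup_cst lookup_lft)

lemma lookup_mult_0:
  fixes p q :: "('v, 'k::comm_ring_1) mpoly"
  shows "lookup (p * q) 0 = lookup p 0 * lookup q 0"
proof -
  define p' where "p' = p - single 0 (lookup p 0)"
  have p'0: "lookup p' 0 = 0" by (simp add: p'_def lookup_minus)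
  have "0 \<notin> keys (p' * q)"
  proof
    assume "0 \<in> keys (p' * q)"
    then obtain a b where ab: "0 = a + b" "a \<in> keys p'" using keys_mult[of p' q] by blast
    then have "a = 0" by (auto intro!: poly_mapping_eqI dest!: arg_cong[of _ _ lookup] simp: lookup_add fun_eq_iff)
    then show False using ab p'0 by (simp add: in_keys_iff)
  qed
  moreover have "p * q = single 0 (lookup p 0) * q + p' * q" by (simp add: p'_def algebra_simps)
  ultimately show ?thesis
    using lookup_single_mult[of 0 "lookup p 0" q 0] by (simp add: lookup_add in_keys_iff)
qed

text \<open>Taking constant terms is multiplicative, so reduction modulo the variables is a chain
  map.\<close>

lemma tor_bdry_cst: "tor_bdry R i (cst x) = cst (lin_ext (bdry R i) x)"
proof (rule poly_mapping_eqI)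
  fix c
  have "keys (cst x) \<subseteq> keys x" by (auto simp: in_keys_iff lookup_cst)
  then have "lookup (tor_bdry R i (cst x)) c =
      (\<Sum>b\<in>keys x. lookup (cst x) b * lookup (lookup (bdry R i b) c) 0)"
    unfolding tor_bdry_def
    by (subst lin_ext_superset[of "keys x"]) (auto simp: lookup_sum lookup_scale lookup_map0)
  then show "lookup (tor_bdry R i (cst x)) c = lookup (cst (lin_ext (bdry R i) x)) c"
    by (simp add: lookup_cst lookup_lin_ext lookup_sum lookup_mult_0)
qed

lemma cst_Fgr: "x \<in> Fgr V R i e \<Longrightarrow> cst x \<in> tor_chains R i e"
  unfolding tor_chains_def
proof (intro CollectI subsetI)
  fix b assume x: "x \<in> Fgr V R i e" and b: "b \<in> keys (cst x)"
  then have "0 \<in> keys (lookup x b)" by (simp add: in_keys_iff lookup_cst)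
  moreover have "\<forall>t\<in>keys (lookup x b). mon_degree t + gdeg R i b = e" using x by (simp add: Fgr_def)
  ultimately have "gdeg R i b = e" "lookup x b \<noteq> 0" by force+
  then show "b \<in> gens R i \<and> gdeg R i b = e" using Fgr_lookup(1)[OF x] by simp
qed

lemma lft_Fgr:
  assumes "y \<in> tor_chains R i e"
  shows "lft y \<in> Fgr V R i e"
proof (rule FgrI)
  fix b assume "lookup (lft y) b \<noteq> 0"
  then have "b \<in> keys y" by (auto simp: lookup_lft in_keys_iff)
  then have "b \<in> gens R i" "gdeg R i b = e" using assms by (auto simp: tor_chains_def)
  then show "b \<in> gens R i \<and> gdeg R i b \<le> e \<and> lookup (lft y) b \<in> pgr V (e - gdeg R i b)"
    by (auto simp: lookup_lft pgr_def polys_def split: if_splits)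
qed

locale resolved_complex = signed_complex V sg C
  for V :: "'v set" and sg :: "'v \<Rightarrow> 'v set \<Rightarrow> 'k::idom" and C :: "'v set set" +
  fixes R :: "('v, 'k) free_complex"
  assumes res: "graded_free_resolution V (SR_ideal V C) R"
begin

definition D :: "nat \<Rightarrow> (nat \<Rightarrow>\<^sub>0 ('v, 'k) mpoly) \<Rightarrow> (nat \<Rightarrow>\<^sub>0 ('v, 'k) mpoly)" where
  "D i = lin_ext (bdry R i)"

text \<open>The kernel of the map leaving \<open>R\<close> in degree \<open>i\<close>. Thus the free
  module in degree 0 modulo \<open>syz 0\<close> is the Stanley--Reisner ring, and the one in degree
  \<open>Suc i\<close> modulo \<open>syz (Suc i)\<close> is isomorphic to
  \<open>syz i\<close>.\<close>

definition syz :: "nat \<Rightarrow> (nat \<Rightarrow>\<^sub>0 ('v, 'k) mpoly) set" where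
  "syz i = (case i of 0 \<Rightarrow> {x \<in> free_mod V R 0. augm_ext R x \<in> SR_ideal V C}
     | Suc i' \<Rightarrow> {x \<in> free_mod V R (Suc i'). D i' x = 0})"

lemma augm_homogeneous:
  assumes "b \<in> gens R 0"
  shows "augm R b \<in> polys V" "t \<in> keys (augm R b) \<Longrightarrow> mon_degree t = gdeg R 0 b"
  using res assms unfolding graded_free_resolution_def by blast+

lemma bdry_homogeneous:
  assumes "b \<in> gens R (Suc i)"
  shows "bdry R i b \<in> free_mod V R i"
    "t \<in> keys (lookup (bdry R i b) c) \<Longrightarrow> mon_degree t + gdeg R i c = gdeg R (Suc i) b"
proof -
  note res' = res[unfolded graded_free_resolution_def, THEN conjunct2, THEN conjunct1, rule_format, OF assms]
  show "bdry R i b \<in> free_mod V R i" by (rule res'[THEN conjunct1])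
  show "t \<in> keys (lookup (bdry R i b) c) \<Longrightarrow> mon_degree t + gdeg R i c = gdeg R (Suc i) b"
    by (rule res'[THEN conjunct2, rule_format])
qed

lemma augm_surj: "f \<in> polys V \<Longrightarrow> \<exists>x\<in>free_mod V R 0. f - augm_ext R x \<in> SR_ideal V C"
  by (rule res[unfolded graded_free_resolution_def, THEN conjunct2, THEN conjunct2, THEN conjunct1, rule_format])

lemma syz_eq: "syz i = D i ` free_mod V R (Suc i)"
proof (cases i)
  case 0
  show ?thesis
    using res[unfolded graded_free_resolution_def, THEN conjunct2, THEN conjunct2, THEN conjunct2, THEN conjunct1]
    unfolding 0 syz_def D_def by simp
next
  case (Suc i')
  show ?thesis
    using res[unfolded graded_free_resolution_def, THEN conjunct2, THEN conjunct2, THEN conjunct2, THEN conjunct2,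
        rule_format, of i']
    unfolding Suc syz_def D_def by simp
qed

lemma D_add: "D i (x + y) = D i x + D i y"
  by (simp add: D_def lin_ext_add)

lemma D_diff: "D i (x - y) = D i x - D i y"
  by (simp add: D_def lin_ext_diff)

lemma D_scale: "D i (scale c x) = scale c (D i x)"
  by (simp add: D_def lin_ext_scale)

lemma D_kscl: "D i (kscl r x) = kscl r (D i x)"
  by (simp add: kscl_def D_scale)

lemma syz_subset: "syz i \<subseteq> free_mod V R i"
  by (cases i) (auto simp: syz_def)

lemma SR_iff: "f \<in> SR_ideal V C \<longleftrightarrow> f \<in> polys V \<and> (\<forall>t\<in>keys f. keys t \<notin> C)"
  using SR_ideal_iff[OF fin_V, of C f] down by blast

lemma SR_zero: "0 \<in> SR_ideal V C"
  by (simp add: SR_iff polys_zero)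

lemma SR_add: "f \<in> SR_ideal V C \<Longrightarrow> g \<in> SR_ideal V C \<Longrightarrow> f + g \<in> SR_ideal V C"
  using keys_add[of f g] by (auto simp: SR_iff polys_add)

lemma SR_mult:
  assumes p: "p \<in> polys V" and f: "f \<in> SR_ideal V C"
  shows "p * f \<in> SR_ideal V C"
  unfolding SR_iff
proof (intro conjI ballI)
  show "p * f \<in> polys V" using p f by (simp add: SR_iff polys_mult)
  fix t assume t: "t \<in> keys (p * f)"
  then obtain a b where "t = a + b" "b \<in> keys f" using keys_mult[of p f] by blast
  then show "keys t \<notin> C" using f down[of "keys t" "keys b"] by (auto simp: SR_iff keys_add_nat)
qed

definition syz_gr :: "nat \<Rightarrow> nat \<Rightarrow> (nat \<Rightarrow>\<^sub>0 ('v, 'k) mpoly) set" where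
  "syz_gr i e = Fgr V R i e \<inter> syz i"

lemma syz_zero: "0 \<in> syz i"
  by (cases i) (auto simp: syz_def free_mod_zero D_def lin_ext_zero augm_ext_def SR_zero)

lemma syz_add: "x \<in> syz i \<Longrightarrow> y \<in> syz i \<Longrightarrow> x + y \<in> syz i"
  by (cases i) (auto simp: syz_def submod_free_mod_add D_add augm_ext_add SR_add)

lemma syz_scale: "p \<in> polys V \<Longrightarrow> x \<in> syz i \<Longrightarrow> scale p x \<in> syz i"
  by (cases i) (auto simp: syz_def free_mod_scale D_scale augm_ext_scale SR_mult scale_zero_right)

lemma gsub_syz_gr: "KF.gsub (syz_gr i)"
  unfolding KF.gsub_def
proof (intro conjI allI ballI)
  fix e
  show "submod kscl (syz_gr i e)"
  proof (rule submodI)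
    note F = submodD[OF submod_Fgr]
    show "0 \<in> syz_gr i e" using F(1) syz_zero unfolding syz_gr_def by blast
    show "x + y \<in> syz_gr i e" if "x \<in> syz_gr i e" "y \<in> syz_gr i e" for x y
      using that F(2) syz_add unfolding syz_gr_def by blast
    show "kscl r x \<in> syz_gr i e" if x: "x \<in> syz_gr i e" for r x
    proof -
      have "single 0 r \<in> polys V" by (rule polys_single) simp
      then show ?thesis using x F(3)[of x _ _ _ _ r] syz_scale[of "single 0 r" x i] unfolding syz_gr_def kscl_def by blast
    qed
  qed
  fix v x assume v: "v \<in> V" and x: "x \<in> syz_gr i e"
  then show "scale (var v) x \<in> syz_gr i (e + 2)"
    using Fgr_var[OF v, of x R i e] syz_scale[OF polys_var[OF v], of x i] by (simp add: syz_gr_def)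
qed

lemma syz_gr_subset: "syz_gr i e \<subseteq> Fgr V R i e"
  by (simp add: syz_gr_def)

abbreviation hcomp :: "nat \<Rightarrow> nat \<Rightarrow> (nat \<Rightarrow>\<^sub>0 ('v, 'k) mpoly) \<Rightarrow> (nat \<Rightarrow>\<^sub>0 ('v, 'k) mpoly)" where
  "hcomp i \<equiv> gcomp (gdeg R i)"

lemma hcomp_Fgr:
  assumes "x \<in> free_mod V R i"
  shows "hcomp i e x \<in> Fgr V R i e"
  unfolding Fgr_def free_mod_def mem_Collect_eq
proof (intro conjI allI ballI subsetI)
  show "b \<in> gens R i" if "b \<in> keys (hcomp i e x)" for b
  proof -
    have "b \<in> keys x" using that keys_gcomp by blast
    then show ?thesis using assms by (auto simp: free_mod_def)
  qed
  show "lookup (hcomp i e x) b \<in> polys V" for b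
    using assms by (simp add: lookup_gcomp filt_polys free_mod_def)
  show "mon_degree t + gdeg R i b = e" if "t \<in> keys (lookup (hcomp i e x) b)" for b t
    using that by (simp add: lookup_gcomp keys_filt)
qed

lemma hcomp_id: "x \<in> Fgr V R i e \<Longrightarrow> hcomp i e x = x"
  by (rule poly_mapping_eqI, subst lookup_gcomp, rule filt_id) (auto simp: Fgr_def)

lemma D_hcomp:
  assumes x: "x \<in> free_mod V R (Suc i)"
  shows "D i (hcomp (Suc i) e x) = hcomp i e (D i x)"
  unfolding D_def
proof (rule lin_ext_gcomp)
  fix b c t assume "b \<in> keys x" and t: "t \<in> keys (lookup (bdry R i b) c)"
  then have "b \<in> gens R (Suc i)" using x by (auto simp: free_mod_def)
  from bdry_homogeneous(2)[OF this t] show "mon_degree t + gdeg R i c = gdeg R (Suc i) b" .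
qed

lemma augm_hcomp:
  assumes x: "x \<in> free_mod V R 0"
  shows "augm_ext R (hcomp 0 e x) = filt (\<lambda>t. mon_degree t + 0 = e) (augm_ext R x)"
proof -
  have k: "keys (hcomp 0 e x) \<subseteq> keys x" by (rule keys_gcomp)
  have "filt (\<lambda>t. mon_degree t + 0 = e) (augm_ext R x) =
      (\<Sum>b\<in>keys x. filt (\<lambda>t. mon_degree t + 0 = e) (lookup x b * augm R b))"
    by (simp only: augm_ext_def filt_sum)
  also have "\<dots> = (\<Sum>b\<in>keys x. lookup (hcomp 0 e x) b * augm R b)"
  proof (intro sum.cong refl)
    fix b assume "b \<in> keys x"
    then have "b \<in> gens R 0" using x by (auto simp: free_mod_def)
    then show "filt (\<lambda>t. mon_degree t + 0 = e) (lookup x b * augm R b) = lookup (hcomp 0 e x) b * augm R b"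
      unfolding lookup_gcomp by (intro filt_mult) (simp add: augm_homogeneous)
  qed
  also have "\<dots> = augm_ext R (hcomp 0 e x)" by (rule augm_ext_superset[OF _ k, symmetric]) simp
  finally show ?thesis by simp
qed

lemma D_into: "x \<in> Fgr V R (Suc i) e \<Longrightarrow> D i x \<in> syz_gr i e"
proof -
  assume x: "x \<in> Fgr V R (Suc i) e"
  then have xf: "x \<in> free_mod V R (Suc i)" by (simp add: Fgr_def)
  then have Z: "D i x \<in> syz i" by (auto simp: syz_eq)
  then have "D i x \<in> free_mod V R i" using syz_subset by blast
  from hcomp_Fgr[OF this, of e] have "hcomp i e (D i x) \<in> Fgr V R i e" .
  then show ?thesis using Z hcomp_id[OF x] D_hcomp[OF xf, of e] by (simp add: syz_gr_def)
qed

lemma D_kernel: "x \<in> Fgr V R (Suc i) e \<Longrightarrow> D i x = 0 \<longleftrightarrow> x \<in> syz_gr (Suc i) e"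
  by (auto simp: syz_gr_def syz_def Fgr_def)

text \<open>Exactness of a resolution is stated without reference to degrees; the homogeneous
  component of an arbitrary preimage is again a preimage of the homogeneous
  \<open>z\<close>.\<close>

lemma D_surj:
  assumes z: "z \<in> syz_gr i e"
  shows "\<exists>x\<in>Fgr V R (Suc i) e. D i x = z"
proof -
  obtain x where x: "x \<in> free_mod V R (Suc i)" "z = D i x" using z by (auto simp: syz_gr_def syz_eq)
  have "D i (hcomp (Suc i) e x) = z"
    using D_hcomp[OF x(1), of e] hcomp_id[of z i e] z x(2) by (simp add: syz_gr_def)
  then show ?thesis using hcomp_Fgr[OF x(1)] by blast
qed

lemma augm_into: "x \<in> Fgr V R 0 e \<Longrightarrow> augm_ext R x \<in> pgr V e"
proof -
  assume x: "x \<in> Fgr V R 0 e"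
  then have xf: "x \<in> free_mod V R 0" by (simp add: Fgr_def)
  have eq: "augm_ext R x = filt (\<lambda>t. mon_degree t + 0 = e) (augm_ext R x)"
    using augm_hcomp[OF xf, of e] hcomp_id[OF x] by simp
  have "augm_ext R x \<in> polys V"
    unfolding augm_ext_def
    by (intro polys_sum polys_mult augm_homogeneous(1)) (use xf in \<open>auto simp: free_mod_def\<close>)
  moreover have "mon_degree t = e" if "t \<in> keys (augm_ext R x)" for t
  proof -
    have "t \<in> keys (filt (\<lambda>t. mon_degree t + 0 = e) (augm_ext R x))" using that eq by simp
    then show ?thesis unfolding keys_filt by simp
  qed
  ultimately show ?thesis by (simp add: pgr_def)
qed

lemma augm_kernel: "x \<in> Fgr V R 0 e \<Longrightarrow> augm_ext R x \<in> Igr e \<longleftrightarrow> x \<in> syz_gr 0 e"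
  using augm_into[of x e] by (auto simp: syz_gr_def syz_def Fgr_def Igr_eq)

lemma augm_surj_gr:
  assumes y: "y \<in> pgr V e"
  shows "\<exists>x\<in>Fgr V R 0 e. y - augm_ext R x \<in> Igr e"
proof -
  obtain x where x: "x \<in> free_mod V R 0" "y - augm_ext R x \<in> SR_ideal V C"
    using augm_surj[of y] y by (auto simp: pgr_def)
  have "y = filt (\<lambda>t. mon_degree t + 0 = e) y" using y by (intro filt_id[symmetric]) (simp add: pgr_def)
  then have eq: "y - augm_ext R (hcomp 0 e x) = filt (\<lambda>t. mon_degree t + 0 = e) (y - augm_ext R x)"
    unfolding augm_hcomp[OF x(1)] filt_diff by simp
  have "filt (\<lambda>t. mon_degree t + 0 = e) (y - augm_ext R x) \<in> Igr e"
    using x(2) by (auto simp: Igr_def pgr_def SR_iff keys_filt filt_polys)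
  then show ?thesis using hcomp_Fgr[OF x(1), of e] unfolding eq[symmetric] by blast
qed

text \<open>The augmentation identifies the Stanley--Reisner ring with the first free module modulo
  its syzygies, degree by degree.\<close>

lemma kh_augm: "K.kh a e (pgr V) Igr = KF.kh a e (Fgr V R 0) (syz_gr 0)"
proof (rule kh_iso[OF KF.koszul_axioms K.koszul_axioms, symmetric, where \<phi> = "augm_ext R"])
  show "KF.gsub (Fgr V R 0)" "KF.gsub (syz_gr 0)" "K.gsub (pgr V)" "K.gsub Igr"
    by (rule gsub_Fgr gsub_syz_gr gsub_pgr gsub_Igr)+
  show "syz_gr 0 e \<subseteq> Fgr V R 0 e" "Igr e \<subseteq> pgr V e" for e by (rule syz_gr_subset Igr_subset)+
  show "augm_ext R (x + y) = augm_ext R x + augm_ext R y" for x y by (rule augm_ext_add)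
  show "augm_ext R (kscl r x) = scale r (augm_ext R x)" for r x
    by (simp add: kscl_def augm_ext_scale scale_mpoly)
  show "augm_ext R (scale (var v) x) = var v * augm_ext R x" for v x by (rule augm_ext_scale)
  show "augm_ext R x \<in> pgr V e" if "x \<in> Fgr V R 0 e" for e x by (rule augm_into[OF that])
  show "augm_ext R x \<in> Igr e \<longleftrightarrow> x \<in> syz_gr 0 e" if "x \<in> Fgr V R 0 e" for e x by (rule augm_kernel[OF that])
  show "\<exists>x\<in>Fgr V R 0 e. y - augm_ext R x \<in> Igr e" if "y \<in> pgr V e" for e y by (rule augm_surj_gr[OF that])
qed

text \<open>Dimension shifting: the Koszul homology of a module equals that of its syzygies, one degree lower.\<close>

lemma kh_step: "KF.kh (Suc (Suc a)) e (Fgr V R i) (syz_gr i) = KF.kh (Suc a) e (Fgr V R (Suc i)) (syz_gr (Suc i))"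
proof -
  have "KF.kh (Suc (Suc a)) e (Fgr V R i) (syz_gr i) = KF.kh (Suc a) e (syz_gr i) (\<lambda>_. {0})"
    by (rule KF.kh_shift[OF gsub_Fgr gsub_syz_gr syz_gr_subset kexact_Fgr])
  also have "\<dots> = KF.kh (Suc a) e (Fgr V R (Suc i)) (syz_gr (Suc i))"
  proof (rule kh_iso[OF KF.koszul_axioms KF.koszul_axioms, symmetric, where \<phi> = "D i"])
    show "KF.gsub (Fgr V R (Suc i))" "KF.gsub (syz_gr (Suc i))" "KF.gsub (syz_gr i)" "KF.gsub (\<lambda>_. {0})"
      by (rule gsub_Fgr gsub_syz_gr KF.gsub_zero)+
    show "syz_gr (Suc i) e \<subseteq> Fgr V R (Suc i) e" for e by (rule syz_gr_subset)
    show "{0} \<subseteq> syz_gr i e" for e using submodD(1) gsub_syz_gr[of i] unfolding KF.gsub_def by auto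
    show "D i (x + y) = D i x + D i y" for x y by (rule D_add)
    show "D i (kscl r x) = kscl r (D i x)" for r x by (rule D_kscl)
    show "D i (scale (var v) x) = scale (var v) (D i x)" for v x by (rule D_scale)
    show "D i x \<in> syz_gr i e" if "x \<in> Fgr V R (Suc i) e" for e x by (rule D_into[OF that])
    show "D i x \<in> {0} \<longleftrightarrow> x \<in> syz_gr (Suc i) e" if "x \<in> Fgr V R (Suc i) e" for e x using D_kernel[OF that] by simp
    show "\<exists>x\<in>Fgr V R (Suc i) e. y - D i x \<in> {0}" if "y \<in> syz_gr i e" for e y using D_surj[OF that] by force
  qed
  finally show ?thesis .
qed

text \<open>Each step trades one exterior degree for one step of the resolution; the exterior degree
  stays positive, as \<open>kh_step\<close> demands.\<close>

lemma kh_steps: "KF.kh (Suc (a + i)) e (Fgr V R 0) (syz_gr 0) = KF.kh (Suc a) e (Fgr V R i) (syz_gr i)"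
proof (induction i arbitrary: a)
  case (Suc i)
  have "KF.kh (Suc (a + Suc i)) e (Fgr V R 0) (syz_gr 0) = KF.kh (Suc (Suc a + i)) e (Fgr V R 0) (syz_gr 0)" by simp
  also have "\<dots> = KF.kh (Suc (Suc a)) e (Fgr V R i) (syz_gr i)" by (rule Suc.IH)
  also have "\<dots> = KF.kh (Suc a) e (Fgr V R (Suc i)) (syz_gr (Suc i))" by (rule kh_step)
  finally show ?case .
qed simp

lemma mprod_iff: "x \<in> Fgr V R i e \<Longrightarrow> x \<in> KF.mprod e (Fgr V R i) \<longleftrightarrow> cst x = 0"
  by (auto simp: mprod_Fgr poly_mapping_eq_iff fun_eq_iff lookup_cst)

lemma kd_D: "KF.kd (\<lambda>\<sigma>. D i (c \<sigma>)) \<sigma> = D i (KF.kd c \<sigma>)"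
  unfolding KF.kd_def
  by (subst additive_sum[of "D i", OF D_add]) (simp only: D_kscl D_scale)

text \<open>Multiples of variables in the syzygies lift through \<open>D i\<close>, which is onto
  them and commutes with the variables.\<close>

lemma mprod_syz_gr: "KF.mprod e (syz_gr i) = D i ` KF.mprod e (Fgr V R (Suc i))"
proof (intro equalityI subsetI)
  fix z assume "z \<in> KF.mprod e (syz_gr i)"
  then obtain c where c: "c \<in> KF.Kc 1 e (syz_gr i)" "z = KF.kd c {}" unfolding KF.mprod_def by blast
  have "\<forall>\<sigma>. \<exists>x. x \<in> Fgr V R (Suc i) (e - 2 * 1) \<and> D i x = c \<sigma> \<and> (c \<sigma> = 0 \<longrightarrow> x = 0)"
  proof
    fix \<sigma>
    show "\<exists>x. x \<in> Fgr V R (Suc i) (e - 2 * 1) \<and> D i x = c \<sigma> \<and> (c \<sigma> = 0 \<longrightarrow> x = 0)"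
    proof (cases "c \<sigma> = 0")
      case True
      then show ?thesis using submodD(1)[OF submod_Fgr] by (intro exI[of _ 0]) (simp add: D_def lin_ext_zero)
    next
      case False
      have "c \<sigma> \<in> syz_gr i (e - 2 * 1)" using c(1) unfolding KF.Kc_def by blast
      from D_surj[OF this] show ?thesis using False by blast
    qed
  qed
  then obtain c' where c': "\<forall>\<sigma>. c' \<sigma> \<in> Fgr V R (Suc i) (e - 2 * 1) \<and> D i (c' \<sigma>) = c \<sigma> \<and> (c \<sigma> = 0 \<longrightarrow> c' \<sigma> = 0)"
    by (rule choice[THEN exE])
  have "c' \<in> KF.Kc 1 e (Fgr V R (Suc i))" using c' c(1) unfolding KF.Kc_def by blast
  moreover have "D i (KF.kd c' {}) = z"
    using kd_D[of i c' "{}"] c' c(2) by simp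
  ultimately show "z \<in> D i ` KF.mprod e (Fgr V R (Suc i))" unfolding KF.mprod_def by blast
next
  fix z assume "z \<in> D i ` KF.mprod e (Fgr V R (Suc i))"
  then obtain c where c: "c \<in> KF.Kc 1 e (Fgr V R (Suc i))" "z = D i (KF.kd c {})" unfolding KF.mprod_def by blast
  have D0: "D i 0 = 0" by (simp add: D_def lin_ext_zero)
  have "(\<lambda>\<sigma>. D i (c \<sigma>)) \<in> KF.Kc 1 e (syz_gr i)"
    unfolding KF.Kc_def mem_Collect_eq
  proof (intro allI conjI impI)
    fix \<sigma>
    have "c \<sigma> \<in> Fgr V R (Suc i) (e - 2 * 1)" using c(1) unfolding KF.Kc_def by blast
    then show "D i (c \<sigma>) \<in> syz_gr i (e - 2 * 1)" by (rule D_into)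
    assume "D i (c \<sigma>) \<noteq> 0"
    then have "c \<sigma> \<noteq> 0" using D0 by auto
    then show "\<sigma> \<subseteq> V" "card \<sigma> = 1" "2 * 1 \<le> e" using c(1) unfolding KF.Kc_def by blast+
  qed
  moreover have "z = KF.kd (\<lambda>\<sigma>. D i (c \<sigma>)) {}" using kd_D[of i c "{}"] c(2) by simp
  ultimately show "z \<in> KF.mprod e (syz_gr i)" unfolding KF.mprod_def by blast
qed

lemma tor_boundaries_iff: "y \<in> tor_boundaries R i e \<longleftrightarrow> (\<exists>w\<in>Fgr V R (Suc i) e. y = cst (D i w))"
proof
  assume "y \<in> tor_boundaries R i e"
  then obtain w where w: "w \<in> tor_chains R (Suc i) e" "y = tor_bdry R i w" by (auto simp: tor_boundaries_def)
  have "y = cst (D i (lft w))" using tor_bdry_cst[of R i "lft w"] w(2) by (simp add: cst_lft D_def)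
  then show "\<exists>w\<in>Fgr V R (Suc i) e. y = cst (D i w)" using lft_Fgr[OF w(1), of V] by blast
next
  assume "\<exists>w\<in>Fgr V R (Suc i) e. y = cst (D i w)"
  then obtain w where w: "w \<in> Fgr V R (Suc i) e" "y = cst (D i w)" by blast
  then have "y = tor_bdry R i (cst w)" by (simp add: tor_bdry_cst D_def)
  then show "y \<in> tor_boundaries R i e" using cst_Fgr[OF w(1)] by (auto simp: tor_boundaries_def)
qed

lemma submod_tor_chains: "submod scale (tor_chains R i e)"
  by (rule submodI) (use keys_add keys_scale_subset in \<open>fastforce simp: tor_chains_def\<close>)+

lemma tor_bdry_add: "tor_bdry R i (x + y) = tor_bdry R i x + tor_bdry R i y"
  by (simp add: tor_bdry_def lin_ext_add)

lemma tor_bdry_scale: "tor_bdry R i (scale r x) = scale r (tor_bdry R i x)"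
  by (simp add: tor_bdry_def lin_ext_scale)

lemma submod_tor_cycles: "submod scale (tor_cycles R i e)"
proof (rule submodI)
  note T = submodD[OF submod_tor_chains]
  show "0 \<in> tor_cycles R i e"
    using T(1) by (auto simp: tor_cycles_def tor_bdry_def lin_ext_zero split: nat.split)
  show "x + y \<in> tor_cycles R i e" if "x \<in> tor_cycles R i e" "y \<in> tor_cycles R i e" for x y
    using that T(2) by (auto simp: tor_cycles_def tor_bdry_add split: nat.splits)
  show "scale r x \<in> tor_cycles R i e" if "x \<in> tor_cycles R i e" for r x
    using that T(3) by (auto simp: tor_cycles_def tor_bdry_scale scale_zero_right split: nat.splits)
qed

lemma zero_tor_boundaries: "0 \<in> tor_boundaries R i e"
proof -
  have "0 = cst (D i 0)" by (simp add: D_def lin_ext_zero cst_zero)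
  then show ?thesis unfolding tor_boundaries_iff using submodD(1)[OF submod_Fgr] by blast
qed

text \<open>For the ideal \<open>m\<close> generated by the variables, \<open>Tor\<close> in degree \<open>i + 1\<close> is \<open>(Z\<^sub>i \<inter> m F\<^sub>i) / m Z\<^sub>i\<close>, which is also
  the first Koszul homology of \<open>F\<^sub>i / Z\<^sub>i\<close>.\<close>

lemma tor_rank_Suc: "mrank kscl (syz_gr i e \<inter> KF.mprod e (Fgr V R i)) (KF.mprod e (syz_gr i)) =
    mrank scale (tor_cycles R (Suc i) e) (tor_boundaries R (Suc i) e)"
\<comment> \<open>Neither side maps to the other directly; they are related through a homogeneous
  element \<open>x\<close> with boundary \<open>z\<close> and constant part
  \<open>y\<close>.\<close>
proof (rule quot_iso_rel_mrank[OF kmodule_kscl kmodule_scale,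
      where \<rho> = "\<lambda>z y. \<exists>x\<in>Fgr V R (Suc i) e. z = D i x \<and> y = cst x"])
  let ?F = "Fgr V R (Suc i) e"
  note F = submodD[OF submod_Fgr[of V R "Suc i" e]]
  show "quot_iso_rel kscl scale (syz_gr i e \<inter> KF.mprod e (Fgr V R i)) (KF.mprod e (syz_gr i))
     (tor_cycles R (Suc i) e) (tor_boundaries R (Suc i) e) (\<lambda>z y. \<exists>x\<in>?F. z = D i x \<and> y = cst x)"
    unfolding quot_iso_rel_def
  proof (intro conjI allI impI ballI)
    show "submod kscl (syz_gr i e \<inter> KF.mprod e (Fgr V R i))"
    proof -
      have "submod kscl (syz_gr i e)" using gsub_syz_gr unfolding KF.gsub_def by blast
      then show ?thesis using KF.submod_mprod[OF gsub_Fgr, of e R i] unfolding submod_def by blast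
    qed
    show "submod scale (tor_cycles R (Suc i) e)" by (rule submod_tor_cycles)
    show "0 \<in> KF.mprod e (syz_gr i)" by (rule submodD(1)[OF KF.submod_mprod[OF gsub_syz_gr]])
    show "0 \<in> tor_boundaries R (Suc i) e" by (rule zero_tor_boundaries)
    show "\<exists>x\<in>?F. 0 = D i x \<and> 0 = cst x"
      using F(1) by (intro bexI[of _ 0]) (simp_all add: D_def lin_ext_zero cst_zero)
    show "\<exists>x\<in>?F. z + z' = D i x \<and> y + y' = cst x"
      if "\<exists>x\<in>?F. z = D i x \<and> y = cst x" "\<exists>x\<in>?F. z' = D i x \<and> y' = cst x" for z y z' y'
      using that F(2) D_add cst_add by metis
    show "\<exists>x\<in>?F. kscl r z = D i x \<and> scale r y = cst x" if "\<exists>x\<in>?F. z = D i x \<and> y = cst x" for r z y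
      using that F(3) D_kscl cst_kscl by metis
    show "\<exists>y\<in>tor_cycles R (Suc i) e. \<exists>x\<in>?F. z = D i x \<and> y = cst x"
      if z: "z \<in> syz_gr i e \<inter> KF.mprod e (Fgr V R i)" for z
    proof -
      obtain x where x: "x \<in> ?F" "D i x = z" using D_surj[of z i e] z by blast
      have "cst z = 0" using z mprod_iff[of z i e] syz_gr_subset by blast
      then have "cst x \<in> tor_cycles R (Suc i) e"
        using cst_Fgr[OF x(1)] x(2) by (simp add: tor_cycles_def tor_bdry_cst D_def)
      then show ?thesis using x by blast
    qed
    show "\<exists>z\<in>syz_gr i e \<inter> KF.mprod e (Fgr V R i). \<exists>x\<in>?F. z = D i x \<and> y = cst x"
      if y: "y \<in> tor_cycles R (Suc i) e" for y
    proof -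
      have y': "y \<in> tor_chains R (Suc i) e" "tor_bdry R i y = 0" using y by (auto simp: tor_cycles_def)
      define x where "x = (lft y :: nat \<Rightarrow>\<^sub>0 ('v, 'k) mpoly)"
      have x: "x \<in> ?F" unfolding x_def by (rule lft_Fgr[OF y'(1)])
      have cx: "cst x = y" by (simp add: x_def cst_lft)
      have Z: "D i x \<in> syz_gr i e" by (rule D_into[OF x])
      have "cst (D i x) = 0" using tor_bdry_cst[of R i x] y'(2) cx by (simp add: D_def)
      then have "D i x \<in> KF.mprod e (Fgr V R i)" using mprod_iff[of "D i x" i e] Z syz_gr_subset by blast
      then show ?thesis using Z x cx by blast
    qed
    show "z \<in> KF.mprod e (syz_gr i) \<longleftrightarrow> y \<in> tor_boundaries R (Suc i) e"
      if \<rho>: "\<exists>x\<in>?F. z = D i x \<and> y = cst x" for z y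
    proof -
      obtain x where x: "x \<in> ?F" "z = D i x" "y = cst x" using \<rho> by blast
      show ?thesis
      proof
        assume "z \<in> KF.mprod e (syz_gr i)"
        then obtain u where u: "u \<in> KF.mprod e (Fgr V R (Suc i))" "z = D i u" unfolding mprod_syz_gr by blast
        then have uF: "u \<in> ?F" "cst u = 0" using mprod_iff[of u "Suc i" e] by (auto simp: mprod_Fgr)
        \<comment> \<open>Since \<open>u\<close> has no constant terms, \<open>x - u\<close> is a
          syzygy with the same constant part as \<open>x\<close>, and exactness makes it a
          boundary.\<close>
        have "x - u \<in> ?F" by (rule kmodule.submod_diff[OF kmodule_kscl submod_Fgr x(1) uF(1)])
        moreover have "D i (x - u) = 0" using x(2) u(2) by (simp add: D_diff)
        ultimately have "x - u \<in> syz_gr (Suc i) e" using D_kernel by blast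
        from D_surj[OF this] obtain w where w: "w \<in> Fgr V R (Suc (Suc i)) e" "D (Suc i) w = x - u" by blast
        have "cst (D (Suc i) w) = y" using w(2) uF(2) x(3) by (simp add: cst_diff)
        then show "y \<in> tor_boundaries R (Suc i) e" unfolding tor_boundaries_iff using w(1) by blast
      next
        assume "y \<in> tor_boundaries R (Suc i) e"
        then obtain w where w: "w \<in> Fgr V R (Suc (Suc i)) e" "y = cst (D (Suc i) w)"
          unfolding tor_boundaries_iff by blast
        have Dw: "D (Suc i) w \<in> syz_gr (Suc i) e" by (rule D_into[OF w(1)])
        then have DwF: "D (Suc i) w \<in> ?F" using syz_gr_subset by blast
        have xw: "x - D (Suc i) w \<in> ?F" by (rule kmodule.submod_diff[OF kmodule_kscl submod_Fgr x(1) DwF])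
        have "cst (x - D (Suc i) w) = 0" using w(2) x(3) by (simp add: cst_diff)
        then have "x - D (Suc i) w \<in> KF.mprod e (Fgr V R (Suc i))" using mprod_iff[OF xw] by simp
        moreover have "D i (x - D (Suc i) w) = z" using Dw D_kernel[OF DwF] x(2) by (simp add: D_diff)
        ultimately show "z \<in> KF.mprod e (syz_gr i)" unfolding mprod_syz_gr by blast
      qed
    qed
  qed
qed

text \<open>Both sides describe the first free module modulo its syzygies and multiples of
  variables; a chain of exterior degree 0 is determined by its value at the empty set.\<close>

lemma tor_rank_0: "KF.kh 0 e (Fgr V R 0) (syz_gr 0) = mrank scale (tor_cycles R 0 e) (tor_boundaries R 0 e)"
  unfolding KF.kh_def
proof (rule quot_iso_rel_mrank[OF KF.kmodule_cscl kmodule_scale, where \<rho> = "\<lambda>c y. y = cst (c {})"])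
  let ?F = "Fgr V R 0 e"
  show "quot_iso_rel KF.cscl scale (KF.Zk 0 e (Fgr V R 0) (syz_gr 0)) (KF.Bk 0 e (Fgr V R 0) (syz_gr 0))
     (tor_cycles R 0 e) (tor_boundaries R 0 e) (\<lambda>c y. y = cst (c {}))"
    unfolding quot_iso_rel_def
  proof (intro conjI allI impI ballI)
    show "submod KF.cscl (KF.Zk 0 e (Fgr V R 0) (syz_gr 0))" "0 \<in> KF.Bk 0 e (Fgr V R 0) (syz_gr 0)"
      by (intro KF.submod_Zk KF.zero_Bk gsub_Fgr gsub_syz_gr)+
    show "submod scale (tor_cycles R 0 e)" by (rule submod_tor_cycles)
    show "0 \<in> tor_boundaries R 0 e" by (rule zero_tor_boundaries)
    show "0 = cst ((0 :: 'v set \<Rightarrow> nat \<Rightarrow>\<^sub>0 ('v, 'k) mpoly) {})" by (simp add: cst_zero)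
    show "y + y' = cst ((c + c') {})" if "y = cst (c {})" "y' = cst (c' {})"
      for y y' and c c' :: "'v set \<Rightarrow> nat \<Rightarrow>\<^sub>0 ('v, 'k) mpoly"
      using that by (simp add: cst_add)
    show "scale r y = cst (KF.cscl r c {})" if "y = cst (c {})" for r y c
      using that by (simp add: KF.cscl_def cst_kscl)
    have KcF: "c {} \<in> ?F" if "c \<in> KF.Kc 0 e (Fgr V R 0)" for c
    proof -
      have "c {} \<in> Fgr V R 0 (e - 2 * 0)" using that unfolding KF.Kc_def by blast
      then show ?thesis by simp
    qed
    show "\<exists>y\<in>tor_cycles R 0 e. y = cst (c {})" if c: "c \<in> KF.Zk 0 e (Fgr V R 0) (syz_gr 0)" for c
      using c KcF[of c] cst_Fgr[of "c {}" V R 0 e] by (simp add: KF.Zk_def tor_cycles_def)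
    have mk: "(\<lambda>\<sigma>. if \<sigma> = {} then x else 0) \<in> KF.Kc 0 e M" if "x \<in> M e" "KF.gsub M" for x M
      using that submodD(1) unfolding KF.gsub_def KF.Kc_def by auto
    show "\<exists>c\<in>KF.Zk 0 e (Fgr V R 0) (syz_gr 0). y = cst (c {})" if y: "y \<in> tor_cycles R 0 e" for y
    proof -
      have "lft y \<in> ?F" using y by (intro lft_Fgr) (simp add: tor_cycles_def)
      note c = mk[of "lft y" "Fgr V R 0", OF this gsub_Fgr]
      have "KF.kd (\<lambda>\<sigma>. if \<sigma> = {} then lft y else 0) \<in> KF.Kc (0 - 1) e (syz_gr 0)"
        unfolding KF.kd_Kc_0[OF c] by (rule submodD(1)[OF KF.submod_Kc[OF gsub_syz_gr]])
      then have "(\<lambda>\<sigma>. if \<sigma> = {} then lft y else 0) \<in> KF.Zk 0 e (Fgr V R 0) (syz_gr 0)"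
        using c unfolding KF.Zk_def by blast
      then show ?thesis by (rule bexI[rotated]) (simp add: cst_lft)
    qed
    show "c \<in> KF.Bk 0 e (Fgr V R 0) (syz_gr 0) \<longleftrightarrow> y \<in> tor_boundaries R 0 e"
      if c: "c \<in> KF.Zk 0 e (Fgr V R 0) (syz_gr 0)" and y: "y = cst (c {})" for c y
    proof
      assume "c \<in> KF.Bk 0 e (Fgr V R 0) (syz_gr 0)"
      then obtain b n where b: "b \<in> KF.Kc (Suc 0) e (Fgr V R 0)" "n \<in> KF.Kc 0 e (syz_gr 0)" "c = KF.kd b + n"
        unfolding KF.Bk_def by blast
      have "KF.kd b {} \<in> KF.mprod e (Fgr V R 0)" using b(1) unfolding KF.mprod_def by auto
      then have "cst (KF.kd b {}) = 0" using mprod_iff[of "KF.kd b {}" 0 e] by (auto simp: mprod_Fgr)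
      then have yn: "y = cst (n {})" by (simp add: y b(3) cst_add)
      have "n {} \<in> syz_gr 0 (e - 2 * 0)" using b(2) unfolding KF.Kc_def by blast
      then have "n {} \<in> syz_gr 0 e" by simp
      from D_surj[OF this] show "y \<in> tor_boundaries R 0 e" unfolding tor_boundaries_iff yn by metis
    next
      assume "y \<in> tor_boundaries R 0 e"
      then obtain w where w: "w \<in> Fgr V R (Suc 0) e" "y = cst (D 0 w)" unfolding tor_boundaries_iff by blast
      have Dw: "D 0 w \<in> syz_gr 0 e" by (rule D_into[OF w(1)])
      have cK: "c \<in> KF.Kc 0 e (Fgr V R 0)" using c by (simp add: KF.Zk_def)
      have DwF: "D 0 w \<in> ?F" using Dw syz_gr_subset by blast
      have "c {} - D 0 w \<in> ?F" by (rule kmodule.submod_diff[OF kmodule_kscl submod_Fgr KcF[OF cK] DwF])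
      moreover have "cst (c {} - D 0 w) = 0" using w(2) y by (simp add: cst_diff)
      ultimately have "c {} - D 0 w \<in> KF.mprod e (Fgr V R 0)" using mprod_iff by blast
      then obtain b where b: "b \<in> KF.Kc 1 e (Fgr V R 0)" "c {} - D 0 w = KF.kd b {}" unfolding KF.mprod_def by blast
      define n where "n \<sigma> = (if \<sigma> = {} then D 0 w else 0)" for \<sigma> :: "'v set"
      have n: "n \<in> KF.Kc 0 e (syz_gr 0)" unfolding n_def by (rule mk[of _ "syz_gr 0", OF Dw gsub_syz_gr])
      have nF: "n \<in> KF.Kc 0 e (Fgr V R 0)" using n KF.Kc_mono[of "syz_gr 0" "Fgr V R 0", OF syz_gr_subset] by blast
      have kb: "KF.kd b \<in> KF.Kc 0 e (Fgr V R 0)" using KF.kd_Kc[OF gsub_Fgr, of b 0] b(1) by simp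
      have "c - (KF.kd b + n) \<in> KF.Kc 0 e (Fgr V R 0)"
        by (rule kmodule.submod_diff[OF KF.kmodule_cscl KF.submod_Kc[OF gsub_Fgr] cK
              submodD(2)[OF KF.submod_Kc[OF gsub_Fgr] kb nF]])
      moreover have "(c - (KF.kd b + n)) {} = 0"
        using b(2) by (simp add: fun_diff_def n_def algebra_simps)
      ultimately have "c - (KF.kd b + n) = 0" by (rule KF.Kc_0_eqI)
      then have "c = KF.kd b + n" by (simp only: right_minus_eq)
      then show "c \<in> KF.Bk 0 e (Fgr V R 0) (syz_gr 0)" unfolding KF.Bk_def using b(1) n by auto
    qed
  qed
qed

theorem tor_eq_koszul:
  "subquotient_rank (tor_cycles R i e) (tor_boundaries R i e) = K.kh i e (pgr V) Igr"
proof (cases i)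
  case 0
  then show ?thesis by (simp add: subquotient_rank_eq_mrank kh_augm tor_rank_0)
next
  case (Suc i')
  have "K.kh i e (pgr V) Igr = KF.kh (Suc (0 + i')) e (Fgr V R 0) (syz_gr 0)" using Suc by (simp add: kh_augm)
  also have "\<dots> = KF.kh (Suc 0) e (Fgr V R i') (syz_gr i')" by (rule kh_steps)
  also have "\<dots> = mrank kscl (syz_gr i' e \<inter> KF.mprod e (Fgr V R i')) (KF.mprod e (syz_gr i'))"
    using KF.kh_one[OF gsub_Fgr[of R i'] gsub_syz_gr[of i'] syz_gr_subset kexact_Fgr] by simp
  also have "\<dots> = mrank scale (tor_cycles R i e) (tor_boundaries R i e)" unfolding Suc by (rule tor_rank_Suc)
  finally show ?thesis by (simp add: subquotient_rank_eq_mrank)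
qed

end

subsection \<open>Existence of graded free resolutions over countable coefficients\<close>

text \<open>The solutions of equations \<open>b x = a\<close> with integers \<open>a\<close> and
  \<open>b\<close>, where \<open>b\<close> is nonzero in the field, form a subfield and hence
  exhaust the field. Each equation has at most one solution, so countably many elements arise,
  whatever the characteristic.\<close>

lemma countable_prime_field:
  assumes "prime_field TYPE('k::idom)"
  shows "countable (UNIV :: 'k set)"
proof -
  define Q where "Q = {x :: 'k. \<exists>a b. of_int b \<noteq> (0 :: 'k) \<and> of_int b * x = of_int a}"
  have QI: "x \<in> Q" if "of_int b * x = of_int a" "of_int b \<noteq> (0 :: 'k)" for x a b
    unfolding Q_def mem_Collect_eq by (intro exI[of _ a] exI[of _ b] conjI that)
  have fld: "field (class_ring :: 'k ring)" using assms by (simp add: prime_field_def)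
  have rng: "ring (class_ring :: 'k ring)"
    by (rule cring.axioms(1)[OF domain.axioms(1)[OF field.axioms(1)[OF fld]]])
  have "subfield Q (class_ring :: 'k ring)"
  proof (rule field.subfieldI'[OF fld])
    show "subring Q (class_ring :: 'k ring)"
    proof (rule ring.subringI[OF rng])
      show "Q \<subseteq> carrier class_ring" by simp
      have "of_int 1 \<noteq> (0::'k) \<and> of_int 1 * (1::'k) = of_int 1" by simp
      then show "\<one>\<^bsub>class_ring\<^esub> \<in> Q" unfolding Q_def by (metis (mono_tags, lifting) mem_Collect_eq monoid.simps(2))
      show "\<ominus>\<^bsub>class_ring\<^esub> h \<in> Q" if h: "h \<in> Q" for h
      proof -
        obtain a b where ab: "of_int b \<noteq> (0::'k)" "of_int b * h = of_int a" using h by (auto simp: Q_def)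
        have "\<ominus>\<^bsub>class_ring\<^esub> h = - h" by (simp add: class_ring_simps)
        moreover have "of_int b * (- h) = of_int (- a)" using ab by simp
        ultimately show ?thesis using ab(1) unfolding Q_def by (metis (mono_tags, lifting) mem_Collect_eq)
      qed
      show "h1 \<otimes>\<^bsub>class_ring\<^esub> h2 \<in> Q" if h: "h1 \<in> Q" "h2 \<in> Q" for h1 h2
      proof -
        obtain a b c d where ab: "of_int b \<noteq> (0::'k)" "of_int b * h1 = of_int a"
          "of_int d \<noteq> (0::'k)" "of_int d * h2 = of_int c" using h by (auto simp: Q_def)
        have "of_int (b * d) * (h1 * h2) = (of_int b * h1) * (of_int d * h2)" by (simp add: ac_simps)
        also have "\<dots> = of_int (a * c)" using ab by simp
        finally have "of_int (b * d) * (h1 * h2) = of_int (a * c)" .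
        moreover have "of_int (b * d) \<noteq> (0::'k)" using ab by simp
        ultimately have "h1 * h2 \<in> Q" by (rule QI)
        then show ?thesis by simp
      qed
      show "h1 \<oplus>\<^bsub>class_ring\<^esub> h2 \<in> Q" if h: "h1 \<in> Q" "h2 \<in> Q" for h1 h2
      proof -
        obtain a b c d where ab: "of_int b \<noteq> (0::'k)" "of_int b * h1 = of_int a"
          "of_int d \<noteq> (0::'k)" "of_int d * h2 = of_int c" using h by (auto simp: Q_def)
        have "of_int (b * d) * (h1 + h2) = of_int d * (of_int b * h1) + of_int b * (of_int d * h2)"
          by (simp add: algebra_simps)
        also have "\<dots> = of_int (d * a + b * c)" using ab by simp
        finally have "of_int (b * d) * (h1 + h2) = of_int (d * a + b * c)" .
        moreover have "of_int (b * d) \<noteq> (0::'k)" using ab by simp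
        ultimately have "h1 + h2 \<in> Q" by (rule QI)
        then show ?thesis by simp
      qed
    qed
    show "inv\<^bsub>class_ring\<^esub> k \<in> Q" if "k \<in> Q - {\<zero>\<^bsub>class_ring\<^esub>}" for k
    proof -
      have k: "k \<in> Q" "k \<noteq> 0" using that by auto
      obtain a b where ab: "of_int b \<noteq> (0::'k)" "of_int b * k = of_int a" using k(1) by (auto simp: Q_def)
      have "k * inv\<^bsub>class_ring\<^esub> k = 1" using monoid.Units_r_inv[OF ring.is_monoid[OF rng], of k] field.field_Units[OF fld] k(2) by simp
      then have "of_int a * inv\<^bsub>class_ring\<^esub> k = of_int b"
        unfolding ab(2)[symmetric] by (simp add: mult.assoc)
      moreover have "of_int a \<noteq> (0::'k)" using ab k(2) by (metis mult_eq_0_iff)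
      ultimately show ?thesis by (rule QI)
    qed
  qed
  then have "Q = UNIV" using assms by (simp add: prime_field_def)
  have "Q \<subseteq> (\<Union>(a, b)\<in>(UNIV :: (int \<times> int) set). {x :: 'k. of_int b \<noteq> (0::'k) \<and> of_int b * x = of_int a})"
    by (auto simp: Q_def)
  moreover have "countable {x :: 'k. of_int b \<noteq> (0::'k) \<and> of_int b * x = of_int a}" (is "countable ?S") for a b
  proof (cases "?S = {}")
    case False
    then obtain y where y: "y \<in> ?S" by auto
    have "?S \<subseteq> {y}"
    proof
      fix x assume "x \<in> ?S"
      then have "of_int b * x = of_int b * y" using y by simp
      then show "x \<in> {y}" using y by simp
    qed
    then show ?thesis by (rule countable_subset) simp
  next
    case True
    show ?thesis unfolding True by (rule countable_empty)
  qed
  then have "countable (\<Union>(a, b)\<in>(UNIV :: (int \<times> int) set). {x :: 'k. of_int b \<noteq> (0::'k) \<and> of_int b * x = of_int a})"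
    by (intro countable_UN) auto
  ultimately have "countable Q" by (rule countable_subset)
  then show ?thesis using \<open>Q = UNIV\<close> by simp
qed

lemma countable_coefficients:
  assumes "integers_or_prime_field TYPE('k::idom)"
  shows "countable (UNIV :: 'k set)"
proof (cases "bij (of_int :: int \<Rightarrow> 'k)")
  case True
  then have "range (of_int :: int \<Rightarrow> 'k) = UNIV" by (rule bij_is_surj)
  then show ?thesis by (metis countable_image countableI_type)
next
  case False
  then show ?thesis using assms countable_prime_field by (auto simp: integers_or_prime_field_def)
qed

text \<open>A finitely supported function is determined by its graph over the support, a finite
  subset of a countable set.\<close>

lemma countable_poly_mappings:
  fixes A :: "'a set" and B :: "'b::zero set"
  assumes "countable A" "countable B"
  shows "countable {p :: 'a \<Rightarrow>\<^sub>0 'b. keys p \<subseteq> A \<and> (\<forall>a. lookup p a \<in> B)}"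
proof (rule countable_image_inj_on)
  let ?g = "\<lambda>p :: 'a \<Rightarrow>\<^sub>0 'b. (\<lambda>a. (a, lookup p a)) ` keys p"
  let ?P = "{p :: 'a \<Rightarrow>\<^sub>0 'b. keys p \<subseteq> A \<and> (\<forall>a. lookup p a \<in> B)}"
  have "?g ` ?P \<subseteq> {S. finite S \<and> S \<subseteq> A \<times> B}" by auto
  moreover have "countable {S. finite S \<and> S \<subseteq> A \<times> B}"
    using assms by (intro countable_Collect_finite_subset) auto
  ultimately show "countable (?g ` ?P)" using countable_subset by blast
  show "inj_on ?g ?P"
  proof (rule inj_onI)
    fix p q :: "'a \<Rightarrow>\<^sub>0 'b" assume eq: "?g p = ?g q"
    have mem: "(a, c) \<in> ?g r \<longleftrightarrow> c \<noteq> 0 \<and> lookup r a = c" for a c and r :: "'a \<Rightarrow>\<^sub>0 'b"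
      by (auto simp: in_keys_iff)
    show "p = q"
    proof (rule poly_mapping_eqI)
      fix a
      have "c \<noteq> 0 \<and> lookup p a = c \<longleftrightarrow> c \<noteq> 0 \<and> lookup q a = c" for c
        using mem[of a c p] mem[of a c q] eq by simp
      then show "lookup p a = lookup q a" by metis
    qed
  qed
qed

lemma countable_polys:
  assumes "countable (UNIV :: 'k::comm_ring_1 set)" "finite V"
  shows "countable (polys V :: ('v, 'k) mpoly set)"
proof -
  have "countable {t :: 'v \<Rightarrow>\<^sub>0 nat. keys t \<subseteq> V \<and> (\<forall>v. lookup t v \<in> UNIV)}"
    using assms(2) by (intro countable_poly_mappings) (auto intro: countable_finite)
  then have "countable {p :: ('v, 'k) mpoly. keys p \<subseteq> {t. keys t \<subseteq> V} \<and> (\<forall>t. lookup p t \<in> UNIV)}"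
    using assms(1) by (intro countable_poly_mappings) auto
  then show ?thesis by (rule countable_subset[rotated]) (auto simp: polys_def)
qed

lemma lin_ext_single: "lin_ext f (single b c) = scale c (f b)"
  by (cases "c = 0") (simp_all add: lin_ext_def scale_zero_left)

lemma lin_ext_sum: "lin_ext f (sum g A) = (\<Sum>a\<in>A. lin_ext f (g a))"
  by (rule additive_sum) (rule lin_ext_add)

definition fmod :: "'v set \<Rightarrow> nat set \<Rightarrow> (nat \<Rightarrow>\<^sub>0 ('v, 'k::comm_ring_1) mpoly) set" where
  "fmod V g = {x. keys x \<subseteq> g \<and> (\<forall>b. lookup x b \<in> polys V)}"

text \<open>A stage of the construction consists of a set of generators, their degrees and the module of
  relations still to be resolved. The next generators are all homogeneous relations; they have to be
  numbered by naturals, which is why the coefficients must be countable.\<close>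

type_synonym ('v, 'k) stage = "nat set \<times> (nat \<Rightarrow> nat) \<times> (nat \<Rightarrow>\<^sub>0 ('v, 'k) mpoly) set"

text \<open>The degree is stored with the relation because the zero relation is homogeneous of every
  degree, while each generator needs one definite degree.\<close>

definition hom_rels :: "('v, 'k::comm_ring_1) stage \<Rightarrow> ((nat \<Rightarrow>\<^sub>0 ('v, 'k) mpoly) \<times> nat) set" where
  "hom_rels s = {(x, e). x \<in> snd (snd s) \<and> (\<forall>b. \<forall>t\<in>keys (lookup x b). mon_degree t + fst (snd s) b = e)}"

definition next_bdry :: "('v, 'k::comm_ring_1) stage \<Rightarrow> nat \<Rightarrow> (nat \<Rightarrow>\<^sub>0 ('v, 'k) mpoly)" where
  "next_bdry s n = fst (from_nat_into (hom_rels s) n)"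

definition next_stage :: "'v set \<Rightarrow> ('v, 'k::comm_ring_1) stage \<Rightarrow> ('v, 'k) stage" where
  "next_stage V s = (let g = to_nat_on (hom_rels s) ` hom_rels s in
     (g, (\<lambda>n. snd (from_nat_into (hom_rels s) n)), {x \<in> fmod V g. lin_ext (next_bdry s) x = 0}))"

text \<open>The relations form a graded submodule of the free module; these properties pass to the
  next stage.\<close>

definition good_stage :: "'v set \<Rightarrow> ('v, 'k::comm_ring_1) stage \<Rightarrow> bool" where
  "good_stage V s \<longleftrightarrow> snd (snd s) \<subseteq> fmod V (fst s) \<and> 0 \<in> snd (snd s) \<and>
     (\<forall>x\<in>snd (snd s). \<forall>y\<in>snd (snd s). x + y \<in> snd (snd s)) \<and>
     (\<forall>p\<in>polys V. \<forall>x\<in>snd (snd s). scale p x \<in> snd (snd s)) \<and>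
     (\<forall>e. \<forall>x\<in>snd (snd s). gcomp (fst (snd s)) e x \<in> snd (snd s))"

lemma fmod_add: "x \<in> fmod V g \<Longrightarrow> y \<in> fmod V g \<Longrightarrow> x + y \<in> fmod V g"
  using keys_add[of x y] by (auto simp: fmod_def lookup_add intro!: polys_add)

lemma fmod_scale: "p \<in> polys V \<Longrightarrow> x \<in> fmod V g \<Longrightarrow> scale p x \<in> fmod V g"
  using keys_scale_subset[of p x] by (auto simp: fmod_def lookup_scale intro!: polys_mult)

lemma fmod_zero: "0 \<in> fmod V g"
  by (simp add: fmod_def polys_zero)

lemma fmod_gcomp: "x \<in> fmod V g \<Longrightarrow> gcomp d e x \<in> fmod V g"
  using keys_gcomp[of d e x] by (auto simp: fmod_def lookup_gcomp filt_polys)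

lemma fmod_sum: "(\<And>a. a \<in> A \<Longrightarrow> f a \<in> fmod V g) \<Longrightarrow> sum f A \<in> fmod V g"
  by (induction A rule: infinite_finite_induct) (auto simp: fmod_zero fmod_add)

lemma sum_gcomp:
  assumes "finite E" "\<And>b t. t \<in> keys (lookup x b) \<Longrightarrow> mon_degree t + d b \<in> E"
  shows "(\<Sum>e\<in>E. gcomp d e x) = x"
proof (rule poly_mapping_eqI, rule poly_mapping_eqI)
  fix b t
  have "lookup (lookup (\<Sum>e\<in>E. gcomp d e x) b) t = (\<Sum>e\<in>E. if e = mon_degree t + d b then lookup (lookup x b) t else 0)"
    by (auto simp: lookup_sum lookup_gcomp lookup_filt intro!: sum.cong)
  also have "\<dots> = lookup (lookup x b) t"
    using assms(1) assms(2)[of t b] by (auto simp: in_keys_iff)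
  finally show "lookup (lookup (\<Sum>e\<in>E. gcomp d e x) b) t = lookup (lookup x b) t" .
qed

context
  fixes V :: "'v set" and s :: "('v, 'k::comm_ring_1) stage"
  assumes good: "good_stage V s" and cnt: "countable (UNIV :: 'k set)" and fin: "finite V"
begin

lemma countable_hom_rels: "countable (hom_rels s)"
proof -
  have "countable (fmod V (fst s) :: (nat \<Rightarrow>\<^sub>0 ('v, 'k) mpoly) set)"
    unfolding fmod_def by (intro countable_poly_mappings countable_polys cnt fin) auto
  then have "countable ((fmod V (fst s) :: (nat \<Rightarrow>\<^sub>0 ('v, 'k) mpoly) set) \<times> (UNIV :: nat set))" by auto
  then show ?thesis
    by (rule countable_subset[rotated]) (use good in \<open>auto simp: hom_rels_def good_stage_def\<close>)
qed

lemma next_gens: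
  assumes "n \<in> fst (next_stage V s)"
  shows "next_bdry s n \<in> snd (snd s)"
    "t \<in> keys (lookup (next_bdry s n) c) \<Longrightarrow> mon_degree t + fst (snd s) c = fst (snd (next_stage V s)) n"
proof -
  obtain p where "p \<in> hom_rels s" "n = to_nat_on (hom_rels s) p" using assms by (auto simp: next_stage_def Let_def)
  then have "from_nat_into (hom_rels s) n \<in> hom_rels s" using countable_hom_rels by simp
  then obtain x e where xe: "from_nat_into (hom_rels s) n = (x, e)" "(x, e) \<in> hom_rels s" by (metis surj_pair)
  show "next_bdry s n \<in> snd (snd s)" using xe by (simp add: next_bdry_def hom_rels_def)
  show "t \<in> keys (lookup (next_bdry s n) c) \<Longrightarrow> mon_degree t + fst (snd s) c = fst (snd (next_stage V s)) n"
    using xe by (simp add: next_bdry_def hom_rels_def next_stage_def Let_def)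
qed

lemma good_next: "good_stage V (next_stage V s)"
proof -
  have Z: "snd (snd (next_stage V s)) = {x \<in> fmod V (fst (next_stage V s)). lin_ext (next_bdry s) x = 0}"
    by (simp add: next_stage_def Let_def)
  have g0: "gcomp d e (0 :: nat \<Rightarrow>\<^sub>0 ('v, 'k) mpoly) = 0" for d e
    by (rule poly_mapping_eqI) (simp add: lookup_gcomp filt_zero)
  have "lin_ext (next_bdry s) (gcomp (fst (snd (next_stage V s))) e x) = 0"
    if "x \<in> fmod V (fst (next_stage V s))" "lin_ext (next_bdry s) x = 0" for e x
  proof -
    have "lin_ext (next_bdry s) (gcomp (fst (snd (next_stage V s))) e x) = gcomp (fst (snd s)) e (lin_ext (next_bdry s) x)"
    proof (rule lin_ext_gcomp)
      fix b c t assume "b \<in> keys x" and t: "t \<in> keys (lookup (next_bdry s b) c)"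
      then have "b \<in> fst (next_stage V s)" using that by (auto simp: fmod_def)
      from next_gens(2)[OF this t] show "mon_degree t + fst (snd s) c = fst (snd (next_stage V s)) b" .
    qed
    then show ?thesis using that(2) g0 by simp
  qed
  then show ?thesis
    unfolding good_stage_def Z
    by (auto simp: fmod_zero fmod_add fmod_scale fmod_gcomp lin_ext_zero lin_ext_add lin_ext_scale scale_zero_right)
qed

text \<open>Every homogeneous relation is itself the image of a generator, so an arbitrary relation
  is reached by summing the generators of its homogeneous components.\<close>

lemma next_exact: "lin_ext (next_bdry s) ` fmod V (fst (next_stage V s)) = snd (snd s)"
proof (intro equalityI subsetI)
  fix z assume "z \<in> lin_ext (next_bdry s) ` fmod V (fst (next_stage V s))"
  then obtain x where x: "x \<in> fmod V (fst (next_stage V s))" "z = lin_ext (next_bdry s) x" by blast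
  have "(\<Sum>b\<in>A. scale (lookup x b) (next_bdry s b)) \<in> snd (snd s)" if "finite A" "A \<subseteq> keys x" for A
    using that
  proof induction
    case empty
    then show ?case using good by (simp add: good_stage_def)
  next
    case (insert b A)
    then have "b \<in> fst (next_stage V s)" "lookup x b \<in> polys V" using x(1) by (auto simp: fmod_def)
    then have "scale (lookup x b) (next_bdry s b) \<in> snd (snd s)"
      using next_gens(1) good unfolding good_stage_def by blast
    then show ?case using insert good by (simp add: good_stage_def)
  qed
  then show "z \<in> snd (snd s)" unfolding x(2) lin_ext_def by simp
next
  fix z assume z: "z \<in> snd (snd s)"
  let ?d = "fst (snd s)"
  define E where "E = (\<Union>b\<in>keys z. (\<lambda>t. mon_degree t + ?d b) ` keys (lookup z b))"
  have finE: "finite E" by (simp add: E_def)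
  have sum: "(\<Sum>e\<in>E. gcomp ?d e z) = z"
  proof (rule sum_gcomp[OF finE])
    fix b t assume t: "t \<in> keys (lookup z b)"
    then have "b \<in> keys z" by (auto simp: in_keys_iff)
    then show "mon_degree t + ?d b \<in> E" unfolding E_def using t by (intro UN_I[of b] image_eqI[of _ _ t]) simp_all
  qed
  have hom: "(gcomp ?d e z, e) \<in> hom_rels s" for e
    using good z by (auto simp: hom_rels_def good_stage_def lookup_gcomp keys_filt)
  define n where "n e = to_nat_on (hom_rels s) (gcomp ?d e z, e)" for e
  have n: "n e \<in> fst (next_stage V s)" "next_bdry s (n e) = gcomp ?d e z" for e
    using hom[of e] countable_hom_rels by (auto simp: n_def next_stage_def Let_def next_bdry_def)
  define x where "x = (\<Sum>e\<in>E. single (n e) (1 :: ('v, 'k) mpoly))"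
  have one: "(1 :: ('v, 'k) mpoly) \<in> polys V" by (auto simp: polys_def)
  have "x \<in> fmod V (fst (next_stage V s))"
    unfolding x_def
    by (intro fmod_sum) (auto simp: fmod_def n(1) lookup_single when_def one polys_zero)
  moreover have "lin_ext (next_bdry s) x = z"
    by (simp add: x_def lin_ext_sum lin_ext_single scale_one n(2) sum)
  ultimately show "z \<in> lin_ext (next_bdry s) ` fmod V (fst (next_stage V s))" by blast
qed

end

text \<open>The quotient ring is cyclic: it starts with one generator of degree 0, whose relations
  are its multiples by elements of the ideal.\<close>

primrec stages :: "'v set \<Rightarrow> ('v, 'k::comm_ring_1) mpoly set \<Rightarrow> nat \<Rightarrow> ('v, 'k) stage" where
  "stages V I 0 = ({0}, (\<lambda>_. 0), {x \<in> fmod V {0}. lookup x 0 \<in> I})"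
| "stages V I (Suc i) = next_stage V (stages V I i)"

theorem resolution_exists:
  fixes V :: "'v set" and C :: "'v set set"
  assumes cnt: "countable (UNIV :: 'k::comm_ring_1 set)" and fin: "finite V"
    and down: "\<And>\<sigma> \<tau>. \<sigma> \<in> C \<Longrightarrow> \<tau> \<subseteq> \<sigma> \<Longrightarrow> \<tau> \<in> C"
  shows "\<exists>R :: ('v, 'k) free_complex. graded_free_resolution V (SR_ideal V C) R"
proof -
  define I :: "('v, 'k) mpoly set" where "I = SR_ideal V C"
  have I: "f \<in> I \<longleftrightarrow> f \<in> polys V \<and> (\<forall>t\<in>keys f. keys t \<notin> C)" for f
    unfolding I_def by (rule SR_ideal_iff[OF fin down])
  have I_add: "f + g \<in> I" if "f \<in> I" "g \<in> I" for f g
    using that keys_add[of f g] by (auto simp: I polys_add)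
  have I_mult: "p * f \<in> I" if p: "p \<in> polys V" and f: "f \<in> I" for p f
    unfolding I
  proof (intro conjI ballI)
    show "p * f \<in> polys V" using p f by (simp add: I polys_mult)
    fix t assume t: "t \<in> keys (p * f)"
    then obtain a b where "t = a + b" "b \<in> keys f" using keys_mult[of p f] by blast
    then show "keys t \<notin> C" using f down[of "keys t" "keys b"] by (auto simp: I keys_add_nat)
  qed
  let ?s = "stages V I"
  have "good_stage V (?s 0)"
    unfolding good_stage_def
    by (auto simp: fmod_zero fmod_add fmod_scale fmod_gcomp lookup_add lookup_scale lookup_gcomp
        intro!: I_add I_mult) (auto simp: I polys_zero filt_polys keys_filt)
  then have good: "good_stage V (?s i)" for i
    by (induction i) (simp_all add: good_next[OF _ cnt fin])
  define R :: "('v, 'k) free_complex" where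
    "R = \<lparr>gens = \<lambda>i. fst (?s i), gdeg = \<lambda>i. fst (snd (?s i)), bdry = \<lambda>i. next_bdry (?s i), augm = \<lambda>_. 1\<rparr>"
  have R: "gens R i = fst (?s i)" "gdeg R i = fst (snd (?s i))" "bdry R i = next_bdry (?s i)" "augm R b = 1" for i b
    by (simp_all add: R_def)
  have fm: "free_mod V R i = fmod V (fst (?s i))" for i by (simp add: free_mod_def fmod_def R)
  have one: "(1 :: ('v, 'k) mpoly) \<in> polys V" by (auto simp: polys_def)
  have augm: "augm_ext R x = lookup x 0" if "x \<in> fmod V {0}" for x
    using that by (subst augm_ext_superset[of "{0}"]) (auto simp: fmod_def R)
  note ng = next_gens[OF good cnt fin, folded stages.simps(2)]
  have ex: "lin_ext (next_bdry (?s i)) ` fmod V (fst (?s (Suc i))) = snd (snd (?s i))" for i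
    using next_exact[OF good[of i] cnt fin] by simp
  have "graded_free_resolution V I R"
    unfolding graded_free_resolution_def fm
  proof (intro conjI allI ballI)
    show "augm R b \<in> polys V" for b by (simp add: R one)
    show "mon_degree t = gdeg R 0 b" if "t \<in> keys (augm R b)" for b t
      using that by (simp add: R)
    show "bdry R i b \<in> fmod V (fst (?s i))" if "b \<in> gens R (Suc i)" for i b
      using ng(1)[of b i] that good[of i] unfolding R good_stage_def by blast
    show "mon_degree t + gdeg R i c = gdeg R (Suc i) b"
      if "b \<in> gens R (Suc i)" "t \<in> keys (lookup (bdry R i b) c)" for i b c t
      using ng(2)[of b i t c] that unfolding R by blast
    show "\<exists>x\<in>fmod V (fst (?s 0)). f - augm_ext R x \<in> I" if f: "f \<in> polys V" for f
    proof (rule bexI[of _ "single 0 f"])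
      show s: "single 0 f \<in> fmod V (fst (?s 0))" using f by (auto simp: fmod_def lookup_single when_def polys_zero)
      have "augm_ext R (single 0 f) = f" using augm[of "single 0 f"] s by simp
      then show "f - augm_ext R (single 0 f) \<in> I" by (simp add: I polys_zero)
    qed
    have "{x \<in> fmod V (fst (?s 0)). augm_ext R x \<in> I} = snd (snd (?s 0))" using augm by auto
    then show "{x \<in> fmod V (fst (?s 0)). augm_ext R x \<in> I} = lin_ext (bdry R 0) ` fmod V (fst (?s 1))"
      using ex[of 0] by (simp add: R)
    show "{x \<in> fmod V (fst (?s (Suc i))). lin_ext (bdry R i) x = 0} =
        lin_ext (bdry R (Suc i)) ` fmod V (fst (?s (Suc (Suc i))))" for i
    proof -
      have "{x \<in> fmod V (fst (?s (Suc i))). lin_ext (bdry R i) x = 0} = snd (snd (?s (Suc i)))"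
        by (simp add: R next_stage_def Let_def)
      then show ?thesis using ex[of "Suc i"] by (simp only: R)
    qed
  qed
  then show ?thesis unfolding I_def by blast
qed

subsection \<open>Betti numbers of independence complexes\<close>

definition faces :: "'v set set \<Rightarrow> 'v set \<Rightarrow> nat \<Rightarrow> 'v set set" where
  "faces C J d = {\<tau>. \<tau> \<subseteq> J \<and> \<tau> \<in> C \<and> card \<tau> = d}"

lemma (in signed_complex) face_eq_faces: "face J d = faces C J d"
  by (simp add: face_def faces_def)

text \<open>Countable coefficients provide a resolution, so what \<open>SOME\<close> selects is one,
  and its Tor agrees with Koszul homology whichever it is.\<close>

lemma betti_eq_sum_crank:
  assumes k: "integers_or_prime_field TYPE('k::idom)" and sc: "signed_complex V sg C"
    and ij: "i \<le> j"
  shows "betti TYPE('k) V C i j = (\<Sum>J | J \<subseteq> V \<and> card J = j. signed_complex.crank (sg :: _ \<Rightarrow> _ \<Rightarrow> 'k) C J (j - i))"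
proof -
  interpret signed_complex V sg C by fact
  define R :: "('a, 'k) free_complex" where "R = (SOME R. graded_free_resolution V (SR_ideal V C) R)"
  have "\<exists>R :: ('a, 'k) free_complex. graded_free_resolution V (SR_ideal V C) R"
    by (rule resolution_exists[OF countable_coefficients[OF k] fin_V down])
  then have "graded_free_resolution V (SR_ideal V C) R" unfolding R_def by (rule someI_ex)
  then interpret resolved_complex V sg C R by unfold_locales
  have "betti TYPE('k) V C i j = subquotient_rank (tor_cycles R i (2 * j)) (tor_boundaries R i (2 * j))"
    by (simp add: betti_def tor_rank_def R_def Let_def)
  also have "\<dots> = K.kh i (2 * j) (pgr V) Igr" by (rule tor_eq_koszul)
  also have "\<dots> = (\<Sum>J | J \<subseteq> V \<and> card J = j. crank J (j - i))"
    unfolding crank_def using ij by (intro kh_eq_cochain_rank) simp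
  finally show ?thesis .
qed

lemma exists_signed_complex:
  assumes "finite V" "\<forall>\<sigma>\<in>C. \<forall>\<tau>. \<tau> \<subseteq> \<sigma> \<longrightarrow> \<tau> \<in> C"
  shows "\<exists>sg :: 'v \<Rightarrow> 'v set \<Rightarrow> 'k::idom. signed_complex V sg C"
proof -
  obtain sg :: "'v \<Rightarrow> 'v set \<Rightarrow> 'k" where "sign_system V sg" using sign_system_exists[OF assms(1)] by blast
  then have "signed_complex V sg C"
    using assms by (intro signed_complex.intro signs.intro signed_complex_axioms.intro) blast+
  then show ?thesis by blast
qed

text \<open>The reduced cohomology of the full subcomplex on a set of rank \<open>r\<close> is concentrated in degree
  \<open>r - 1\<close>, so that only sets of rank \<open>j - i\<close> contribute, each by an Euler characteristic.\<close>

lemma betti_indep_complex: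
  fixes V :: "'v set"
  assumes k: "integers_or_prime_field TYPE('k::idom)" and V: "finite V" and ij: "i \<le> j"
    and C: "indep_complex C"
  shows "int (betti TYPE('k) V C i j) =
    (\<Sum>J | J \<subseteq> V \<and> card J = j \<and> faces C J (j - i) \<noteq> {} \<and> faces C J (Suc (j - i)) = {}.
      \<Sum>d\<le>j - i. (-1) ^ (j - i - d) * int (card (faces C J d)))"
proof -
  note CD = indep_complexD[OF C]
  obtain sg :: "'v \<Rightarrow> 'v set \<Rightarrow> 'k" where sc: "signed_complex V sg C"
    using exists_signed_complex[OF V, of C] CD(3) by blast
  interpret signed_complex V sg C by fact
  let ?r = "\<lambda>J. faces C J (j - i) \<noteq> {} \<and> faces C J (Suc (j - i)) = {}"
  have CJ: "indep_complex {\<tau> \<in> C. \<tau> \<subseteq> J}" for J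
    unfolding indep_complex_def
  proof (intro conjI ballI allI impI)
    show "finite {\<tau> \<in> C. \<tau> \<subseteq> J}" using CD(1) by simp
    show "finite A" if "A \<in> {\<tau> \<in> C. \<tau> \<subseteq> J}" for A using that CD(2) by simp
    show "B \<in> {\<tau> \<in> C. \<tau> \<subseteq> J}" if "A \<in> {\<tau> \<in> C. \<tau> \<subseteq> J}" "B \<subseteq> A" for A B using that CD(3) by blast
    show "\<exists>b\<in>B - A. insert b A \<in> {\<tau> \<in> C. \<tau> \<subseteq> J}"
      if "A \<in> {\<tau> \<in> C. \<tau> \<subseteq> J}" "B \<in> {\<tau> \<in> C. \<tau> \<subseteq> J}" "card A < card B" for A B
      using that CD(4)[of A B] by blast
  qed
  have zero: "crank J (j - i) = 0" if J: "J \<subseteq> V" and nr: "\<not> ?r J" for J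
  \<comment> \<open>Without any face inside \<open>J\<close> there is no maximum to take as the
    rank, and all cochains vanish.\<close>
  proof (cases "C \<inter> Pow J = {}")
    case True
    then have "face J (j - i) = {}" by (auto simp: face_def)
    then have "f = 0" if "f \<in> CZ J (j - i)" for f using that by (auto simp: CZ_def supported_on_def)
    then have "CZ J (j - i) \<subseteq> CB J (j - i)" using submodD(1)[OF submod_CB] by blast
    then show ?thesis unfolding crank_def
      by (rule mrank_trivial[OF kmodule_fscale]) (rule submodD(1)[OF submod_CB])
  next
    case False
    define r where "r = Max (card ` (C \<inter> Pow J))"
    have fin: "finite (card ` (C \<inter> Pow J))" using CD(1) by simp
    have "r \<in> card ` (C \<inter> Pow J)" unfolding r_def using False fin by (intro Max_in) auto
    then have r1: "face J r \<noteq> {}" by (auto simp: face_def)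
    have r2: "face J (Suc r) = {}"
    proof (rule ccontr)
      assume "face J (Suc r) \<noteq> {}"
      then obtain \<tau> where "\<tau> \<in> C \<inter> Pow J" "card \<tau> = Suc r" unfolding face_def by blast
      then have "Suc r \<in> card ` (C \<inter> Pow J)" by (metis image_eqI)
      then have "Suc r \<le> r" unfolding r_def using fin by (intro Max_ge)
      then show False by simp
    qed
    have "j - i \<noteq> r" using nr r1 r2 by (auto simp: face_eq_faces)
    then show ?thesis by (rule crank_eq_0[OF J CJ r1 r2])
  qed
  have "int (betti TYPE('k) V C i j) = (\<Sum>J | J \<subseteq> V \<and> card J = j. int (crank J (j - i)))"
    by (simp add: betti_eq_sum_crank[OF k sc ij])
  also have "\<dots> = (\<Sum>J | J \<subseteq> V \<and> card J = j \<and> ?r J. int (crank J (j - i)))"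
    by (rule sum.mono_neutral_right) (use V zero in auto)
  also have "\<dots> = (\<Sum>J | J \<subseteq> V \<and> card J = j \<and> ?r J. \<Sum>d\<le>j - i. (-1) ^ (j - i - d) * int (card (faces C J d)))"
    by (intro sum.cong refl) (simp add: crank_eq[OF _ CJ] face_eq_faces)
  finally show ?thesis .
qed

text \<open>Homological index \<open>j - l\<close> corresponds to cochains on faces of size
  \<open>l\<close>, as \<open>l \<le> n \<le> j\<close>. The alternating sum over \<open>l\<close>
  is therefore, for each vertex set of size \<open>j\<close>, an Euler characteristic.\<close>

lemma betti_euler_characteristic:
  fixes V :: "'v set"
  assumes k: "integers_or_prime_field TYPE('k::idom)" and V: "finite V" and nj: "n \<le> j"
    and down: "\<And>\<sigma> \<tau>. \<sigma> \<in> C \<Longrightarrow> \<tau> \<subseteq> \<sigma> \<Longrightarrow> \<tau> \<in> C" and dim: "\<And>J. J \<subseteq> V \<Longrightarrow> faces C J (Suc n) = {}"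
  shows "(\<Sum>l\<le>n. (-1) ^ l * int (betti TYPE('k) V C (j - l) j)) =
    (\<Sum>J | J \<subseteq> V \<and> card J = j. \<Sum>d\<le>n. (-1) ^ d * int (card (faces C J d)))"
proof -
  obtain sg :: "'v \<Rightarrow> 'v set \<Rightarrow> 'k" where sc: "signed_complex V sg C"
    using exists_signed_complex[OF V, of C] down by blast
  interpret signed_complex V sg C by fact
  have "(\<Sum>l\<le>n. (-1) ^ l * int (betti TYPE('k) V C (j - l) j)) =
      (\<Sum>l\<le>n. \<Sum>J | J \<subseteq> V \<and> card J = j. (-1) ^ l * int (crank J l))"
    by (intro sum.cong refl) (use nj in \<open>simp add: betti_eq_sum_crank[OF k sc] sum_distrib_left\<close>)
  also have "\<dots> = (\<Sum>J | J \<subseteq> V \<and> card J = j. \<Sum>l\<le>n. (-1) ^ l * int (crank J l))"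
    by (rule sum.swap)
  also have "\<dots> = (\<Sum>J | J \<subseteq> V \<and> card J = j. \<Sum>d\<le>n. (-1) ^ d * int (card (faces C J d)))"
  proof (rule sum.cong[OF refl])
    fix J assume "J \<in> {J. J \<subseteq> V \<and> card J = j}"
    then have J: "J \<subseteq> V" by simp
    have "face J (Suc n) = {}" using dim[OF J] by (simp add: face_eq_faces)
    from euler_characteristic[OF J this]
    show "(\<Sum>l\<le>n. (-1) ^ l * int (crank J l)) = (\<Sum>d\<le>n. (-1) ^ d * int (card (faces C J d)))"
      by (simp add: face_eq_faces)
  qed
  finally show ?thesis .
qed

subsection \<open>Counting linearly independent sets over a finite field\<close>

text \<open>Coordinate space as functions vanishing from \<open>n\<close> on: spaces of all
  dimensions then live in one type, where the vector space theory behind \<open>fvs\<close>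
  applies.\<close>

abbreviation fspace :: "nat \<Rightarrow> (nat \<Rightarrow> 'f::field) set" where
  "fspace n \<equiv> supported_on {..<n}"

abbreviation indep :: "(nat \<Rightarrow> 'f::field) set \<Rightarrow> bool" where
  "indep A \<equiv> \<not> fvs.dependent A"

lemma indepD:
  assumes "indep P" "S \<subseteq> P" "finite S" "(\<Sum>v\<in>S. fscale (u v) v) = 0" "v \<in> S"
  shows "u v = 0"
  by (rule assms(1)[unfolded fvs.independent_explicit_finite_subsets, rule_format, OF assms(2-5)])

lemma card_fspace: "card (fspace n :: (nat \<Rightarrow> 'f::{field,finite}) set) = CARD('f) ^ n"
proof -
  have "bij_betw (\<lambda>f. restrict f {..<n}) (fspace n :: (nat \<Rightarrow> 'f) set) ({..<n} \<rightarrow>\<^sub>E UNIV)"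
    by (rule bij_betwI[where g = "\<lambda>g i. if i < n then g i else 0"])
      (auto simp: supported_on_def fun_eq_iff restrict_def PiE_def extensional_def)
  then have "card (fspace n :: (nat \<Rightarrow> 'f) set) = card ({..<n} \<rightarrow>\<^sub>E (UNIV :: 'f set))"
    by (rule bij_betw_same_card)
  then show ?thesis by (simp add: card_funcsetE)
qed

lemma finite_fspace: "finite (fspace n :: (nat \<Rightarrow> 'f::{field,finite}) set)"
  by (rule card_ge_0_finite) (simp add: card_fspace)

lemma subspace_fspace: "fvs.subspace (fspace n)"
  by (auto simp: fvs.subspace_def supported_on_def fscale_apply)

lemma span_subset_fspace: "A \<subseteq> fspace n \<Longrightarrow> fvs.span A \<subseteq> fspace n"
  by (rule fvs.span_minimal[OF _ subspace_fspace])

text \<open>A coordinate system on the subspace \<open>W\<close>, used to move counts between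
  \<open>W\<close> and \<open>fspace d\<close>.\<close>

locale linear_iso =
  fixes \<phi> :: "(nat \<Rightarrow> 'f::{field,finite}) \<Rightarrow> (nat \<Rightarrow> 'f)" and d :: nat and W :: "(nat \<Rightarrow> 'f) set"
  assumes add: "\<phi> (x + y) = \<phi> x + \<phi> y" and scl: "\<phi> (fscale c x) = fscale c (\<phi> x)"
    and inj: "inj_on \<phi> (fspace d)" and im: "\<phi> ` fspace d = W"
begin

lemma zero: "\<phi> 0 = 0"
  using add[of 0 0] by (simp only: add_0_left add_cancel_right_left)

lemma lincomb: "\<phi> (\<Sum>v\<in>S. fscale (u v) v) = (\<Sum>v\<in>S. fscale (u v) (\<phi> v))"
  by (subst additive_sum[of \<phi>, OF add]) (simp only: scl)

lemma lincomb_fspace: "S \<subseteq> fspace d \<Longrightarrow> (\<Sum>v\<in>S. fscale (u v) v) \<in> fspace d"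
  by (rule fvs.subspace_sum[OF subspace_fspace]) (rule fvs.subspace_scale[OF subspace_fspace], auto)

lemma indep_image_iff:
  assumes A: "A \<subseteq> fspace d"
  shows "indep (\<phi> ` A) \<longleftrightarrow> indep A"
proof
  assume ind: "indep (\<phi> ` A)"
  show "indep A"
    unfolding fvs.independent_explicit_finite_subsets
  proof (intro allI impI ballI)
    fix S u v assume S: "S \<subseteq> A" "finite S" and 0: "(\<Sum>v\<in>S. fscale (u v) v) = 0" and v: "v \<in> S"
    have injS: "inj_on \<phi> S" by (rule inj_on_subset[OF inj]) (use S A in blast)
    have "(\<Sum>w\<in>\<phi> ` S. fscale (u (the_inv_into S \<phi> w)) w) = (\<Sum>v\<in>S. fscale (u v) (\<phi> v))"
      unfolding sum.reindex[OF injS] by (intro sum.cong refl) (simp add: the_inv_into_f_f[OF injS])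
    also have "\<dots> = 0" unfolding lincomb[symmetric] 0 by (rule zero)
    finally have "(\<Sum>w\<in>\<phi> ` S. fscale (u (the_inv_into S \<phi> w)) w) = 0" .
    moreover have "\<phi> ` S \<subseteq> \<phi> ` A" "finite (\<phi> ` S)" using S by auto
    ultimately have "u (the_inv_into S \<phi> (\<phi> v)) = 0"
      by (intro indepD[OF ind, of "\<phi> ` S" "\<lambda>w. u (the_inv_into S \<phi> w)"] imageI v)
    then show "u v = 0" using v by (simp add: the_inv_into_f_f[OF injS])
  qed
next
  assume ind: "indep A"
  show "indep (\<phi> ` A)"
    unfolding fvs.independent_explicit_finite_subsets
  proof (intro allI impI ballI)
    fix T u w assume T: "T \<subseteq> \<phi> ` A" "finite T" and 0: "(\<Sum>v\<in>T. fscale (u v) v) = 0" and w: "w \<in> T"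
    define S where "S = A \<inter> \<phi> -` T"
    have ST: "\<phi> ` S = T" using T(1) by (auto simp: S_def)
    have SA: "S \<subseteq> A" by (auto simp: S_def)
    have injS: "inj_on \<phi> S" by (rule inj_on_subset[OF inj]) (use SA A in blast)
    have finS: "finite S" using ST T(2) injS finite_imageD by blast
    have "\<phi> (\<Sum>v\<in>S. fscale (u (\<phi> v)) v) = (\<Sum>v\<in>T. fscale (u v) v)"
      unfolding lincomb ST[symmetric] sum.reindex[OF injS] comp_def ..
    then have "\<phi> (\<Sum>v\<in>S. fscale (u (\<phi> v)) v) = \<phi> 0" unfolding 0 zero .
    moreover have "(\<Sum>v\<in>S. fscale (u (\<phi> v)) v) \<in> fspace d" using SA A by (intro lincomb_fspace) auto
    moreover have "0 \<in> fspace d" by (rule fvs.subspace_0[OF subspace_fspace])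
    ultimately have z0: "(\<Sum>v\<in>S. fscale (u (\<phi> v)) v) = 0" by (rule inj_onD[OF inj])
    have "\<forall>v\<in>S. u (\<phi> v) = 0" by (intro ballI indepD[OF ind SA finS z0])
    then show "u w = 0" using w ST by auto
  qed
qed

end

lemma linear_iso_span:
  fixes B :: "(nat \<Rightarrow> 'f::{field,finite}) set"
  assumes B: "indep B" "finite B" "card B = d"
  shows "\<exists>\<phi>. linear_iso \<phi> d (fvs.span B)"
proof -
  obtain h where h: "bij_betw h {..<d} B"
    using B(2,3) ex_bij_betw_nat_finite[of B] by (auto simp: atLeast0LessThan)
  then have injh: "inj_on h {..<d}" and imh: "h ` {..<d} = B" by (auto simp: bij_betw_def)
  define \<phi> where "\<phi> g = (\<Sum>i<d. fscale (g i) (h i))" for g :: "nat \<Rightarrow> 'f"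
  have \<phi>B: "\<phi> g = (\<Sum>b\<in>B. fscale (g (the_inv_into {..<d} h b)) b)" for g
    unfolding imh[symmetric] sum.reindex[OF injh] \<phi>_def
    by (intro sum.cong refl) (simp add: the_inv_into_f_f[OF injh])
  have add: "\<phi> (x + y) = \<phi> x + \<phi> y" for x y
    unfolding \<phi>_def by (simp add: fvs.scale_left_distrib sum.distrib)
  have scl: "\<phi> (fscale c x) = fscale c (\<phi> x)" for c x
    unfolding \<phi>_def by (simp add: fvs.scale_sum_right fscale_apply)
  have ker: "g = 0" if g: "g \<in> fspace d" "\<phi> g = 0" for g
  proof (rule ext)
    fix i
    show "g i = 0 i"
    proof (cases "i < d")
      case True
      have "\<forall>b\<in>B. g (the_inv_into {..<d} h b) = 0"
        by (intro ballI indepD[OF B(1) subset_refl B(2) g(2)[unfolded \<phi>B]])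
      then show ?thesis using True imh by (auto simp: the_inv_into_f_f[OF injh])
    next
      case False
      then show ?thesis using g(1) by (simp add: supported_on_def)
    qed
  qed
  have inj: "inj_on \<phi> (fspace d)"
  proof (rule inj_onI)
    fix x y assume xy: "x \<in> fspace d" "y \<in> fspace d" "\<phi> x = \<phi> y"
    have "\<phi> (x - y) = 0" using add[of "x - y" y] xy(3) by simp
    moreover have "x - y \<in> fspace d" by (rule fvs.subspace_diff[OF subspace_fspace xy(1,2)])
    ultimately have "x - y = 0" by (rule ker[rotated])
    then show "x = y" by (simp only: right_minus_eq)
  qed
  have im: "\<phi> ` fspace d = fvs.span B"
  proof (intro equalityI subsetI)
    fix w assume "w \<in> \<phi> ` fspace d"
    then obtain g where "w = \<phi> g" by blast
    then show "w \<in> fvs.span B" unfolding \<phi>B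
      by (simp only:) (intro fvs.span_sum fvs.span_scale fvs.span_base)
  next
    fix w assume "w \<in> fvs.span B"
    then obtain u where u: "w = (\<Sum>v\<in>B. fscale (u v) v)" unfolding fvs.span_finite[OF B(2)] by blast
    define g where "g i = (if i < d then u (h i) else 0)" for i
    have "w = \<phi> g"
      unfolding u \<phi>_def imh[symmetric] sum.reindex[OF injh] by (intro sum.cong refl) (simp add: g_def)
    moreover have "g \<in> fspace d" by (simp add: g_def supported_on_def)
    ultimately show "w \<in> \<phi> ` fspace d" by blast
  qed
  show ?thesis by (rule exI[of _ \<phi>]) (unfold_locales; fact add scl inj im)
qed

lemma card_span:
  fixes B :: "(nat \<Rightarrow> 'f::{field,finite}) set"
  assumes "indep B" "finite B"
  shows "card (fvs.span B) = CARD('f) ^ card B"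
proof -
  obtain \<phi> where "linear_iso \<phi> (card B) (fvs.span B)" using linear_iso_span[OF assms refl] by blast
  then interpret linear_iso \<phi> "card B" "fvs.span B" .
  show ?thesis using card_image[OF inj] im card_fspace[of "card B", where 'f='f] by simp
qed

definition indep_subsets :: "(nat \<Rightarrow> 'f::field) set \<Rightarrow> nat \<Rightarrow> (nat \<Rightarrow> 'f) set set" where
  "indep_subsets J s = {A. A \<subseteq> J \<and> indep A \<and> card A = s}"

lemma finite_indep_subsets: "finite J \<Longrightarrow> finite (indep_subsets J s)"
  by (rule finite_subset[of _ "Pow J"]) (auto simp: indep_subsets_def)

text \<open>Counts independent sets of size \<open>Suc k\<close> with a marked element in two ways:
  the mark is any member of the set, or any vector outside the span of the other \<open>k\<close>.
  That span has \<open>CARD('f) ^ k\<close> elements.\<close>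

lemma card_indep_subsets_Suc:
  "Suc k * card (indep_subsets (fspace n :: (nat \<Rightarrow> 'f::{field,finite}) set) (Suc k)) =
    card (indep_subsets (fspace n :: (nat \<Rightarrow> 'f) set) k) * (CARD('f) ^ n - CARD('f) ^ k)"
proof -
  let ?E = "fspace n :: (nat \<Rightarrow> 'f) set"
  note finE = finite_fspace[of n, where 'f='f]
  have finA: "finite A" if "A \<subseteq> ?E" for A by (rule finite_subset[OF that finE])
  have P: "card (SIGMA A:indep_subsets ?E k. ?E - fvs.span A) = card (indep_subsets ?E k) * (CARD('f) ^ n - CARD('f) ^ k)"
  proof -
    have "card (?E - fvs.span A) = CARD('f) ^ n - CARD('f) ^ k" if "A \<in> indep_subsets ?E k" for A
    proof -
      have A: "A \<subseteq> ?E" "indep A" "card A = k" using that by (auto simp: indep_subsets_def)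
      have "fvs.span A \<subseteq> ?E" by (rule span_subset_fspace[OF A(1)])
      then show ?thesis
        using card_Diff_subset[of "fvs.span A" ?E] finA card_span[OF A(2) finA[OF A(1)]] A(3) card_fspace[of n, where 'f='f]
        by simp
    qed
    then show ?thesis using finite_indep_subsets[OF finE] finE by (simp add: card_SigmaI)
  qed
  have Q: "card (SIGMA B:indep_subsets ?E (Suc k). B) = Suc k * card (indep_subsets ?E (Suc k))"
  proof -
    have "card (SIGMA B:indep_subsets ?E (Suc k). B) = (\<Sum>B\<in>indep_subsets ?E (Suc k). card B)"
      by (rule card_SigmaI) (use finite_indep_subsets[OF finE] finA in \<open>auto simp: indep_subsets_def\<close>)
    also have "\<dots> = (\<Sum>B\<in>indep_subsets ?E (Suc k). Suc k)" by (intro sum.cong refl) (simp add: indep_subsets_def)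
    finally show ?thesis by simp
  qed
  have "bij_betw (\<lambda>(A, v). (insert v A, v)) (SIGMA A:indep_subsets ?E k. ?E - fvs.span A) (SIGMA B:indep_subsets ?E (Suc k). B)"
  proof (rule bij_betwI[where g = "\<lambda>(B, v). (B - {v}, v)"])
    have "insert v A \<in> indep_subsets ?E (Suc k)" if A: "A \<in> indep_subsets ?E k" and v: "v \<in> ?E - fvs.span A" for A v
    proof -
      have "indep (insert v A)" using A v by (intro fvs.independent_insertI) (auto simp: indep_subsets_def)
      moreover have "v \<notin> A" using v fvs.span_base by blast
      ultimately show ?thesis using A v finA[of A] by (simp add: indep_subsets_def)
    qed
    then show "(\<lambda>(A, v). (insert v A, v)) \<in> (SIGMA A:indep_subsets ?E k. ?E - fvs.span A) \<rightarrow> (SIGMA B:indep_subsets ?E (Suc k). B)"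
      by auto
    have "B - {v} \<in> indep_subsets ?E k \<and> v \<in> ?E - fvs.span (B - {v})" if B: "B \<in> indep_subsets ?E (Suc k)" and v: "v \<in> B" for B v
    proof -
      have B': "B \<subseteq> ?E" "indep B" "card B = Suc k" using B by (auto simp: indep_subsets_def)
      have "indep (B - {v})" by (rule fvs.independent_mono[OF B'(2)]) blast
      moreover have "card (B - {v}) = k" using B' v finA[OF B'(1)] by simp
      moreover have "v \<notin> fvs.span (B - {v})" using B'(2) v unfolding fvs.dependent_def by blast
      ultimately show ?thesis using B' v by (auto simp: indep_subsets_def)
    qed
    then show "(\<lambda>(B, v). (B - {v}, v)) \<in> (SIGMA B:indep_subsets ?E (Suc k). B) \<rightarrow> (SIGMA A:indep_subsets ?E k. ?E - fvs.span A)"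
      by auto
    show "(case case x of (A, v) \<Rightarrow> (insert v A, v) of (B, v) \<Rightarrow> (B - {v}, v)) = x"
      if "x \<in> (SIGMA A:indep_subsets ?E k. ?E - fvs.span A)" for x
      using that fvs.span_base by (auto simp: indep_subsets_def)
    show "(case case y of (B, v) \<Rightarrow> (B - {v}, v) of (A, v) \<Rightarrow> (insert v A, v)) = y"
      if "y \<in> (SIGMA B:indep_subsets ?E (Suc k). B)" for y
      using that by auto
  qed
  then have "card (SIGMA A:indep_subsets ?E k. ?E - fvs.span A) = card (SIGMA B:indep_subsets ?E (Suc k). B)"
    by (rule bij_betw_same_card)
  then show ?thesis using P Q by simp
qed

text \<open>A vector of \<open>B0\<close> outside \<open>fvs.span B\<close> would enlarge
  \<open>B\<close> to an independent set in \<open>fvs.span B0\<close> with too many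
  elements.\<close>

lemma span_swap:
  assumes "indep B" "indep B0" "finite B" "finite B0" "card B = card B0" "B \<subseteq> fvs.span B0"
  shows "B0 \<subseteq> fvs.span B"
proof
  fix b assume b: "b \<in> B0"
  show "b \<in> fvs.span B"
  proof (rule ccontr)
    assume nb: "b \<notin> fvs.span B"
    then have "indep (insert b B)" using assms(1) by (intro fvs.independent_insertI)
    moreover have "insert b B \<subseteq> fvs.span B0" using b assms(6) fvs.span_base by auto
    ultimately have "card (insert b B) \<le> card B0" using fvs.independent_span_bound[OF assms(4)] by blast
    moreover have "b \<notin> B" using nb fvs.span_base by blast
    ultimately show False using assms(3,5) by simp
  qed
qed

text \<open>Size \<open>j\<close> and rank \<open>d\<close>: an independent set at one size and none
  at the next expresses the rank in the form in which \<open>betti_indep_complex\<close> produces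
  it.\<close>

definition full_rank_sets :: "nat \<Rightarrow> nat \<Rightarrow> nat \<Rightarrow> (nat \<Rightarrow> 'f::field) set set" where
  "full_rank_sets n d j = {J. J \<subseteq> fspace n - {0} \<and> card J = j \<and> indep_subsets J d \<noteq> {} \<and> indep_subsets J (Suc d) = {}}"

definition euler_sum :: "nat \<Rightarrow> (nat \<Rightarrow> 'f::field) set \<Rightarrow> int" where
  "euler_sum d J = (\<Sum>s\<le>d. (-1) ^ (d - s) * int (card (indep_subsets J s)))"

lemma full_rank_span:
  assumes "B0 \<in> indep_subsets J d" "indep_subsets J (Suc d) = {}" "finite J"
  shows "J \<subseteq> fvs.span B0"
proof
  fix v assume v: "v \<in> J"
  show "v \<in> fvs.span B0"
  proof (rule ccontr)
    assume nv: "v \<notin> fvs.span B0"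
    then have "indep (insert v B0)" using assms(1) by (intro fvs.independent_insertI) (auto simp: indep_subsets_def)
    moreover have "v \<notin> B0" using nv fvs.span_base by blast
    moreover have "finite B0" using assms(1,3) finite_subset by (auto simp: indep_subsets_def)
    ultimately have "insert v B0 \<in> indep_subsets J (Suc d)" using assms(1) v by (auto simp: indep_subsets_def)
    then show False using assms(2) by blast
  qed
qed

context linear_iso begin

lemma indep_subsets_image: "J \<subseteq> fspace d \<Longrightarrow> indep_subsets (\<phi> ` J) s = (`) \<phi> ` indep_subsets J s"
proof (intro equalityI subsetI)
  assume J: "J \<subseteq> fspace d"
  have cardA: "card (\<phi> ` A) = card A" if "A \<subseteq> J" for A
    by (rule card_image[OF inj_on_subset[OF inj]]) (use J that in blast)
  fix A assume A: "A \<in> indep_subsets (\<phi> ` J) s"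
  then obtain A' where A': "A' \<subseteq> J" "A = \<phi> ` A'" by (auto simp: indep_subsets_def subset_image_iff)
  then have "A' \<in> indep_subsets J s" using A cardA[OF A'(1)] indep_image_iff[of A'] J by (auto simp: indep_subsets_def)
  then show "A \<in> (`) \<phi> ` indep_subsets J s" using A' by blast
next
  assume J: "J \<subseteq> fspace d"
  fix A assume "A \<in> (`) \<phi> ` indep_subsets J s"
  then obtain A' where A': "A' \<in> indep_subsets J s" "A = \<phi> ` A'" by blast
  have sub: "A' \<subseteq> fspace d" using A' J by (auto simp: indep_subsets_def)
  have "card A = card A'" unfolding A'(2) by (rule card_image[OF inj_on_subset[OF inj sub]])
  then show "A \<in> indep_subsets (\<phi> ` J) s" using A' indep_image_iff[OF sub] by (auto simp: indep_subsets_def)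
qed

lemma inj_image: "inj_on ((`) \<phi>) (Pow (fspace d))"
  by (rule inj_on_image_Pow[OF inj])

lemma card_indep_subsets_image: "J \<subseteq> fspace d \<Longrightarrow> card (indep_subsets (\<phi> ` J) s) = card (indep_subsets J s)"
  unfolding indep_subsets_image by (rule card_image, rule inj_on_subset[OF inj_image]) (auto simp: indep_subsets_def)

lemma euler_sum_image: "J \<subseteq> fspace d \<Longrightarrow> euler_sum s (\<phi> ` J) = euler_sum s J"
  by (simp add: euler_sum_def card_indep_subsets_image)

lemma full_rank_sets_image:
  assumes W: "W \<subseteq> fspace n"
  shows "{J \<in> full_rank_sets n e j. J \<subseteq> W} = (`) \<phi> ` full_rank_sets d e j"
proof (intro equalityI subsetI)
  have z: "\<phi> x = 0 \<longleftrightarrow> x = 0" if "x \<in> fspace d" for x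
    using inj_on_eq_iff[OF inj that fvs.subspace_0[OF subspace_fspace]] zero by simp
  fix J assume "J \<in> {J \<in> full_rank_sets n e j. J \<subseteq> W}"
  then have J: "J \<in> full_rank_sets n e j" "J \<subseteq> \<phi> ` fspace d" using im by auto
  then obtain J' where J': "J' \<subseteq> fspace d" "J = \<phi> ` J'" by (auto simp: subset_image_iff)
  have "0 \<notin> J'" using J(1) J'(2) zero by (force simp: full_rank_sets_def)
  moreover have "card J' = j" using J(1) card_image[OF inj_on_subset[OF inj J'(1)]] J'(2) by (simp add: full_rank_sets_def)
  ultimately have "J' \<in> full_rank_sets d e j" using J(1) J' indep_subsets_image[OF J'(1)] by (auto simp: full_rank_sets_def)
  then show "J \<in> (`) \<phi> ` full_rank_sets d e j" using J' by blast
next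
  have z: "\<phi> x = 0 \<longleftrightarrow> x = 0" if "x \<in> fspace d" for x
    using inj_on_eq_iff[OF inj that fvs.subspace_0[OF subspace_fspace]] zero by simp
  fix J assume "J \<in> (`) \<phi> ` full_rank_sets d e j"
  then obtain J' where J': "J' \<in> full_rank_sets d e j" "J = \<phi> ` J'" by blast
  then have sub: "J' \<subseteq> fspace d" "0 \<notin> J'" by (auto simp: full_rank_sets_def)
  have JW: "J \<subseteq> W" using sub im J'(2) by blast
  have "0 \<notin> J" using sub z J'(2) by (metis image_iff subsetD)
  moreover have "card J = j" using J' card_image[OF inj_on_subset[OF inj sub(1)]] by (simp add: full_rank_sets_def)
  ultimately have "J \<in> full_rank_sets n e j" using J' indep_subsets_image[OF sub(1)] JW W by (auto simp: full_rank_sets_def)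
  then show "J \<in> {J \<in> full_rank_sets n e j. J \<subseteq> W}" using JW by blast
qed

end

text \<open>Both sides count pairs of a set \<open>J\<close> and a basis of its span: over all of \<open>fspace n\<close>, each basis
  spans a copy of \<open>fspace d\<close>.\<close>

lemma count_full_rank_sets:
  "int (card (indep_subsets (fspace d :: (nat \<Rightarrow> 'f::{field,finite}) set) d)) * (\<Sum>J\<in>full_rank_sets n d j. euler_sum d (J :: (nat \<Rightarrow> 'f) set)) =
    int (card (indep_subsets (fspace n :: (nat \<Rightarrow> 'f) set) d)) * (\<Sum>J\<in>full_rank_sets d d j. euler_sum d (J :: (nat \<Rightarrow> 'f) set))"
proof -
  let ?E = "fspace n :: (nat \<Rightarrow> 'f) set" and ?D = "fspace d :: (nat \<Rightarrow> 'f) set"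
  note finE = finite_fspace[of n, where 'f='f]
  have finR: "finite (full_rank_sets n d j :: (nat \<Rightarrow> 'f) set set)"
    by (rule finite_subset[of _ "Pow ?E"]) (use finE in \<open>auto simp: full_rank_sets_def\<close>)
  \<comment> \<open>The independent sets counted for \<open>J\<close> are exactly the bases of its
    span, and their number depends only on \<open>d\<close>.\<close>
  have inner: "card {B \<in> indep_subsets ?E d. J \<subseteq> fvs.span B} = card (indep_subsets ?D d)" if J: "J \<in> full_rank_sets n d j" for J
  proof -
    have JE: "J \<subseteq> ?E" "indep_subsets J (Suc d) = {}" using J by (auto simp: full_rank_sets_def)
    have finJ: "finite J" by (rule finite_subset[OF JE(1) finE])
    obtain B0 where B0: "B0 \<in> indep_subsets J d" using J by (auto simp: full_rank_sets_def)
    then have B0': "B0 \<subseteq> J" "indep B0" "card B0 = d" by (auto simp: indep_subsets_def)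
    have finB0: "finite B0" by (rule finite_subset[OF B0'(1) finJ])
    have JB0: "J \<subseteq> fvs.span B0" by (rule full_rank_span[OF B0 JE(2) finJ])
    have WE: "fvs.span B0 \<subseteq> ?E" by (rule span_subset_fspace) (use B0' JE in blast)
    have "{B \<in> indep_subsets ?E d. J \<subseteq> fvs.span B} = indep_subsets (fvs.span B0) d"
    proof (intro equalityI subsetI)
      fix B assume "B \<in> {B \<in> indep_subsets ?E d. J \<subseteq> fvs.span B}"
      then have B: "B \<subseteq> ?E" "indep B" "card B = d" "J \<subseteq> fvs.span B" by (auto simp: indep_subsets_def)
      have "finite B" by (rule finite_subset[OF B(1) finE])
      moreover have "B0 \<subseteq> fvs.span B" using B0'(1) B(4) by blast
      ultimately have "B \<subseteq> fvs.span B0" using span_swap[OF B0'(2) B(2) finB0] B0'(3) B(3) by simp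
      then show "B \<in> indep_subsets (fvs.span B0) d" using B by (simp add: indep_subsets_def)
    next
      fix B assume "B \<in> indep_subsets (fvs.span B0) d"
      then have B: "B \<subseteq> fvs.span B0" "indep B" "card B = d" by (auto simp: indep_subsets_def)
      have BE: "B \<subseteq> ?E" using B(1) WE by blast
      have "finite B" by (rule finite_subset[OF BE finE])
      then have "B0 \<subseteq> fvs.span B" using span_swap[OF B(2) B0'(2) _ finB0 _ B(1)] B0'(3) B(3) by simp
      then have "fvs.span B0 \<subseteq> fvs.span B" by (rule fvs.span_minimal) (rule fvs.subspace_span)
      then show "B \<in> {B \<in> indep_subsets ?E d. J \<subseteq> fvs.span B}" using B BE JB0 by (auto simp: indep_subsets_def)
    qed
    moreover obtain \<phi> where "linear_iso \<phi> d (fvs.span B0)" using linear_iso_span[OF B0'(2) finB0 B0'(3)] by blast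
    then interpret linear_iso \<phi> d "fvs.span B0" .
    have "card (indep_subsets (fvs.span B0) d) = card (indep_subsets ?D d)" using card_indep_subsets_image[of ?D d] im by simp
    ultimately show ?thesis by simp
  qed
  \<comment> \<open>Coordinates on the span of \<open>B\<close> carry the sets of rank
    \<open>d\<close> inside it to those in \<open>fspace d\<close>, with the same Euler
    sums.\<close>
  have outer: "(\<Sum>J\<in>{J \<in> full_rank_sets n d j. J \<subseteq> fvs.span B}. euler_sum d J) = (\<Sum>J\<in>full_rank_sets d d j. euler_sum d (J :: (nat \<Rightarrow> 'f) set))"
    if B: "B \<in> indep_subsets ?E d" for B
  proof -
    have B': "B \<subseteq> ?E" "indep B" "card B = d" using B by (auto simp: indep_subsets_def)
    have finB: "finite B" by (rule finite_subset[OF B'(1) finE])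
    obtain \<phi> where "linear_iso \<phi> d (fvs.span B)" using linear_iso_span[OF B'(2) finB B'(3)] by blast
    then interpret linear_iso \<phi> d "fvs.span B" .
    have "inj_on ((`) \<phi>) (full_rank_sets d d j)" by (rule inj_on_subset[OF inj_image]) (auto simp: full_rank_sets_def)
    then have "(\<Sum>J\<in>(`) \<phi> ` full_rank_sets d d j. euler_sum d J) = (\<Sum>J\<in>full_rank_sets d d j. euler_sum d (\<phi> ` J))"
      by (simp add: sum.reindex)
    also have "\<dots> = (\<Sum>J\<in>full_rank_sets d d j. euler_sum d (J :: (nat \<Rightarrow> 'f) set))"
      by (rule sum.cong[OF refl], rule euler_sum_image) (auto simp: full_rank_sets_def)
    finally show ?thesis unfolding full_rank_sets_image[OF span_subset_fspace[OF B'(1)]] .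
  qed
  have "int (card (indep_subsets ?D d)) * (\<Sum>J\<in>full_rank_sets n d j. euler_sum d (J :: (nat \<Rightarrow> 'f) set)) =
      (\<Sum>J\<in>full_rank_sets n d j. \<Sum>B | B \<in> indep_subsets ?E d \<and> J \<subseteq> fvs.span B. euler_sum d J)"
    unfolding sum_distrib_left by (rule sum.cong[OF refl]) (use inner in simp)
  also have "\<dots> = (\<Sum>B\<in>indep_subsets ?E d. \<Sum>J | J \<in> full_rank_sets n d j \<and> J \<subseteq> fvs.span B. euler_sum d J)"
    by (rule sum.swap_restrict[OF finR finite_indep_subsets[OF finE]])
  also have "\<dots> = (\<Sum>B\<in>indep_subsets ?E d. \<Sum>J\<in>full_rank_sets d d j. euler_sum d (J :: (nat \<Rightarrow> 'f) set))"
    by (intro sum.cong refl outer)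
  finally show ?thesis by simp
qed

lemma card_supersets:
  assumes "finite U" "A \<subseteq> U" "card A \<le> j"
  shows "card {J. J \<subseteq> U \<and> card J = j \<and> A \<subseteq> J} = (card U - card A) choose (j - card A)"
proof -
  have finA: "finite A" using assms finite_subset by blast
  have "bij_betw (\<lambda>K. K \<union> A) {K. K \<subseteq> U - A \<and> card K = j - card A} {J. J \<subseteq> U \<and> card J = j \<and> A \<subseteq> J}"
  proof (rule bij_betwI[where g = "\<lambda>J. J - A"])
    show "(\<lambda>K. K \<union> A) \<in> {K. K \<subseteq> U - A \<and> card K = j - card A} \<rightarrow> {J. J \<subseteq> U \<and> card J = j \<and> A \<subseteq> J}"
    proof
      fix K assume "K \<in> {K. K \<subseteq> U - A \<and> card K = j - card A}"
      then have K: "K \<subseteq> U - A" "card K = j - card A" by auto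
      have "finite K" using K(1) assms(1) finite_subset by blast
      then have "card (K \<union> A) = card K + card A" using K(1) finA by (intro card_Un_disjoint) auto
      then show "K \<union> A \<in> {J. J \<subseteq> U \<and> card J = j \<and> A \<subseteq> J}" using K assms by auto
    qed
    show "(\<lambda>J. J - A) \<in> {J. J \<subseteq> U \<and> card J = j \<and> A \<subseteq> J} \<rightarrow> {K. K \<subseteq> U - A \<and> card K = j - card A}"
      using finA by (auto simp: card_Diff_subset)
  qed auto
  then have "card {J. J \<subseteq> U \<and> card J = j \<and> A \<subseteq> J} = card {K. K \<subseteq> U - A \<and> card K = j - card A}"
    by (rule bij_betw_same_card[symmetric])
  also have "\<dots> = card (U - A) choose (j - card A)" using assms by (intro n_subsets) auto
  also have "card (U - A) = card U - card A" by (rule card_Diff_subset[OF finA assms(2)])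
  finally show ?thesis .
qed

lemma indep_nonzero: "indep A \<Longrightarrow> 0 \<notin> A"
  using fvs.dependent_zero by blast

text \<open>The sums over \<open>J\<close> and over independent sets \<open>A\<close> are exchanged:
  an \<open>A\<close> of size \<open>s\<close> lies in as many \<open>J\<close> as there are choices
  of \<open>j - s\<close> further vectors among the \<open>CARD('f) ^ n - 1 - s\<close> remaining
  nonzero ones.\<close>

lemma sum_faces_count:
  assumes s: "s \<le> j"
  shows "(\<Sum>J | J \<subseteq> fspace n - {0} \<and> card J = j. card (indep_subsets (J :: (nat \<Rightarrow> 'f::{field,finite}) set) s)) =
    card (indep_subsets (fspace n :: (nat \<Rightarrow> 'f) set) s) * ((CARD('f) ^ n - 1 - s) choose (j - s))"
proof -
  let ?E = "fspace n :: (nat \<Rightarrow> 'f) set" and ?\<J> = "{J. J \<subseteq> fspace n - {0 :: nat \<Rightarrow> 'f} \<and> card J = j}"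
  note finE = finite_fspace[of n, where 'f='f]
  have fin: "finite ?\<J>" by (rule finite_subset[of _ "Pow ?E"]) (use finE in auto)
  have U: "card (?E - {0}) = CARD('f) ^ n - 1"
    using card_fspace[of n, where 'f='f] fvs.subspace_0[OF subspace_fspace] finE by (subst card_Diff_singleton) simp_all
  have "(\<Sum>J\<in>?\<J>. card (indep_subsets J s)) = (\<Sum>J\<in>?\<J>. \<Sum>A | A \<in> indep_subsets ?E s \<and> A \<subseteq> J. 1)"
  proof (intro sum.cong refl)
    fix J assume "J \<in> ?\<J>"
    then have "indep_subsets J s = {A. A \<in> indep_subsets ?E s \<and> A \<subseteq> J}" by (auto simp: indep_subsets_def)
    then show "card (indep_subsets J s) = (\<Sum>A | A \<in> indep_subsets ?E s \<and> A \<subseteq> J. 1)" by simp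
  qed
  also have "\<dots> = (\<Sum>A\<in>indep_subsets ?E s. \<Sum>J | J \<in> ?\<J> \<and> A \<subseteq> J. 1)"
    by (rule sum.swap_restrict[OF fin finite_indep_subsets[OF finE]])
  also have "\<dots> = (\<Sum>A\<in>indep_subsets ?E s. (CARD('f) ^ n - 1 - s) choose (j - s))"
  proof (intro sum.cong refl)
    fix A assume "A \<in> indep_subsets ?E s"
    then have A: "A \<subseteq> ?E - {0}" "card A = s" using indep_nonzero by (auto simp: indep_subsets_def)
    have "(\<Sum>J | J \<in> ?\<J> \<and> A \<subseteq> J. 1) = card {J. J \<subseteq> ?E - {0} \<and> card J = j \<and> A \<subseteq> J}" by simp
    also have "\<dots> = (CARD('f) ^ n - 1 - s) choose (j - s)"
      using card_supersets[of "?E - {0}" A j] finE A s U by simp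
    finally show "(\<Sum>J | J \<in> ?\<J> \<and> A \<subseteq> J. 1) = (CARD('f) ^ n - 1 - s) choose (j - s)" .
  qed
  finally show ?thesis by simp
qed

subsection \<open>The universal complex\<close>

text \<open>Coordinates extended by zero. The dimension is forgotten, so injectivity holds only on a
  fixed \<open>carrier_vec n\<close>.\<close>

definition vec_fun :: "'f::field vec \<Rightarrow> nat \<Rightarrow> 'f" where
  "vec_fun v = (\<lambda>i. if i < dim_vec v then v $ i else 0)"

lemma inj_on_vec_fun: "inj_on vec_fun (carrier_vec n)"
proof (rule inj_onI)
  fix v w :: "'f::field vec" assume vw: "v \<in> carrier_vec n" "w \<in> carrier_vec n" "vec_fun v = vec_fun w"
  show "v = w"
  proof (rule eq_vecI)
    show "dim_vec v = dim_vec w" using vw by simp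
    fix i assume "i < dim_vec w"
    then show "v $ i = w $ i" using fun_cong[OF vw(3), of i] vw(1,2) by (simp add: vec_fun_def)
  qed
qed

lemma vec_fun_in_fspace: "v \<in> carrier_vec n \<Longrightarrow> vec_fun v \<in> fspace n"
  by (auto simp: vec_fun_def supported_on_def)

lemma vec_fun_image: "vec_fun ` carrier_vec n = (fspace n :: (nat \<Rightarrow> 'f::field) set)"
proof (intro equalityI subsetI)
  fix f :: "nat \<Rightarrow> 'f" assume "f \<in> fspace n"
  then have "f = vec_fun (vec n f)" by (auto simp: vec_fun_def supported_on_def fun_eq_iff)
  then show "f \<in> vec_fun ` carrier_vec n" by (rule image_eqI) simp
qed (auto simp: vec_fun_in_fspace)

lemma vec_fun_zero: "vec_fun (0\<^sub>v n) = 0"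
  by (auto simp: vec_fun_def)

lemma vec_fun_eq_0_iff: "v \<in> carrier_vec n \<Longrightarrow> vec_fun v = 0 \<longleftrightarrow> v = 0\<^sub>v n"
  using inj_onD[OF inj_on_vec_fun, of v "0\<^sub>v n" n] vec_fun_zero by (metis zero_carrier_vec)

text \<open>The bridge between linear dependence over a carrier and over a type: coefficients are
  transported along the injection, and zero combinations correspond to zero combinations.\<close>

lemma indep_vec_fun_iff:
  fixes A :: "'f::field vec set"
  assumes A: "A \<subseteq> carrier_vec n"
  shows "indep (vec_fun ` A) \<longleftrightarrow> \<not> LinearCombinations.module.lin_dep class_ring (module_vec TYPE('f) n) A"
proof -
  interpret vec_space "TYPE('f)" n .
  have injS: "inj_on vec_fun S" if "S \<subseteq> A" for S by (rule inj_on_subset[OF inj_on_vec_fun[of n]]) (use A that in blast)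
  have lc: "lincomb a S = 0\<^sub>v n \<longleftrightarrow> (\<Sum>w\<in>vec_fun ` S. fscale (a (the_inv_into S vec_fun w)) w) = 0"
    if S: "finite S" "S \<subseteq> A" for a S
  proof -
    have SC: "S \<subseteq> carrier_vec n" using S A by blast
    have eq: "(\<Sum>w\<in>vec_fun ` S. fscale (a (the_inv_into S vec_fun w)) w) = (\<Sum>v\<in>S. fscale (a v) (vec_fun v))"
      unfolding sum.reindex[OF injS[OF S(2)]]
      by (intro sum.cong refl) (simp add: the_inv_into_f_f[OF injS[OF S(2)]])
    have car: "lincomb a S \<in> carrier_vec n" by (rule lincomb_closed[OF SC])
    have "vec_fun (lincomb a S) i = (\<Sum>v\<in>S. fscale (a v) (vec_fun v)) i" for i
    proof (cases "i < n")
      case True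
      have "vec_fun (lincomb a S) i = lincomb a S $ i" using car True by (simp add: vec_fun_def)
      also have "\<dots> = (\<Sum>v\<in>S. a v * v $ i)" by (rule lincomb_index[OF True SC])
      also have "\<dots> = (\<Sum>v\<in>S. a v * vec_fun v i)" using SC True by (intro sum.cong refl) (auto simp: vec_fun_def)
      finally show ?thesis by (simp add: sum_fun_apply fscale_apply)
    next
      case False
      then have "vec_fun v i = 0" if "v \<in> S" for v using SC that by (auto simp: vec_fun_def)
      moreover have "vec_fun (lincomb a S) i = 0" using car False by (simp add: vec_fun_def)
      ultimately show ?thesis by (simp add: sum_fun_apply fscale_apply)
    qed
    then have "vec_fun (lincomb a S) = (\<Sum>v\<in>S. fscale (a v) (vec_fun v))" by (rule ext)
    then show ?thesis unfolding eq using vec_fun_eq_0_iff[OF car] by simp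
  qed
  show ?thesis
  proof
    assume ind: "indep (vec_fun ` A)"
    show "\<not> lin_dep A"
    proof
      assume "lin_dep A"
      then obtain S a v where S: "finite S" "S \<subseteq> A" "lincomb a S = 0\<^sub>v n" "v \<in> S" "a v \<noteq> 0"
        unfolding lin_dep_def by auto
      have "a (the_inv_into S vec_fun (vec_fun v)) = 0"
        using S(1,2,4) lc[OF S(1,2), of a] S(3)
        by (intro indepD[OF ind, of "vec_fun ` S" "\<lambda>w. a (the_inv_into S vec_fun w)"]) auto
      then show False using S(4,5) by (simp add: the_inv_into_f_f[OF injS[OF S(2)]])
    qed
  next
    assume ind: "\<not> lin_dep A"
    show "indep (vec_fun ` A)"
      unfolding fvs.independent_explicit_finite_subsets
    proof (intro allI impI ballI)
      fix T u w assume T: "T \<subseteq> vec_fun ` A" "finite T" and 0: "(\<Sum>v\<in>T. fscale (u v) v) = 0" and w: "w \<in> T"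
      define S where "S = A \<inter> vec_fun -` T"
      have ST: "vec_fun ` S = T" using T(1) by (auto simp: S_def)
      have SA: "S \<subseteq> A" by (auto simp: S_def)
      have finS: "finite S" using ST T(2) injS[OF SA] finite_imageD by blast
      have "(\<Sum>w\<in>vec_fun ` S. fscale (u (vec_fun (the_inv_into S vec_fun w))) w) = (\<Sum>w\<in>T. fscale (u w) w)"
        unfolding ST by (rule sum.cong[OF refl]) (simp add: f_the_inv_into_f[OF injS[OF SA]] ST)
      then have lc0: "lincomb (u \<circ> vec_fun) S = 0\<^sub>v n" unfolding lc[OF finS SA] using 0 by simp
      obtain v where v: "v \<in> S" "w = vec_fun v" using w ST by blast
      show "u w = 0"
      proof (rule ccontr)
        assume "u w \<noteq> 0"
        then have "lin_dep A" unfolding lin_dep_def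
          by (intro exI[of _ S] exI[of _ "u \<circ> vec_fun"] exI[of _ v]) (use finS SA lc0 v in auto)
        then show False using ind by blast
      qed
    qed
  qed
qed

lemma X_simplices_eq:
  "X_simplices TYPE('p::prime_card) n = {A. A \<subseteq> carrier_vec n \<and> indep (vec_fun ` A)}"
  unfolding X_simplices_def by (rule Collect_cong) (use indep_vec_fun_iff in blast)

lemma finite_carrier_vec: "finite (carrier_vec n :: 'f::{field,finite} vec set)"
  by (rule finite_imageD[OF _ inj_on_vec_fun]) (simp only: vec_fun_image finite_fspace)

lemma card_vec_fun_image: "A \<subseteq> carrier_vec n \<Longrightarrow> card (vec_fun ` A) = card A"
  by (rule card_image[OF inj_on_subset[OF inj_on_vec_fun]])

lemma vec_fun_image_faces:
  assumes J: "J \<subseteq> carrier_vec n"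
  shows "(`) vec_fun ` faces (X_simplices TYPE('p::prime_card) n) J d = indep_subsets (vec_fun ` J) d"
proof (intro equalityI subsetI)
  fix A assume "A \<in> (`) vec_fun ` faces (X_simplices TYPE('p) n) J d"
  then show "A \<in> indep_subsets (vec_fun ` J) d"
    by (auto simp: faces_def X_simplices_eq indep_subsets_def card_vec_fun_image)
next
  fix A assume A: "A \<in> indep_subsets (vec_fun ` J) d"
  then obtain A' where A': "A' \<subseteq> J" "A = vec_fun ` A'" by (auto simp: indep_subsets_def subset_image_iff)
  then have sub: "A' \<subseteq> carrier_vec n" using J by blast
  have "A' \<in> faces (X_simplices TYPE('p) n) J d"
    using A A' sub card_vec_fun_image[OF sub] by (simp add: faces_def X_simplices_eq indep_subsets_def)
  then show "A \<in> (`) vec_fun ` faces (X_simplices TYPE('p) n) J d" using A' by blast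
qed

lemma card_faces_X:
  assumes J: "J \<subseteq> carrier_vec n"
  shows "card (faces (X_simplices TYPE('p::prime_card) n) J d) = card (indep_subsets (vec_fun ` J) d)"
proof -
  have "inj_on ((`) vec_fun) (faces (X_simplices TYPE('p) n) J d)"
    by (rule inj_on_subset[OF inj_on_image_Pow[OF inj_on_vec_fun[of n]]]) (use J in \<open>auto simp: faces_def\<close>)
  from card_image[OF this] show ?thesis unfolding vec_fun_image_faces[OF J] by simp
qed

lemma faces_X_empty_iff:
  "J \<subseteq> carrier_vec n \<Longrightarrow>
    faces (X_simplices TYPE('p::prime_card) n) J d = {} \<longleftrightarrow> indep_subsets (vec_fun ` J) d = {}"
  by (simp flip: vec_fun_image_faces)

text \<open>Steinitz exchange: if no element of \<open>B\<close> extended \<open>A\<close>, then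
  \<open>B\<close> would lie in the span of \<open>A\<close> and could not be larger.\<close>

lemma indep_complex_X: "indep_complex (X_simplices TYPE('p::prime_card) n)"
  unfolding indep_complex_def
proof (intro conjI ballI allI impI)
  let ?X = "X_simplices TYPE('p) n"
  have "?X \<subseteq> Pow (carrier_vec n)" by (auto simp: X_simplices_eq)
  then show "finite ?X" by (rule finite_subset) (simp add: finite_carrier_vec)
  show finA: "finite A" if "A \<in> ?X" for A
    by (rule finite_subset[OF _ finite_carrier_vec[of n]]) (use that in \<open>auto simp: X_simplices_eq\<close>)
  show "B \<in> ?X" if "A \<in> ?X" "B \<subseteq> A" for A B
    using that fvs.independent_mono[of "vec_fun ` A" "vec_fun ` B"] by (auto simp: X_simplices_eq)
  show "\<exists>b\<in>B - A. insert b A \<in> ?X" if A: "A \<in> ?X" and B: "B \<in> ?X" and AB: "card A < card B" for A B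
  proof (rule ccontr)
    assume no: "\<not> (\<exists>b\<in>B - A. insert b A \<in> ?X)"
    have A': "A \<subseteq> carrier_vec n" "indep (vec_fun ` A)" and B': "B \<subseteq> carrier_vec n" "indep (vec_fun ` B)"
      using A B by (auto simp: X_simplices_eq)
    have "vec_fun ` B \<subseteq> fvs.span (vec_fun ` A)"
    proof (rule image_subsetI, rule ccontr)
      fix b assume b: "b \<in> B" and nb: "vec_fun b \<notin> fvs.span (vec_fun ` A)"
      have "b \<notin> A" using nb fvs.span_base by blast
      moreover have "indep (vec_fun ` insert b A)"
        unfolding image_insert by (rule fvs.independent_insertI[OF nb A'(2)])
      ultimately show False using no b A'(1) B'(1) by (auto simp: X_simplices_eq)
    qed
    then have "card (vec_fun ` B) \<le> card (vec_fun ` A)"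
      using fvs.independent_span_bound[OF _ B'(2)] finA[OF A] by blast
    then show False using AB A' B' by (simp add: card_vec_fun_image)
  qed
qed

lemma finite_X_vertices: "finite (X_vertices TYPE('p::prime_card) n)"
  unfolding X_vertices_def using finite_carrier_vec by blast

lemma vec_fun_image_X_vertices: "vec_fun ` X_vertices TYPE('p::prime_card) n = fspace n - {0}"
proof -
  have "vec_fun ` X_vertices TYPE('p) n = vec_fun ` carrier_vec n - vec_fun ` {0\<^sub>v n}"
    unfolding X_vertices_def by (rule inj_on_image_set_diff[OF inj_on_vec_fun[of n]]) auto
  then show ?thesis by (simp only: vec_fun_image vec_fun_zero image_insert image_empty)
qed

lemma bij_betw_vec_fun_vertex_sets:
  "bij_betw ((`) vec_fun) {J. J \<subseteq> X_vertices TYPE('p::prime_card) n \<and> P (vec_fun ` J)} {J. J \<subseteq> fspace n - {0} \<and> P J}"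
  unfolding bij_betw_def
proof
  have "inj_on vec_fun (X_vertices TYPE('p) n)"
    by (rule inj_on_subset[OF inj_on_vec_fun[of n]]) (auto simp: X_vertices_def)
  from inj_on_image_Pow[OF this]
  show "inj_on ((`) vec_fun) {J. J \<subseteq> X_vertices TYPE('p) n \<and> P (vec_fun ` J)}" by (rule inj_on_subset) auto
  show "(`) vec_fun ` {J. J \<subseteq> X_vertices TYPE('p) n \<and> P (vec_fun ` J)} = {J. J \<subseteq> fspace n - {0} \<and> P J}"
    unfolding vec_fun_image_X_vertices[symmetric] by (auto simp: subset_image_iff)
qed

lemma X_vertices_subset: "J \<subseteq> X_vertices TYPE('p::prime_card) n \<Longrightarrow> J \<subseteq> carrier_vec n"
  by (auto simp: X_vertices_def)

lemma betti_X_eq_sum_full_rank_sets: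
  assumes k: "integers_or_prime_field TYPE('k::idom)" and ij: "i \<le> j"
  shows "int (betti_X TYPE('k) TYPE('p::prime_card) n i j) =
    (\<Sum>J\<in>full_rank_sets n (j - i) j. euler_sum (j - i) (J :: (nat \<Rightarrow> 'p mod_ring) set))"
proof -
  let ?X = "X_simplices TYPE('p) n" and ?V = "X_vertices TYPE('p) n"
  let ?P = "\<lambda>J :: (nat \<Rightarrow> 'p mod_ring) set. card J = j \<and> indep_subsets J (j - i) \<noteq> {} \<and> indep_subsets J (Suc (j - i)) = {}"
  have "int (betti_X TYPE('k) TYPE('p) n i j) =
      (\<Sum>J | J \<subseteq> ?V \<and> card J = j \<and> faces ?X J (j - i) \<noteq> {} \<and> faces ?X J (Suc (j - i)) = {}.
        \<Sum>d\<le>j - i. (-1) ^ (j - i - d) * int (card (faces ?X J d)))"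
    unfolding betti_X_def by (rule betti_indep_complex[OF k finite_X_vertices ij indep_complex_X])
  also have "\<dots> = (\<Sum>J | J \<subseteq> ?V \<and> ?P (vec_fun ` J). euler_sum (j - i) (vec_fun ` J))"
  proof (rule sum.cong)
    show "{J. J \<subseteq> ?V \<and> card J = j \<and> faces ?X J (j - i) \<noteq> {} \<and> faces ?X J (Suc (j - i)) = {}} =
        {J. J \<subseteq> ?V \<and> ?P (vec_fun ` J)}"
    proof (rule Collect_cong, rule conj_cong[OF refl])
      fix J assume "J \<subseteq> ?V"
      note J = X_vertices_subset[OF this]
      show "(card J = j \<and> faces ?X J (j - i) \<noteq> {} \<and> faces ?X J (Suc (j - i)) = {}) = ?P (vec_fun ` J)"
        unfolding faces_X_empty_iff[OF J] card_vec_fun_image[OF J] ..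
    qed
    fix J assume "J \<in> {J. J \<subseteq> ?V \<and> ?P (vec_fun ` J)}"
    then have "J \<subseteq> ?V" by blast
    note J = X_vertices_subset[OF this]
    show "(\<Sum>d\<le>j - i. (-1) ^ (j - i - d) * int (card (faces ?X J d))) = euler_sum (j - i) (vec_fun ` J)"
      unfolding euler_sum_def card_faces_X[OF J] ..
  qed
  also have "\<dots> = (\<Sum>J | J \<subseteq> fspace n - {0} \<and> ?P J. euler_sum (j - i) J)"
    by (rule sum.reindex_bij_betw[OF bij_betw_vec_fun_vertex_sets])
  finally show ?thesis unfolding full_rank_sets_def .
qed

text \<open>The recursion \<open>card_indep_subsets_Suc\<close> at \<open>k = n\<close> has the
  factor \<open>CARD('f) ^ n - CARD('f) ^ n\<close>, so the count is zero.\<close>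

lemma indep_subsets_Suc_fspace: "J \<subseteq> fspace n \<Longrightarrow> indep_subsets (J :: (nat \<Rightarrow> 'f::{field,finite}) set) (Suc n) = {}"
proof -
  assume J: "J \<subseteq> fspace n"
  have "card (indep_subsets (fspace n :: (nat \<Rightarrow> 'f) set) (Suc n)) = 0"
    using card_indep_subsets_Suc[of n n, where 'f='f] by simp
  moreover have "finite (indep_subsets (fspace n :: (nat \<Rightarrow> 'f) set) (Suc n))" by (rule finite_indep_subsets[OF finite_fspace])
  ultimately have "indep_subsets (fspace n :: (nat \<Rightarrow> 'f) set) (Suc n) = {}" by (simp only: card_0_eq)
  then show ?thesis using J unfolding indep_subsets_def by blast
qed

lemma alternating_sum_betti_X:
  assumes k: "integers_or_prime_field TYPE('k::idom)" and nj: "n \<le> j"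
  shows "(\<Sum>l\<le>n. (-1) ^ l * int (betti_X TYPE('k) TYPE('p::prime_card) n (j - l) j)) =
    (\<Sum>d\<le>n. (-1) ^ d * int (card (indep_subsets (fspace n :: (nat \<Rightarrow> 'p mod_ring) set) d) * ((CARD('p) ^ n - 1 - d) choose (j - d))))"
proof -
  let ?X = "X_simplices TYPE('p) n" and ?V = "X_vertices TYPE('p) n"
  let ?E = "fspace n :: (nat \<Rightarrow> 'p mod_ring) set"
  note X = indep_complexD[OF indep_complex_X[of n, where 'p='p]]
  have "faces ?X J (Suc n) = {}" if J: "J \<subseteq> ?V" for J
    unfolding faces_X_empty_iff[OF X_vertices_subset[OF J]]
    using X_vertices_subset[OF J] by (intro indep_subsets_Suc_fspace) (auto intro: vec_fun_in_fspace)
  then have "(\<Sum>l\<le>n. (-1) ^ l * int (betti_X TYPE('k) TYPE('p) n (j - l) j)) =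
      (\<Sum>J | J \<subseteq> ?V \<and> card J = j. \<Sum>d\<le>n. (-1) ^ d * int (card (faces ?X J d)))"
    unfolding betti_X_def by (intro betti_euler_characteristic[OF k finite_X_vertices nj]) (rule X(3))
  also have "\<dots> = (\<Sum>J | J \<subseteq> ?V \<and> card (vec_fun ` J) = j. \<Sum>d\<le>n. (-1) ^ d * int (card (indep_subsets (vec_fun ` J) d)))"
  proof (rule sum.cong)
    show "{J. J \<subseteq> ?V \<and> card J = j} = {J. J \<subseteq> ?V \<and> card (vec_fun ` J) = j}"
      using card_vec_fun_image[OF X_vertices_subset] by auto
    fix J assume "J \<in> {J. J \<subseteq> ?V \<and> card (vec_fun ` J) = j}"
    then have "J \<subseteq> ?V" by blast
    note J = X_vertices_subset[OF this]
    show "(\<Sum>d\<le>n. (-1) ^ d * int (card (faces ?X J d))) = (\<Sum>d\<le>n. (-1) ^ d * int (card (indep_subsets (vec_fun ` J) d)))"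
      unfolding card_faces_X[OF J] ..
  qed
  also have "\<dots> = (\<Sum>J | J \<subseteq> ?E - {0} \<and> card J = j. \<Sum>d\<le>n. (-1) ^ d * int (card (indep_subsets J d)))"
    by (rule sum.reindex_bij_betw[OF bij_betw_vec_fun_vertex_sets])
  also have "\<dots> = (\<Sum>d\<le>n. \<Sum>J | J \<subseteq> ?E - {0} \<and> card J = j. (-1) ^ d * int (card (indep_subsets J d)))"
    by (rule sum.swap)
  also have "\<dots> = (\<Sum>d\<le>n. (-1) ^ d * int (card (indep_subsets ?E d) * ((CARD('p) ^ n - 1 - d) choose (j - d))))"
  proof (rule sum.cong[OF refl])
    fix d assume d: "d \<in> {..n}"
    then have dj: "d \<le> j" using nj by simp
    have "(\<Sum>J | J \<subseteq> ?E - {0} \<and> card J = j. (-1) ^ d * int (card (indep_subsets J d))) =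
        (-1) ^ d * int (\<Sum>J | J \<subseteq> ?E - {0} \<and> card J = j. card (indep_subsets J d))"
      by (simp only: sum_distrib_left of_nat_sum)
    also have "\<dots> = (-1) ^ d * int (card (indep_subsets ?E d) * ((CARD('p mod_ring) ^ n - 1 - d) choose (j - d)))"
      by (subst sum_faces_count[OF dj]) (rule refl)
    finally show "(\<Sum>J | J \<subseteq> ?E - {0} \<and> card J = j. (-1) ^ d * int (card (indep_subsets J d))) =
        (-1) ^ d * int (card (indep_subsets ?E d) * ((CARD('p) ^ n - 1 - d) choose (j - d)))" by simp
  qed
  finally show ?thesis .
qed

subsection \<open>Gaussian binomials\<close>

lemma p_poch_0: "p_poch q 0 = 1"
  by (simp add: p_poch_def)

lemma p_poch_Suc: "p_poch q (Suc k) = p_poch q k * (of_nat q ^ Suc k - 1)"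
  by (simp add: p_poch_def)

lemma p_poch_neq_0: "2 \<le> q \<Longrightarrow> p_poch q k \<noteq> 0"
proof (induction k)
  case (Suc k)
  have "(1 :: rat) < of_nat q ^ Suc k" by (rule one_less_power) (use Suc.prems in simp_all)
  then show ?case using Suc by (simp add: p_poch_Suc)
qed (simp add: p_poch_0)

text \<open>With q the field size there are (q^n - 1)(q^n - q)...(q^n - q^(k-1)) ordered independent
  families, and each set has \<open>fact k\<close> orderings. Pulling the powers of q out of the
  factors gives the exponent 0 + 1 + ... + (k - 1). The product form keeps the induction free of
  division.\<close>

lemma card_indep_subsets_p_poch:
  assumes "k \<le> n"
  shows "of_nat (card (indep_subsets (fspace n :: (nat \<Rightarrow> 'f::{field,finite}) set) k)) * (fact k * p_poch (CARD('f)) (n - k)) =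
    of_nat (CARD('f)) ^ (k * (k - 1) div 2) * p_poch (CARD('f)) n"
  using assms
proof (induction k)
  case 0
  have "indep_subsets (fspace n :: (nat \<Rightarrow> 'f) set) 0 = {{}}"
    using finite_subset[OF _ finite_fspace[of n, where 'f='f]] fvs.independent_empty by (auto simp: indep_subsets_def)
  then show ?case by simp
next
  case (Suc k)
  let ?q = "CARD('f)" and ?c = "\<lambda>k. card (indep_subsets (fspace n :: (nat \<Rightarrow> 'f) set) k)"
  have q: "1 \<le> ?q" by (simp add: Suc_leI)
  have nk: "n - k = Suc (n - Suc k)" using Suc.prems by simp
  have "?q ^ n = ?q ^ k * ?q ^ (n - k)" using Suc.prems by (simp flip: power_add)
  then have d: "?q ^ n - ?q ^ k = ?q ^ k * (?q ^ (n - k) - 1)" by (simp add: right_diff_distrib')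
  have "of_nat (Suc k) * of_nat (?c (Suc k)) = of_nat (?c k) * (of_nat ?q ^ k * (of_nat ?q ^ (n - k) - 1) :: rat)"
  proof -
    have "of_nat (Suc k * ?c (Suc k)) = (of_nat (?c k * (?q ^ k * (?q ^ (n - k) - 1))) :: rat)"
      unfolding card_indep_subsets_Suc d ..
    then show ?thesis using q by (simp only: of_nat_mult of_nat_power of_nat_diff[OF one_le_power[OF q]] of_nat_1)
  qed
  then have "of_nat (?c (Suc k)) * (fact (Suc k) * p_poch ?q (n - Suc k)) =
      of_nat ?q ^ k * (of_nat (?c k) * (fact k * p_poch ?q (n - k)))"
    (is "?C * (_ * ?P) = _")
  proof -
    assume h: "of_nat (Suc k) * ?C = of_nat (?c k) * (of_nat ?q ^ k * (of_nat ?q ^ (n - k) - 1))"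
    have "?C * (fact (Suc k) * ?P) = of_nat (Suc k) * ?C * (fact k * ?P)"
      unfolding fact_Suc by (simp only: mult_ac)
    also have "\<dots> = of_nat ?q ^ k * (of_nat (?c k) * (fact k * p_poch ?q (n - k)))"
      unfolding h unfolding nk p_poch_Suc by (simp only: mult_ac)
    finally show ?thesis .
  qed
  also have "\<dots> = of_nat ?q ^ k * (of_nat ?q ^ (k * (k - 1) div 2) * p_poch ?q n)"
    using Suc by simp
  also have "\<dots> = of_nat ?q ^ (Suc k * (Suc k - 1) div 2) * p_poch ?q n"
  proof -
    have "Suc k * (Suc k - 1) = k * (k - 1) + k * 2" by (cases k) (auto simp: algebra_simps)
    then have "Suc k * (Suc k - 1) div 2 = k + k * (k - 1) div 2" by simp
    then show ?thesis by (simp only: power_add mult.assoc)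
  qed
  finally show ?case .
qed

theorem theorem3p7:
  fixes p n i j :: nat
  assumes "CARD('p::prime_card) = p"
    and "integers_or_prime_field TYPE('k::idom)"
    and "n \<ge> 1"
    and "i \<le> j"
  shows "(j - i < n \<longrightarrow>
      of_nat (betti_X TYPE('k) TYPE('p) n i j) =
        gauss_binomial p n (j - i) * of_nat (betti_X TYPE('k) TYPE('p) (j - i) i j)) \<and>
    (j - i = n \<longrightarrow>
      (of_nat (betti_X TYPE('k) TYPE('p) n i j) :: rat) =
        (\<Sum>k=0..n. (-1) ^ (n - k) * of_nat p ^ (k * (k - 1) div 2) * p_poch p n
            / (fact k * p_poch p (n - k)) * of_nat ((p ^ n - 1 - k) choose (j - k)))
        - (\<Sum>l<n. (-1) ^ (n - l) * of_nat (betti_X TYPE('k) TYPE('p) n (j - l) j)))"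
proof (intro conjI impI)
  let ?b = "\<lambda>n i. betti_X TYPE('k) TYPE('p) n i j"
  let ?c = "\<lambda>n k. card (indep_subsets (fspace n :: (nat \<Rightarrow> 'p mod_ring) set) k)"
  have "prime p" using assms(1) prime_card[where 'a='p] by simp
  then have p2: "2 \<le> p" by (rule prime_ge_2_nat)
  note nz = p_poch_neq_0[OF p2]
  have c: "of_nat (?c n k) = of_nat p ^ (k * (k - 1) div 2) * p_poch p n / (fact k * p_poch p (n - k))"
    if "k \<le> n" for n k
    using card_indep_subsets_p_poch[OF that, where 'f="'p mod_ring"] assms(1) nz by (simp add: eq_divide_eq)
  {
    assume lt: "j - i < n"
    let ?d = "j - i"
    have "int (?c ?d ?d) * int (?b n i) = int (?c n ?d) * int (?b ?d i)"
      unfolding betti_X_eq_sum_full_rank_sets[OF assms(2,4)] by (rule count_full_rank_sets)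
    then have "?c ?d ?d * ?b n i = ?c n ?d * ?b ?d i"
      by (simp only: of_nat_mult[symmetric] of_nat_eq_iff)
    then have "of_nat (?c ?d ?d) * of_nat (?b n i) = (of_nat (?c n ?d) * of_nat (?b ?d i) :: rat)"
      by (simp only: of_nat_mult[symmetric])
    \<comment> \<open>In the quotient of the two counts of independent sets the factorial and the
      power of \<open>p\<close> cancel, leaving the Gaussian binomial.\<close>
    then show "of_nat (?b n i) = gauss_binomial p n ?d * (of_nat (?b ?d i) :: rat)"
      using lt p2 nz[of ?d] nz[of "n - ?d"] by (simp add: c p_poch_0 gauss_binomial_def field_simps)
  next
    assume eq: "j - i = n"
    then have nj: "n \<le> j" and i: "j - n = i" using assms(4) by auto
    let ?F = "\<lambda>k. ?c n k * ((p ^ n - 1 - k) choose (j - k))"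
    \<comment> \<open>Multiplying the alternating sum by \<open>(-1) ^ n\<close> gives the term
      \<open>l = n\<close> the sign +1; since \<open>j - n = i\<close>, this is the Betti number to
      be isolated.\<close>
    have sgn: "(-1) ^ n * (-1) ^ l = ((-1) ^ (n - l) :: rat)" if "l \<le> n" for l
    proof -
      have "n + l = (n - l) + 2 * l" using that by simp
      then have "(-1 :: rat) ^ (n + l) = (-1) ^ (n - l + 2 * l)" by (simp only:)
      then show ?thesis by (simp add: power_add power_mult)
    qed
    have "of_int (\<Sum>l\<le>n. (-1) ^ l * int (?b n (j - l))) = (of_int (\<Sum>k\<le>n. (-1) ^ k * int (?F k)) :: rat)"
      unfolding alternating_sum_betti_X[OF assms(2) nj] assms(1) ..
    then have "(\<Sum>l\<le>n. (-1) ^ l * of_nat (?b n (j - l))) = (\<Sum>k\<le>n. (-1) ^ k * (of_nat (?F k) :: rat))"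
      by simp
    then have "(\<Sum>l\<le>n. (-1) ^ n * (-1) ^ l * of_nat (?b n (j - l))) = (\<Sum>k\<le>n. (-1) ^ n * (-1) ^ k * (of_nat (?F k) :: rat))"
      by (simp only: mult.assoc sum_distrib_left[symmetric])
    moreover have "(\<Sum>l\<le>n. (-1) ^ n * (-1) ^ l * of_nat (?b n (j - l))) =
        (\<Sum>l\<le>n. (-1) ^ (n - l) * (of_nat (?b n (j - l)) :: rat))"
      by (rule sum.cong[OF refl]) (simp only: sgn atMost_iff)
    moreover have "\<dots> = of_nat (?b n i) + (\<Sum>l<n. (-1) ^ (n - l) * of_nat (?b n (j - l)))"
      unfolding lessThan_Suc_atMost[symmetric] by (simp add: i)
    moreover have "(\<Sum>k\<le>n. (-1) ^ n * (-1) ^ k * (of_nat (?F k) :: rat)) =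
        (\<Sum>k=0..n. (-1) ^ (n - k) * of_nat p ^ (k * (k - 1) div 2) * p_poch p n
            / (fact k * p_poch p (n - k)) * of_nat ((p ^ n - 1 - k) choose (j - k)))"
      unfolding atLeast0AtMost
      by (rule sum.cong[OF refl]) (simp only: atMost_iff sgn c of_nat_mult times_divide_eq_right times_divide_eq_left mult.assoc)
    ultimately show "(of_nat (?b n i) :: rat) =
        (\<Sum>k=0..n. (-1) ^ (n - k) * of_nat p ^ (k * (k - 1) div 2) * p_poch p n
            / (fact k * p_poch p (n - k)) * of_nat ((p ^ n - 1 - k) choose (j - k)))
        - (\<Sum>l<n. (-1) ^ (n - l) * of_nat (?b n (j - l)))"
      by linarith
  }
qed

end
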